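(* The number of cohorts of arch systems with $n$ arches behaves asymptotically as $c\, n^{-3/2} \gamma^n$, where $c \approx 1.13$ and $\gamma \approx 2.4975$.
   Context: An arch system of size $n$ is a set of $n$ non-crossing arches above a baseline connecting $2n$ points, each point an endpoint of exactly one arch; the empty system has size $0$. Concatenation $AB$ places $B$ right of $A$. An atom is a non-empty arch system that is not a concatenation of two non-empty ones; every atom is $\langle A\rangle$, obtained from its contents $A$ by adding one enclosing arch. The relation $\sim$ is the finest equivalence relation on arch systems such that for all arch systems $A,B,P,Q$ and all $a,b,c$ each an atom or empty: (R1) $A\sim B\Rightarrow\langle A\rangle\sim\langle B\rangle$; (R2) $a\sim b\Rightarrow PaQ\sim PbQ$; (R3) $PabQ\sim PbaQ$; (R4) $a\langle bc\rangle\sim\langle ab\rangle c$. Its equivalence classes are called cohorts; $\sim$-equivalent systems have the same number of arches, and the cohorts of arch systems with $n$ arches are the equivalence classes of $\sim$ restricted to systems with $n$ arches. *)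

theory Defs
  imports Complex_Main "HOL-Library.Landau_Symbols"
begin

(* An arch is the pair (left endpoint, right endpoint). A system of n arches lives on the
   points 0, ..., 2n-1 of the baseline, so its size n is its cardinality. *)
definition arch_system :: "(nat \<times> nat) set \<Rightarrow> bool" where
  "arch_system A \<longleftrightarrow>
     finite A \<and>
     (\<forall>(i, j) \<in> A. i < j \<and> j < 2 * card A) \<and>
     (\<forall>k < 2 * card A. \<exists>!p. p \<in> A \<and> (k = fst p \<or> k = snd p)) \<and>
     (\<forall>(i, j) \<in> A. \<forall>(k, l) \<in> A. \<not> (i < k \<and> k < j \<and> j < l))"

definition arch_shift :: "nat \<Rightarrow> (nat \<times> nat) set \<Rightarrow> (nat \<times> nat) set" where
  "arch_shift d A = (\<lambda>(i, j). (i + d, j + d)) ` A"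

definition arch_concat :: "(nat \<times> nat) set \<Rightarrow> (nat \<times> nat) set \<Rightarrow> (nat \<times> nat) set"
    (infixr "\<odot>" 70) where
  "A \<odot> B = A \<union> arch_shift (2 * card A) B"

definition enclose :: "(nat \<times> nat) set \<Rightarrow> (nat \<times> nat) set" ("\<langle>_\<rangle>") where
  "\<langle>A\<rangle> = insert (0, 2 * card A + 1) (arch_shift 1 A)"

definition atom :: "(nat \<times> nat) set \<Rightarrow> bool" where
  "atom A \<longleftrightarrow> arch_system A \<and> A \<noteq> {} \<and>
     \<not> (\<exists>B C. arch_system B \<and> B \<noteq> {} \<and> arch_system C \<and> C \<noteq> {} \<and> A = B \<odot> C)"

abbreviation atom_or_empty :: "(nat \<times> nat) set \<Rightarrow> bool" where
  "atom_or_empty A \<equiv> atom A \<or> A = {}"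

inductive cohort_eq :: "(nat \<times> nat) set \<Rightarrow> (nat \<times> nat) set \<Rightarrow> bool" (infix "\<sim>" 50) where
  refl: "arch_system A \<Longrightarrow> A \<sim> A"
| sym: "A \<sim> B \<Longrightarrow> B \<sim> A"
| trans: "A \<sim> B \<Longrightarrow> B \<sim> C \<Longrightarrow> A \<sim> C"
| R1: "A \<sim> B \<Longrightarrow> \<langle>A\<rangle> \<sim> \<langle>B\<rangle>"
| R2: "arch_system P \<Longrightarrow> arch_system Q \<Longrightarrow> atom_or_empty a \<Longrightarrow> atom_or_empty b \<Longrightarrow>
       a \<sim> b \<Longrightarrow> P \<odot> a \<odot> Q \<sim> P \<odot> b \<odot> Q"
| R3: "arch_system P \<Longrightarrow> arch_system Q \<Longrightarrow> atom_or_empty a \<Longrightarrow> atom_or_empty b \<Longrightarrow>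
       P \<odot> a \<odot> b \<odot> Q \<sim> P \<odot> b \<odot> a \<odot> Q"
| R4: "atom_or_empty a \<Longrightarrow> atom_or_empty b \<Longrightarrow> atom_or_empty c \<Longrightarrow>
       a \<odot> \<langle>b \<odot> c\<rangle> \<sim> \<langle>a \<odot> b\<rangle> \<odot> c"

definition cohorts :: "nat \<Rightarrow> (nat \<times> nat) set set set" where
  "cohorts n = {A. arch_system A \<and> card A = n} //
     {(A, B). arch_system A \<and> card A = n \<and> arch_system B \<and> card B = n \<and> A \<sim> B}"

end

theory Submission
  imports Defs "HOL-Complex_Analysis.Complex_Analysis" "HOL-Library.Multiset" "HOL-Real_Asymp.Real_Asymp"
begin

text \<open>
Arch systems are plane forests, and a forest is best viewed as a tree with an extra root. Modulo (R2)--(R4)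
a vertex with at most two children loses its identity: padding the children with empty leaves, the tree
becomes the multiset union of the trees below it, whereas a vertex with at least three children stays, as
the multiset of these. Hence a tree is a multiset of leaves, where a leaf is empty or a multiset of at least
three trees. This invariant is complete, and cohorts with \<open>n\<close> arches correspond to trees of weight \<open>n + 1\<close>.

For the generating functions \<open>T\<close> of trees and \<open>L\<close> of leaves this means \<open>1 + x + x T = exp (\<Sum>k. L(x^k) / k)\<close>
and \<open>L = x + x^2 (H - 1 - T - (T^2 + T(x^2)) / 2)\<close> with \<open>H = exp (\<Sum>k. T(x^k) / k)\<close>. Differentiating,
\<open>x (1 - K) T' = N\<close> where \<open>K\<close> and \<open>N\<close> are explicit in \<open>x\<close>, \<open>T\<close> and series with a larger radius of convergence.
At the radius of convergence \<open>\<rho>\<close> we have \<open>K = 1\<close>, since otherwise a fixed point argument yields convergence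
beyond \<open>\<rho>\<close>, and \<open>\<bar>K\<bar> < 1\<close> at the other points of the closed disc. So \<open>D = 1 - K\<close> satisfies
\<open>T' = P / D\<close> and \<open>D' = Q / D\<close> with \<open>P\<close>, \<open>Q\<close> continuous up to the boundary. Consequently \<open>D^2\<close> is approximately linear
at \<open>\<rho>\<close>, and \<open>T'\<close> minus a multiple of \<open>1 / sqrt (1 - z / \<rho>)\<close> has a derivative of order \<open>1 / \<bar>1 - z / \<rho>\<bar>\<close>; by Cauchy's
estimate its coefficients are \<open>O(log n / n)\<close>.

For the constants, \<open>\<rho>\<close> is enclosed by proving convergence at one rational number and the absence of a solution
of the functional equation at another one, and \<open>T(\<rho>)\<close> is enclosed by means of \<open>K = 1\<close>.
\<close>

section \<open>Arch systems and plane forests\<close>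

text \<open>Three obstacles shape the proof. Completeness of the invariant requires seeing (R2)-(R4)
  as associativity and commutativity of a product on "slots", that is, on a tree or nothing; leaves
  are what cannot be split further. Convergence cannot be presupposed, so every bound on the series
  comes from an induction on coefficients: trees of weight at most N form a class with its own
  exponential formula, and any y at which the right-hand side of the functional equation is at most
  the left-hand side bounds all partial sums. Finally, T is used only on the closed disc of
  convergence, without continuation beyond it, so the local behaviour has to follow from D D' = Q
  and continuity. The tolerance 0.0001 for \<gamma> = 1 / \<rho> allows an error of about 1.6e-5 in
  \<rho>. Near \<rho> both sides of the functional equation, as functions of the unknown, are almost
  tangent, so the gap that decides about convergence is of the order of the distance to \<rho>. The
  unknown is therefore tested close to T(\<rho>), roughly 1.1146. The constant is c = sqrt
  (N(\<rho>) / (2 \<pi> U(\<rho>))) / \<rho>.\<close>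

definition arch_on :: "nat \<Rightarrow> nat \<Rightarrow> (nat \<times> nat) set \<Rightarrow> bool" where
  "arch_on a b A \<longleftrightarrow>
     finite A \<and>
     (\<forall>i j. (i, j) \<in> A \<longrightarrow> a \<le> i \<and> i < j \<and> j < b) \<and>
     (\<forall>k. a \<le> k \<longrightarrow> k < b \<longrightarrow> (\<exists>i j. (i, j) \<in> A \<and> (k = i \<or> k = j))) \<and>
     (\<forall>i j k l. (i, j) \<in> A \<longrightarrow> (k, l) \<in> A \<longrightarrow> i = k \<or> i = l \<or> j = k \<or> j = l \<longrightarrow> i = k \<and> j = l) \<and>
     (\<forall>i j k l. (i, j) \<in> A \<longrightarrow> (k, l) \<in> A \<longrightarrow> \<not> (i < k \<and> k < j \<and> j < l))"

lemma arch_onD: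
  assumes "arch_on a b A"
  shows "finite A"
    and "(i, j) \<in> A \<Longrightarrow> a \<le> i" "(i, j) \<in> A \<Longrightarrow> i < j" "(i, j) \<in> A \<Longrightarrow> j < b"
    and "a \<le> k \<Longrightarrow> k < b \<Longrightarrow> \<exists>i j. (i, j) \<in> A \<and> (k = i \<or> k = j)"
    and "(i, j) \<in> A \<Longrightarrow> (k, l) \<in> A \<Longrightarrow> i = k \<or> i = l \<or> j = k \<or> j = l \<Longrightarrow> i = k \<and> j = l"
    and "(i, j) \<in> A \<Longrightarrow> (k, l) \<in> A \<Longrightarrow> \<not> (i < k \<and> k < j \<and> j < l)"
proof -
  have f: "finite A"
    and r: "\<forall>i j. (i, j) \<in> A \<longrightarrow> a \<le> i \<and> i < j \<and> j < b"
    and c: "\<forall>k. a \<le> k \<longrightarrow> k < b \<longrightarrow> (\<exists>i j. (i, j) \<in> A \<and> (k = i \<or> k = j))"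
    and u: "\<forall>i j k l. (i, j) \<in> A \<longrightarrow> (k, l) \<in> A \<longrightarrow>
              i = k \<or> i = l \<or> j = k \<or> j = l \<longrightarrow> i = k \<and> j = l"
    and n: "\<forall>i j k l. (i, j) \<in> A \<longrightarrow> (k, l) \<in> A \<longrightarrow> \<not> (i < k \<and> k < j \<and> j < l)"
    using assms unfolding arch_on_def by - ((elim conjE, assumption)+)
  show "finite A" by (rule f)
  show "(i, j) \<in> A \<Longrightarrow> a \<le> i" "(i, j) \<in> A \<Longrightarrow> i < j" "(i, j) \<in> A \<Longrightarrow> j < b"
    using r by blast+
  show "a \<le> k \<Longrightarrow> k < b \<Longrightarrow> \<exists>i j. (i, j) \<in> A \<and> (k = i \<or> k = j)"
    by (rule c[rule_format])
  show "(i, j) \<in> A \<Longrightarrow> (k, l) \<in> A \<Longrightarrow> i = k \<or> i = l \<or> j = k \<or> j = l \<Longrightarrow> i = k \<and> j = l"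
    by (rule u[rule_format])
  show "(i, j) \<in> A \<Longrightarrow> (k, l) \<in> A \<Longrightarrow> \<not> (i < k \<and> k < j \<and> j < l)"
    by (rule n[rule_format])
qed

lemma arch_onI:
  assumes "finite A"
    and "\<And>i j. (i, j) \<in> A \<Longrightarrow> a \<le> i \<and> i < j \<and> j < b"
    and "\<And>k. a \<le> k \<Longrightarrow> k < b \<Longrightarrow> \<exists>i j. (i, j) \<in> A \<and> (k = i \<or> k = j)"
    and "\<And>i j k l. (i, j) \<in> A \<Longrightarrow> (k, l) \<in> A \<Longrightarrow> i = k \<or> i = l \<or> j = k \<or> j = l \<Longrightarrow> i = k \<and> j = l"
    and "\<And>i j k l. (i, j) \<in> A \<Longrightarrow> (k, l) \<in> A \<Longrightarrow> \<not> (i < k \<and> k < j \<and> j < l)"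
  shows "arch_on a b A"
  unfolding arch_on_def by (intro conjI allI impI assms) (assumption | erule assms)+

text \<open>Left and right endpoints split the interval into two disjoint sets, each in bijection
  with \<open>A\<close>.\<close>

lemma arch_on_card:
  assumes "arch_on a b A" "a \<le> b"
  shows "b - a = 2 * card A"
proof -
  note D = arch_onD[OF assms(1)]
  have eq: "{a..<b} = fst ` A \<union> snd ` A"
  proof (intro subset_antisym subsetI)
    fix k assume "k \<in> {a..<b}"
    then obtain i j where "(i, j) \<in> A" "k = i \<or> k = j" using D(5)[of k] by auto
    then show "k \<in> fst ` A \<union> snd ` A" by force
  next
    fix k assume "k \<in> fst ` A \<union> snd ` A"
    then obtain i j where "(i, j) \<in> A" "k = i \<or> k = j" by auto
    then show "k \<in> {a..<b}" using D(2-4)[of i j] by auto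
  qed
  have inj: "inj_on fst A" "inj_on snd A"
    by (rule inj_onI, metis D(6) prod.collapse)+
  have disj: "fst ` A \<inter> snd ` A = {}"
  proof (rule ccontr)
    assume "fst ` A \<inter> snd ` A \<noteq> {}"
    then obtain i j k where "(i, j) \<in> A" "(k, i) \<in> A" by auto
    then show False using D(6)[of i j k i] D(3)[of i j] by auto
  qed
  have "card {a..<b} = card (fst ` A) + card (snd ` A)"
    unfolding eq using D(1) disj by (intro card_Un_disjoint) auto
  then show ?thesis
    using inj by (simp add: card_image)
qed

text \<open>Intervals [a, b) allow pieces cut out of a system to be handled without renumbering.
  Unique existence of an arch at each point is split into covering and the rule that arches sharing
  a point coincide.\<close>

lemma arch_system_iff_arch_on: "arch_system A \<longleftrightarrow> arch_on 0 (2 * card A) A"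
proof
  assume "arch_system A"
  then have fin: "finite A"
    and bd': "\<forall>(i, j) \<in> A. i < j \<and> j < 2 * card A"
    and ex1: "\<forall>k < 2 * card A. \<exists>!p. p \<in> A \<and> (k = fst p \<or> k = snd p)"
    and nc': "\<forall>(i, j) \<in> A. \<forall>(k, l) \<in> A. \<not> (i < k \<and> k < j \<and> j < l)"
    unfolding arch_system_def by - ((elim conjE, assumption)+)
  have bd: "i < j \<and> j < 2 * card A" if "(i, j) \<in> A" for i j
    using bd' that by blast
  have nc: "\<not> (i < k \<and> k < j \<and> j < l)" if "(i, j) \<in> A" "(k, l) \<in> A" for i j k l
    using nc' that by blast
  have uniq: "i = k \<and> j = l"
    if "(i, j) \<in> A" "(k, l) \<in> A" "x = i \<or> x = j" "x = k \<or> x = l" for i j k l x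
  proof -
    have "x < 2 * card A" using that bd[OF that(1)] by auto
    with ex1 have "\<exists>!p. p \<in> A \<and> (x = fst p \<or> x = snd p)" by blast
    then have "(i, j) = (k, l)"
      using that by (elim ex1E) (metis fst_conv snd_conv)
    then show ?thesis by simp
  qed
  have ex: "\<exists>i j. (i, j) \<in> A \<and> (k = i \<or> k = j)" if "k < 2 * card A" for k
    using ex1 that by (metis prod.collapse)
  show "arch_on 0 (2 * card A) A"
  proof (rule arch_onI)
    show "i = k \<and> j = l" if "(i, j) \<in> A" "(k, l) \<in> A" "i = k \<or> i = l \<or> j = k \<or> j = l" for i j k l
      using uniq[OF that(1,2), of i] uniq[OF that(1,2), of j] that(3) by blast
  qed (use fin bd ex nc in \<open>simp_all\<close>)
next
  assume A: "arch_on 0 (2 * card A) A"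
  note D = arch_onD[OF A]
  have "\<exists>!p. p \<in> A \<and> (k = fst p \<or> k = snd p)" if "k < 2 * card A" for k
  proof -
    have "\<exists>i j. (i, j) \<in> A \<and> (k = i \<or> k = j)" by (rule D(5)) (use that in simp_all)
    then obtain i j where "(i, j) \<in> A" "k = i \<or> k = j" by blast
    then show ?thesis
    proof (intro ex1I[of _ "(i, j)"])
      fix p assume "p \<in> A \<and> (k = fst p \<or> k = snd p)"
      then show "p = (i, j)"
        using D(6)[of "fst p" "snd p" i j] \<open>(i, j) \<in> A\<close> \<open>k = i \<or> k = j\<close> by (metis prod.collapse)
    qed auto
  qed
  moreover have "\<forall>(i, j) \<in> A. i < j \<and> j < 2 * card A"
    using D(3,4) by (intro ballI) (simp only: case_prod_beta', metis prod.collapse)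
  moreover have "\<forall>(i, j) \<in> A. \<forall>(k, l) \<in> A. \<not> (i < k \<and> k < j \<and> j < l)"
    using D(7) by (intro ballI) (simp only: case_prod_beta', metis prod.collapse)
  ultimately show "arch_system A"
    unfolding arch_system_def using D(1) by blast
qed

lemma arch_on_imp_arch_system:
  assumes "arch_on 0 n A"
  shows "arch_system A" "n = 2 * card A"
  using assms arch_on_card[OF assms] by (auto simp: arch_system_iff_arch_on)

section \<open>Shifting, juxtaposition and enclosure of arch systems\<close>

lemma mem_arch_shift: "(i, j) \<in> arch_shift d A \<longleftrightarrow> d \<le> i \<and> d \<le> j \<and> (i - d, j - d) \<in> A"
  unfolding arch_shift_def by (force simp: image_iff)

lemma mem_arch_shift_add [simp]: "(i + d, j + d) \<in> arch_shift d A \<longleftrightarrow> (i, j) \<in> A"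
  by (simp add: mem_arch_shift)

lemma card_arch_shift [simp]: "card (arch_shift d A) = card A"
  unfolding arch_shift_def by (intro card_image) (auto simp: inj_on_def)

lemma finite_arch_shift [simp]: "finite A \<Longrightarrow> finite (arch_shift d A)"
  unfolding arch_shift_def by simp

lemma arch_shift_empty [simp]: "arch_shift d {} = {}"
  by (simp add: arch_shift_def)

lemma arch_shift_0 [simp]: "arch_shift 0 A = A"
  by (auto simp: arch_shift_def)

lemma arch_shift_Un: "arch_shift d (A \<union> B) = arch_shift d A \<union> arch_shift d B"
  by (auto simp: arch_shift_def)

lemma arch_shift_arch_shift: "arch_shift d (arch_shift e A) = arch_shift (e + d) A"
  by (force simp: arch_shift_def image_image add.assoc)

lemma arch_shift_inject [simp]: "arch_shift d A = arch_shift d B \<longleftrightarrow> A = B"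
proof
  assume "arch_shift d A = arch_shift d B"
  then have "(i + d, j + d) \<in> arch_shift d A \<longleftrightarrow> (i + d, j + d) \<in> arch_shift d B" for i j by simp
  then show "A = B" by auto
qed auto

lemma arch_on_shift:
  assumes "arch_on a b A"
  shows "arch_on (a + d) (b + d) (arch_shift d A)"
proof -
  note D = arch_onD[OF assms]
  have 1: "a + d \<le> i \<and> i < j \<and> j < b + d" if "(i, j) \<in> arch_shift d A" for i j
  proof -
    from that have "d \<le> i" "d \<le> j" "(i - d, j - d) \<in> A" by (auto simp: mem_arch_shift)
    then show ?thesis using D(2,3,4)[of "i - d" "j - d"] by auto
  qed
  have 2: "\<exists>i j. (i, j) \<in> arch_shift d A \<and> (k = i \<or> k = j)" if "a + d \<le> k" "k < b + d" for k
  proof -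
    have kd: "a \<le> k - d" "k - d < b" using that by simp_all
    obtain i j where "(i, j) \<in> A" "k - d = i \<or> k - d = j" using D(5)[of "k - d", OF kd] by blast
    moreover from this have "k = i + d \<or> k = j + d" using that by arith
    ultimately show ?thesis using mem_arch_shift_add by blast
  qed
  have 3: "i = k \<and> j = l" if "(i, j) \<in> arch_shift d A" "(k, l) \<in> arch_shift d A"
      "i = k \<or> i = l \<or> j = k \<or> j = l" for i j k l
  proof -
    have "(i - d, j - d) \<in> A" "(k - d, l - d) \<in> A" and le: "d \<le> i" "d \<le> j" "d \<le> k" "d \<le> l"
      using that(1,2) by (simp_all add: mem_arch_shift)
    from D(6)[OF this(1,2)] le that(3) show ?thesis by arith
  qed
  have 4: "\<not> (i < k \<and> k < j \<and> j < l)" if "(i, j) \<in> arch_shift d A" "(k, l) \<in> arch_shift d A" for i j k l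
  proof -
    have "(i - d, j - d) \<in> A" "(k - d, l - d) \<in> A" and le: "d \<le> i" "d \<le> j" "d \<le> k" "d \<le> l"
      using that(1,2) by (simp_all add: mem_arch_shift)
    from D(7)[OF this(1,2)] le show ?thesis by arith
  qed
  show ?thesis
    by (rule arch_onI) (rule D(1) finite.insertI finite_arch_shift 1 2 3 4 | assumption)+
qed

lemma arch_on_unshift:
  assumes "arch_on d b A"
  shows "\<exists>B. A = arch_shift d B \<and> arch_on 0 (b - d) B"
proof -
  note D = arch_onD[OF assms]
  define B where "B = (\<lambda>(i, j). (i - d, j - d)) ` A"
  have mem: "(i, j) \<in> B \<longleftrightarrow> (i + d, j + d) \<in> A" for i j
    unfolding B_def using D(2,3) by (force simp: image_iff)
  have "A = arch_shift d B"
    using D(2,3) by (auto simp: mem_arch_shift mem) force+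
  moreover have 2: "\<exists>i j. (i, j) \<in> B \<and> (k = i \<or> k = j)" if "k < b - d" for k
  proof -
    have "k + d < b" using that by simp
    then obtain i j where "(i, j) \<in> A" "k + d = i \<or> k + d = j" using D(5)[of "k + d", OF le_add2] by blast
    moreover from this have "d \<le> i" "d \<le> j" using D(2,3)[of i j] by auto
    ultimately have "(i - d, j - d) \<in> B" "k = i - d \<or> k = j - d" by (simp add: mem, arith)
    then show ?thesis by blast
  qed
  have 1: "finite B" using D(1) by (simp add: B_def)
  have 3: "i < j \<and> j < b - d" if "(i, j) \<in> B" for i j
    using that D(2,3,4)[of "i + d" "j + d"] by (auto simp: mem)
  have 4: "i = k \<and> j = l" if "(i, j) \<in> B" "(k, l) \<in> B"
      "i = k \<or> i = l \<or> j = k \<or> j = l" for i j k l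
    using that(3) D(6)[OF that(1,2)[unfolded mem]] by arith
  have 5: "\<not> (i < k \<and> k < j \<and> j < l)" if "(i, j) \<in> B" "(k, l) \<in> B" for i j k l
    using D(7)[OF that(1,2)[unfolded mem]] by arith
  have "arch_on 0 (b - d) B"
    by (rule arch_onI) (rule 1 2 3 4 5 conjI le0 | assumption)+
  ultimately show ?thesis by blast
qed

lemma arch_on_Un:
  assumes "arch_on a b A" "arch_on b c B" "a \<le> b" "b \<le> c"
  shows "arch_on a c (A \<union> B)"
proof -
  note D = arch_onD[OF assms(1)] and E = arch_onD[OF assms(2)]
  have A: "a \<le> i \<and> i < j \<and> j < b" if "(i, j) \<in> A" for i j using D(2-4) that by auto
  have B: "b \<le> i \<and> i < j \<and> j < c" if "(i, j) \<in> B" for i j using E(2-4) that by auto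
  have 2: "\<exists>i j. (i, j) \<in> A \<union> B \<and> (k = i \<or> k = j)" if "a \<le> k" "k < c" for k
  proof (cases "k < b")
    case True
    then show ?thesis using D(5)[of k] that by blast
  next
    case False
    then show ?thesis using E(5)[of k] that by (meson UnI2 leI)
  qed
  have 34: "(i = k \<or> i = l \<or> j = k \<or> j = l \<longrightarrow> i = k \<and> j = l) \<and> \<not> (i < k \<and> k < j \<and> j < l)"
    if "(i, j) \<in> A \<union> B" "(k, l) \<in> A \<union> B" for i j k l
  proof -
    from that consider "(i, j) \<in> A" "(k, l) \<in> A" | "(i, j) \<in> A" "(k, l) \<in> B"
      | "(i, j) \<in> B" "(k, l) \<in> A" | "(i, j) \<in> B" "(k, l) \<in> B" by blast
    then show ?thesis
    proof cases
      case 1 then show ?thesis using D(6,7)[of i j k l] by blast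
    next
      case 2 then show ?thesis using A[of i j] B[of k l] by linarith
    next
      case 3 then show ?thesis using B[of i j] A[of k l] by linarith
    next
      case 4 then show ?thesis using E(6,7)[of i j k l] by blast
    qed
  qed
  have 3: "i = k \<and> j = l" if "(i, j) \<in> A \<union> B" "(k, l) \<in> A \<union> B"
      "i = k \<or> i = l \<or> j = k \<or> j = l" for i j k l
    using 34[OF that(1,2)] that(3) by blast
  have 4: "\<not> (i < k \<and> k < j \<and> j < l)" if "(i, j) \<in> A \<union> B" "(k, l) \<in> A \<union> B" for i j k l
    using 34[OF that] by blast
  have 1: "a \<le> i \<and> i < j \<and> j < c" if "(i, j) \<in> A \<union> B" for i j
    using that A[of i j] B[of i j] assms(3,4) by auto
  show ?thesis
    by (rule arch_onI) (rule D(1) E(1) 1 2 3 4 finite_UnI | assumption)+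
qed

lemma arch_on_insert:
  assumes "arch_on (Suc a) b A" "a < b"
  shows "arch_on a (Suc b) (insert (a, b) A)"
proof -
  note D = arch_onD[OF assms(1)]
  have A: "Suc a \<le> i \<and> i < j \<and> j < b" if "(i, j) \<in> A" for i j using D(2-4) that by auto
  have 2: "\<exists>i j. (i, j) \<in> insert (a, b) A \<and> (k = i \<or> k = j)" if "a \<le> k" "k < Suc b" for k
  proof (cases "k = a \<or> k = b")
    case False
    then show ?thesis using D(5)[of k] that by force
  qed auto
  have 34: "(i = k \<or> i = l \<or> j = k \<or> j = l \<longrightarrow> i = k \<and> j = l) \<and> \<not> (i < k \<and> k < j \<and> j < l)"
    if "(i, j) \<in> insert (a, b) A" "(k, l) \<in> insert (a, b) A" for i j k l
  proof -
    from that consider "(i, j) \<in> A" "(k, l) \<in> A" | "(i, j) \<in> A" "k = a" "l = b"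
      | "i = a" "j = b" "(k, l) \<in> A" | "i = a" "j = b" "k = a" "l = b" by blast
    then show ?thesis
    proof cases
      case 1 then show ?thesis using D(6,7)[of i j k l] by blast
    next
      case 2 then show ?thesis using A[of i j] assms(2) by linarith
    next
      case 3 then show ?thesis using A[of k l] assms(2) by linarith
    qed simp
  qed
  have 3: "i = k \<and> j = l" if "(i, j) \<in> insert (a, b) A" "(k, l) \<in> insert (a, b) A"
      "i = k \<or> i = l \<or> j = k \<or> j = l" for i j k l
    using 34[OF that(1,2)] that(3) by blast
  have 4: "\<not> (i < k \<and> k < j \<and> j < l)" if "(i, j) \<in> insert (a, b) A" "(k, l) \<in> insert (a, b) A" for i j k l
    using 34[OF that] by blast
  have 1: "a \<le> i \<and> i < j \<and> j < Suc b" if "(i, j) \<in> insert (a, b) A" for i j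
    using that A[of i j] assms(2) by auto
  show ?thesis
    by (rule arch_onI) (rule D(1) finite.insertI finite_arch_shift 1 2 3 4 | assumption)+
qed

lemma arch_system_empty [simp]: "arch_system {}"
  by (simp add: arch_system_def)

lemma arch_system_concat:
  assumes "arch_system A" "arch_system B"
  shows "arch_system (A \<odot> B)" and "card (A \<odot> B) = card A + card B"
proof -
  have "arch_on (0 + 2 * card A) (2 * card B + 2 * card A) (arch_shift (2 * card A) B)"
    using assms(2) by (intro arch_on_shift) (simp add: arch_system_iff_arch_on)
  then have *: "arch_on 0 (2 * card A + 2 * card B) (A \<odot> B)"
    unfolding arch_concat_def using assms(1)
    by (intro arch_on_Un[of _ "2 * card A"]) (auto simp: arch_system_iff_arch_on add.commute)
  from arch_on_imp_arch_system[OF *] show "arch_system (A \<odot> B)" "card (A \<odot> B) = card A + card B"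
    by auto
qed

lemma arch_system_enclose:
  assumes "arch_system A"
  shows "arch_system \<langle>A\<rangle>" and "card \<langle>A\<rangle> = Suc (card A)"
proof -
  have "arch_on (0 + 1) (2 * card A + 1) (arch_shift 1 A)"
    using assms by (intro arch_on_shift) (simp add: arch_system_iff_arch_on)
  then have *: "arch_on 0 (Suc (2 * card A + 1)) \<langle>A\<rangle>"
    unfolding enclose_def by (intro arch_on_insert) auto
  from arch_on_imp_arch_system[OF *] show "arch_system \<langle>A\<rangle>" "card \<langle>A\<rangle> = Suc (card A)"
    by auto
qed

lemma concat_empty_left [simp]: "{} \<odot> A = A"
  by (simp add: arch_concat_def)

lemma concat_empty_right [simp]: "A \<odot> {} = A"
  by (simp add: arch_concat_def)

lemma concat_assoc:
  assumes "arch_system A" "arch_system B"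
  shows "(A \<odot> B) \<odot> C = A \<odot> (B \<odot> C)"
proof -
  have "(A \<odot> B) \<odot> C = (A \<odot> B) \<union> arch_shift (2 * card (A \<odot> B)) C"
    by (rule arch_concat_def)
  also have "2 * card (A \<odot> B) = 2 * card B + 2 * card A"
    using arch_system_concat(2)[OF assms] by simp
  finally show ?thesis
    by (simp only: arch_concat_def arch_shift_Un arch_shift_arch_shift Un_assoc)
qed

text \<open>The last hypothesis says that no arch has exactly one endpoint in [c, d), so every point
  of this range stays covered after cutting it out.\<close>

lemma arch_on_part:
  assumes "arch_on a b A" "a \<le> c" "d \<le> b"
    and "\<And>i j. (i, j) \<in> A \<Longrightarrow> (c \<le> i \<and> i < d) = (c \<le> j \<and> j < d)"
  shows "arch_on c d {(i, j) \<in> A. c \<le> i \<and> j < d}"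
proof -
  note D = arch_onD[OF assms(1)]
  show ?thesis
  proof (rule arch_onI)
    show "finite {(i, j) \<in> A. c \<le> i \<and> j < d}"
      by (rule finite_subset[OF _ D(1)]) auto
  next
    fix i j assume "(i, j) \<in> {(i, j) \<in> A. c \<le> i \<and> j < d}"
    then show "c \<le> i \<and> i < j \<and> j < d" using D(3)[of i j] by simp
  next
    fix k assume k: "c \<le> k" "k < d"
    then have "\<exists>i j. (i, j) \<in> A \<and> (k = i \<or> k = j)" using assms(2,3) by (intro D(5)) auto
    then obtain i j where "(i, j) \<in> A" "k = i \<or> k = j" by blast
    then have "(i, j) \<in> {(i, j) \<in> A. c \<le> i \<and> j < d} \<and> (k = i \<or> k = j)"
      using assms(4)[of i j] k by auto
    then show "\<exists>i j. (i, j) \<in> {(i, j) \<in> A. c \<le> i \<and> j < d} \<and> (k = i \<or> k = j)" by blast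
  next
    fix i j k l assume "(i, j) \<in> {(i, j) \<in> A. c \<le> i \<and> j < d}"
      "(k, l) \<in> {(i, j) \<in> A. c \<le> i \<and> j < d}"
    then have "(i, j) \<in> A" "(k, l) \<in> A" by simp_all
    then show "i = k \<or> i = l \<or> j = k \<or> j = l \<Longrightarrow> i = k \<and> j = l" and "\<not> (i < k \<and> k < j \<and> j < l)"
      using D(6,7)[of i j k l] by blast+
  qed
qed

text \<open>First-return decomposition: the arch starting at 0 encloses the first atom, because
  non-crossing forces any other arch to lie strictly inside it or strictly to its right.\<close>

lemma arch_system_decompose:
  assumes "arch_system A" "A \<noteq> {}"
  shows "\<exists>B C. arch_system B \<and> arch_system C \<and> A = \<langle>B\<rangle> \<odot> C"
proof -
  let ?n = "2 * card A"
  have on: "arch_on 0 ?n A" using assms by (simp add: arch_system_iff_arch_on)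
  note D = arch_onD[OF on]
  have "0 < ?n" using assms D(1) by (simp add: card_gt_0_iff)
  then obtain i j where "(i, j) \<in> A" "0 = i \<or> 0 = j" using D(5)[of 0] by auto
  with D(3) have j: "(0, j) \<in> A" by force
  then have j0: "0 < j" "j < ?n" using D(3,4) by auto
  have split: "(0 < i \<and> k < j) \<or> j < i" if "(i, k) \<in> A" "(i, k) \<noteq> (0, j)" for i k
  proof -
    have "\<not> (0 = i \<or> 0 = k \<or> j = i \<or> j = k)" using D(6)[OF j that(1)] that(2) by blast
    then show ?thesis using D(3)[OF that(1)] D(7)[OF j that(1)] by linarith
  qed
  define I where "I = {(i, k) \<in> A. 1 \<le> i \<and> k < j}"
  define R where "R = {(i, k) \<in> A. Suc j \<le> i \<and> k < ?n}"
  have I: "arch_on 1 j I"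
    unfolding I_def
  proof (rule arch_on_part[OF on])
    fix i k assume *: "(i, k) \<in> A"
    show "(1 \<le> i \<and> i < j) = (1 \<le> k \<and> k < j)"
    proof (cases "(i, k) = (0, j)")
      case False
      then show ?thesis using split[OF * False] D(3)[OF *] by auto
    qed simp
  qed (use j0 in auto)
  have R: "arch_on (Suc j) ?n R"
    unfolding R_def
  proof (rule arch_on_part[OF on])
    fix i k assume *: "(i, k) \<in> A"
    show "(Suc j \<le> i \<and> i < ?n) = (Suc j \<le> k \<and> k < ?n)"
    proof (cases "(i, k) = (0, j)")
      case False
      then show ?thesis using split[OF * False] D(3,4)[OF *] by auto
    qed simp
  qed (use j0 in auto)
  obtain B where B: "I = arch_shift 1 B" "arch_on 0 (j - 1) B" using arch_on_unshift[OF I] by auto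
  obtain C where C: "R = arch_shift (Suc j) C" "arch_on 0 (?n - Suc j) C"
    using arch_on_unshift[OF R] by auto
  note B' = arch_on_imp_arch_system[OF B(2)] and C' = arch_on_imp_arch_system[OF C(2)]
  have jB: "j = 2 * card B + 1" using B'(2) j0 by auto
  have "A = insert (0, j) I \<union> R"
  proof (rule set_eqI, clarify)
    fix i k show "((i, k) \<in> A) = ((i, k) \<in> insert (0, j) I \<union> R)"
      using split[of i k] j D(4)[of i k] by (auto simp: I_def R_def)
  qed
  also have "insert (0, j) I = \<langle>B\<rangle>" by (simp add: enclose_def B jB)
  also have "\<langle>B\<rangle> \<union> R = \<langle>B\<rangle> \<odot> C"
    by (simp add: arch_concat_def arch_system_enclose[OF B'(1)] C jB)
  finally show ?thesis using B' C' by blast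
qed

text \<open>The arch at 0 fixes the number of arches inside it; then \<open>B\<close> and
  \<open>C\<close> are read off as the arches inside it and to its right.\<close>

lemma enclose_concat_inject:
  assumes "arch_system B" "arch_system C" "arch_system B'" "arch_system C'"
    and eq: "\<langle>B\<rangle> \<odot> C = \<langle>B'\<rangle> \<odot> C'"
  shows "B = B'" "C = C'"
proof -
  have sys: "arch_system (\<langle>B\<rangle> \<odot> C)"
    using assms by (intro arch_system_concat arch_system_enclose)
  then have on: "arch_on 0 (2 * card (\<langle>B\<rangle> \<odot> C)) (\<langle>B\<rangle> \<odot> C)" by (simp add: arch_system_iff_arch_on)
  have first: "(0, 2 * card B + 1) \<in> \<langle>B\<rangle> \<odot> C" for B C by (simp add: arch_concat_def enclose_def)
  have cB: "card B = card B'"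
    using arch_onD(6)[OF on first, of 0 "2 * card B' + 1"] first[of B' C'] eq by simp
  have part: "{(i, k) \<in> \<langle>B\<rangle> \<odot> C. 0 < i \<and> k < 2 * card B + 1} = arch_shift 1 B"
             "{(i, k) \<in> \<langle>B\<rangle> \<odot> C. 2 * card B + 1 < i} = arch_shift (2 * card B + 2) C"
    if "arch_system B" "arch_system C" for B C
  proof -
    have B: "i < k \<and> k < 2 * card B" if "(i, k) \<in> B" for i k
      using \<open>arch_system B\<close> that by (auto simp: arch_system_def)
    have C: "i < k" if "(i, k) \<in> C" for i k
      using \<open>arch_system C\<close> that by (auto simp: arch_system_def)
    have mem: "(i, k) \<in> \<langle>B\<rangle> \<odot> C \<longleftrightarrow> i = 0 \<and> k = 2 * card B + 1 \<or> (i, k) \<in> arch_shift 1 B \<or>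
        (i, k) \<in> arch_shift (2 * card B + 2) C" for i k
      unfolding arch_concat_def[of "\<langle>B\<rangle>"] arch_system_enclose(2)[OF that(1)] by (simp add: enclose_def)
    have sB: "0 < i \<and> k < 2 * card B + 1 \<and> i < 2 * card B + 1" if "(i, k) \<in> arch_shift 1 B" for i k
      using B[of "i - 1" "k - 1"] that by (simp add: mem_arch_shift, arith)
    have sC: "2 * card B + 1 < i \<and> 2 * card B + 1 < k" if "(i, k) \<in> arch_shift (2 * card B + 2) C" for i k
      using that by (simp add: mem_arch_shift)
    show "{(i, k) \<in> \<langle>B\<rangle> \<odot> C. 0 < i \<and> k < 2 * card B + 1} = arch_shift 1 B"
    proof (rule set_eqI, clarify)
      fix i k show "((i, k) \<in> {(i, k) \<in> \<langle>B\<rangle> \<odot> C. 0 < i \<and> k < 2 * card B + 1}) = ((i, k) \<in> arch_shift 1 B)"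
        using mem[of i k] sB[of i k] sC[of i k] by (simp only: mem_Collect_eq case_prod_conv, linarith)
    qed
    show "{(i, k) \<in> \<langle>B\<rangle> \<odot> C. 2 * card B + 1 < i} = arch_shift (2 * card B + 2) C"
    proof (rule set_eqI, clarify)
      fix i k show "((i, k) \<in> {(i, k) \<in> \<langle>B\<rangle> \<odot> C. 2 * card B + 1 < i}) = ((i, k) \<in> arch_shift (2 * card B + 2) C)"
        using mem[of i k] sB[of i k] sC[of i k] by (simp only: mem_Collect_eq case_prod_conv, linarith)
    qed
  qed
  have "arch_shift 1 B = arch_shift 1 B'"
    unfolding part(1)[OF assms(1,2), symmetric] cB part(1)[OF assms(3,4), symmetric] eq ..
  then show "B = B'" by simp
  have "arch_shift (2 * card B' + 2) C = arch_shift (2 * card B' + 2) C'"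
    by (rule HOL.trans[OF HOL.sym, OF part(2)[OF assms(1,2), unfolded eq cB] part(2)[OF assms(3,4)]])
  then show "C = C'" using cB by simp
qed

section \<open>Plane trees as codes for arch systems\<close>

datatype tree = Node "tree list"

primrec arch :: "tree \<Rightarrow> (nat \<times> nat) set" where
  "arch (Node ts) = \<langle>foldr (\<odot>) (map arch ts) {}\<rangle>"

definition arches :: "tree list \<Rightarrow> (nat \<times> nat) set" where
  "arches ts = foldr (\<odot>) (map arch ts) {}"

primrec tsize :: "tree \<Rightarrow> nat" where
  "tsize (Node ts) = Suc (sum_list (map tsize ts))"

lemma arch_Node [simp]: "arch (Node ts) = \<langle>arches ts\<rangle>"
  by (simp add: arches_def)

declare arch.simps [simp del]

lemma arches_Nil [simp]: "arches [] = {}"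
  and arches_Cons [simp]: "arches (t # ts) = arch t \<odot> arches ts"
  by (auto simp: arches_def)

lemma arch_system_arch_aux: "arch_system (arch t) \<and> card (arch t) = tsize t"
proof (induction t)
  case (Node ts)
  then have "arch_system (arches ts) \<and> card (arches ts) = sum_list (map tsize ts)"
    by (induction ts) (auto simp: arch_system_concat)
  then show ?case by (simp add: arch_system_enclose)
qed

lemma arch_system_arch [simp]: "arch_system (arch t)" and card_arch [simp]: "card (arch t) = tsize t"
  using arch_system_arch_aux by auto

lemma arches_aux: "arch_system (arches ts) \<and> card (arches ts) = sum_list (map tsize ts)"
  by (induction ts) (auto simp: arch_system_concat)

lemma arch_system_arches [simp]: "arch_system (arches ts)"
  and card_arches [simp]: "card (arches ts) = sum_list (map tsize ts)"
  using arches_aux by auto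

lemma arches_append [simp]: "arches (ts @ us) = arches ts \<odot> arches us"
  by (induction ts) (auto simp: concat_assoc)

lemma arches_surj:
  assumes "arch_system A"
  shows "\<exists>ts. A = arches ts"
  using assms
proof (induction "card A" arbitrary: A rule: less_induct)
  case less
  show ?case
  proof (cases "A = {}")
    case True
    then show ?thesis by (intro exI[of _ "[]"]) simp
  next
    case False
    from arch_system_decompose[OF less.prems False] obtain B C
      where BC: "arch_system B" "arch_system C" "A = \<langle>B\<rangle> \<odot> C" by blast
    then have "card A = Suc (card B) + card C"
      by (simp add: arch_system_concat arch_system_enclose)
    then obtain bs cs where "B = arches bs" "C = arches cs"
      using less.hyps[of B] less.hyps[of C] BC by auto
    then show ?thesis using BC by (intro exI[of _ "Node bs # cs"]) simp
  qed
qed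

lemma arches_eq_empty [simp]: "arches ts = {} \<longleftrightarrow> ts = []"
proof (cases ts)
  case (Cons t us)
  then have "card (arches ts) > 0" by (cases t) (simp del: arches_Cons)
  then show ?thesis using Cons by fastforce
qed simp

text \<open>Together with \<open>arches_surj\<close> this turns arch systems into a free datatype,
  so that the relation can be studied on lists of trees.\<close>

lemma arches_inject: "arches ts = arches us \<longleftrightarrow> ts = us"
proof
  assume "arches ts = arches us"
  then show "ts = us"
  proof (induction "sum_list (map tsize ts)" arbitrary: ts us rule: less_induct)
    case less
    show ?case
    proof (cases ts)
      case Nil
      then show ?thesis using less.prems by (metis arches_eq_empty)
    next
      case (Cons t ts')
      then obtain u us' where us: "us = u # us'" using less.prems by (metis arches_eq_empty neq_Nil_conv)
      obtain t' u' where tu: "t = Node t'" "u = Node u'" by (metis tree.exhaust)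
      have "\<langle>arches t'\<rangle> \<odot> arches ts' = \<langle>arches u'\<rangle> \<odot> arches us'"
        using less.prems Cons us tu by simp
      then have "arches t' = arches u'" "arches ts' = arches us'"
        using enclose_concat_inject[of "arches t'" "arches ts'" "arches u'" "arches us'"] by auto
      then show ?thesis
        using less.hyps[of t' u'] less.hyps[of ts' us'] Cons us tu by simp
    qed
  qed
qed simp

text \<open>Concatenations of systems correspond to appended code lists, so atoms are the systems
  coded by singleton lists.\<close>

lemma atom_iff: "atom A \<longleftrightarrow> (\<exists>t. A = arch t)"
proof
  assume "atom A"
  then have A: "arch_system A" "A \<noteq> {}"
    and nd: "\<not> (\<exists>B C. arch_system B \<and> B \<noteq> {} \<and> arch_system C \<and> C \<noteq> {} \<and> A = B \<odot> C)"
    by (auto simp: atom_def)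
  obtain ts where ts: "A = arches ts" using arches_surj[OF A(1)] by blast
  with A obtain t us where tus: "ts = t # us" by (cases ts) auto
  have "arch t \<noteq> {}" using arches_eq_empty[of "[t]"] by simp
  moreover have "A = arch t \<odot> arches us" using ts tus by simp
  ultimately have "arches us = {}" using nd by (metis arch_system_arch arch_system_arches)
  then have "us = []" by simp
  then show "\<exists>t. A = arch t" using ts tus by auto
next
  assume "\<exists>t. A = arch t"
  then obtain t where A: "A = arches [t]" by auto
  have False if BC: "arch_system B" "B \<noteq> {}" "arch_system C" "C \<noteq> {}" "A = B \<odot> C" for B C
  proof -
    obtain bs cs where bc: "B = arches bs" "C = arches cs"
      using arches_surj[OF BC(1)] arches_surj[OF BC(3)] by blast
    then have "arches [t] = arches (bs @ cs)" using that(5) A by (simp only: arches_append)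
    then have "[t] = bs @ cs" by (simp only: arches_inject)
    moreover have "bs \<noteq> []" "cs \<noteq> []" using that(2,4) bc by auto
    ultimately show False by (simp add: Cons_eq_append_conv)
  qed
  moreover have "A \<noteq> {}" using A arches_eq_empty[of "[t]"] by simp
  moreover have "arch_system A" using A by simp
  ultimately show "atom A" unfolding atom_def by blast
qed

lemma atom_or_empty_arches: "length s \<le> 1 \<Longrightarrow> atom_or_empty (arches s)"
  by (cases s) (auto simp: atom_iff)

lemma atom_or_emptyE:
  assumes "atom_or_empty A"
  obtains s where "A = arches s" "length s \<le> 1"
proof (cases "A = {}")
  case True
  then show ?thesis using that[of "[]"] by simp
next
  case False
  then obtain t where "A = arch t" using assms by (auto simp: atom_iff)
  then show ?thesis using that[of "[t]"] by simp
qed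

section \<open>Classification of cohorts\<close>

text \<open>A \<open>leaf multiset\<close> is a tree up to equivalence, and \<open>Big\<close>
  records the children of a vertex that stays. That there are at least three of them is not part of
  the type; \<open>leaves\<close> imposes it later.\<close>

datatype leaf = Empty | Big "leaf multiset multiset"

definition combine :: "leaf multiset list \<Rightarrow> leaf multiset" where
  "combine Ns = (if length Ns \<ge> 3 then {#Big (mset Ns)#}
     else sum_list Ns + replicate_mset (2 - length Ns) Empty)"

primrec shape :: "tree \<Rightarrow> leaf multiset" where
  "shape (Node ts) = combine (map shape ts)"

definition fshape :: "tree list \<Rightarrow> leaf multiset" where
  "fshape ts = combine (map shape ts)"

lemma shape_Node [simp]: "shape (Node ts) = fshape ts"
  by (simp add: fshape_def)

declare shape.simps [simp del]

text \<open>Lists of length at most one, called slots, encode "an atom or empty" in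
  (R2)-(R4).\<close>

definition slot_shape :: "tree list \<Rightarrow> leaf multiset" where
  "slot_shape s = (if s = [] then {#Empty#} else shape (hd s))"

lemma slot_shape_simps [simp]: "slot_shape [] = {#Empty#}" "slot_shape (t # s) = shape t"
  by (auto simp: slot_shape_def)

lemma slot_cases: "length s \<le> 1 \<Longrightarrow> s = [] \<or> (\<exists>t. s = [t])"
  by (cases s) auto

lemma fshape_slots:
  assumes "length a \<le> 1" "length b \<le> 1"
  shows "fshape (a @ b) = slot_shape a + slot_shape b"
  using slot_cases[OF assms(1)] slot_cases[OF assms(2)]
  by (elim disjE exE) (simp_all add: fshape_def combine_def numeral_2_eq_2)

lemma fshape_big: "length f \<ge> 3 \<Longrightarrow> fshape f = {#Big (mset (map shape f))#}"
  by (simp add: fshape_def combine_def)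

lemma short_forest_cases:
  assumes "\<not> length f \<ge> 3"
  obtains a b where "length a \<le> 1" "length b \<le> 1" "f = a @ b"
proof
  show "length (take 1 f) \<le> 1" "length (drop 1 f) \<le> 1" "f = take 1 f @ drop 1 f"
    using assms by auto
qed

lemma shape_nonempty: "shape t \<noteq> {#}"
proof (induction t)
  case (Node ts)
  show ?case
  proof (cases "length ts \<ge> 3")
    case True
    then show ?thesis by (simp add: fshape_big)
  next
    case False
    then obtain a b where ab: "length a \<le> 1" "length b \<le> 1" "ts = a @ b" by (rule short_forest_cases)
    have "slot_shape a \<noteq> {#}" using slot_cases[OF ab(1)] Node ab(3) by auto
    then show ?thesis using ab by (simp add: fshape_slots)
  qed
qed

lemma slot_shape_nonempty: "length s \<le> 1 \<Longrightarrow> slot_shape s \<noteq> {#}"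
  using slot_cases[of s] shape_nonempty by auto

text \<open>Both slots contribute at least one leaf. As a forest of three or more trees has a shape
  of size 1, the size of the shape separates the two cases.\<close>

lemma size_fshape_short:
  assumes "\<not> length f \<ge> 3"
  shows "size (fshape f) \<ge> 2"
proof -
  obtain a b where ab: "length a \<le> 1" "length b \<le> 1" "f = a @ b"
    using assms by (rule short_forest_cases)
  then have "size (slot_shape a) \<ge> 1" "size (slot_shape b) \<ge> 1"
    using slot_shape_nonempty by (simp_all add: Suc_le_eq nonempty_has_size)
  then show ?thesis using ab by (simp add: fshape_slots)
qed

lemma shape_neq_Empty: "shape t \<noteq> {#Empty#}"
proof (cases t)
  case (Node ts)
  show ?thesis
  proof (cases "length ts \<ge> 3")
    case True
    then show ?thesis by (simp add: Node fshape_big)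
  next
    case False
    from size_fshape_short[OF this] show ?thesis by (auto simp: Node)
  qed
qed

text \<open>Adding a second empty slot on both sides turns equal forest shapes into equal slot
  shapes. No tree has shape \<open>{#Empty#}\<close>, so an empty slot is never confused with an
  occupied one. This makes (R2) sound in contexts of any length.\<close>

lemma fshape_slot_inject:
  assumes "length a \<le> 1" "length b \<le> 1" "fshape a = fshape b"
  shows "map shape a = map shape b"
proof -
  have "slot_shape a = slot_shape b"
    using assms fshape_slots[of a "[]"] fshape_slots[of b "[]"] by simp
  then show ?thesis
    using slot_cases[OF assms(1)] slot_cases[OF assms(2)] shape_neq_Empty
    by (elim disjE exE) (simp_all, metis)
qed

lemma combine_mset:
  assumes "mset Ns = mset Ms"
  shows "combine Ns = combine Ms"
proof -
  have "length Ns = length Ms" using assms by (metis size_mset)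
  moreover have "sum_list Ns = sum_list Ms" using assms by (metis sum_mset_sum_list)
  ultimately show ?thesis using assms by (simp add: combine_def)
qed

lemma cohort_eq_fshape:
  assumes "A \<sim> B"
  shows "\<exists>f g. A = arches f \<and> B = arches g \<and> fshape f = fshape g"
  using assms
proof induction
  case (refl A)
  then show ?case using arches_surj by blast
next
  case (sym A B)
  then show ?case by metis
next
  case (trans A B C)
  then show ?case by (metis arches_inject)
next
  case (R1 A B)
  then obtain f g where "A = arches f" "B = arches g" "fshape f = fshape g" by blast
  then show ?case
    by (intro exI[of _ "[Node f]"] exI[of _ "[Node g]"]) (simp add: fshape_def)
next
  case (R2 P Q a b)
  obtain p q where pq: "P = arches p" "Q = arches q" using arches_surj R2.hyps(1,2) by blast
  obtain s where s: "a = arches s" "length s \<le> 1" using R2.hyps(3) by (rule atom_or_emptyE)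
  obtain s' where s': "b = arches s'" "length s' \<le> 1" using R2.hyps(4) by (rule atom_or_emptyE)
  have "fshape s = fshape s'" using R2.IH s s' by (auto simp: arches_inject)
  then have "map shape s = map shape s'" using s s' by (intro fshape_slot_inject)
  then have "fshape (p @ s @ q) = fshape (p @ s' @ q)" by (simp add: fshape_def)
  then show ?case using pq s s' by (metis arches_append)
next
  case (R3 P Q a b)
  obtain p q where pq: "P = arches p" "Q = arches q" using arches_surj R3.hyps(1,2) by blast
  obtain s where s: "a = arches s" "length s \<le> 1" using R3.hyps(3) by (rule atom_or_emptyE)
  obtain s' where s': "b = arches s'" "length s' \<le> 1" using R3.hyps(4) by (rule atom_or_emptyE)
  have "fshape (p @ s @ s' @ q) = fshape (p @ s' @ s @ q)"
    unfolding fshape_def by (rule combine_mset) simp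
  then show ?case using pq s s' by (metis arches_append)
next
  case (R4 a b c)
  obtain s where s: "a = arches s" "length s \<le> 1" using R4(1) by (rule atom_or_emptyE)
  obtain s' where s': "b = arches s'" "length s' \<le> 1" using R4(2) by (rule atom_or_emptyE)
  obtain s'' where s'': "c = arches s''" "length s'' \<le> 1" using R4(3) by (rule atom_or_emptyE)
  \<comment> \<open>Both sides have the shape
    \<open>slot_shape s + slot_shape s' + slot_shape s''\<close>: (R4) is associativity of multiset
    union.\<close>
  have "fshape (s @ [Node (s' @ s'')]) = fshape ([Node (s @ s')] @ s'')"
    using s s' s'' fshape_slots[of s "[Node (s' @ s'')]"] fshape_slots[of "[Node (s @ s')]" s'']
    by (simp add: fshape_slots)
  moreover have "a \<odot> \<langle>b \<odot> c\<rangle> = arches (s @ [Node (s' @ s'')])" "\<langle>a \<odot> b\<rangle> \<odot> c = arches ([Node (s @ s')] @ s'')"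
    using s s' s'' by simp_all
  ultimately show ?case by blast
qed

section \<open>Completeness of the invariant: the calculus of slots\<close>

definition forest_eq :: "tree list \<Rightarrow> tree list \<Rightarrow> bool" (infix "\<simeq>" 50) where
  "f \<simeq> g \<longleftrightarrow> arches f \<sim> arches g"

lemma forest_eq_refl [simp]: "f \<simeq> f"
  by (simp add: forest_eq_def cohort_eq.refl)

lemma forest_eq_sym: "f \<simeq> g \<Longrightarrow> g \<simeq> f"
  unfolding forest_eq_def by (rule cohort_eq.sym)

lemma forest_eq_trans [trans]: "f \<simeq> g \<Longrightarrow> g \<simeq> h \<Longrightarrow> f \<simeq> h"
  unfolding forest_eq_def by (rule cohort_eq.trans)

lemma forest_eq_Node: "f \<simeq> g \<Longrightarrow> [Node f] \<simeq> [Node g]"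
  unfolding forest_eq_def using cohort_eq.R1 by simp

lemma forest_eq_context:
  "length s \<le> 1 \<Longrightarrow> length s' \<le> 1 \<Longrightarrow> s \<simeq> s' \<Longrightarrow> p @ s @ q \<simeq> p @ s' @ q"
  unfolding forest_eq_def arches_append arches_Cons arches_Nil arch_Node concat_empty_right
  by (rule cohort_eq.R2) (simp_all only: arch_system_arches atom_or_empty_arches)

lemma forest_eq_swap:
  "length s \<le> 1 \<Longrightarrow> length s' \<le> 1 \<Longrightarrow> p @ s @ s' @ q \<simeq> p @ s' @ s @ q"
  unfolding forest_eq_def arches_append arches_Cons arches_Nil arch_Node concat_empty_right
  by (rule cohort_eq.R3) (simp_all only: arch_system_arches atom_or_empty_arches)

lemma forest_eq_assoc:
  "length a \<le> 1 \<Longrightarrow> length b \<le> 1 \<Longrightarrow> length c \<le> 1 \<Longrightarrow> a @ [Node (b @ c)] \<simeq> [Node (a @ b)] @ c"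
  unfolding forest_eq_def arches_append arches_Cons arches_Nil arch_Node concat_empty_right
  by (rule cohort_eq.R4) (simp_all only: arch_system_arches atom_or_empty_arches)

lemma forest_eq_move: "p @ g @ [t] @ q \<simeq> p @ [t] @ g @ q"
proof (induction g arbitrary: q rule: rev_induct)
  case (snoc x g)
  have "p @ (g @ [x]) @ [t] @ q \<simeq> p @ g @ [t] @ [x] @ q"
    using forest_eq_swap[of "[x]" "[t]" "p @ g" q] by simp
  also have "\<dots> \<simeq> p @ [t] @ g @ [x] @ q" by (rule snoc.IH)
  finally show ?case by simp
qed simp

lemma forest_eq_mset: "mset f = mset g \<Longrightarrow> p @ f \<simeq> p @ g"
proof (induction f arbitrary: p g)
  case (Cons t f)
  then have "t \<in> set g" by (metis list.set_intros(1) set_mset_mset)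
  then obtain g1 g2 where g: "g = g1 @ t # g2" by (meson split_list)
  with Cons.prems have "mset f = mset (g1 @ g2)" by simp
  from Cons.IH[OF this, of "p @ [t]"] have "p @ t # f \<simeq> p @ [t] @ g1 @ g2" by simp
  also have "\<dots> \<simeq> p @ g1 @ [t] @ g2" by (rule forest_eq_sym[OF forest_eq_move])
  finally show ?case by (simp add: g)
qed simp

lemma forest_eq_list_all2: "list_all2 (\<lambda>t u. [t] \<simeq> [u]) f g \<Longrightarrow> p @ f \<simeq> p @ g"
proof (induction f g arbitrary: p rule: list_all2_induct)
  case (Cons t f u g)
  have "p @ [t] @ f \<simeq> p @ [u] @ f"
    by (rule forest_eq_context) (use Cons in simp_all)
  also have "p @ [u] @ f \<simeq> p @ [u] @ g"
    using Cons.IH[of "p @ [u]"] by simp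
  finally show ?case by simp
qed simp

text \<open>Read \<open>[Node (a @ b)]\<close> as the product of the slots \<open>a\<close> and
  \<open>b\<close>. Then (R4) is associativity with the outermost arch stripped off.
  \<open>slot_prod\<close> is the right-nested product, and a single slot is its own
  product.\<close>

fun slot_prod :: "tree list list \<Rightarrow> tree list" where
  "slot_prod [] = []"
| "slot_prod [s] = s"
| "slot_prod (s # s' # ss) = [Node (s @ slot_prod (s' # ss))]"

abbreviation slots :: "tree list list \<Rightarrow> bool" where
  "slots ss \<equiv> (\<forall>s \<in> set ss. length s \<le> 1)"

lemma length_slot_prod: "slots ss \<Longrightarrow> length (slot_prod ss) \<le> 1"
  by (induction ss rule: slot_prod.induct) auto

lemma slot_prod_Cons: "ss \<noteq> [] \<Longrightarrow> slot_prod (s # ss) = [Node (s @ slot_prod ss)]"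
  by (cases ss) auto

lemma pair_cong:
  assumes "length a \<le> 1" "length b \<le> 1" "length a' \<le> 1" "length b' \<le> 1" "a \<simeq> a'" "b \<simeq> b'"
  shows "a @ b \<simeq> a' @ b'"
proof -
  have "a @ b \<simeq> a' @ b" using forest_eq_context[of a a' "[]" b] assms by simp
  also have "\<dots> \<simeq> a' @ b'" using forest_eq_context[of b b' a' "[]"] assms by simp
  finally show ?thesis .
qed

lemma pair_commute: "length a \<le> 1 \<Longrightarrow> length b \<le> 1 \<Longrightarrow> a @ b \<simeq> b @ a"
  using forest_eq_swap[of a b "[]" "[]"] by simp

text \<open>Reassociate until \<open>a\<close> and \<open>b\<close> share a node, exchange them
  there by (R3), and reassociate back.\<close>

lemma slot_prod_swap:
  assumes "length a \<le> 1" "length b \<le> 1" "slots ss"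
  shows "a @ slot_prod (b # ss) \<simeq> b @ slot_prod (a # ss)"
proof (cases "ss = []")
  case True
  then show ?thesis using pair_commute assms by simp
next
  case False
  let ?c = "slot_prod ss"
  have c: "length ?c \<le> 1" using assms by (intro length_slot_prod)
  have "a @ [Node (b @ ?c)] \<simeq> [Node (a @ b)] @ ?c"
    using assms c by (intro forest_eq_assoc)
  also have "\<dots> \<simeq> [Node (b @ a)] @ ?c"
    using assms c by (intro pair_cong forest_eq_Node pair_commute) auto
  also have "\<dots> \<simeq> b @ [Node (a @ ?c)]"
    using assms c by (intro forest_eq_sym[OF forest_eq_assoc])
  finally show ?thesis using False by (simp add: slot_prod_Cons)
qed

text \<open>The same product without its outermost arch, because a forest has two slots but no root
  of its own.\<close>

definition forest_prod :: "tree list list \<Rightarrow> tree list" where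
  "forest_prod ss = hd ss @ slot_prod (tl ss)"

lemma forest_prod_Cons [simp]: "forest_prod (s # ss) = s @ slot_prod ss"
  by (simp add: forest_prod_def)

lemma slot_prod_eq: "length ss \<ge> 2 \<Longrightarrow> slot_prod ss = [Node (forest_prod ss)]"
  by (cases ss rule: slot_prod.cases) auto

text \<open>Below the first factor \<open>x\<close>, the factor \<open>l\<close> moves to the front
  by induction, inside the nested product; \<open>slot_prod_swap\<close> then exchanges it with
  \<open>x\<close>.\<close>

lemma forest_prod_front:
  assumes "slots (xs @ l # ys)" "xs @ ys \<noteq> []"
  shows "forest_prod (xs @ l # ys) \<simeq> forest_prod (l # xs @ ys)"
  using assms
proof (induction xs)
  case (Cons x xs)
  have l: "length l \<le> 1" "length x \<le> 1" "slots (xs @ ys)" using Cons.prems by auto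
  have "slot_prod (xs @ l # ys) \<simeq> slot_prod (l # xs @ ys)"
  proof (cases "xs @ ys = []")
    case False
    then have "forest_prod (xs @ l # ys) \<simeq> forest_prod (l # xs @ ys)"
      using Cons by simp
    moreover have "length (xs @ ys) > 0" using False by blast
    then have "length (xs @ l # ys) \<ge> 2" "length (l # xs @ ys) \<ge> 2"
      unfolding length_append list.size by linarith+
    ultimately show ?thesis using forest_eq_Node by (simp only: slot_prod_eq)
  qed simp
  then have "x @ slot_prod (xs @ l # ys) \<simeq> x @ slot_prod (l # xs @ ys)"
    using Cons.prems by (intro pair_cong length_slot_prod) auto
  also have "\<dots> \<simeq> l @ slot_prod (x # xs @ ys)"
    by (rule slot_prod_swap[OF l(2,1,3)])
  finally show ?case by simp
qed simp

lemma forest_prod_mset: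
  assumes "mset ls = mset ms" "slots ls" "length ls \<ge> 2"
  shows "forest_prod ls \<simeq> forest_prod ms"
  using assms
proof (induction ls arbitrary: ms)
  case (Cons l ls)
  then have "l \<in> set ms" by (metis list.set_intros(1) set_mset_mset)
  then obtain g1 g2 where g: "ms = g1 @ l # g2" by (meson split_list)
  with Cons.prems(1) have eq: "mset ls = mset (g1 @ g2)" by simp
  have ne: "ls \<noteq> []" using Cons.prems by auto
  then have ne': "g1 @ g2 \<noteq> []" using eq by auto
  have sl: "slots (l # g1 @ g2)"
    using Cons.prems(2) eq by (metis list.set(2) mset_eq_setD)
  have "slot_prod ls \<simeq> slot_prod (g1 @ g2)"
  proof (cases "length ls \<ge> 2")
    case True
    moreover have "length (g1 @ g2) = length ls" using eq by (metis size_mset)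
    ultimately show ?thesis
      using forest_eq_Node[OF Cons.IH[OF eq]] Cons.prems(2) by (simp add: slot_prod_eq)
  next
    case False
    then obtain x where "ls = [x]" using ne by (cases ls; cases "tl ls") auto
    then have "g1 @ g2 = ls" using eq by (metis mset_single_iff_right mset.simps(1,2) add_mset_eq_single)
    then show ?thesis by simp
  qed
  then have "l @ slot_prod ls \<simeq> l @ slot_prod (g1 @ g2)"
    using Cons.prems(2) sl by (intro pair_cong length_slot_prod) auto
  also have "\<dots> \<simeq> forest_prod (g1 @ l # g2)"
    using forest_eq_sym[OF forest_prod_front[of g1 l g2]] sl ne' by simp
  finally show ?case by (simp add: g)
qed simp

lemma slot_prod_list_all2:
  assumes "list_all2 (\<simeq>) ls ms" "slots ls" "slots ms"
  shows "slot_prod ls \<simeq> slot_prod ms"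
  using assms
proof (induction ls ms rule: list_all2_induct)
  case (Cons l ls m ms)
  have "l @ slot_prod ls \<simeq> m @ slot_prod ms"
    using Cons by (intro pair_cong length_slot_prod) auto
  moreover have "ls = [] \<longleftrightarrow> ms = []" using Cons.hyps by auto
  ultimately show ?case
    using Cons.hyps(1) forest_eq_Node by (cases "ls = []") (auto simp: slot_prod_Cons)
qed simp

lemma forest_prod_list_all2:
  assumes "list_all2 (\<simeq>) ls ms" "slots ls" "slots ms"
  shows "forest_prod ls \<simeq> forest_prod ms"
proof (cases ls)
  case Nil
  then show ?thesis using assms by simp
next
  case (Cons l ls')
  then obtain m ms' where "ms = m # ms'" "l \<simeq> m" "list_all2 (\<simeq>) ls' ms'"
    using assms(1) by (auto simp: list_all2_Cons1)
  then show ?thesis using Cons assms by (auto intro!: pair_cong slot_prod_list_all2 length_slot_prod)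
qed

text \<open>Each use of (R4) peels one factor off the left product and moves the rest of it into the
  node on the right.\<close>

lemma slot_prod_append:
  assumes "slots xs" "slots ys" "xs \<noteq> []" "ys \<noteq> []"
  shows "slot_prod xs @ slot_prod ys \<simeq> forest_prod (xs @ ys)"
  using assms
proof (induction xs)
  case (Cons x xs)
  show ?case
  proof (cases "xs = []")
    case False
    have l: "length x \<le> 1" "length (slot_prod xs) \<le> 1" "length (slot_prod ys) \<le> 1" "slots (xs @ ys)"
      using Cons.prems length_slot_prod[of xs] length_slot_prod[of ys] by auto
    have "length xs > 0" "length ys > 0" using False Cons.prems by auto
    then have len: "length (xs @ ys) \<ge> 2" by (simp del: length_greater_0_conv)
    have "slot_prod (x # xs) @ slot_prod ys = [Node (x @ slot_prod xs)] @ slot_prod ys"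
      using False by (simp add: slot_prod_Cons)
    also have "\<dots> \<simeq> x @ [Node (slot_prod xs @ slot_prod ys)]"
      using l by (intro forest_eq_sym[OF forest_eq_assoc])
    also have "\<dots> \<simeq> x @ [Node (forest_prod (xs @ ys))]"
      using l False Cons by (intro pair_cong forest_eq_Node Cons.IH) auto
    also have "\<dots> = forest_prod ((x # xs) @ ys)" using len by (simp add: slot_prod_eq)
    finally show ?thesis .
  qed simp
qed simp

text \<open>The slots at which the unfolding of nodes with at most two children stops.\<close>

definition is_leaf :: "tree list \<Rightarrow> bool" where
  "is_leaf s \<longleftrightarrow> s = [] \<or> (\<exists>f. s = [Node f] \<and> length f \<ge> 3)"

lemma is_leaf_slot: "is_leaf s \<Longrightarrow> length s \<le> 1"
  by (auto simp: is_leaf_def)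

abbreviation fsize :: "tree list \<Rightarrow> nat" where
  "fsize f \<equiv> sum_list (map tsize f)"

text \<open>Nodes with at most two children are unfolded until none is left. The bound on
  \<open>fsize l\<close> allows the completeness proof to compare the leaves within its own
  induction on size.\<close>

lemma leaf_decomposition:
  assumes "\<not> length f \<ge> 3"
  shows "\<exists>ls. length ls \<ge> 2 \<and> (\<forall>l \<in> set ls. is_leaf l \<and> fsize l \<le> fsize f) \<and>
           f \<simeq> forest_prod ls \<and> fshape f = sum_list (map slot_shape ls)"
  using assms
proof (induction "fsize f" arbitrary: f rule: less_induct)
  case less
  obtain a b where ab: "length a \<le> 1" "length b \<le> 1" "f = a @ b"
    using less.prems by (rule short_forest_cases)
  have slot: "\<exists>ls. ls \<noteq> [] \<and> (\<forall>l \<in> set ls. is_leaf l \<and> fsize l \<le> fsize f) \<and>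
        s \<simeq> slot_prod ls \<and> slot_shape s = sum_list (map slot_shape ls)"
    if s: "length s \<le> 1" "fsize s \<le> fsize f" for s
  proof (cases "is_leaf s")
    case True
    then show ?thesis using s by (intro exI[of _ "[s]"]) auto
  next
    case False
    then obtain t where "s = [t]" using slot_cases[OF s(1)] by (auto simp: is_leaf_def)
    moreover obtain h where "t = Node h" by (cases t)
    ultimately have h: "s = [Node h]" "\<not> length h \<ge> 3" using False by (auto simp: is_leaf_def)
    then have "fsize h < fsize f" using s(2) by simp
    from less.hyps[OF this h(2)] obtain ls where ls: "length ls \<ge> 2"
      "\<forall>l \<in> set ls. is_leaf l \<and> fsize l \<le> fsize h" "h \<simeq> forest_prod ls"
      "fshape h = sum_list (map slot_shape ls)" by blast
    have "s \<simeq> slot_prod ls" using forest_eq_Node[OF ls(3)] ls(1) h by (simp add: slot_prod_eq)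
    moreover have "ls \<noteq> []" using ls(1) by auto
    ultimately show ?thesis
      using ls(2,4) h(1) \<open>fsize h < fsize f\<close> by (intro exI[of _ ls]) force
  qed
  have "fsize a \<le> fsize f" "fsize b \<le> fsize f" using ab by simp_all
  from slot[OF ab(1) this(1)] slot[OF ab(2) this(2)] obtain xs ys where
    xs: "xs \<noteq> []" "\<forall>l \<in> set xs. is_leaf l \<and> fsize l \<le> fsize f" "a \<simeq> slot_prod xs"
      "slot_shape a = sum_list (map slot_shape xs)" and
    ys: "ys \<noteq> []" "\<forall>l \<in> set ys. is_leaf l \<and> fsize l \<le> fsize f" "b \<simeq> slot_prod ys"
      "slot_shape b = sum_list (map slot_shape ys)" by blast
  have sl: "slots xs" "slots ys" using xs(2) ys(2) is_leaf_slot by blast+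
  have "f \<simeq> slot_prod xs @ slot_prod ys"
    unfolding ab(3) using ab(1,2) sl xs(3) ys(3) by (intro pair_cong length_slot_prod)
  also have "\<dots> \<simeq> forest_prod (xs @ ys)" using sl xs(1) ys(1) by (intro slot_prod_append)
  finally have "f \<simeq> forest_prod (xs @ ys)" .
  moreover have "fshape f = sum_list (map slot_shape (xs @ ys))"
    using ab xs(4) ys(4) by (simp add: fshape_slots)
  moreover have "length xs > 0" "length ys > 0" using xs(1) ys(1) by auto
  then have "length (xs @ ys) \<ge> 2" by (simp del: length_greater_0_conv)
  ultimately show ?case using xs(2) ys(2) by (intro exI[of _ "xs @ ys"]) auto
qed

lemma mset_map_eq_permute:
  "mset (map f xs) = mset (map g ys) \<Longrightarrow> \<exists>zs. mset zs = mset ys \<and> map f xs = map g zs"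
proof (induction xs arbitrary: ys)
  case (Cons x xs)
  then have "f x \<in> set (map g ys)" by (metis list.set_intros(1) list.simps(9) set_mset_mset)
  then obtain y where y: "y \<in> set ys" "f x = g y" by auto
  then obtain g1 g2 where ys: "ys = g1 @ y # g2" by (meson split_list)
  have "mset (map f xs) = mset (map g (g1 @ g2))" using Cons.prems ys y by simp
  from Cons.IH[OF this] obtain zs where "mset zs = mset (g1 @ g2)" "map f xs = map g zs" by blast
  then show ?case using y ys by (intro exI[of _ "y # zs"]) simp
qed simp

lemma forest_eq_mset_shape:
  assumes "mset (map shape f) = mset (map shape g)"
    and "\<And>t u. t \<in> set f \<Longrightarrow> u \<in> set g \<Longrightarrow> shape t = shape u \<Longrightarrow> [t] \<simeq> [u]"
  shows "f \<simeq> g"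
proof -
  obtain h where h: "mset h = mset g" "map shape f = map shape h"
    using mset_map_eq_permute[OF assms(1)] by blast
  have "list_all2 (\<lambda>t u. [t] \<simeq> [u]) f h"
  proof (rule list_all2_all_nthI)
    show len: "length f = length h" using h(2) by (metis length_map)
    fix n assume n: "n < length f"
    have "f ! n \<in> set f" "h ! n \<in> set g" using n len h(1) by (metis nth_mem mset_eq_setD)+
    moreover have "shape (f ! n) = shape (h ! n)" using h(2) n len by (metis nth_map)
    ultimately show "[f ! n] \<simeq> [h ! n]" by (rule assms(2))
  qed
  from forest_eq_list_all2[OF this, of "[]"] forest_eq_mset[OF h(1), of "[]"]
  show ?thesis using forest_eq_trans by simp
qed

lemma leaf_shape: "is_leaf l \<Longrightarrow> \<exists>x. slot_shape l = {#x#}"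
  by (auto simp: is_leaf_def fshape_big)

text \<open>Two short forests of equal shape are products of leaves that agree in value after a
  permutation. Products can be reordered, and leaves of equal value are both empty or are nodes
  whose children can be matched, which is settled by induction.\<close>

lemma fshape_complete:
  assumes "fshape f = fshape g"
  shows "f \<simeq> g"
  using assms
proof (induction "fsize f + fsize g" arbitrary: f g rule: less_induct)
  case less
  \<comment> \<open>The induction hypothesis is applied to the contents, which are smaller than the
    trees; hence the tree sizes may add up to the full bound.\<close>
  have tree: "[t] \<simeq> [u]" if tu: "tsize t + tsize u \<le> fsize f + fsize g" "shape t = shape u" for t u
  proof -
    obtain f' g' where fg: "t = Node f'" "u = Node g'" by (metis tree.exhaust)
    have "f' \<simeq> g'" using tu by (intro less.hyps) (simp_all add: fg)
    then show ?thesis by (simp add: fg forest_eq_Node)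
  qed
  have big: "f' \<simeq> g'" if fg: "fsize f' + fsize g' \<le> fsize f + fsize g"
      "mset (map shape f') = mset (map shape g')" for f' g'
  proof (rule forest_eq_mset_shape[OF fg(2)])
    fix t u assume "t \<in> set f'" "u \<in> set g'" "shape t = shape u"
    moreover from this have "tsize t \<le> fsize f'" "tsize u \<le> fsize g'"
      by (auto intro!: member_le_sum_list)
    ultimately show "[t] \<simeq> [u]" using fg(1) by (intro tree) auto
  qed
  show ?case
  proof (cases "length f \<ge> 3")
    case True
    then have ff: "fshape f = {#Big (mset (map shape f))#}" by (rule fshape_big)
    then have "size (fshape g) = 1" using less.prems by simp
    then have "length g \<ge> 3" using size_fshape_short[of g] by (cases "length g \<ge> 3") auto
    then have "mset (map shape f) = mset (map shape g)"
      using ff less.prems by (simp add: fshape_big)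
    then show ?thesis by (intro big) auto
  next
    case False
    have F: "\<not> length g \<ge> 3"
      using size_fshape_short[OF False] less.prems fshape_big[of g] by auto
    obtain ls where ls: "length ls \<ge> 2" "\<forall>l \<in> set ls. is_leaf l \<and> fsize l \<le> fsize f"
      "f \<simeq> forest_prod ls" "fshape f = sum_list (map slot_shape ls)"
      using leaf_decomposition[OF False] by blast
    obtain ms where ms: "length ms \<ge> 2" "\<forall>l \<in> set ms. is_leaf l \<and> fsize l \<le> fsize g"
      "g \<simeq> forest_prod ms" "fshape g = sum_list (map slot_shape ms)"
      using leaf_decomposition[OF F] by blast
    \<comment> \<open>The value of a leaf slot: its shape is a singleton by
      \<open>leaf_shape\<close>.\<close>
    define v where "v l = (THE x. slot_shape l = {#x#})" for l
    have v: "slot_shape l = {#v l#}" if "is_leaf l" for l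
      using leaf_shape[OF that] by (auto simp: v_def)
    have sum: "sum_list (map slot_shape ls) = mset (map v ls)" if "\<forall>l \<in> set ls. is_leaf l" for ls
      using that by (induction ls) (auto simp: v)
    have "mset (map v ls) = mset (map v ms)"
      using sum[of ls] sum[of ms] ls(2,4) ms(2,4) less.prems by auto
    then obtain ns where ns: "mset ns = mset ms" "map v ls = map v ns"
      using mset_map_eq_permute by blast
    have sns: "set ns = set ms" using ns(1) by (rule mset_eq_setD)
    have sl: "slots ls" "slots ms" "slots ns" using ls(2) ms(2) is_leaf_slot sns by auto
    have "list_all2 (\<simeq>) ls ns"
    proof (rule list_all2_all_nthI)
      show len: "length ls = length ns" using ns(2) by (metis length_map)
      fix n assume n: "n < length ls"
      define l m where "l = ls ! n" and "m = ns ! n"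
      have "l \<in> set ls" using n by (simp add: l_def)
      moreover have "m \<in> set ms" using n len unfolding sns[symmetric] by (simp add: m_def)
      ultimately have lm: "is_leaf l" "is_leaf m" "fsize l \<le> fsize f" "fsize m \<le> fsize g"
        using ls(2) ms(2) by auto
      have "v l = v m" using ns(2) n len unfolding l_def m_def by (metis nth_map)
      then have eq: "slot_shape l = slot_shape m" using lm v by simp
      show "ls ! n \<simeq> ns ! n"
      proof (cases "l = []")
        case True
        then have "m = []" using eq lm(2) by (auto simp: is_leaf_def fshape_big)
        then show ?thesis using True by (simp add: l_def m_def)
      next
        case False
        then obtain l' where l': "l = [Node l']" "length l' \<ge> 3" using lm by (auto simp: is_leaf_def)
        then have "m \<noteq> []" using eq by (auto simp: fshape_big)
        then obtain m' where m': "m = [Node m']" "length m' \<ge> 3" using lm by (auto simp: is_leaf_def)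
        have "mset (map shape l') = mset (map shape m')" using eq l' m' by (simp add: fshape_big)
        then have "l' \<simeq> m'" using lm l' m' by (intro big) auto
        then have "l \<simeq> m" using l' m' forest_eq_Node by simp
        then show ?thesis by (simp add: l_def m_def)
      qed
    qed
    then have "forest_prod ls \<simeq> forest_prod ns" using sl by (intro forest_prod_list_all2)
    moreover have "forest_prod ns \<simeq> forest_prod ms"
    proof (rule forest_prod_mset)
      show "length ns \<ge> 2" using ns(1) ms(1) by (metis size_mset)
    qed (use ns sl in auto)
    ultimately show ?thesis using ls(3) ms(3) forest_eq_sym forest_eq_trans by meson
  qed
qed

theorem cohort_eq_iff: "arches f \<sim> arches g \<longleftrightarrow> fshape f = fshape g"
proof
  assume "arches f \<sim> arches g"
  then show "fshape f = fshape g" using cohort_eq_fshape by (metis arches_inject)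
next
  assume "fshape f = fshape g"
  then show "arches f \<sim> arches g" using fshape_complete by (simp add: forest_eq_def)
qed

theorem card_cohorts: "card (cohorts n) = card (fshape ` {f. fsize f = n})"
proof -
  let ?S = "{A. arch_system A \<and> card A = n}"
  let ?R = "{(A, B). arch_system A \<and> card A = n \<and> arch_system B \<and> card B = n \<and> A \<sim> B}"
  let ?cls = "\<lambda>v. {arches g | g. fsize g = n \<and> fshape g = v}"
  have S: "?S = arches ` {f. fsize f = n}"
  proof (intro subset_antisym subsetI)
    fix A assume A: "A \<in> ?S"
    then obtain f where "A = arches f" using arches_surj by blast
    then show "A \<in> arches ` {f. fsize f = n}" using A by auto
  qed auto
  have cls: "?R `` {arches f} = ?cls (fshape f)" if "fsize f = n" for f
  proof (intro subset_antisym subsetI)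
    fix B assume B: "B \<in> ?R `` {arches f}"
    then obtain g where "B = arches g" using arches_surj by blast
    then show "B \<in> ?cls (fshape f)" using B by (auto simp: cohort_eq_iff)
  qed (use that in \<open>auto simp: cohort_eq_iff\<close>)
  have "cohorts n = (\<lambda>A. ?R `` {A}) ` ?S"
    unfolding cohorts_def quotient_def by blast
  also have "\<dots> = (\<lambda>f. ?R `` {arches f}) ` {f. fsize f = n}"
    unfolding S image_image ..
  also have "\<dots> = (\<lambda>f. ?cls (fshape f)) ` {f. fsize f = n}"
    by (intro image_cong HOL.refl cls) simp
  also have "\<dots> = ?cls ` fshape ` {f. fsize f = n}"
    unfolding image_image ..
  finally have "cohorts n = ?cls ` fshape ` {f. fsize f = n}" .
  moreover have "inj_on ?cls (fshape ` {f. fsize f = n})"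
  proof (rule inj_onI)
    fix v w assume "v \<in> fshape ` {f. fsize f = n}" "w \<in> fshape ` {f. fsize f = n}" and eq: "?cls v = ?cls w"
    then obtain f where f: "fsize f = n" "v = fshape f" by blast
    then have "arches f \<in> ?cls w" using eq by blast
    then show "v = w" using f by (auto simp: arches_inject)
  qed
  ultimately show ?thesis by (simp add: card_image)
qed

section \<open>Counting multisets and trees\<close>

definition wmsets :: "'a set \<Rightarrow> ('a \<Rightarrow> nat) \<Rightarrow> nat \<Rightarrow> 'a multiset set" where
  "wmsets X w n = {M. set_mset M \<subseteq> X \<and> (\<Sum>x\<in>#M. w x) = n}"

definition wcount :: "'a set \<Rightarrow> ('a \<Rightarrow> nat) \<Rightarrow> nat \<Rightarrow> nat" where
  "wcount X w n = card {x \<in> X. w x = n}"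

text \<open>Positivity bounds the number of members of a multiset of given weight, and finiteness
  bounds the choices for each member, so multisets of given weight can be counted.\<close>

definition weighted :: "'a set \<Rightarrow> ('a \<Rightarrow> nat) \<Rightarrow> bool" where
  "weighted X w \<longleftrightarrow> (\<forall>n. finite {x \<in> X. w x = n}) \<and> (\<forall>x \<in> X. w x > 0)"

lemma weightedD:
  assumes "weighted X w"
  shows "finite {x \<in> X. w x = n}" "x \<in> X \<Longrightarrow> w x > 0" "finite {x \<in> X. w x \<le> n}"
proof -
  show *: "finite {x \<in> X. w x = n}" for n using assms by (simp add: weighted_def)
  show "x \<in> X \<Longrightarrow> w x > 0" using assms by (simp add: weighted_def)
  have "{x \<in> X. w x \<le> n} = (\<Union>k\<in>{..n}. {x \<in> X. w x = k})" by auto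
  then show "finite {x \<in> X. w x \<le> n}" using * by simp
qed

lemma weighted_subset: "weighted X w \<Longrightarrow> Y \<subseteq> X \<Longrightarrow> weighted Y w"
  unfolding weighted_def by (blast intro: rev_finite_subset)

lemma member_weight_le: "x \<in># M \<Longrightarrow> w x \<le> (\<Sum>x\<in>#M. w x :: nat)"
  by (drule multi_member_split) auto

lemma size_le_weight:
  assumes "weighted X w" "set_mset M \<subseteq> X"
  shows "size M \<le> (\<Sum>x\<in>#M. w x)"
  using assms(2)
proof (induction M)
  case (add x M)
  then have "w x > 0" using weightedD(2)[OF assms(1)] by simp
  then show ?case using add by simp
qed simp

lemma count_le_weight:
  assumes "weighted X w" "M \<in> wmsets X w n"
  shows "count M x \<le> n"
proof -
  have "set_mset M \<subseteq> X" "(\<Sum>x\<in>#M. w x) = n" using assms(2) by (auto simp: wmsets_def)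
  then show ?thesis using size_le_weight[OF assms(1), of M] count_le_size[of M x] by linarith
qed

lemma finite_multisets_size_le:
  assumes "finite X"
  shows "finite {M. set_mset M \<subseteq> X \<and> size M \<le> n}"
proof -
  have "{M. set_mset M \<subseteq> X \<and> size M \<le> n} \<subseteq> mset ` {xs. set xs \<subseteq> X \<and> length xs \<le> n}"
  proof
    fix M assume M: "M \<in> {M. set_mset M \<subseteq> X \<and> size M \<le> n}"
    obtain xs where "mset xs = M" using ex_mset by blast
    then show "M \<in> mset ` {xs. set xs \<subseteq> X \<and> length xs \<le> n}" using M by auto
  qed
  then show ?thesis using finite_lists_length_le[OF assms] finite_surj by blast
qed

lemma finite_wmsets:
  assumes "weighted X w"
  shows "finite (wmsets X w n)"
proof (rule finite_subset)
  show "wmsets X w n \<subseteq> {M. set_mset M \<subseteq> {x \<in> X. w x \<le> n} \<and> size M \<le> n}"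
  proof
    fix M assume M: "M \<in> wmsets X w n"
    then have "w x \<le> n" if "x \<in># M" for x using member_weight_le[OF that, of w] by (simp add: wmsets_def)
    then show "M \<in> {M. set_mset M \<subseteq> {x \<in> X. w x \<le> n} \<and> size M \<le> n}"
      using M size_le_weight[OF assms, of M] by (auto simp: wmsets_def)
  qed
  show "finite {M. set_mset M \<subseteq> {x \<in> X. w x \<le> n} \<and> size M \<le> n}"
    using weightedD(3)[OF assms] by (rule finite_multisets_size_le)
qed

text \<open>Removing \<open>j\<close> copies of \<open>x\<close> is a bijection onto the multisets
  whose weight is smaller by \<open>j * w x\<close>.\<close>

lemma card_wmsets_count_ge:
  assumes "x \<in> X"
  shows "card {M \<in> wmsets X w n. j \<le> count M x} = (if j * w x \<le> n then card (wmsets X w (n - j * w x)) else 0)"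
proof -
  have wt: "(\<Sum>y\<in>#M + replicate_mset j x. w y) = (\<Sum>y\<in>#M. w y) + j * w x" for M
    by simp
  have dec: "\<exists>L. M = L + replicate_mset j x" if "j \<le> count M x" for M
    using that by (metis count_le_replicate_mset_subset_eq subset_mset.diff_add)
  show ?thesis
  proof (cases "j * w x \<le> n")
    case True
    have "{M \<in> wmsets X w n. j \<le> count M x} = (\<lambda>M. M + replicate_mset j x) ` wmsets X w (n - j * w x)"
    proof (intro subset_antisym subsetI)
      fix M assume M: "M \<in> {M \<in> wmsets X w n. j \<le> count M x}"
      then obtain L where L: "M = L + replicate_mset j x" using dec by blast
      have "L \<in> wmsets X w (n - j * w x)" using M wt[of L] by (auto simp: wmsets_def L)
      then show "M \<in> (\<lambda>M. M + replicate_mset j x) ` wmsets X w (n - j * w x)" using L by blast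
    next
      fix M assume "M \<in> (\<lambda>M. M + replicate_mset j x) ` wmsets X w (n - j * w x)"
      then obtain L where L: "M = L + replicate_mset j x" "L \<in> wmsets X w (n - j * w x)" by blast
      have "set_mset M \<subseteq> X" using L assms by (auto simp: wmsets_def split: if_splits)
      then show "M \<in> {M \<in> wmsets X w n. j \<le> count M x}"
        using L(2) wt[of L] True by (simp add: wmsets_def L(1))
    qed
    moreover have "inj_on (\<lambda>M. M + replicate_mset j x) (wmsets X w (n - j * w x))"
      by (rule inj_onI) simp
    ultimately show ?thesis using True by (simp add: card_image)
  next
    case False
    have "{M \<in> wmsets X w n. j \<le> count M x} = {}"
    proof (rule ccontr)
      assume "{M \<in> wmsets X w n. j \<le> count M x} \<noteq> {}"
      then obtain M where M: "M \<in> wmsets X w n" "j \<le> count M x" by blast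
      obtain L where "M = L + replicate_mset j x" using dec[OF M(2)] by blast
      then show False using M(1) wt[of L] False by (simp add: wmsets_def)
    qed
    then show ?thesis using False by (simp only: card.empty if_False)
  qed
qed

lemma sum_mset_eq_sum_count:
  assumes "finite Y" "set_mset M \<subseteq> Y"
  shows "(\<Sum>x\<in>#M. f x :: nat) = (\<Sum>x\<in>Y. count M x * f x)"
  using assms(2)
proof (induction M)
  case (add x M)
  have "(\<Sum>y\<in>Y. count (add_mset x M) y * f y) = (\<Sum>y\<in>Y. count M y * f y + (if y = x then f x else 0))"
    by (rule sum.cong) auto
  also have "\<dots> = (\<Sum>y\<in>Y. count M y * f y) + f x"
    using add.prems assms(1) by (simp add: sum.distrib)
  finally show ?case using add by simp
qed simp

text \<open>The multiplicity of \<open>x\<close> is expressed as the number of \<open>j\<close> with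
  \<open>j \<le> count M x\<close>. The index ranges then do not depend on \<open>M\<close>, so
  summation over \<open>M\<close> can be moved inside.\<close>

lemma mset_weight_eq_sum:
  assumes "weighted X w" "M \<in> wmsets X w n"
  shows "n = (\<Sum>x\<in>{x \<in> X. w x \<le> n}. \<Sum>j\<in>{1..n}. if j \<le> count M x then w x else 0)"
proof -
  have "w x \<le> n" if "x \<in># M" for x using member_weight_le[OF that, of w] assms(2) by (simp add: wmsets_def)
  then have sub: "set_mset M \<subseteq> {x \<in> X. w x \<le> n}"
    using assms(2) by (auto simp: wmsets_def)
  have "n = (\<Sum>x\<in>#M. w x)" using assms(2) by (simp add: wmsets_def)
  also have "\<dots> = (\<Sum>x\<in>{x \<in> X. w x \<le> n}. count M x * w x)"
    by (rule sum_mset_eq_sum_count[OF weightedD(3)[OF assms(1)] sub])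
  also have "\<dots> = (\<Sum>x\<in>{x \<in> X. w x \<le> n}. \<Sum>j\<in>{1..n}. if j \<le> count M x then w x else 0)"
  proof (rule sum.cong[OF HOL.refl])
    fix x
    have "{j \<in> {1..n}. j \<le> count M x} = {1..count M x}"
      using count_le_weight[OF assms, of x] by auto
    then show "count M x * w x = (\<Sum>j\<in>{1..n}. if j \<le> count M x then w x else 0)"
      by (simp add: sum.If_cases Int_def)
  qed
  finally show ?thesis .
qed

text \<open>Both sides count pairs of a multiset \<open>M\<close> of weight \<open>n\<close> and an occurrence of an
  element in it, weighted by the element; removing \<open>j\<close> copies of the \<open>j\<close>-th occurrence
  gives the right-hand side.\<close>

lemma euler_recurrence:
  assumes "weighted X w"
  shows "n * card (wmsets X w n) =
    (\<Sum>k\<in>{1..n}. (\<Sum>d | d \<in> {1..k} \<and> d dvd k. d * wcount X w d) * card (wmsets X w (n - k)))"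
proof -
  let ?X = "{x \<in> X. w x \<le> n}" and ?m = "\<lambda>n. card (wmsets X w n)"
  let ?g = "\<lambda>d. \<Sum>j\<in>{1..n}. if j * d \<le> n then d * ?m (n - j * d) else 0"
  note fin = finite_wmsets[OF assms] weightedD(1,3)[OF assms]
  have "n * ?m n = (\<Sum>M\<in>wmsets X w n. n)" by simp
  also have "\<dots> = (\<Sum>M\<in>wmsets X w n. \<Sum>x\<in>?X. \<Sum>j\<in>{1..n}. if j \<le> count M x then w x else 0)"
    by (intro sum.cong HOL.refl mset_weight_eq_sum[OF assms])
  also have "\<dots> = (\<Sum>x\<in>?X. \<Sum>M\<in>wmsets X w n. \<Sum>j\<in>{1..n}. if j \<le> count M x then w x else 0)"
    by (rule sum.swap)
  also have "\<dots> = (\<Sum>x\<in>?X. \<Sum>j\<in>{1..n}. \<Sum>M\<in>wmsets X w n. if j \<le> count M x then w x else 0)"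
    by (intro sum.cong HOL.refl sum.swap)
  also have "\<dots> = (\<Sum>x\<in>?X. \<Sum>j\<in>{1..n}. w x * card {M \<in> wmsets X w n. j \<le> count M x})"
    by (intro sum.cong HOL.refl) (simp add: sum.If_cases fin Int_def)
  also have "\<dots> = (\<Sum>x\<in>?X. ?g (w x))"
    by (intro sum.cong HOL.refl) (simp add: card_wmsets_count_ge)
  also have "\<dots> = (\<Sum>d\<in>{1..n}. \<Sum>x\<in>{x\<in>?X. w x = d}. ?g (w x))"
    using weightedD(2)[OF assms] by (intro sum.group[symmetric] fin) (auto simp: Suc_le_eq)
  also have "\<dots> = (\<Sum>d\<in>{1..n}. wcount X w d * ?g d)"
  proof (rule sum.cong[OF HOL.refl])
    fix d assume "d \<in> {1..n}"
    then have "{x\<in>?X. w x = d} = {x \<in> X. w x = d}" by auto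
    then have "(\<Sum>x\<in>{x\<in>?X. w x = d}. ?g (w x)) = (\<Sum>x\<in>{x \<in> X. w x = d}. ?g d)"
      by (rule sum.cong) (simp only: mem_Collect_eq)
    then show "(\<Sum>x\<in>{x\<in>?X. w x = d}. ?g (w x)) = wcount X w d * ?g d"
      by (simp only: sum_constant wcount_def of_nat_id)
  qed
  also have "\<dots> = (\<Sum>d\<in>{1..n}. \<Sum>j\<in>{1..n}. if j * d \<le> n then d * wcount X w d * ?m (n - j * d) else 0)"
    by (intro sum.cong HOL.refl) (simp add: sum_distrib_left if_distrib mult_ac cong: if_cong)
  \<comment> \<open>Reindexing by the removed weight \<open>k = j * d\<close> makes \<open>d\<close>
    a divisor of \<open>k\<close>.\<close>
  also have "\<dots> = (\<Sum>d\<in>{1..n}. \<Sum>k\<in>{1..n}. if d dvd k then d * wcount X w d * ?m (n - k) else 0)"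
  proof (rule sum.cong[OF HOL.refl])
    fix d assume d: "d \<in> {1..n}"
    have "(\<Sum>j\<in>{1..n}. if j * d \<le> n then d * wcount X w d * ?m (n - j * d) else 0)
        = (\<Sum>j\<in>{j\<in>{1..n}. j * d \<le> n}. d * wcount X w d * ?m (n - j * d))"
      by (simp add: sum.If_cases Int_def)
    also have "\<dots> = (\<Sum>k\<in>{k\<in>{1..n}. d dvd k}. d * wcount X w d * ?m (n - k))"
    proof (rule sum.reindex_bij_witness[of _ "\<lambda>k. k div d" "\<lambda>j. j * d"])
      fix j assume "j \<in> {j\<in>{1..n}. j * d \<le> n}"
      then show "j * d div d = j" "j * d \<in> {k\<in>{1..n}. d dvd k}" using d by auto
    next
      fix k assume k: "k \<in> {k\<in>{1..n}. d dvd k}"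
      then show "k div d * d = k" by simp
      have "k div d \<noteq> 0" using k d by (auto simp: div_eq_0_iff dest: dvd_imp_le)
      moreover have "k div d \<le> n" by (rule le_trans[OF div_le_dividend]) (use k in simp)
      moreover have "k div d * d \<le> n" using k by simp
      ultimately show "k div d \<in> {j\<in>{1..n}. j * d \<le> n}" by simp
    qed auto
    also have "\<dots> = (\<Sum>k\<in>{1..n}. if d dvd k then d * wcount X w d * ?m (n - k) else 0)"
      by (simp add: sum.If_cases Int_def)
    finally show "(\<Sum>j\<in>{1..n}. if j * d \<le> n then d * wcount X w d * ?m (n - j * d) else 0)
        = (\<Sum>k\<in>{1..n}. if d dvd k then d * wcount X w d * ?m (n - k) else 0)" .
  qed
  also have "\<dots> = (\<Sum>k\<in>{1..n}. \<Sum>d\<in>{1..n}. if d dvd k then d * wcount X w d * ?m (n - k) else 0)"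
    by (rule sum.swap)
  also have "\<dots> = (\<Sum>k\<in>{1..n}. (\<Sum>d | d \<in> {1..k} \<and> d dvd k. d * wcount X w d) * ?m (n - k))"
  proof (rule sum.cong[OF HOL.refl])
    fix k assume k: "k \<in> {1..n}"
    then have "{d \<in> {1..n}. d dvd k} = {d. d \<in> {1..k} \<and> d dvd k}" by (auto dest: dvd_imp_le)
    then show "(\<Sum>d\<in>{1..n}. if d dvd k then d * wcount X w d * ?m (n - k) else 0)
        = (\<Sum>d | d \<in> {1..k} \<and> d dvd k. d * wcount X w d) * ?m (n - k)"
      by (simp add: sum.If_cases Int_def sum_distrib_right)
  qed
  finally show ?thesis .
qed

lemma card_pairs_weight:
  assumes "weighted X w"
  shows "card {(x, y). x \<in> X \<and> y \<in> X \<and> w x + w y = n} = (\<Sum>i\<le>n. wcount X w i * wcount X w (n - i))"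
proof -
  have "{(x, y). x \<in> X \<and> y \<in> X \<and> w x + w y = n} =
      (\<Union>i\<in>{..n}. {x \<in> X. w x = i} \<times> {y \<in> X. w y = n - i})" by force
  moreover have "card (\<Union>i\<in>{..n}. {x \<in> X. w x = i} \<times> {y \<in> X. w y = n - i}) =
      (\<Sum>i\<le>n. card ({x \<in> X. w x = i} \<times> {y \<in> X. w y = n - i}))"
    by (rule card_UN_disjoint) (use weightedD(1)[OF assms] in auto)
  ultimately show ?thesis by (simp add: card_cartesian_product wcount_def)
qed

text \<open>Ordered pairs and diagonal elements together hit each multiset twice:
  \<open>{#x, y#}\<close> with distinct members by two ordered pairs, \<open>{#x, x#}\<close> by one
  ordered pair and one diagonal element.\<close>

lemma card_wmsets_size_2:
  assumes "weighted X w"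
  shows "2 * card {M \<in> wmsets X w n. size M = 2} =
    (\<Sum>i\<le>n. wcount X w i * wcount X w (n - i)) + (if even n then wcount X w (n div 2) else 0)"
proof -
  let ?P = "{(x, y). x \<in> X \<and> y \<in> X \<and> w x + w y = n}"
  let ?Q = "{M \<in> wmsets X w n. size M = 2}"
  let ?D = "{x \<in> X. w x + w x = n}"
  let ?pr = "\<lambda>(x, y). {#x, y#}"
  have finQ: "finite ?Q" using finite_wmsets[OF assms] by simp
  have "?P \<subseteq> {x \<in> X. w x \<le> n} \<times> {x \<in> X. w x \<le> n}" by auto
  then have finP: "finite ?P" using weightedD(3)[OF assms] finite_subset by blast
  have finD: "finite ?D" by (rule finite_subset[OF _ weightedD(3)[OF assms, of n]]) auto
  have imP: "?pr ` ?P \<subseteq> ?Q" by (auto simp: wmsets_def)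
  have imD: "(\<lambda>x. {#x, x#}) ` ?D \<subseteq> ?Q" by (auto simp: wmsets_def)
  have "card ?P = (\<Sum>M\<in>?Q. card {p \<in> ?P. ?pr p = M})"
    unfolding card_eq_sum by (rule sum.group[OF finP finQ imP, symmetric])
  moreover have "card ?D = (\<Sum>M\<in>?Q. card {x \<in> ?D. {#x, x#} = M})"
    unfolding card_eq_sum by (rule sum.group[OF finD finQ imD, symmetric])
  ultimately have "card ?P + card ?D = (\<Sum>M\<in>?Q. card {p \<in> ?P. ?pr p = M}) + (\<Sum>M\<in>?Q. card {x \<in> ?D. {#x, x#} = M})"
    by (simp only:)
  also have "\<dots> = (\<Sum>M\<in>?Q. card {p \<in> ?P. ?pr p = M} + card {x \<in> ?D. {#x, x#} = M})"
    by (rule sum.distrib[symmetric])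
  also have "\<dots> = (\<Sum>M\<in>?Q. 2)"
  proof (rule sum.cong[OF HOL.refl])
    fix M assume M: "M \<in> ?Q"
    then have "size M = Suc 1" by simp
    then obtain x N where N: "M = add_mset x N" using size_eq_Suc_imp_eq_union by blast
    then have "size N = 1" using M by simp
    then obtain y where "N = {#y#}" using size_1_singleton_mset by blast
    with N have xy: "M = {#x, y#}" by simp
    have X: "x \<in> X" "y \<in> X" "w x + w y = n" using M by (auto simp: wmsets_def xy)
    show "card {p \<in> ?P. ?pr p = M} + card {x \<in> ?D. {#x, x#} = M} = 2"
    proof (cases "x = y")
      case True
      have "{p \<in> ?P. ?pr p = M} = {(x, x)}" "{x \<in> ?D. {#x, x#} = M} = {x}"
        using X True by (auto simp: xy add_eq_conv_ex)
      then show ?thesis by simp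
    next
      case False
      have 1: "{p \<in> ?P. ?pr p = M} = {(x, y), (y, x)}"
        using X False by (auto simp: xy add_eq_conv_ex add.commute)
      have 2: "{x \<in> ?D. {#x, x#} = M} = {}" using False by (auto simp: xy add_eq_conv_ex)
      show ?thesis unfolding 1 2 using False by simp
    qed
  qed
  also have "\<dots> = 2 * card ?Q" by simp
  finally have "2 * card ?Q = card ?P + card ?D" by simp
  moreover have "card ?D = (if even n then wcount X w (n div 2) else 0)"
  proof (cases "even n")
    case True
    then have "?D = {x \<in> X. w x = n div 2}" by auto
    then show ?thesis using True by (simp add: wcount_def)
  next
    case False
    then have "w x + w x \<noteq> n" for x by auto
    then have "?D = {}" by blast
    then show ?thesis using False by (simp only: card.empty if_False)
  qed
  ultimately show ?thesis by (simp add: card_pairs_weight[OF assms])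
qed

text \<open>Sizes 0, 1 and 2 are split off. Doubling keeps the count of unordered pairs free of
  division in the natural numbers.\<close>

lemma card_wmsets_size_ge_3:
  assumes "weighted X w"
  shows "2 * card (wmsets X w n) = 2 * card {M \<in> wmsets X w n. size M \<ge> 3} + (if n = 0 then 2 else 0)
    + 2 * wcount X w n + (\<Sum>i\<le>n. wcount X w i * wcount X w (n - i))
    + (if even n then wcount X w (n div 2) else 0)"
proof -
  let ?W = "wmsets X w n"
  note fin = finite_wmsets[OF assms, of n]
  have "size M \<ge> 3 \<or> size M = 0 \<or> size M = 1 \<or> size M = 2" for M :: "'a multiset"
    by linarith
  then have "?W = {M \<in> ?W. size M \<ge> 3} \<union> ({M \<in> ?W. size M = 0} \<union> ({M \<in> ?W. size M = 1} \<union> {M \<in> ?W. size M = 2}))"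
    by blast
  moreover have "card ({M \<in> ?W. size M \<ge> 3} \<union> ({M \<in> ?W. size M = 0} \<union> ({M \<in> ?W. size M = 1} \<union> {M \<in> ?W. size M = 2})))
    = card {M \<in> ?W. size M \<ge> 3} + card ({M \<in> ?W. size M = 0} \<union> ({M \<in> ?W. size M = 1} \<union> {M \<in> ?W. size M = 2}))"
    by (rule card_Un_disjoint) (use fin in auto)
  moreover have "card ({M \<in> ?W. size M = 0} \<union> ({M \<in> ?W. size M = 1} \<union> {M \<in> ?W. size M = 2}))
    = card {M \<in> ?W. size M = 0} + card ({M \<in> ?W. size M = 1} \<union> {M \<in> ?W. size M = 2})"
    by (rule card_Un_disjoint) (use fin in auto)
  moreover have "card ({M \<in> ?W. size M = 1} \<union> {M \<in> ?W. size M = 2})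
    = card {M \<in> ?W. size M = 1} + card {M \<in> ?W. size M = 2}"
    by (rule card_Un_disjoint) (use fin in auto)
  ultimately have "card ?W = card {M \<in> ?W. size M \<ge> 3} +
      (card {M \<in> ?W. size M = 0} + (card {M \<in> ?W. size M = 1} + card {M \<in> ?W. size M = 2}))"
    by presburger
  moreover have "{M \<in> ?W. size M = 0} = (if n = 0 then {{#}} else {})"
    by (auto simp: wmsets_def)
  moreover have "{M \<in> ?W. size M = 1} = (\<lambda>x. {#x#}) ` {x \<in> X. w x = n}"
  proof (intro subset_antisym subsetI)
    fix M assume M: "M \<in> {M \<in> ?W. size M = 1}"
    then obtain x where "M = {#x#}" using size_1_singleton_mset by blast
    then show "M \<in> (\<lambda>x. {#x#}) ` {x \<in> X. w x = n}" using M by (simp add: wmsets_def)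
  qed (auto simp: wmsets_def)
  moreover have "card ((\<lambda>x. {#x#}) ` {x \<in> X. w x = n}) = wcount X w n"
    unfolding wcount_def by (rule card_image) (simp add: inj_on_def)
  ultimately show ?thesis using card_wmsets_size_2[OF assms, of n] by simp
qed

lemma card_wmsets_0: "weighted X w \<Longrightarrow> card (wmsets X w 0) = 1"
proof -
  assume w: "weighted X w"
  have "M = {#}" if "set_mset M \<subseteq> X" "(\<Sum>x\<in>#M. w x) = 0" for M
    using size_le_weight[OF w that(1)] that(2) by simp
  then have "wmsets X w 0 = {{#}}" by (auto simp: wmsets_def)
  then show ?thesis by simp
qed

text \<open>The weight is the number of arches plus 1, so that joining two slots under a new arch
  adds their weights. The 2 in \<open>Big\<close> is the arch of the node and this extra 1. The
  nested maps come from recursion through multisets; \<open>leaf_weight_Big\<close> is the readable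
  form.\<close>

primrec leaf_weight :: "leaf \<Rightarrow> nat" where
  "leaf_weight Empty = 1"
| "leaf_weight (Big Y) = 2 + sum_mset (image_mset (\<lambda>N. sum_mset N - 1) (image_mset (image_mset leaf_weight) Y))"

text \<open>The number of arches of the tree: by additivity its leaf weights sum to that number plus
  1.\<close>

definition shape_weight :: "leaf multiset \<Rightarrow> nat" where
  "shape_weight N = (\<Sum>l\<in>#N. leaf_weight l) - 1"

lemma leaf_weight_Big: "leaf_weight (Big Y) = 2 + (\<Sum>N\<in>#Y. shape_weight N)"
  by (simp add: shape_weight_def image_mset.compositionality comp_def)

declare leaf_weight.simps(2) [simp del]

lemma sum_leaf_weight_slot:
  assumes "length s \<le> 1" "\<And>t. t \<in> set s \<Longrightarrow> (\<Sum>l\<in>#shape t. leaf_weight l) = tsize t + 1"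
  shows "(\<Sum>l\<in>#slot_shape s. leaf_weight l) = fsize s + 1"
  using slot_cases[OF assms(1)] assms(2) by auto

lemma sum_leaf_weight_shape: "(\<Sum>l\<in>#shape t. leaf_weight l) = tsize t + 1"
proof (induction t)
  case (Node ts)
  show ?case
  proof (cases "length ts \<ge> 3")
    case True
    have "(\<Sum>N\<in>#mset (map shape ts). shape_weight N) = fsize ts"
      using Node by (induction ts) (auto simp: shape_weight_def)
    then show ?thesis using True by (simp add: fshape_big leaf_weight_Big)
  next
    case False
    then obtain a b where ab: "length a \<le> 1" "length b \<le> 1" "ts = a @ b" by (rule short_forest_cases)
    then show ?thesis
      using sum_leaf_weight_slot[OF ab(1)] sum_leaf_weight_slot[OF ab(2)] Node
      by (simp add: fshape_slots)
  qed
qed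

lemma shape_weight_shape [simp]: "shape_weight (shape t) = tsize t"
  by (simp add: shape_weight_def sum_leaf_weight_shape)

abbreviation shapes :: "leaf multiset set" where
  "shapes \<equiv> range shape"

text \<open>The leaves that occur in trees; the type also contains, for instance, \<open>Big\<close>
  of a multiset with fewer than three members.\<close>

definition leaves :: "leaf set" where
  "leaves = insert Empty (Big ` {Y. set_mset Y \<subseteq> shapes \<and> size Y \<ge> 3})"

lemma set_mset_shape: "set_mset (shape t) \<subseteq> leaves"
proof (induction t)
  case (Node ts)
  show ?case
  proof (cases "length ts \<ge> 3")
    case True
    then have "mset (map shape ts) \<in> {Y. set_mset Y \<subseteq> shapes \<and> size Y \<ge> 3}" by auto
    then show ?thesis using True by (simp only: shape_Node fshape_big leaves_def) simp
  next
    case False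
    then obtain a b where ab: "length a \<le> 1" "length b \<le> 1" "ts = a @ b" by (rule short_forest_cases)
    have slot: "set_mset (slot_shape s) \<subseteq> leaves" if "length s \<le> 1" "set s \<subseteq> set ts" for s
      using slot_cases[OF that(1)]
    proof (elim disjE exE)
      fix t assume "s = [t]"
      then show ?thesis using Node[of t] that(2) by simp
    qed (simp add: leaves_def)
    have "set_mset (slot_shape a) \<subseteq> leaves" "set_mset (slot_shape b) \<subseteq> leaves"
      by (rule slot[OF ab(1)], simp add: ab(3), rule slot[OF ab(2)], simp add: ab(3))
    then show ?thesis using ab by (simp add: fshape_slots)
  qed
qed

lemma ex_shapes_list: "set_mset Y \<subseteq> shapes \<Longrightarrow> \<exists>ts. mset (map shape ts) = Y"
proof (induction Y)
  case (add N Y)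
  then obtain ts t where "mset (map shape ts) = Y" "N = shape t" by auto
  then show ?case by (intro exI[of _ "t # ts"]) simp
qed simp

lemma ex_slot_leaf:
  assumes "l \<in> leaves"
  shows "\<exists>s. length s \<le> 1 \<and> slot_shape s = {#l#}"
proof (cases "l = Empty")
  case True
  then show ?thesis by (intro exI[of _ "[]"]) simp
next
  case False
  then obtain Y where Y: "l = Big Y" "set_mset Y \<subseteq> shapes" "size Y \<ge> 3"
    using assms by (auto simp: leaves_def)
  then obtain ts where ts: "mset (map shape ts) = Y" using ex_shapes_list by blast
  then have "length ts \<ge> 3" using Y(3) by auto
  then show ?thesis using ts Y by (intro exI[of _ "[Node ts]"]) (simp add: fshape_big)
qed

lemma ex_slot_shape: "set_mset N \<subseteq> leaves \<Longrightarrow> N \<noteq> {#} \<Longrightarrow> \<exists>s. length s \<le> 1 \<and> slot_shape s = N"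
proof (induction N)
  case (add l N)
  obtain s where s: "length s \<le> 1" "slot_shape s = {#l#}" using ex_slot_leaf add.prems by auto
  show ?case
  proof (cases "N = {#}")
    case True
    then show ?thesis using s by blast
  next
    case False
    then obtain s' where "length s' \<le> 1" "slot_shape s' = N" using add by auto
    then show ?thesis using s by (intro exI[of _ "[Node (s @ s')]"]) (simp add: fshape_slots)
  qed
qed simp

text \<open>Joining leaves one at a time realises every non-empty multiset of leaves by a slot, and
  that slot can be empty only for \<open>{#Empty#}\<close>.\<close>

lemma shapes_eq: "shapes = {N. set_mset N \<subseteq> leaves \<and> N \<noteq> {#} \<and> N \<noteq> {#Empty#}}"
proof (intro subset_antisym subsetI)
  fix N assume "N \<in> shapes"
  then show "N \<in> {N. set_mset N \<subseteq> leaves \<and> N \<noteq> {#} \<and> N \<noteq> {#Empty#}}"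
    using set_mset_shape shape_nonempty shape_neq_Empty by auto
next
  fix N assume N: "N \<in> {N. set_mset N \<subseteq> leaves \<and> N \<noteq> {#} \<and> N \<noteq> {#Empty#}}"
  then obtain s where s: "length s \<le> 1" "slot_shape s = N" using ex_slot_shape by blast
  then show "N \<in> shapes" using N slot_cases[OF s(1)] by auto
qed

lemma finite_forests: "finite {f. fsize f = n}"
proof (induction n rule: less_induct)
  case (less n)
  let ?F = "\<lambda>k. {f. fsize f = k}"
  have "?F n \<subseteq> insert [] ((\<lambda>(g, h). Node g # h) ` (\<Union>k\<in>{..<n}. ?F k \<times> ?F (n - Suc k)))"
  proof
    fix f assume f: "f \<in> ?F n"
    show "f \<in> insert [] ((\<lambda>(g, h). Node g # h) ` (\<Union>k\<in>{..<n}. ?F k \<times> ?F (n - Suc k)))"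
    proof (cases f)
      case (Cons t h)
      obtain g where g: "t = Node g" by (cases t)
      have "fsize g < n" "fsize h = n - Suc (fsize g)" using f Cons g by auto
      then have "(g, h) \<in> (\<Union>k\<in>{..<n}. ?F k \<times> ?F (n - Suc k))" by auto
      then show ?thesis using Cons g by force
    qed simp
  qed
  moreover have "finite (insert [] ((\<lambda>(g, h). Node g # h) ` (\<Union>k\<in>{..<n}. ?F k \<times> ?F (n - Suc k))))"
    using less.IH by auto
  ultimately show ?case using finite_subset by blast
qed

lemma shapes_weight_eq: "{N \<in> shapes. shape_weight N = Suc n} = fshape ` {f. fsize f = n}"
proof (intro subset_antisym subsetI)
  fix N assume "N \<in> {N \<in> shapes. shape_weight N = Suc n}"
  then obtain t where t: "N = shape t" "tsize t = Suc n" by auto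
  obtain f where "t = Node f" by (cases t)
  then show "N \<in> fshape ` {f. fsize f = n}" using t by auto
next
  fix N assume "N \<in> fshape ` {f. fsize f = n}"
  then obtain f where f: "N = shape (Node f)" "fsize f = n" by auto
  then have "shape_weight N = Suc n" by (simp only: shape_weight_shape tsize.simps)
  then show "N \<in> {N \<in> shapes. shape_weight N = Suc n}" using f by blast
qed

lemma weighted_shapes: "weighted shapes shape_weight"
  unfolding weighted_def
proof (intro conjI allI ballI)
  fix N assume "N \<in> shapes"
  then obtain t where "N = shape t" by blast
  then show pos: "shape_weight N > 0" by (cases t) (metis shape_weight_shape tsize.simps zero_less_Suc)
next
  fix n
  show "finite {N \<in> shapes. shape_weight N = n}"
  proof (cases n)
    case 0
    have "shape_weight (shape t) > 0" for t by (cases t) (metis shape_weight_shape tsize.simps zero_less_Suc)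
    then have "{N \<in> shapes. shape_weight N = n} = {}" using 0 by force
    then show ?thesis by (simp only: finite.emptyI)
  next
    case (Suc m)
    then show ?thesis using finite_forests by (simp only: shapes_weight_eq finite_imageI)
  qed
qed

lemma weighted_leaves: "weighted leaves leaf_weight"
  unfolding weighted_def
proof (intro conjI allI ballI)
  fix l assume "l \<in> leaves"
  then show "leaf_weight l > 0" by (cases l) (auto simp: leaf_weight_Big)
next
  fix n
  have "{l \<in> leaves. leaf_weight l = n} \<subseteq>
      insert Empty (Big ` wmsets shapes shape_weight (n - 2))"
    by (auto simp: leaves_def wmsets_def leaf_weight_Big)
  then show "finite {l \<in> leaves. leaf_weight l = n}"
    using finite_wmsets[OF weighted_shapes] by (meson finite.insertI finite_imageI finite_subset)
qed

definition tree_count :: "nat \<Rightarrow> nat" where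
  "tree_count = wcount shapes shape_weight"

definition leaf_count :: "nat \<Rightarrow> nat" where
  "leaf_count = wcount leaves leaf_weight"

lemma card_cohorts_eq_tree_count: "card (cohorts n) = tree_count (Suc n)"
  unfolding card_cohorts tree_count_def wcount_def shapes_weight_eq ..

lemma tree_count_0: "tree_count 0 = 0"
proof -
  have "shape_weight N \<noteq> 0" if "N \<in> shapes" for N using weightedD(2)[OF weighted_shapes that] by simp
  then have "{N \<in> shapes. shape_weight N = 0} = {}" by blast
  then show ?thesis by (simp only: tree_count_def wcount_def card.empty)
qed

text \<open>The leaf weights of a tree of weight \<open>n\<close> sum to \<open>Suc n\<close>. For
  positive \<open>n\<close> this rules out \<open>{#}\<close> and \<open>{#Empty#}\<close>, the two
  multisets of leaves that are not shapes.\<close>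

lemma tree_count_eq_wmsets:
  assumes "n > 0"
  shows "tree_count n = card (wmsets leaves leaf_weight (Suc n))"
proof -
  have "{N \<in> shapes. shape_weight N = n} = wmsets leaves leaf_weight (Suc n)"
    unfolding shapes_eq using assms by (auto simp: wmsets_def shape_weight_def)
  then show ?thesis by (simp only: tree_count_def wcount_def)
qed

lemma leaf_count_0: "leaf_count 0 = 0"
proof -
  have "leaf_weight N \<noteq> 0" if "N \<in> leaves" for N using weightedD(2)[OF weighted_leaves that] by simp
  then have "{N \<in> leaves. leaf_weight N = 0} = {}" by blast
  then show ?thesis by (simp only: leaf_count_def wcount_def card.empty)
qed

lemma leaf_count_1: "leaf_count 1 = 1"
proof -
  have "{l \<in> leaves. leaf_weight l = 1} = {Empty}" by (auto simp: leaves_def leaf_weight_Big)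
  then have "leaf_count 1 = card {Empty}" by (simp only: leaf_count_def wcount_def)
  then show ?thesis by simp
qed

lemma leaf_count_add_2:
  "leaf_count (n + 2) = card {Y \<in> wmsets shapes shape_weight n. size Y \<ge> 3}"
proof -
  have "{l \<in> leaves. leaf_weight l = n + 2} = Big ` {Y \<in> wmsets shapes shape_weight n. size Y \<ge> 3}"
    by (auto simp: leaves_def wmsets_def leaf_weight_Big)
  then show ?thesis by (simp only: leaf_count_def wcount_def) (simp add: card_image inj_on_def)
qed

section \<open>Coefficients of functions with a square root singularity\<close>

text \<open>Taylor's formula gives x - x^3 / 6 as a lower bound, and x^2 is at most 4 here because
  \<pi> < 4.\<close>

lemma sin_ge_third:
  fixes x :: real
  assumes "0 \<le> x" "x \<le> pi / 2"
  shows "sin x \<ge> x / 3"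
proof -
  have x2: "x \<le> 2" using assms pi_less_4 by simp
  have "\<bar>sin x - (\<Sum>m<3. sin_coeff m * x ^ m)\<bar> \<le> inverse (fact 3) * \<bar>x\<bar> ^ 3"
    by (rule Maclaurin_sin_bound)
  moreover have "(\<Sum>m<3. sin_coeff m * x ^ m) = x"
    by (simp add: numeral_3_eq_3 sin_coeff_def)
  moreover have "inverse (fact 3) * \<bar>x\<bar> ^ 3 = x ^ 3 / 6"
    using assms by (simp add: fact_numeral)
  ultimately have "\<bar>sin x - x\<bar> \<le> x ^ 3 / 6" by metis
  then have "sin x \<ge> x - x ^ 3 / 6" by linarith
  moreover have "x * x \<le> 2 * 2" using x2 assms by (intro mult_mono) auto
  then have "x * (x * x) \<le> x * 4" using assms by (intro mult_left_mono) auto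
  ultimately show ?thesis by (simp add: power3_eq_cube)
qed

text \<open>An average of two bounds: 1 - r from the modulus with weight 1/4, and a third of
  \<open>min t (1 - t)\<close> from the angle with weight 3/4. For the angle, the imaginary part is
  used for t up to 1/4; between 1/4 and 1/2 the point has non-positive real part; the other half is
  symmetric.\<close>

lemma norm_one_minus_circle:
  fixes r t :: real
  assumes "1/2 \<le> r" "r \<le> 1" "0 \<le> t" "t \<le> 1"
  shows "norm (1 - of_real r * exp (2 * of_real pi * \<i> * of_real t)) \<ge> (1 - r + min t (1 - t)) / 4"
proof -
  define w where "w = of_real r * exp (2 * of_real pi * \<i> * of_real t)"
  have re: "Re w = r * cos (2 * pi * t)" and im: "Im w = r * sin (2 * pi * t)"
    by (simp_all add: w_def Re_exp Im_exp)
  have "norm w = r" using assms by (simp add: w_def norm_mult)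
  then have 1: "norm (1 - w) \<ge> 1 - r"
    using norm_triangle_ineq2[of 1 w] by simp
  have first: "norm (1 - w) \<ge> u / 3" if u: "0 \<le> u" "u \<le> 1/2"
    and cs: "cos (2 * pi * t) = cos (2 * pi * u)" "\<bar>sin (2 * pi * t)\<bar> = \<bar>sin (2 * pi * u)\<bar>" for u
  proof (cases "u \<le> 1/4")
    case True
    have "sin (2 * pi * u) \<ge> 2 * pi * u / 3"
      using u True by (intro sin_ge_third) (auto simp: field_simps)
    moreover have "2 * u \<le> pi * u" using pi_ge_two u by (intro mult_right_mono) auto
    ultimately have s: "sin (2 * pi * u) \<ge> 2 / 3 * u" using u by simp
    have "1/2 * (2 / 3 * u) \<le> r * \<bar>sin (2 * pi * u)\<bar>"
      using s assms u by (intro mult_mono) auto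
    also have "\<dots> = \<bar>Im (1 - w)\<bar>" using assms by (simp add: im abs_mult cs)
    also have "\<dots> \<le> norm (1 - w)" by (rule abs_Im_le_cmod)
    finally show ?thesis by simp
  next
    case False
    have "cos (2 * pi * u) = - sin (2 * pi * u - pi / 2)" by (simp add: sin_diff)
    moreover have "sin (2 * pi * u - pi / 2) \<ge> 0"
      using False u by (intro sin_ge_zero) (auto simp: field_simps)
    ultimately have "cos (2 * pi * u) \<le> 0" by simp
    then have "Re w \<le> 0" using assms by (simp add: re cs mult_nonneg_nonpos)
    then have "1 \<le> Re (1 - w)" by simp
    also have "\<dots> \<le> norm (1 - w)" by (rule complex_Re_le_cmod)
    finally show ?thesis using u by simp
  qed
  have "norm (1 - w) \<ge> min t (1 - t) / 3"
  proof (cases "t \<le> 1/2")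
    case True
    then show ?thesis using first[of t] assms by (simp add: min_def)
  next
    case False
    have "cos (2 * pi * t) = cos (2 * pi * (1 - t))"
      using cos_2pi_minus[of "2 * pi * t"] by (simp add: algebra_simps)
    moreover have "\<bar>sin (2 * pi * t)\<bar> = \<bar>sin (2 * pi * (1 - t))\<bar>"
      using sin_2pi_minus[of "2 * pi * t"] by (simp add: algebra_simps)
    ultimately show ?thesis using first[of "1 - t"] assms False by (simp add: min_def)
  qed
  with 1 have "(1 - r) / 4 + min t (1 - t) / 4 \<le> 1 / 4 * norm (1 - w) + 3 / 4 * norm (1 - w)"
    by (intro add_mono) auto
  then show ?thesis unfolding w_def[symmetric] by (simp add: add_divide_distrib)
qed

text \<open>The integrand dominates 1 / (d + min t (1 - t)) and has an elementary
  antiderivative.\<close>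

lemma integral_inverse_shift:
  fixes d :: real
  assumes "d > 0"
  shows "((\<lambda>t. 1 / (d + t) + 1 / (d + (1 - t))) has_integral 2 * (ln (1 + d) - ln d)) {0..1}"
proof -
  have "((\<lambda>t. 1 / (d + t) + 1 / (d + (1 - t))) has_integral
      (ln (d + 1) - ln (d + (1 - 1))) - (ln (d + 0) - ln (d + (1 - 0)))) {0..1}"
  proof (rule fundamental_theorem_of_calculus)
    fix t :: real assume t: "t \<in> {0..1}"
    then have "d + t > 0" "d + (1 - t) > 0" using assms by auto
    then show "((\<lambda>t. ln (d + t) - ln (d + (1 - t))) has_vector_derivative 1 / (d + t) + 1 / (d + (1 - t))) (at t within {0..1})"
      unfolding has_real_derivative_iff_has_vector_derivative[symmetric]
      by (auto intro!: derivative_eq_intros simp: divide_simps)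
  qed simp
  then show ?thesis by (simp add: algebra_simps)
qed

text \<open>Cauchy's estimate on the circle of radius \<open>1 - 1/n\<close>; the integral of \<open>1 / |1 - z|\<close>
  over it is only logarithmic in \<open>n\<close>.\<close>

lemma higher_deriv_bound_of_simple_pole_bound:
  fixes g :: "complex \<Rightarrow> complex"
  assumes holo: "g holomorphic_on ball 0 1" and n: "n \<ge> 2"
    and bound: "\<And>z. norm z < 1 \<Longrightarrow> norm (g z) \<le> C / norm (1 - z)"
  shows "norm ((deriv ^^ n) g 0 / fact n) \<le> 64 * C * (ln 2 + ln (real n))"
proof -
  define d where "d = 1 / real n"
  define r where "r = 1 - d"
  have d: "0 < d" "d \<le> 1/2" using n by (auto simp: d_def field_simps)
  then have r: "1/2 \<le> r" "r < 1" by (auto simp: r_def)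
  have C: "0 \<le> C" using bound[of 0] norm_ge_zero[of "g 0"] by (simp del: norm_ge_zero)
  let ?c = "circlepath 0 r"
  let ?D = "(deriv ^^ n) g 0 / fact n"
  have "((\<lambda>u. g u / (u - 0) ^ Suc n) has_contour_integral (2 * pi * \<i>) / fact n * (deriv ^^ n) g 0) ?c"
    using r by (intro Cauchy_has_contour_integral_higher_derivative_circlepath
        holomorphic_on_imp_continuous_on[OF holomorphic_on_subset[OF holo]] holomorphic_on_subset[OF holo]) auto
  then have int: "((\<lambda>t. g (?c t) / (?c t) ^ Suc n * vector_derivative ?c (at t)) has_integral 2 * pi * \<i> * ?D) {0..1}"
    by (simp add: has_contour_integral field_simps)
  have cp: "?c t = of_real r * exp (2 * of_real pi * \<i> * of_real t)" for t
    by (simp add: circlepath)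
  have nc: "norm (?c t) = r" for t using r by (simp add: cp norm_mult)
  have vd: "norm (vector_derivative ?c (at t)) = 2 * pi * r" for t
    using r by (simp add: vector_derivative_circlepath norm_mult)
  define K where "K = 2 * pi * C * 4 / r ^ n"
  have K: "0 \<le> K" using C r by (simp add: K_def)
  have int2: "((\<lambda>t. K * (1 / (d + t) + 1 / (d + (1 - t)))) has_integral K * (2 * (ln (1 + d) - ln d))) {0..1}"
    by (intro has_integral_mult_right integral_inverse_shift d)
  have le: "norm (g (?c t) / (?c t) ^ Suc n * vector_derivative ?c (at t)) \<le> K * (1 / (d + t) + 1 / (d + (1 - t)))"
    if t: "t \<in> {0..1}" for t
  proof -
    define m where "m = min t (1 - t)"
    have m: "0 \<le> m" using t by (simp add: m_def)
    have "norm (1 - ?c t) \<ge> (1 - r + min t (1 - t)) / 4"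
      unfolding cp using t r by (intro norm_one_minus_circle) auto
    then have nb: "norm (1 - ?c t) \<ge> (d + m) / 4" by (simp add: r_def m_def)
    have "norm (g (?c t)) \<le> C / norm (1 - ?c t)" using r nc by (intro bound) simp
    also have "\<dots> \<le> C / ((d + m) / 4)"
      using nb m d C by (intro divide_left_mono) (auto intro!: mult_pos_pos)
    also have "\<dots> = 4 * C * (1 / (d + m))" by simp
    also have "\<dots> \<le> 4 * C * (1 / (d + t) + 1 / (d + (1 - t)))"
    proof (rule mult_left_mono)
      have "0 \<le> 1 / (d + t)" "0 \<le> 1 / (d + (1 - t))" using t d by auto
      then show "1 / (d + m) \<le> 1 / (d + t) + 1 / (d + (1 - t))" by (simp add: m_def min_def)
    qed (use C in simp)
    finally have gb: "norm (g (?c t)) \<le> 4 * C * (1 / (d + t) + 1 / (d + (1 - t)))" .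
    have "norm (g (?c t) / (?c t) ^ Suc n * vector_derivative ?c (at t)) = norm (g (?c t)) * (2 * pi / r ^ n)"
      using r by (simp add: norm_mult norm_divide norm_power nc vd)
    also have "\<dots> \<le> 4 * C * (1 / (d + t) + 1 / (d + (1 - t))) * (2 * pi / r ^ n)"
      using gb r by (intro mult_right_mono) auto
    also have "\<dots> = K * (1 / (d + t) + 1 / (d + (1 - t)))" by (simp add: K_def)
    finally show ?thesis .
  qed
  have "norm (2 * pi * \<i> * ?D) \<le> K * (2 * (ln (1 + d) - ln d))"
    using integral_norm_bound_integral[OF has_integral_integrable[OF int] has_integral_integrable[OF int2] le]
    by (simp only: integral_unique[OF int] integral_unique[OF int2])
  then have "2 * pi * norm ?D \<le> K * (2 * (ln (1 + d) - ln d))"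
    by (simp add: norm_mult norm_divide)
  also have "\<dots> = 2 * pi * (8 * C / r ^ n * (ln (1 + d) - ln d))"
    by (simp add: K_def)
  finally have "norm ?D \<le> 8 * C / r ^ n * (ln (1 + d) - ln d)"
    by (simp only: mult_le_cancel_left_pos pi_gt_zero zero_less_numeral mult_pos_pos)
  also have "\<dots> \<le> 64 * C * (ln 2 + ln (real n))"
  proof (rule mult_mono)
    \<comment> \<open>The exponent is split into two halves, because Bernoulli's inequality for the
      full exponent yields only 1 - n d = 0.\<close>
    have "1 / 8 \<le> r ^ n"
    proof -
      have even_half: "1 + real (n div 2) * (- d) \<le> (1 + (- d)) ^ (n div 2)"
        using d by (intro Bernoulli_inequality) auto
      have odd_half: "1 + real (n - n div 2) * (- d) \<le> (1 + (- d)) ^ (n - n div 2)"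
        using d by (intro Bernoulli_inequality) auto
      show ?thesis
      proof (cases "even n")
        case True
        then obtain k where k: "n = 2 * k" by (elim evenE)
        have "real k * d = 1/2" using n by (simp add: d_def k)
        then have h: "1/2 \<le> r ^ k" using even_half by (simp add: r_def k)
        have "1/2 * (1/2) \<le> r ^ k * r ^ k" using h r by (intro mult_mono) auto
        also have "\<dots> = r ^ n" by (simp add: k mult_2 flip: power_add)
        finally show ?thesis by simp
      next
        case False
        then obtain k where k: "n = 2 * k + 1" by (elim oddE)
        have k1: "k \<ge> 1" using n k by auto
        have h: "1 - real k * d \<le> r ^ k" using even_half by (simp add: k r_def)
        have h': "1 - real (k + 1) * d \<le> r ^ (k + 1)" using odd_half by (simp add: k r_def)
        have e: "1 - real k * d = (real k + 1) / (2 * real k + 1)" "1 - real (k + 1) * d = real k / (2 * real k + 1)"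
          by (auto simp: d_def k field_simps)
        have "(2 * u + 1) * (2 * u + 1) \<le> 8 * ((u + 1) * u)" if "1 \<le> u" for u :: real
        proof -
          have "8 * ((u + 1) * u) - (2 * u + 1) * (2 * u + 1) = 4 * (u * u) + 4 * u - 1"
            by (simp add: algebra_simps)
          moreover have "0 \<le> u * u" by simp
          ultimately show ?thesis using that by linarith
        qed
        from this[of "real k"] have "(2 * real k + 1) * (2 * real k + 1) \<le> 8 * ((real k + 1) * real k)"
          using k1 by simp
        then have "1/8 \<le> (real k + 1) / (2 * real k + 1) * (real k / (2 * real k + 1))"
          by (simp add: divide_simps)
        also have "\<dots> \<le> r ^ k * r ^ (k + 1)"
          using h h' e r by (intro mult_mono) auto
        also have "\<dots> = r ^ n" by (simp add: k mult_2 flip: power_add)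
        finally show ?thesis .
      qed
    qed
    then have "8 * C / r ^ n \<le> 8 * C / (1 / 8)" using C r by (intro divide_left_mono) auto
    then show "8 * C / r ^ n \<le> 64 * C" by simp
    have "ln (1 + d) \<le> ln 2" using d by simp
    moreover have "ln d = - ln (real n)" using n by (simp add: d_def ln_div)
    ultimately show "ln (1 + d) - ln d \<le> ln 2 + ln (real n)" by simp
    have "ln d \<le> 0" using d by simp
    moreover have "0 \<le> ln (1 + d)" using d by simp
    ultimately show "0 \<le> ln (1 + d) - ln d" by linarith
  qed (use C in auto)
  finally show ?thesis .
qed

text \<open>Coefficient n of \<open>f\<close> is coefficient n - 1 of its derivative divided by n;
  this division gains what is needed against the factor sqrt n.\<close>

lemma coefficients_tendsto_0_of_simple_pole_bound:
  fixes f :: "complex \<Rightarrow> complex"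
  assumes holo: "f holomorphic_on ball 0 1"
    and bound: "\<And>z. norm z < 1 \<Longrightarrow> norm (deriv f z) \<le> C / norm (1 - z)"
  shows "(\<lambda>n. of_real (sqrt (real n)) * ((deriv ^^ n) f 0 / fact n)) \<longlonglongrightarrow> 0"
proof (rule Lim_null_comparison)
  show "(\<lambda>n. 64 * C * (ln 2 + ln (real (n - 1))) * sqrt (real n) / real n) \<longlonglongrightarrow> 0"
    by real_asymp
  have "norm (of_real (sqrt (real n)) * ((deriv ^^ n) f 0 / fact n)) \<le> 64 * C * (ln 2 + ln (real (n - 1))) * sqrt (real n) / real n"
    if n: "n \<ge> 3" for n
  proof -
    obtain m where m: "n = Suc m" "m \<ge> 2" using n by (cases n) auto
    have "(deriv ^^ n) f 0 = (deriv ^^ m) (deriv f) 0" by (simp add: m funpow_swap1)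
    moreover have "norm ((deriv ^^ m) (deriv f) 0 / fact m) \<le> 64 * C * (ln 2 + ln (real m))"
      by (intro higher_deriv_bound_of_simple_pole_bound holomorphic_deriv holo bound m) auto
    ultimately have "norm ((deriv ^^ n) f 0 / fact n) * real n \<le> 64 * C * (ln 2 + ln (real m))"
      by (simp add: m norm_divide norm_mult field_simps del: of_nat_Suc)
    then have "norm ((deriv ^^ n) f 0 / fact n) \<le> 64 * C * (ln 2 + ln (real m)) / real n"
      using n by (simp add: field_simps)
    then have "sqrt (real n) * norm ((deriv ^^ n) f 0 / fact n) \<le> sqrt (real n) * (64 * C * (ln 2 + ln (real m)) / real n)"
      by (intro mult_left_mono) auto
    moreover have "norm (of_real (sqrt (real n)) * ((deriv ^^ n) f 0 / fact n)) = sqrt (real n) * norm ((deriv ^^ n) f 0 / fact n)"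
      by (simp only: norm_mult norm_of_real real_sqrt_abs2 abs_of_nonneg real_sqrt_ge_zero of_nat_0_le_iff)
    moreover have "sqrt (real n) * (64 * C * (ln 2 + ln (real m)) / real n) = 64 * C * (ln 2 + ln (real (n - 1))) * sqrt (real n) / real n"
      by (simp add: m(1))
    ultimately show ?thesis by linarith
  qed
  then show "\<forall>\<^sub>F n in sequentially. norm (of_real (sqrt (real n)) * ((deriv ^^ n) f 0 / fact n))
      \<le> 64 * C * (ln 2 + ln (real (n - 1))) * sqrt (real n) / real n"
    unfolding eventually_sequentially by blast
qed

text \<open>At \<open>w\<close> itself only continuity is assumed, and the derivative may blow up
  like a power greater than -1 of the distance, which is integrable. The comparison function along
  the segment is -C / a times the distance to \<open>w\<close> to the power
  \<open>a\<close>.\<close>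

lemma segment_growth_bound:
  fixes f f' :: "complex \<Rightarrow> complex"
  assumes a: "a > 0" and z: "z \<noteq> w"
    and cont: "continuous_on (closed_segment z w) f"
    and deriv: "\<And>u. u \<in> closed_segment z w - {w} \<Longrightarrow> (f has_field_derivative f' u) (at u)"
    and bound: "\<And>u. u \<in> closed_segment z w - {w} \<Longrightarrow> norm (f' u) \<le> C * norm (w - u) powr (a - 1)"
  shows "norm (f z - f w) \<le> C / a * norm (w - z) powr a"
proof -
  define \<gamma> where "\<gamma> t = z + of_real t * (w - z)" for t :: real
  define N where "N = norm (w - z)"
  have N: "N > 0" using z by (simp add: N_def)
  have seg: "\<gamma> t \<in> closed_segment z w" if "t \<in> {0..1}" for t
    using that unfolding closed_segment_def \<gamma>_def
    by (auto intro!: exI[of _ t] simp: scaleR_conv_of_real algebra_simps)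
  have nw: "norm (w - \<gamma> t) = (1 - t) * N" if "t \<le> 1" for t
  proof -
    have "w - \<gamma> t = of_real (1 - t) * (w - z)" by (simp add: \<gamma>_def algebra_simps)
    then show ?thesis using that by (simp only: norm_mult norm_of_real N_def abs_of_nonneg diff_ge_0_iff_ge)
  qed
  have ne: "\<gamma> t \<noteq> w" if "t < 1" for t
  proof
    assume "\<gamma> t = w"
    then have "(1 - t) * N = 0" using nw[of t] that by simp
    then show False using that N by simp
  qed
  have "norm ((f \<circ> \<gamma>) 1 - (f \<circ> \<gamma>) 0) \<le> (- C / a * ((1 - 1) * N) powr a) - (- C / a * ((1 - 0) * N) powr a)"
  proof (rule differentiable_bound_general)
    show "continuous_on {0..1} (f \<circ> \<gamma>)"
      using seg by (intro continuous_on_compose continuous_on_subset[OF cont]) (auto simp: \<gamma>_def intro!: continuous_intros)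
    show "continuous_on {0..1} (\<lambda>t. - C / a * ((1 - t) * N) powr a)"
      using a N by (intro continuous_intros continuous_on_powr') auto
    show "((f \<circ> \<gamma>) has_vector_derivative (f' (\<gamma> t) * (w - z))) (at t)" if t: "0 < t" "t < 1" for t
    proof -
      have 1: "(\<gamma> has_vector_derivative (w - z)) (at t)"
        unfolding \<gamma>_def by (auto intro!: derivative_eq_intros simp: has_vector_derivative_def scaleR_conv_of_real)
      have "(f has_field_derivative f' (\<gamma> t)) (at (\<gamma> t))"
        using seg[of t] ne[of t] t by (intro deriv) auto
      from field_vector_diff_chain_at[OF 1 this] show ?thesis by (simp add: mult.commute)
    qed
    show "((\<lambda>t. - C / a * ((1 - t) * N) powr a) has_vector_derivative (C * ((1 - t) * N) powr (a - 1) * N)) (at t)"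
      if t: "0 < t" "t < 1" for t
      unfolding has_real_derivative_iff_has_vector_derivative[symmetric]
      using t N a by (auto intro!: derivative_eq_intros simp: field_simps powr_diff)
    show "norm (f' (\<gamma> t) * (w - z)) \<le> C * ((1 - t) * N) powr (a - 1) * N" if t: "0 < t" "t < 1" for t
    proof -
      have "norm (f' (\<gamma> t)) \<le> C * norm (w - \<gamma> t) powr (a - 1)"
        using seg[of t] ne[of t] t by (intro bound) auto
      then show ?thesis using nw[of t] t by (simp add: norm_mult N_def mult_right_mono)
    qed
  qed simp
  then show ?thesis using a by (simp add: \<gamma>_def N_def norm_minus_commute)
qed


lemma segment_lipschitz_bound:
  fixes f f' :: "complex \<Rightarrow> complex"
  assumes "z \<noteq> w" "continuous_on (closed_segment z w) f"
    and "\<And>u. u \<in> closed_segment z w - {w} \<Longrightarrow> (f has_field_derivative f' u) (at u)"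
    and "\<And>u. u \<in> closed_segment z w - {w} \<Longrightarrow> norm (f' u) \<le> C"
  shows "norm (f z - f w) \<le> C * norm (w - z)"
proof -
  have "norm (f z - f w) \<le> C / 1 * norm (w - z) powr 1"
    using assms by (intro segment_growth_bound[where f' = f']) auto
  then show ?thesis by simp
qed

lemma segment_sqrt_bound:
  fixes f f' :: "complex \<Rightarrow> complex"
  assumes "z \<noteq> w" "continuous_on (closed_segment z w) f"
    and "\<And>u. u \<in> closed_segment z w - {w} \<Longrightarrow> (f has_field_derivative f' u) (at u)"
    and b: "\<And>u. u \<in> closed_segment z w - {w} \<Longrightarrow> norm (f' u) \<le> C / sqrt (norm (w - u))"
  shows "norm (f z - f w) \<le> 2 * C * sqrt (norm (w - z))"
proof -
  have "norm (f z - f w) \<le> C / (1/2) * norm (w - z) powr (1/2)"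
  proof (rule segment_growth_bound[where f' = f'])
    show "norm (f' u) \<le> C * norm (w - u) powr (1/2 - 1)" if "u \<in> closed_segment z w - {w}" for u
    proof -
      have e: "1/2 - 1 = - (1/2 :: real)" by simp
      have "norm (w - u) powr (1/2 - 1) = 1 / sqrt (norm (w - u))"
        unfolding e powr_minus powr_half_sqrt[OF norm_ge_zero] by (simp only: inverse_eq_divide)
      then show ?thesis using b[OF that] by (simp only: times_divide_eq_right mult_1_right)
    qed
  qed (use assms in auto)
  then show ?thesis unfolding powr_half_sqrt[OF norm_ge_zero] by simp
qed

section \<open>Local analysis at a square root singularity\<close>

lemma closed_segment_to_1:
  assumes "norm z < 1" "norm (1 - z) < 1/2" "u \<in> closed_segment z 1 - {1 :: complex}"
  shows "norm u < 1" "norm (1 - u) < 1/2" "norm (1 - u) \<le> norm (1 - z)" "1/2 < norm u"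
proof -
  obtain t where t: "0 \<le> t" "t \<le> 1" "u = (1 - t) *\<^sub>R z + t *\<^sub>R 1"
    using assms(3) by (auto simp: closed_segment_def)
  have t1: "t < 1" using t assms(3) by (cases "t = 1") auto
  have "norm u \<le> (1 - t) * norm z + t"
    unfolding t(3) using t(1,2) by (intro order_trans[OF norm_triangle_ineq]) auto
  also have "\<dots> < (1 - t) * 1 + t" using assms(1) t1 by (intro add_strict_right_mono mult_strict_left_mono) auto
  finally show "norm u < 1" by simp
  have "1 - u = (1 - t) *\<^sub>R (1 - z)" by (simp add: t(3) algebra_simps)
  then have "norm (1 - u) = (1 - t) * norm (1 - z)" using t by simp
  also have "\<dots> \<le> 1 * norm (1 - z)" using t by (intro mult_right_mono) auto
  finally show "norm (1 - u) \<le> norm (1 - z)" by simp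
  then show "norm (1 - u) < 1/2" using assms(2) by simp
  then show "1/2 < norm u" using norm_triangle_ineq2[of 1 u] norm_triangle_ineq[of u "1 - u"] by simp
qed

text \<open>The singularity is moved to 1. From D D' = Q the square of \<open>D\<close> has
  derivative 2 Q, which extends continuously with value -\<beta> at 1; \<open>P / D\<close> will be
  the derivative whose coefficients are sought. The origin is kept away because 1 / z enters
  \<open>P\<close> in the application.\<close>

locale sqrt_singularity =
  fixes D P Q P' Q' :: "complex \<Rightarrow> complex" and \<beta> C :: real
  assumes cont: "continuous_on (cball 0 1 - ball 0 (1/2)) D" "continuous_on (cball 0 1 - ball 0 (1/2)) P"
      "continuous_on (cball 0 1 - ball 0 (1/2)) Q"
    and dD: "\<And>z. 1/2 < norm z \<Longrightarrow> norm z < 1 \<Longrightarrow> (D has_field_derivative Q z / D z) (at z)"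
    and dP: "\<And>z. 1/2 < norm z \<Longrightarrow> norm z < 1 \<Longrightarrow> (P has_field_derivative P' z) (at z)"
    and dQ: "\<And>z. 1/2 < norm z \<Longrightarrow> norm z < 1 \<Longrightarrow> (Q has_field_derivative Q' z) (at z)"
    and bP: "\<And>z. 1/2 < norm z \<Longrightarrow> norm z < 1 \<Longrightarrow> norm (P' z) \<le> C / norm (D z)"
    and bQ: "\<And>z. 1/2 < norm z \<Longrightarrow> norm z < 1 \<Longrightarrow> norm (Q' z) \<le> C / norm (D z)"
    and D1: "D 1 = 0"
    and Dnz: "\<And>z. 1/2 \<le> norm z \<Longrightarrow> norm z \<le> 1 \<Longrightarrow> z \<noteq> 1 \<Longrightarrow> D z \<noteq> 0"
    and Dre: "\<And>z. 1/2 < norm z \<Longrightarrow> norm z < 1 \<Longrightarrow> Re (D z) > 0"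
    and Q1: "Q 1 = of_real (- \<beta> / 2)" and \<beta>: "\<beta> > 0"
begin

abbreviation "ann \<equiv> cball 0 1 - ball 0 (1/2) :: complex set"

lemma compact_ann: "compact ann"
  by (intro compact_diff) auto

lemma bounded_on_ann:
  assumes "continuous_on ann (f :: complex \<Rightarrow> complex)"
  obtains B where "B > 0" "\<And>z. z \<in> ann \<Longrightarrow> norm (f z) \<le> B"
proof -
  have "bounded (f ` ann)" using compact_continuous_image[OF assms compact_ann] compact_imp_bounded by blast
  then obtain B where "B > 0" "\<And>x. x \<in> f ` ann \<Longrightarrow> norm x \<le> B" using bounded_pos by metis
  then show ?thesis using that by blast
qed

lemma segment_subset_ann:
  assumes "norm z < 1" "norm (1 - z) < 1/2"
  shows "closed_segment z 1 \<subseteq> ann"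
proof
  fix u assume "u \<in> closed_segment z 1"
  then show "u \<in> ann" using closed_segment_to_1[OF assms, of u] by (cases "u = 1") auto
qed

text \<open>The error of \<beta> (1 - z) as an approximation of the square of
  \<open>D\<close>.\<close>

definition \<Phi> :: "complex \<Rightarrow> complex" where "\<Phi> z = (D z)\<^sup>2 + of_real \<beta> * (z - 1)"

lemma deriv_\<Phi>:
  assumes "1/2 < norm z" "norm z < 1"
  shows "(\<Phi> has_field_derivative 2 * (Q z - Q 1)) (at z)"
proof -
  have "D z \<noteq> 0" using assms by (intro Dnz) auto
  then show ?thesis unfolding \<Phi>_def
    by (auto intro!: derivative_eq_intros dD[OF assms] simp: Q1)
qed

lemma cont_\<Phi>: "continuous_on ann \<Phi>"
  unfolding \<Phi>_def by (intro continuous_intros cont)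

lemma \<Phi>_bound:
  assumes z: "norm z < 1" "norm (1 - z) < 1/2"
    and b: "\<And>u. u \<in> closed_segment z 1 - {1} \<Longrightarrow> norm (Q u - Q 1) \<le> B"
  shows "norm (\<Phi> z) \<le> 2 * B * norm (1 - z)"
proof -
  have "norm (\<Phi> z - \<Phi> 1) \<le> 2 * B * norm (1 - z)"
  proof (rule segment_lipschitz_bound[where f' = "\<lambda>u. 2 * (Q u - Q 1)"])
    show "continuous_on (closed_segment z 1) \<Phi>"
      by (rule continuous_on_subset[OF cont_\<Phi> segment_subset_ann[OF z]])
    show "(\<Phi> has_field_derivative 2 * (Q u - Q 1)) (at u)" if "u \<in> closed_segment z 1 - {1}" for u
      using closed_segment_to_1[OF z that] by (intro deriv_\<Phi>)
    show "norm (2 * (Q u - Q 1)) \<le> 2 * B" if "u \<in> closed_segment z 1 - {1}" for u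
      using b[OF that] unfolding norm_mult by simp
  qed (use z in auto)
  then show ?thesis by (simp add: \<Phi>_def D1)
qed

text \<open>Near 1, continuity of \<open>Q\<close> keeps the error \<open>\<Phi>\<close> below a
  quarter of the main term \<beta> |1 - z|. On the compact rest of the annulus \<open>D\<close> has
  no zero.\<close>

lemma D_lower:
  obtains c where "c > 0" "\<And>z. 1/2 < norm z \<Longrightarrow> norm z < 1 \<Longrightarrow> c * sqrt (norm (1 - z)) \<le> norm (D z)"
proof -
  have "1 \<in> ann" by simp
  then obtain d where d: "d > 0" "\<And>u. u \<in> ann \<Longrightarrow> dist u 1 < d \<Longrightarrow> dist (Q u) (Q 1) \<le> \<beta> / 8"
    using cont(3) \<beta> unfolding continuous_on_iff
    by (metis divide_pos_pos less_eq_real_def zero_less_numeral)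
  define e where "e = min d (1/2)"
  have e: "e > 0" "e \<le> 1/2" "e \<le> d" using d by (auto simp: e_def)
  have near: "sqrt (\<beta> / 2) * sqrt (norm (1 - z)) \<le> norm (D z)" if z: "norm z < 1" "norm (1 - z) < e" for z
  proof -
    have z': "norm (1 - z) < 1/2" using z e by simp
    have "norm (Q u - Q 1) \<le> \<beta> / 8" if u: "u \<in> closed_segment z 1 - {1}" for u
    proof -
      have "u \<in> ann" using segment_subset_ann[OF z(1) z'] u by blast
      moreover have "dist u 1 < d"
        using closed_segment_to_1(3)[OF z(1) z' u] z(2) e by (simp add: dist_norm norm_minus_commute)
      ultimately show ?thesis using d(2) by (simp add: dist_norm)
    qed
    then have "norm (\<Phi> z) \<le> 2 * (\<beta> / 8) * norm (1 - z)" by (rule \<Phi>_bound[OF z(1) z'])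
    moreover have "\<beta> * norm (1 - z) \<le> norm (\<Phi> z) + norm ((D z)\<^sup>2)"
    proof -
      have "of_real \<beta> * (1 - z) = (D z)\<^sup>2 - \<Phi> z" by (simp add: \<Phi>_def algebra_simps)
      then have "norm (of_real \<beta> * (1 - z)) \<le> norm ((D z)\<^sup>2) + norm (\<Phi> z)" using norm_triangle_ineq4 by metis
      then show ?thesis using \<beta> by (simp add: norm_mult)
    qed
    moreover have "0 \<le> \<beta> * norm (1 - z)" using \<beta> by simp
    ultimately have "\<beta> / 2 * norm (1 - z) \<le> (norm (D z))\<^sup>2" by (simp add: norm_power)
    then have "sqrt (\<beta> / 2 * norm (1 - z)) \<le> norm (D z)" by (simp add: real_le_lsqrt)
    then show ?thesis by (simp only: real_sqrt_mult)
  qed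
  have "compact (ann - ball 1 e)" by (intro compact_diff compact_ann) auto
  moreover have "continuous_on (ann - ball 1 e) (\<lambda>z. norm (D z))"
    by (intro continuous_intros continuous_on_subset[OF cont(1)]) auto
  moreover have "- 1 \<in> ann - ball 1 e" using e by (simp add: dist_norm)
  ultimately obtain w where w: "w \<in> ann - ball 1 e" "\<And>z. z \<in> ann - ball 1 e \<Longrightarrow> norm (D w) \<le> norm (D z)"
    using continuous_attains_inf[of "ann - ball 1 e" "\<lambda>z. norm (D z)"] by blast
  have "D w \<noteq> 0" using w(1) e by (intro Dnz) auto
  then have Dw: "norm (D w) > 0" by simp
  show thesis
  proof (rule that[of "min (sqrt (\<beta> / 2)) (norm (D w) / sqrt 2)"])
    show "min (sqrt (\<beta> / 2)) (norm (D w) / sqrt 2) > 0" using Dw \<beta> by simp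
    fix z :: complex assume z: "1/2 < norm z" "norm z < 1"
    show "min (sqrt (\<beta> / 2)) (norm (D w) / sqrt 2) * sqrt (norm (1 - z)) \<le> norm (D z)"
    proof (cases "norm (1 - z) < e")
      case True
      have "min (sqrt (\<beta> / 2)) (norm (D w) / sqrt 2) * sqrt (norm (1 - z)) \<le> sqrt (\<beta> / 2) * sqrt (norm (1 - z))"
        by (intro mult_right_mono) auto
      then show ?thesis using near[OF z(2) True] by simp
    next
      case False
      have "norm (1 - z) \<le> 2" using norm_triangle_ineq4[of 1 z] z by simp
      then have "min (sqrt (\<beta> / 2)) (norm (D w) / sqrt 2) * sqrt (norm (1 - z)) \<le> norm (D w) / sqrt 2 * sqrt 2"
        using Dw by (intro mult_mono) auto
      also have "\<dots> = norm (D w)" by simp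
      also have "\<dots> \<le> norm (D z)" using z False by (intro w(2)) (auto simp: dist_norm)
      finally show ?thesis .
    qed
  qed
qed

text \<open>By \<open>D_lower\<close> a derivative of order 1 / |D| is of order |1 - z|^(-1/2),
  which integrates to a square root.\<close>

lemma near_sqrt_bound:
  fixes f f' :: "complex \<Rightarrow> complex"
  assumes f: "continuous_on ann f" "\<And>z. 1/2 < norm z \<Longrightarrow> norm z < 1 \<Longrightarrow> (f has_field_derivative f' z) (at z)"
    and b: "\<And>z. 1/2 < norm z \<Longrightarrow> norm z < 1 \<Longrightarrow> norm (f' z) \<le> C / norm (D z)"
  obtains B where "B > 0" "\<And>z. norm z < 1 \<Longrightarrow> norm (1 - z) < 1/2 \<Longrightarrow> norm (f z - f 1) \<le> B * sqrt (norm (1 - z))"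
proof -
  obtain c where c: "c > 0" "\<And>z. 1/2 < norm z \<Longrightarrow> norm z < 1 \<Longrightarrow> c * sqrt (norm (1 - z)) \<le> norm (D z)"
    using D_lower by blast
  define B where "B = \<bar>C\<bar> / c"
  have "norm (f z - f 1) \<le> 2 * B * sqrt (norm (1 - z))" if z: "norm z < 1" "norm (1 - z) < 1/2" for z
  proof (rule segment_sqrt_bound)
    show "continuous_on (closed_segment z 1) f"
      by (rule continuous_on_subset[OF f(1) segment_subset_ann[OF z]])
    fix u assume u: "u \<in> closed_segment z 1 - {1}"
    note u' = closed_segment_to_1[OF z u]
    show "(f has_field_derivative f' u) (at u)" using u' by (intro f)
    have un: "u \<noteq> 1" using u by simp
    have "norm (f' u) \<le> C / norm (D u)" using u' by (intro b)
    also have "\<dots> \<le> \<bar>C\<bar> / norm (D u)" by (intro divide_right_mono) auto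
    also have "\<dots> \<le> \<bar>C\<bar> / (c * sqrt (norm (1 - u)))"
    proof -
      have "c * sqrt (norm (1 - u)) > 0" using c(1) un by simp
      moreover from this have "norm (D u) > 0" using c(2)[OF u'(4,1)] by linarith
      ultimately show ?thesis using c(2)[OF u'(4,1)] by (intro divide_left_mono mult_pos_pos[of "norm (D u)"]) auto
    qed
    finally show "norm (f' u) \<le> B / sqrt (norm (1 - u))" by (simp add: B_def)
  qed (use z in auto)
  moreover have "2 * B * sqrt (norm (1 - z)) \<le> (2 * B + 1) * sqrt (norm (1 - z))" for z :: complex
    by (intro mult_right_mono) auto
  moreover have "2 * B + 1 > 0" using c(1) by (simp add: B_def add_nonneg_pos)
  ultimately show thesis using that[of "2 * B + 1"] by (meson order_trans)
qed

text \<open>The square of the root has positive real part, which puts the root into the sector |Im|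
  < |Re|.\<close>

lemma Re_csqrt_ge:
  assumes "norm z < 1"
  shows "norm (csqrt (1 - z)) \<le> 2 * Re (csqrt (1 - z))"
proof -
  define s where "s = csqrt (1 - z)"
  have "Re z < 1" using complex_Re_le_cmod[of z] assms by simp
  then have "Re (s\<^sup>2) > 0" by (simp add: s_def)
  then have "(Im s)\<^sup>2 < (Re s)\<^sup>2" by (simp add: power2_eq_square)
  then have "\<bar>Im s\<bar> < \<bar>Re s\<bar>" by (meson abs_le_square_iff not_le)
  moreover have "Re s \<ge> 0" unfolding s_def by (rule Re_csqrt)
  moreover have "norm s \<le> \<bar>Re s\<bar> + \<bar>Im s\<bar>" by (rule cmod_le)
  ultimately show ?thesis unfolding s_def by linarith
qed

lemma norm_csqrt: "norm (csqrt z) = sqrt (norm z)"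
  by (metis norm_power power2_csqrt norm_ge_zero real_sqrt_unique)

text \<open>\<open>\<Phi>\<close> is of order |1 - z|^(3/2) and factors into difference and sum of
  \<open>D\<close> and sqrt \<beta> csqrt (1 - z). Both of these have positive real part, which
  fixes the branch: the sum is at least of order |1 - z|^(1/2), so the difference is of order |1 -
  z|.\<close>

lemma D_approx:
  obtains B where "B > 0" "\<And>z. norm z < 1 \<Longrightarrow> norm (1 - z) < 1/2 \<Longrightarrow>
      norm (D z - of_real (sqrt \<beta>) * csqrt (1 - z)) \<le> B * norm (1 - z)"
proof -
  obtain K where K: "K > 0" "\<And>z. norm z < 1 \<Longrightarrow> norm (1 - z) < 1/2 \<Longrightarrow> norm (Q z - Q 1) \<le> K * sqrt (norm (1 - z))"
    using near_sqrt_bound[OF cont(3) dQ bQ] by blast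
  have "norm (D z - of_real (sqrt \<beta>) * csqrt (1 - z)) \<le> 4 * K / sqrt \<beta> * norm (1 - z)"
    if z: "norm z < 1" "norm (1 - z) < 1/2" for z
  proof -
    define s where "s = csqrt (1 - z)"
    have z1: "z \<noteq> 1" using z by auto
    then have s0: "s \<noteq> 0" by (simp add: s_def)
    have ns: "norm s = sqrt (norm (1 - z))" by (simp add: s_def norm_csqrt)
    have zn: "1/2 < norm z" using norm_triangle_ineq[of z "1 - z"] z by simp
    have "norm (Q u - Q 1) \<le> K * sqrt (norm (1 - z))" if u: "u \<in> closed_segment z 1 - {1}" for u
    proof -
      note u' = closed_segment_to_1[OF z u]
      have "norm (Q u - Q 1) \<le> K * sqrt (norm (1 - u))" using u' by (intro K)
      also have "\<dots> \<le> K * sqrt (norm (1 - z))" using u' K(1) by (intro mult_left_mono) auto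
      finally show ?thesis .
    qed
    from \<Phi>_bound[OF z this] have \<Phi>: "norm (\<Phi> z) \<le> 2 * K * norm s * norm (1 - z)" by (simp add: ns mult_ac)
    have "\<Phi> z = (D z)\<^sup>2 - of_real \<beta> * (1 - z)" by (simp add: \<Phi>_def algebra_simps)
    also have "of_real \<beta> * (1 - z) = (of_real (sqrt \<beta>) * s)\<^sup>2"
      using \<beta> by (simp add: s_def power_mult_distrib flip: of_real_power)
    finally have "\<Phi> z = (D z)\<^sup>2 - (of_real (sqrt \<beta>) * s)\<^sup>2" .
    also have "\<dots> = (D z - of_real (sqrt \<beta>) * s) * (D z + of_real (sqrt \<beta>) * s)"
      by (simp add: power2_eq_square algebra_simps)
    finally have prod: "norm (D z - of_real (sqrt \<beta>) * s) * norm (D z + of_real (sqrt \<beta>) * s) = norm (\<Phi> z)"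
      by (simp add: norm_mult)
    have "sqrt \<beta> * norm s / 2 \<le> sqrt \<beta> * Re s"
      using Re_csqrt_ge[OF z(1)] \<beta> by (simp add: s_def)
    also have "\<dots> \<le> Re (D z + of_real (sqrt \<beta>) * s)" using Dre[OF zn z(1)] by simp
    also have "\<dots> \<le> norm (D z + of_real (sqrt \<beta>) * s)" by (rule complex_Re_le_cmod)
    finally have low: "sqrt \<beta> * norm s / 2 \<le> norm (D z + of_real (sqrt \<beta>) * s)" .
    have "norm (D z - of_real (sqrt \<beta>) * s) * (sqrt \<beta> * norm s / 2) \<le> norm (\<Phi> z)"
      unfolding prod[symmetric] using low by (intro mult_left_mono) auto
    also note \<Phi>
    finally have "norm (D z - of_real (sqrt \<beta>) * s) * sqrt \<beta> * norm s \<le> (4 * K * norm (1 - z)) * norm s"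
      by (simp add: mult_ac)
    then have "norm (D z - of_real (sqrt \<beta>) * s) * sqrt \<beta> \<le> 4 * K * norm (1 - z)"
      by (rule mult_right_le_imp_le) (use s0 in simp)
    then show ?thesis using \<beta> by (simp add: s_def field_simps)
  qed
  moreover have "4 * K / sqrt \<beta> > 0" using K \<beta> by simp
  ultimately show thesis using that by blast
qed

end

context sqrt_singularity
begin

lemma deriv_csqrt_inverse:
  assumes "norm z < 1"
  shows "((\<lambda>z. a / csqrt (1 - z)) has_field_derivative a / (2 * csqrt (1 - z) ^ 3)) (at z)"
proof -
  have "Re z < 1" using complex_Re_le_cmod[of z] assms by simp
  then have np: "1 - z \<notin> \<real>\<^sub>\<le>\<^sub>0" by (auto simp: complex_nonpos_Reals_iff)
  have "csqrt (1 - z) \<noteq> 0" using assms by auto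
  then show ?thesis using np
    by (auto intro!: derivative_eq_intros simp: power3_eq_cube field_simps)
qed

text \<open>Here \<open>s\<close> is sqrt |1 - z|, \<open>d\<close> is the value of \<open>D\<close>
  and \<open>e\<close> its approximation. The quotients may be of order s^(-3); since numerators and
  denominators agree up to a relative error of order s, the difference is of order s^(-2).\<close>

lemma cube_quotient_bound:
  fixes d e p q p1 q1 :: complex and s :: real
  assumes s: "0 < s" "s \<le> 2"
    and c: "0 < c" "c * s \<le> norm d" "c * s \<le> norm e"
    and K: "norm e \<le> K * s" "norm d \<le> K * s" "norm (d - e) \<le> K * s\<^sup>2"
    and pq: "norm (p * q - p1 * q1) \<le> K * s" "norm (p1 * q1) \<le> K"
  shows "norm (p * q / d ^ 3 - p1 * q1 / e ^ 3) \<le> (K / c ^ 3 + K * (3 * K ^ 3) / c ^ 6) / s\<^sup>2"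
proof -
  have K0: "0 \<le> K" using pq(2) norm_ge_zero order_trans by blast
  have cs: "0 < c * s" using c s by simp
  have d0: "d \<noteq> 0" "e \<noteq> 0" using c cs by auto
  have d3: "(c * s) ^ 3 \<le> norm d ^ 3" "(c * s) ^ 3 \<le> norm e ^ 3" using c cs by (auto intro!: power_mono)
  have "p * q / d ^ 3 - p1 * q1 / e ^ 3 = (p * q - p1 * q1) / d ^ 3 + p1 * q1 * ((e - d) * (e\<^sup>2 + e * d + d\<^sup>2) / (d ^ 3 * e ^ 3))"
    using d0 by (simp add: field_simps power2_eq_square power3_eq_cube)
  also have "norm \<dots> \<le> norm ((p * q - p1 * q1) / d ^ 3) + norm (p1 * q1 * ((e - d) * (e\<^sup>2 + e * d + d\<^sup>2) / (d ^ 3 * e ^ 3)))"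
    by (rule norm_triangle_ineq)
  also have "norm ((p * q - p1 * q1) / d ^ 3) \<le> K * s / (c * s) ^ 3"
    unfolding norm_divide norm_power using pq d3 cs K0 s by (intro frac_le) auto
  also have "K * s / (c * s) ^ 3 = K / c ^ 3 / s\<^sup>2"
    using s c by (simp add: field_simps power2_eq_square power3_eq_cube)
  also have "norm (p1 * q1 * ((e - d) * (e\<^sup>2 + e * d + d\<^sup>2) / (d ^ 3 * e ^ 3)))
      = norm (p1 * q1) * (norm (d - e) * norm (e\<^sup>2 + e * d + d\<^sup>2) / (norm d ^ 3 * norm e ^ 3))"
    by (simp add: norm_mult norm_divide norm_power norm_minus_commute)
  also have "\<dots> \<le> K * ((K * s\<^sup>2) * (3 * K\<^sup>2 * s\<^sup>2) / ((c * s) ^ 3 * (c * s) ^ 3))"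
  proof (intro mult_mono frac_le)
    have "norm (e\<^sup>2 + e * d + d\<^sup>2) \<le> norm e ^ 2 + norm e * norm d + norm d ^ 2"
      by (metis (no_types, lifting) norm_mult norm_power norm_triangle_mono norm_triangle_ineq order_refl)
    also have "\<dots> \<le> (K * s)\<^sup>2 + (K * s) * (K * s) + (K * s)\<^sup>2"
      using K K0 s by (intro add_mono power_mono mult_mono) auto
    finally show "norm (e\<^sup>2 + e * d + d\<^sup>2) \<le> 3 * K\<^sup>2 * s\<^sup>2" by (simp add: power2_eq_square algebra_simps)
  qed (use pq K K0 d3 cs s in auto)
  also have "\<dots> = K * (3 * K ^ 3) / c ^ 6 / s\<^sup>2"
    using s c by (simp add: field_simps power2_eq_square power3_eq_cube eval_nat_numeral)
  finally show ?thesis by (simp add: add_divide_distrib)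
qed

text \<open>The value of \<open>Q\<close> at 1 makes the terms of order |1 - z|^(-3/2) in the
  derivative of the remainder cancel. Away from 1 this derivative is bounded: by
  \<open>D_lower\<close> in the annulus and by compactness in the inner disc.\<close>

theorem coefficients_asymptotics:
  assumes y: "y holomorphic_on ball 0 1"
    and dy: "\<And>z. 1/2 < norm z \<Longrightarrow> norm z < 1 \<Longrightarrow> (y has_field_derivative P z / D z) (at z)"
  shows "(\<lambda>n. of_real (sqrt (real n)) * (of_nat (Suc n) * ((deriv ^^ Suc n) y 0 / fact (Suc n))))
    \<longlonglongrightarrow> P 1 / of_real (sqrt \<beta> * sqrt pi)"
proof -
  define \<alpha> where "\<alpha> = P 1 / of_real (sqrt \<beta>)"
  define s where "s z = csqrt (1 - z)" for z
  define f where "f z = deriv y z - \<alpha> / s z" for z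
  define f' where "f' z = deriv (deriv y) z - \<alpha> / (2 * s z ^ 3)" for z
  have holy': "deriv y holomorphic_on ball 0 1" using y by (intro holomorphic_deriv) auto
  have df: "(f has_field_derivative f' z) (at z)" if "norm z < 1" for z
    unfolding f_def f'_def s_def
    by (intro DERIV_diff deriv_csqrt_inverse that holomorphic_derivI[OF holy']) (use that in auto)
  then have holf: "f holomorphic_on ball 0 1"
    by (subst holomorphic_on_open) (simp, use df in \<open>force simp: dist_norm\<close>)
  have ns: "norm (s z) = sqrt (norm (1 - z))" for z by (simp add: s_def norm_csqrt)
  have f'_eq: "f' z = P' z / D z - (P z * Q z / D z ^ 3 + \<alpha> / (2 * s z ^ 3))"
    if z: "1/2 < norm z" "norm z < 1" for z
  proof -
    have Dz: "D z \<noteq> 0" using z by (intro Dnz) auto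
    have "((\<lambda>z. P z / D z) has_field_derivative (P' z * D z - P z * (Q z / D z)) / (D z * D z)) (at z)"
      by (intro DERIV_divide dP dD z Dz)
    moreover have "\<forall>\<^sub>F w in nhds z. P w / D w = deriv y w"
    proof -
      have "open (ball 0 1 - cball 0 (1/2) :: complex set)" by auto
      then have "\<forall>\<^sub>F w in nhds z. w \<in> ball 0 1 - cball 0 (1/2)" using z by (intro eventually_nhds_in_open) auto
      then show ?thesis by eventually_elim (auto intro!: DERIV_imp_deriv[symmetric] dy)
    qed
    ultimately have "(deriv y has_field_derivative (P' z * D z - P z * (Q z / D z)) / (D z * D z)) (at z)"
      by (rule DERIV_cong_ev[OF HOL.refl _ HOL.refl, THEN iffD1, rotated])
    then have "deriv (deriv y) z = (P' z * D z - P z * (Q z / D z)) / (D z * D z)" by (rule DERIV_imp_deriv)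
    then show ?thesis using Dz by (simp add: f'_def field_simps power3_eq_cube)
  qed
  obtain c where c: "c > 0" "\<And>z. 1/2 < norm z \<Longrightarrow> norm z < 1 \<Longrightarrow> c * sqrt (norm (1 - z)) \<le> norm (D z)"
    using D_lower by blast
  obtain B1 where B1: "B1 > 0" "\<And>z. norm z < 1 \<Longrightarrow> norm (1 - z) < 1/2 \<Longrightarrow>
      norm (D z - of_real (sqrt \<beta>) * csqrt (1 - z)) \<le> B1 * norm (1 - z)" using D_approx by blast
  have dPQ: "((\<lambda>z. P z * Q z) has_field_derivative (P' z * Q z + Q' z * P z)) (at z)" if "1/2 < norm z" "norm z < 1" for z
    by (intro DERIV_mult dP dQ that)
  obtain BP where BP: "BP > 0" "\<And>z. z \<in> ann \<Longrightarrow> norm (P z) \<le> BP" using bounded_on_ann[OF cont(2)] by blast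
  obtain BQ where BQ: "BQ > 0" "\<And>z. z \<in> ann \<Longrightarrow> norm (Q z) \<le> BQ" using bounded_on_ann[OF cont(3)] by blast
  obtain KP where KP: "KP > 0" "\<And>z. norm z < 1 \<Longrightarrow> norm (1 - z) < 1/2 \<Longrightarrow> norm (P z - P 1) \<le> KP * sqrt (norm (1 - z))"
    using near_sqrt_bound[OF cont(2) dP bP] by blast
  obtain KQ where KQ: "KQ > 0" "\<And>z. norm z < 1 \<Longrightarrow> norm (1 - z) < 1/2 \<Longrightarrow> norm (Q z - Q 1) \<le> KQ * sqrt (norm (1 - z))"
    using near_sqrt_bound[OF cont(3) dQ bQ] by blast
  define e where "e z = of_real (sqrt \<beta>) * s z" for z
  define c' where "c' = min c (sqrt \<beta>)"
  define K where "K = sqrt \<beta> + 2 * B1 + BP * KQ + BQ * KP + BP * BQ"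
  have c': "c' > 0" "c' \<le> c" "c' \<le> sqrt \<beta>" using c \<beta> by (auto simp: c'_def)
  have pos: "BP * KQ > 0" "BQ * KP > 0" "BP * BQ > 0" "sqrt \<beta> > 0" using BP BQ KP KQ \<beta> by auto
  have ann1: "1 \<in> ann" by simp
  define L where "L = K / c' ^ 3 + K * (3 * K ^ 3) / c' ^ 6"
  have near: "norm (f' z) \<le> (\<bar>C\<bar> / c\<^sup>2 + L) / norm (1 - z)"
    if z: "norm z < 1" "norm (1 - z) < 1/2" for z
  proof -
    have z1: "z \<noteq> 1" using z by auto
    have zn: "1/2 < norm z" using norm_triangle_ineq[of z "1 - z"] z by simp
    have za: "z \<in> ann" using zn z by simp
    define r where "r = sqrt (norm (1 - z))"
    have r: "0 < r" "r\<^sup>2 = norm (1 - z)" "norm (s z) = r" using z1 by (auto simp: r_def ns)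
    have "r \<le> sqrt 1" unfolding r_def using z by (intro real_sqrt_le_mono) auto
    then have r1: "r \<le> 1" by simp
    have rr: "r\<^sup>2 \<le> r" unfolding power2_eq_square using r(1) r1 by (simp add: mult_left_le_one_le)
    have ne: "norm (e z) = sqrt \<beta> * r" using \<beta> by (simp add: e_def norm_mult r)
    have de: "norm (D z - e z) \<le> B1 * r\<^sup>2" using B1(2)[OF z] by (simp add: e_def s_def r)
    have nd: "norm (D z) \<le> sqrt \<beta> * r + B1 * r"
    proof -
      have "norm (D z) \<le> norm (e z) + norm (D z - e z)" by (metis add.commute norm_triangle_sub)
      also have "\<dots> \<le> sqrt \<beta> * r + B1 * r\<^sup>2" using ne de by simp
      also have "\<dots> \<le> sqrt \<beta> * r + B1 * r" using rr B1(1) by simp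
      finally show ?thesis .
    qed
    have "norm (P z * Q z / D z ^ 3 - P 1 * Q 1 / e z ^ 3) \<le> L / r\<^sup>2"
      unfolding L_def
    proof (rule cube_quotient_bound)
      show "c' * r \<le> norm (D z)" using c(2)[OF zn z(1)] c' r by (auto simp: r_def intro: order_trans[OF mult_right_mono])
      show "c' * r \<le> norm (e z)" unfolding ne using c' r by (intro mult_right_mono) auto
      show "norm (e z) \<le> K * r" unfolding ne K_def using r B1(1) pos by (intro mult_right_mono) auto
      have "sqrt \<beta> * r + B1 * r = (sqrt \<beta> + B1) * r" by (simp add: algebra_simps)
      also have "\<dots> \<le> K * r" unfolding K_def using r B1(1) pos by (intro mult_right_mono) auto
      finally show "norm (D z) \<le> K * r" using nd by simp
      have "B1 * r\<^sup>2 \<le> K * r\<^sup>2" unfolding K_def using B1(1) pos by (intro mult_right_mono) auto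
      then show "norm (D z - e z) \<le> K * r\<^sup>2" using de by simp
      have "P z * Q z - P 1 * Q 1 = P z * (Q z - Q 1) + (P z - P 1) * Q 1" by (simp add: algebra_simps)
      then have "norm (P z * Q z - P 1 * Q 1) \<le> norm (P z) * norm (Q z - Q 1) + norm (P z - P 1) * norm (Q 1)"
        by (metis norm_mult norm_triangle_ineq)
      also have "\<dots> \<le> BP * (KQ * r) + (KP * r) * BQ"
        using BP BQ KP KQ za ann1 z r unfolding r_def by (intro add_mono mult_mono) auto
      also have "\<dots> = (BP * KQ + BQ * KP) * r" by (simp add: algebra_simps)
      also have "\<dots> \<le> K * r" unfolding K_def using r B1(1) pos by (intro mult_right_mono) auto
      finally show "norm (P z * Q z - P 1 * Q 1) \<le> K * r" .
      have "norm (P 1 * Q 1) \<le> BP * BQ" unfolding norm_mult using BP BQ ann1 by (intro mult_mono) auto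
      also have "\<dots> \<le> K" unfolding K_def using B1(1) pos by simp
      finally show "norm (P 1 * Q 1) \<le> K" .
    qed (use r r1 c' in auto)
    moreover have "P 1 * Q 1 / e z ^ 3 = - \<alpha> / (2 * s z ^ 3)"
    proof -
      have "(of_real (sqrt \<beta>) :: complex) ^ 3 = of_real \<beta> * of_real (sqrt \<beta>)"
        using \<beta> by (simp add: power3_eq_cube flip: of_real_mult)
      then have "e z ^ 3 = of_real \<beta> * of_real (sqrt \<beta>) * s z ^ 3" by (simp add: e_def power_mult_distrib)
      then show ?thesis using \<beta> by (simp add: Q1 \<alpha>_def)
    qed
    ultimately have 1: "norm (P z * Q z / D z ^ 3 + \<alpha> / (2 * s z ^ 3)) \<le> L / r\<^sup>2" by simp
    have "norm (P' z / D z) \<le> (C / norm (D z)) / norm (D z)"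
      unfolding norm_divide using bP[OF zn z(1)] by (intro divide_right_mono) auto
    also have "\<dots> \<le> \<bar>C\<bar> / (norm (D z))\<^sup>2" by (simp add: power2_eq_square divide_right_mono)
    also have "\<dots> \<le> \<bar>C\<bar> / (c * r)\<^sup>2"
      using c(1) c(2)[OF zn z(1)] r Dnz[of z] zn z z1 by (intro divide_left_mono power_mono) (auto simp: r_def)
    also have "\<dots> = \<bar>C\<bar> / c\<^sup>2 / r\<^sup>2" by (simp add: power_mult_distrib)
    finally have 2: "norm (P' z / D z) \<le> \<bar>C\<bar> / c\<^sup>2 / r\<^sup>2" .
    have "norm (f' z) \<le> norm (P' z / D z) + norm (P z * Q z / D z ^ 3 + \<alpha> / (2 * s z ^ 3))"
      unfolding f'_eq[OF zn z(1)] by (rule norm_triangle_ineq4)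
    also have "\<dots> \<le> (\<bar>C\<bar> / c\<^sup>2 + L) / r\<^sup>2" using 1 2 by (simp add: add_divide_distrib)
    finally show ?thesis by (simp add: r)
  qed
  have L0: "0 \<le> L" using c' pos B1 by (simp add: L_def K_def)
  have "continuous_on (cball 0 (1/2)) f'"
    unfolding f'_def s_def
  proof (intro continuous_intros)
    show "continuous_on (cball 0 (1/2)) (deriv (deriv y))"
      by (intro holomorphic_on_imp_continuous_on holomorphic_on_subset[OF holomorphic_deriv[OF holy']]) auto
    show "continuous_on (cball 0 (1/2)) (\<lambda>z. csqrt (1 - z))"
    proof -
      have "1 - z \<in> - \<real>\<^sub>\<le>\<^sub>0" if "z \<in> cball 0 (1/2)" for z :: complex
        using complex_Re_le_cmod[of z] that by (auto simp: complex_nonpos_Reals_iff)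
      then show ?thesis
        by (intro continuous_on_compose2[OF continuous_on_csqrt]) (auto intro!: continuous_intros)
    qed
  qed auto
  then have "bounded (f' ` cball 0 (1/2))" using compact_continuous_image compact_imp_bounded compact_cball by blast
  then obtain B2 where B2: "B2 > 0" "\<And>z. norm z \<le> 1/2 \<Longrightarrow> norm (f' z) \<le> B2"
    using bounded_pos by (metis (no_types, lifting) imageI mem_cball_0)
  define B3 where "B3 = \<bar>C\<bar> / (c * sqrt (1/2))\<^sup>2 + (BP * BQ / (c * sqrt (1/2)) ^ 3 + norm \<alpha> / (2 * sqrt (1/2) ^ 3))"
  have far: "norm (f' z) \<le> B3" if z: "1/2 < norm z" "norm z < 1" "norm (1 - z) \<ge> 1/2" for z
  proof -
    have r: "sqrt (1/2) \<le> sqrt (norm (1 - z))" using z(3) by (rule real_sqrt_le_mono)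
    have "c * sqrt (1/2) \<le> c * sqrt (norm (1 - z))" using c(1) r by (intro mult_left_mono) auto
    then have d: "c * sqrt (1/2) \<le> norm (D z)" using c(2)[OF z(1,2)] by linarith
    have p: "0 < c * sqrt (1/2)" using c by simp
    have D0: "0 < norm (D z)" using d p by linarith
    have za: "z \<in> ann" using z by simp
    have "norm (P' z / D z) \<le> (C / norm (D z)) / norm (D z)"
      unfolding norm_divide using bP[OF z(1,2)] by (intro divide_right_mono) auto
    also have "\<dots> \<le> \<bar>C\<bar> / (norm (D z))\<^sup>2" by (simp add: power2_eq_square divide_right_mono)
    also have "\<dots> \<le> \<bar>C\<bar> / (c * sqrt (1/2))\<^sup>2"
      using c(1) d p D0 by (intro divide_left_mono power_mono mult_pos_pos zero_less_power) auto
    finally have 1: "norm (P' z / D z) \<le> \<bar>C\<bar> / (c * sqrt (1/2))\<^sup>2" .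
    have 2: "norm (P z * Q z / D z ^ 3) \<le> BP * BQ / (c * sqrt (1/2)) ^ 3"
      unfolding norm_divide norm_mult norm_power
      using d p BP BQ za pos by (intro frac_le mult_mono power_mono zero_less_power) auto
    have 3: "norm (\<alpha> / (2 * s z ^ 3)) \<le> norm \<alpha> / (2 * sqrt (1/2) ^ 3)"
      unfolding norm_divide norm_mult norm_power ns norm_numeral
      using r by (intro frac_le mult_left_mono power_mono mult_pos_pos zero_less_power) auto
    have "norm (f' z) \<le> norm (P' z / D z) + norm (P z * Q z / D z ^ 3 + \<alpha> / (2 * s z ^ 3))"
      unfolding f'_eq[OF z(1,2)] by (rule norm_triangle_ineq4)
    also have "\<dots> \<le> norm (P' z / D z) + (norm (P z * Q z / D z ^ 3) + norm (\<alpha> / (2 * s z ^ 3)))"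
      by (intro add_left_mono norm_triangle_ineq)
    also have "\<dots> \<le> B3" unfolding B3_def using 1 2 3 by (intro add_mono)
    finally show ?thesis .
  qed
  define B where "B = (\<bar>C\<bar> / c\<^sup>2 + L) + 2 * B2 + 2 * B3"
  have B3: "0 \<le> B3" using c pos by (simp add: B3_def)
  have bf: "norm (deriv f z) \<le> B / norm (1 - z)" if z: "norm z < 1" for z
  proof -
    have z1: "z \<noteq> 1" using z by auto
    have p: "0 < norm (1 - z)" using z1 by simp
    have two: "norm (1 - z) \<le> 2" using norm_triangle_ineq4[of 1 z] z by simp
    have ge: "x \<le> 2 * x / norm (1 - z)" if "0 \<le> x" for x :: real
      using two p that by (simp add: field_simps mult_left_mono)
    have nn: "0 \<le> \<bar>C\<bar> / c\<^sup>2 + L" using L0 c by simp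
    have "norm (f' z) \<le> B / norm (1 - z)"
    proof (cases "norm (1 - z) < 1/2")
      case True
      have "norm (f' z) \<le> (\<bar>C\<bar> / c\<^sup>2 + L) / norm (1 - z)" by (rule near[OF z True])
      also have "\<dots> \<le> B / norm (1 - z)" unfolding B_def using B2 B3 by (intro divide_right_mono) auto
      finally show ?thesis .
    next
      case False
      show ?thesis
      proof (cases "norm z \<le> 1/2")
        case True
        have "norm (f' z) \<le> B2" by (rule B2(2)[OF True])
        also have "\<dots> \<le> 2 * B2 / norm (1 - z)" using B2 by (intro ge) auto
        also have "\<dots> \<le> B / norm (1 - z)" unfolding B_def using nn B3 by (intro divide_right_mono) auto
        finally show ?thesis .
      next
        case F: False
        have "norm (f' z) \<le> B3" using F False z by (intro far) auto
        also have "\<dots> \<le> 2 * B3 / norm (1 - z)" by (intro ge B3)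
        also have "\<dots> \<le> B / norm (1 - z)" unfolding B_def using nn B2 by (intro divide_right_mono) auto
        finally show ?thesis .
      qed
    qed
    then show ?thesis using DERIV_imp_deriv[OF df[OF z]] by simp
  qed
  have lim1: "(\<lambda>n. of_real (sqrt (real n)) * ((deriv ^^ n) f 0 / fact n)) \<longlonglongrightarrow> 0"
    by (rule coefficients_tendsto_0_of_simple_pole_bound[OF holf bf])
  \<comment> \<open>The Taylor coefficients of 1 / csqrt (1 - z). They behave like 1 / (Gamma (1/2)
    sqrt n), which brings in sqrt \<pi>.\<close>
  define g where "g n = (-1) ^ n * ((- 1 / 2 :: complex) gchoose n)" for n
  have gsum: "(\<lambda>n. g n * z ^ n) sums (1 / s z)" if "norm z < 1" for z
  proof -
    have "(\<lambda>n. ((- 1 / 2 :: complex) gchoose n) * (- z) ^ n) sums (1 + (- z)) powr (- 1 / 2)"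
      using that by (intro gen_binomial_complex) simp
    moreover have "(- z) ^ n = (-1) ^ n * z ^ n" for n by (rule power_minus)
    moreover have "(1 + (- z)) powr (- 1 / 2) = 1 / s z"
    proof -
      have "1 - z \<noteq> 0" using that by auto
      then have "(1 - z) powr (- (1 / 2)) = 1 / csqrt (1 - z)" by (simp only: powr_minus csqrt_conv_powr inverse_eq_divide)
      then show ?thesis by (simp add: s_def)
    qed
    ultimately show ?thesis by (simp add: g_def mult_ac)
  qed
  have gder: "(deriv ^^ n) (\<lambda>z. 1 / s z) 0 / fact n = g n" for n
  proof -
    have "(\<lambda>z. 1 / s z) has_fps_expansion Abs_fps g"
    proof (rule has_fps_expansionI)
      have "\<forall>\<^sub>F z in nhds 0. z \<in> (ball 0 1 :: complex set)" by (intro eventually_nhds_in_open) auto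
      then show "\<forall>\<^sub>F z in nhds 0. (\<lambda>n. fps_nth (Abs_fps g) n * z ^ n) sums (1 / s z)"
        by eventually_elim (use gsum in auto)
    qed
    from fps_nth_fps_expansion[OF this, of n] show ?thesis by simp
  qed
  have hols: "(\<lambda>z. \<alpha> / s z) holomorphic_on ball 0 1" "(\<lambda>z. 1 / s z) holomorphic_on ball 0 1"
    unfolding s_def by (subst holomorphic_on_open; use deriv_csqrt_inverse in force)+
  have coeff: "of_nat (Suc n) * ((deriv ^^ Suc n) y 0 / fact (Suc n)) = (deriv ^^ n) f 0 / fact n + \<alpha> * g n" for n
  proof -
    have "(deriv ^^ n) f 0 = (deriv ^^ n) (deriv y) 0 - (deriv ^^ n) (\<lambda>z. \<alpha> / s z) 0"
      unfolding f_def by (intro higher_deriv_diff[of _ "ball 0 1"] holy' hols) auto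
    also have "(deriv ^^ n) (\<lambda>z. \<alpha> / s z) 0 = \<alpha> * (deriv ^^ n) (\<lambda>z. 1 / s z) 0"
      using higher_deriv_cmult[OF hols(2), of 0 n \<alpha>] by simp
    also have "(deriv ^^ n) (deriv y) 0 = (deriv ^^ Suc n) y 0" by (simp add: funpow_swap1)
    finally have "(deriv ^^ Suc n) y 0 = (deriv ^^ n) f 0 + \<alpha> * (deriv ^^ n) (\<lambda>z. 1 / s z) 0" by simp
    moreover have "of_nat (Suc n) * (x / fact (Suc n)) = x / fact n" for x :: complex
      by (simp add: field_simps del: of_nat_Suc)
    ultimately have "of_nat (Suc n) * ((deriv ^^ Suc n) y 0 / fact (Suc n)) =
        ((deriv ^^ n) f 0 + \<alpha> * (deriv ^^ n) (\<lambda>z. 1 / s z) 0) / fact n"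
      by (simp only:)
    then show ?thesis by (simp only: add_divide_distrib gder[symmetric] times_divide_eq_right)
  qed
  have "(\<lambda>n. of_real (sqrt (real n)) * g n) \<longlonglongrightarrow> inverse (Gamma (1/2))"
  proof -
    have "(\<lambda>n. ((- 1 / 2 :: complex) gchoose n) / ((-1) ^ n / exp ((- 1 / 2 + 1) * of_real (ln (real n))))) \<longlonglongrightarrow> inverse (Gamma (- (- 1 / 2)))"
      by (rule gbinomial_asymptotic)
    moreover have "\<forall>\<^sub>F n in sequentially. ((- 1 / 2 :: complex) gchoose n) / ((-1) ^ n / exp ((- 1 / 2 + 1) * of_real (ln (real n))))
        = of_real (sqrt (real n)) * g n"
      using eventually_gt_at_top[of 0]
    proof eventually_elim
      case (elim n)
      have "exp ((- 1 / 2 + 1) * of_real (ln (real n))) = (of_real (exp (ln (real n) / 2)) :: complex)"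
        by (simp add: exp_of_real[symmetric])
      also have "exp (ln (real n) / 2) = sqrt (real n)" using elim by (simp add: powr_def flip: powr_half_sqrt)
      finally have "exp ((- 1 / 2 + 1) * of_real (ln (real n))) = (of_real (sqrt (real n)) :: complex)" .
      moreover have "x / ((-1) ^ n / r) = r * ((-1) ^ n * x)" for x r :: complex
        by (cases "even n") auto
      ultimately show ?case by (simp only: g_def)
    qed
    ultimately have "(\<lambda>n. of_real (sqrt (real n)) * g n) \<longlonglongrightarrow> inverse (Gamma (- (- 1 / 2)))"
      by (rule Lim_transform_eventually)
    then show ?thesis by simp
  qed
  then have lim2: "(\<lambda>n. \<alpha> * (of_real (sqrt (real n)) * g n)) \<longlonglongrightarrow> \<alpha> * inverse (Gamma (1/2))"
    by (intro tendsto_intros)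
  have "(\<lambda>n. of_real (sqrt (real n)) * ((deriv ^^ n) f 0 / fact n) + \<alpha> * (of_real (sqrt (real n)) * g n))
      \<longlonglongrightarrow> 0 + \<alpha> * inverse (Gamma (1/2))"
    by (intro tendsto_add lim1 lim2)
  moreover have "\<alpha> * inverse (Gamma (1/2)) = P 1 / of_real (sqrt \<beta> * sqrt pi)"
    by (simp only: \<alpha>_def Gamma_one_half_complex of_real_mult inverse_eq_divide times_divide_times_eq mult_1_right)
  moreover have "(\<lambda>n. of_real (sqrt (real n)) * (of_nat (Suc n) * ((deriv ^^ Suc n) y 0 / fact (Suc n)))) =
      (\<lambda>n. of_real (sqrt (real n)) * ((deriv ^^ n) f 0 / fact n) + \<alpha> * (of_real (sqrt (real n)) * g n))"
    by (rule ext) (simp only: coeff distrib_left mult.left_commute)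
  ultimately show ?thesis by (simp only: add_0)
qed

end

section \<open>Euler transforms\<close>

text \<open>Both sides are the double sum of a d * v j * x^(d j), and non-negativity permits
  grouping by n = d j. As \<open>v\<close> vanishes at 0 and 1, only proper divisors remain.\<close>

lemma divisor_double_sum:
  fixes a v V :: "nat \<Rightarrow> real" and x :: real
  assumes x: "0 \<le> x" and a: "\<And>d. 0 \<le> a d" "a 0 = 0"
    and v: "\<And>j. 0 \<le> v j" "v 0 = 0" "v 1 = 0"
    and V: "\<And>d. d > 0 \<Longrightarrow> (\<lambda>j. v j * (x ^ d) ^ j) sums V d"
    and S: "(\<lambda>d. a d * V d) sums S"
  shows "(\<lambda>n. (\<Sum>d | d \<in> {1..<n} \<and> d dvd n. a d * v (n div d)) * x ^ n) sums S"
proof -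
  define f where "f = (\<lambda>(d, j). a d * (v j * (x ^ d) ^ j))"
  have f0: "0 \<le> f p" for p using a v x by (cases p) (simp add: f_def)
  have V0: "0 \<le> V d" if "d > 0" for d
    using v x by (intro sums_le[OF _ sums_zero V[OF that]]) simp
  have inner: "((\<lambda>j. f (d, j)) has_sum a d * V d) UNIV" for d
  proof (cases "d = 0")
    case True
    then show ?thesis using a by (simp add: f_def)
  next
    case False
    then have "(\<lambda>j. f (d, j)) sums (a d * V d)" using V[of d] by (auto simp: f_def intro!: sums_mult)
    then show ?thesis by (rule sums_nonneg_imp_has_sum) (simp add: f0)
  qed
  have outer: "((\<lambda>d. a d * V d) has_sum S) UNIV"
  proof (rule sums_nonneg_imp_has_sum[OF S])
    show "0 \<le> a d * V d" for d using a V0 by (cases "d = 0") auto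
  qed
  have "f summable_on (UNIV \<times> UNIV)"
    using inner outer f0 by (intro summable_on_SigmaI[where g = "\<lambda>d. a d * V d"]) (auto simp: has_sum_imp_summable)
  then have "(f has_sum S) (UNIV \<times> UNIV)"
    using inner outer by (intro has_sum_SigmaI[where g = "\<lambda>d. a d * V d"]) auto
  moreover have "(f has_sum S) ({1..} \<times> {2..}) \<longleftrightarrow> (f has_sum S) (UNIV \<times> UNIV)"
  proof (rule has_sum_cong_neutral)
    fix p :: "nat \<times> nat" assume "p \<in> UNIV \<times> UNIV - {1..} \<times> {2..}"
    then have "fst p = 0 \<or> snd p = 0 \<or> snd p = 1" by (cases p) auto
    then show "f p = 0" using a v by (cases p) (auto simp: f_def)
  qed auto
  ultimately have "(f has_sum S) ({1..} \<times> {2..})" by simp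
  moreover have "bij_betw (\<lambda>(n, d). (d, n div d)) (SIGMA n:(UNIV :: nat set). {d \<in> {1..<n}. d dvd n}) ({1::nat..} \<times> {2::nat..})"
  proof (rule bij_betwI[where g = "\<lambda>(d, j). (d * j, d)"])
    show "(\<lambda>(n, d). (d, n div d)) \<in> (SIGMA n:(UNIV :: nat set). {d \<in> {1..<n}. d dvd n}) \<rightarrow> {1::nat..} \<times> {2::nat..}"
      by (auto elim!: dvdE)
    show "(\<lambda>(d, j). (d * j, d)) \<in> {1::nat..} \<times> {2::nat..} \<rightarrow> (SIGMA n:(UNIV :: nat set). {d \<in> {1..<n}. d dvd n})"
      by auto
  qed auto
  ultimately have "((\<lambda>p. f (case p of (n, d) \<Rightarrow> (d, n div d))) has_sum S) (SIGMA n:(UNIV :: nat set). {d \<in> {1..<n}. d dvd n})"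
    by (subst has_sum_reindex_bij_betw)
  then have "((\<lambda>n. \<Sum>d\<in>{d \<in> {1..<n}. d dvd n}. f (d, n div d)) has_sum S) UNIV"
    by (rule has_sum_SigmaD) (auto intro!: has_sum_finiteI)
  then have "(\<lambda>n. \<Sum>d\<in>{d \<in> {1..<n}. d dvd n}. f (d, n div d)) sums S"
    by (rule has_sum_imp_sums)
  moreover have "(\<Sum>d\<in>{d \<in> {1..<n}. d dvd n}. f (d, n div d)) = (\<Sum>d | d \<in> {1..<n} \<and> d dvd n. a d * v (n div d)) * x ^ n" for n
    unfolding sum_distrib_right
  proof (rule sum.cong[OF HOL.refl])
    fix d assume "d \<in> {d. d \<in> {1..<n} \<and> d dvd n}"
    then show "f (d, n div d) = a d * v (n div d) * x ^ n"
      by (auto simp: f_def power_mult[symmetric])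
  qed
  ultimately show ?thesis by simp
qed

definition divisor_sum :: "(nat \<Rightarrow> real) \<Rightarrow> nat \<Rightarrow> real" where
  "divisor_sum c k = (\<Sum>d | d \<in> {1..k} \<and> d dvd k. real d * c d)"

text \<open>The sequence \<open>h\<close> is the Euler transform of \<open>c\<close>: if \<open>c\<close> counts objects by weight, then \<open>h\<close>
  counts multisets of these objects. In terms of generating functions,
  \<open>h = exp (\<Sum>k. c(x^k) / k)\<close>.\<close>

definition is_euler :: "(nat \<Rightarrow> real) \<Rightarrow> (nat \<Rightarrow> real) \<Rightarrow> bool" where
  "is_euler c h \<longleftrightarrow> h 0 = 1 \<and> (\<forall>n. real n * h n = (\<Sum>k\<in>{1..n}. divisor_sum c k * h (n - k)))"

text \<open>The coefficients of \<Sum>k. c(x^k) / k; the divisor d of n belongs to k = n /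
  d.\<close>

definition log_coeff :: "(nat \<Rightarrow> real) \<Rightarrow> nat \<Rightarrow> real" where
  "log_coeff c n = divisor_sum c n / real n"

text \<open>The part k \<ge> 2 of the same series, which omits the divisor d = n.\<close>

definition log_tail :: "(nat \<Rightarrow> real) \<Rightarrow> nat \<Rightarrow> real" where
  "log_tail c n = (\<Sum>d | d \<in> {1..<n} \<and> d dvd n. real d * c d) / real n"

lemma divisor_sum_0 [simp]: "divisor_sum c 0 = 0"
  by (simp add: divisor_sum_def)

lemma log_coeff_0 [simp]: "log_coeff c 0 = 0"
  by (simp add: log_coeff_def)

lemma log_tail_0 [simp]: "log_tail c 0 = 0"
  by (simp add: log_tail_def)

lemma log_coeff_eq: "n > 0 \<Longrightarrow> log_coeff c n = c n + log_tail c n"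
proof -
  assume n: "n > 0"
  have "{d. d \<in> {1..n} \<and> d dvd n} = insert n {d. d \<in> {1..<n} \<and> d dvd n}" using n by auto
  then show ?thesis using n by (simp add: log_coeff_def log_tail_def divisor_sum_def add_divide_distrib)
qed

lemma divisor_sum_nonneg: "(\<And>n. 0 \<le> c n) \<Longrightarrow> 0 \<le> divisor_sum c k"
  by (auto simp: divisor_sum_def intro!: sum_nonneg)

lemma log_coeff_nonneg: "(\<And>n. 0 \<le> c n) \<Longrightarrow> 0 \<le> log_coeff c n"
  by (simp add: log_coeff_def divisor_sum_nonneg)

lemma log_tail_nonneg: "(\<And>n. 0 \<le> c n) \<Longrightarrow> 0 \<le> log_tail c n"
  by (auto simp: log_tail_def intro!: sum_nonneg divide_nonneg_nonneg)

text \<open>The series \<Sum>j\<ge>2. y^j / j. Thus \<Sum>k\<ge>2. c(x^k) / k is the sum of c n *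
  log_rem (x^n), a form suited to numerical bounds.\<close>

definition log_rem :: "real \<Rightarrow> real" where
  "log_rem y = - ln (1 - y) - y"

lemma log_rem_sums:
  assumes "0 \<le> y" "y < 1"
  shows "(\<lambda>j. (if j \<ge> 2 then 1 / real j else 0) * y ^ j) sums log_rem y"
proof -
  have "(\<lambda>n. - ((- (- y)) ^ n) / of_nat n) sums ln (1 + (- y))"
    using assms by (intro ln_series') simp
  then have "(\<lambda>n. - (- ((- (- y)) ^ n) / of_nat n)) sums (- ln (1 + (- y)))" by (rule sums_minus)
  then have "(\<lambda>n. y ^ n / real n) sums (- ln (1 - y))" by simp
  then have "(\<lambda>n. y ^ n / real n - (if n = 1 then y else 0)) sums (- ln (1 - y) - y)"
    by (intro sums_diff sums_single)
  moreover have "y ^ n / real n - (if n = 1 then y else 0) = (if n \<ge> 2 then 1 / real n else 0) * y ^ n" for n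
    by (cases "n = 0"; cases "n = 1") auto
  ultimately show ?thesis by (simp add: log_rem_def)
qed

lemma geometric_rem_sums:
  assumes "0 \<le> y" "y < (1::real)"
  shows "(\<lambda>j. (if j \<ge> 2 then 1 else 0) * y ^ j) sums (y\<^sup>2 / (1 - y))"
proof -
  have "(\<lambda>j. y ^ j) sums (1 / (1 - y))" using assms by (intro geometric_sums) simp
  then have "(\<lambda>j. y ^ j - (if j = 0 then 1 else 0) - (if j = 1 then y else 0)) sums (1 / (1 - y) - 1 - y)"
    by (intro sums_diff sums_single) (use sums_single[of 0 "\<lambda>_. 1 :: real"] in auto)
  moreover have "y ^ j - (if j = 0 then 1 else 0) - (if j = 1 then y else 0) = (if j \<ge> 2 then 1 else 0) * y ^ j" for j
    by (cases "j = 0"; cases "j = 1") auto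
  moreover have "1 / (1 - y) - 1 - y = y\<^sup>2 / (1 - y)" using assms by (simp add: field_simps power2_eq_square)
  ultimately show ?thesis by simp
qed

lemma log_rem_lower:
  assumes "0 \<le> y" "y < 1"
  shows "y\<^sup>2 / 2 \<le> log_rem y"
proof -
  have "(\<Sum>j\<in>{2}. (if j \<ge> 2 then 1 / real j else 0) * y ^ j) \<le> (\<Sum>j. (if j \<ge> 2 then 1 / real j else 0) * y ^ j)"
    using log_rem_sums[OF assms] assms by (intro sum_le_suminf) (auto simp: sums_iff)
  then show ?thesis using log_rem_sums[OF assms] by (simp add: sums_iff)
qed

lemma log_rem_upper:
  assumes "0 \<le> y" "y < 1"
  shows "log_rem y \<le> y\<^sup>2 / (2 * (1 - y))"
proof -
  have s: "(\<lambda>j. 1/2 * ((if j \<ge> 2 then 1 else 0) * y ^ j)) sums (1/2 * (y\<^sup>2 / (1 - y)))"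
    by (intro sums_mult geometric_rem_sums assms)
  have "(if j \<ge> 2 then 1 / real j else 0) * y ^ j \<le> 1/2 * ((if j \<ge> 2 then 1 else 0) * y ^ j)" for j
  proof (cases "j \<ge> 2")
    case True
    then have "1 / real j * y ^ j \<le> 1/2 * y ^ j" using assms by (intro mult_right_mono) (auto simp: field_simps)
    then show ?thesis using True by simp
  qed simp
  then have "log_rem y \<le> 1/2 * (y\<^sup>2 / (1 - y))"
    by (rule sums_le[OF _ log_rem_sums[OF assms] s])
  then show ?thesis by simp
qed

lemma log_rem_nonneg: "0 \<le> y \<Longrightarrow> y < 1 \<Longrightarrow> 0 \<le> log_rem y"
  using log_rem_lower[of y] by (meson order_trans zero_le_divide_iff zero_le_numeral zero_le_power2)

context
  fixes c :: "nat \<Rightarrow> real" and x :: real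
  assumes c: "\<And>n. 0 \<le> c n" "c 0 = 0" and x: "0 \<le> x" "x < 1"
begin

lemma power_less_1: "n > 0 \<Longrightarrow> x ^ n < 1"
  using x by (simp add: power_less_one_iff)

lemma power_le_self: "n > 0 \<Longrightarrow> x ^ n \<le> x"
  using x power_decreasing[of 1 n x] by simp

lemma log_rem_power_bound:
  "c n * log_rem (x ^ n) \<le> 1 / (2 * (1 - x)) * (c n * (x\<^sup>2) ^ n)"
proof (cases "n = 0")
  case False
  have "log_rem (x ^ n) \<le> (x ^ n)\<^sup>2 / (2 * (1 - x ^ n))"
    using x power_less_1 False by (intro log_rem_upper) auto
  also have "\<dots> \<le> (x ^ n)\<^sup>2 / (2 * (1 - x))"
    using x power_le_self[of n] False by (intro divide_left_mono) (auto intro!: mult_pos_pos simp: power_less_1)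
  also have "\<dots> = 1 / (2 * (1 - x)) * (x\<^sup>2) ^ n" by (simp add: power_mult[symmetric] mult.commute)
  finally have "c n * log_rem (x ^ n) \<le> c n * (1 / (2 * (1 - x)) * (x\<^sup>2) ^ n)" by (rule mult_left_mono[OF _ c(1)])
  then show ?thesis by (simp add: mult_ac)
qed (use c in simp)

lemma log_rem_power_nonneg: "0 \<le> c n * log_rem (x ^ n)"
proof (cases "n = 0")
  case False
  then show ?thesis using c x power_less_1 by (intro mult_nonneg_nonneg log_rem_nonneg) auto
qed (use c in simp)

lemma summable_log_rem:
  assumes "summable (\<lambda>n. c n * (x\<^sup>2) ^ n)"
  shows "summable (\<lambda>n. c n * log_rem (x ^ n))"
  by (rule summable_comparison_test'[OF summable_mult[OF assms, of "1 / (2 * (1 - x))"], of 0])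
     (simp only: real_norm_def abs_of_nonneg[OF log_rem_power_nonneg] log_rem_power_bound)

text \<open>Convergence at x^2 is all that is asked of \<open>c\<close>; this is the source of the
  larger radius of convergence.\<close>

lemma log_tail_sums:
  assumes "summable (\<lambda>n. c n * (x\<^sup>2) ^ n)"
  shows "(\<lambda>n. log_tail c n * x ^ n) sums (\<Sum>n. c n * log_rem (x ^ n))"
proof -
  have "(\<lambda>n. (\<Sum>d | d \<in> {1..<n} \<and> d dvd n. c d * (if n div d \<ge> 2 then 1 / real (n div d) else 0)) * x ^ n)
      sums (\<Sum>n. c n * log_rem (x ^ n))"
  proof (rule divisor_double_sum)
    show "(\<lambda>j. (if j \<ge> 2 then 1 / real j else 0) * (x ^ d) ^ j) sums log_rem (x ^ d)" if "d > 0" for d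
      using x that power_less_1 by (intro log_rem_sums) auto
    show "(\<lambda>d. c d * log_rem (x ^ d)) sums (\<Sum>n. c n * log_rem (x ^ n))"
      by (intro summable_sums summable_log_rem assms)
  qed (use c x in auto)
  moreover have "(\<Sum>d | d \<in> {1..<n} \<and> d dvd n. c d * (if n div d \<ge> 2 then 1 / real (n div d) else 0)) = log_tail c n" for n
    unfolding log_tail_def sum_divide_distrib
  proof (rule sum.cong[OF HOL.refl])
    fix d assume "d \<in> {d. d \<in> {1..<n} \<and> d dvd n}"
    then obtain k where "n = d * k" "d > 0" "k \<ge> 2" by (auto elim!: dvdE)
    then show "c d * (if n div d \<ge> 2 then 1 / real (n div d) else 0) = real d * c d / real n" by simp
  qed
  ultimately show ?thesis by simp
qed

lemma log_tail_deriv_sums: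
  assumes "summable (\<lambda>n. real n * c n * ((x ^ n)\<^sup>2 / (1 - x ^ n)))"
  shows "(\<lambda>n. real n * log_tail c n * x ^ n) sums (\<Sum>n. real n * c n * ((x ^ n)\<^sup>2 / (1 - x ^ n)))"
proof -
  have "(\<lambda>n. (\<Sum>d | d \<in> {1..<n} \<and> d dvd n. (real d * c d) * (if n div d \<ge> 2 then 1 else 0)) * x ^ n)
      sums (\<Sum>n. real n * c n * ((x ^ n)\<^sup>2 / (1 - x ^ n)))"
  proof (rule divisor_double_sum)
    show "(\<lambda>j. (if j \<ge> 2 then 1 else 0) * (x ^ d) ^ j) sums ((x ^ d)\<^sup>2 / (1 - x ^ d))" if "d > 0" for d
      using x that power_less_1 by (intro geometric_rem_sums) auto
    show "(\<lambda>d. real d * c d * ((x ^ d)\<^sup>2 / (1 - x ^ d))) sums (\<Sum>n. real n * c n * ((x ^ n)\<^sup>2 / (1 - x ^ n)))"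
      by (intro summable_sums assms)
  qed (use c x in auto)
  moreover have "(\<Sum>d | d \<in> {1..<n} \<and> d dvd n. (real d * c d) * (if n div d \<ge> 2 then 1 else 0)) = real n * log_tail c n" for n
  proof -
    have "(\<Sum>d | d \<in> {1..<n} \<and> d dvd n. (real d * c d) * (if n div d \<ge> 2 then 1 else 0)) = (\<Sum>d | d \<in> {1..<n} \<and> d dvd n. real d * c d)"
    proof (rule sum.cong[OF HOL.refl])
      fix d assume "d \<in> {d. d \<in> {1..<n} \<and> d dvd n}"
      then obtain k where "n = d * k" "d > 0" "k \<ge> 2" by (auto elim!: dvdE)
      then show "(real d * c d) * (if n div d \<ge> 2 then 1 else 0) = real d * c d" by simp
    qed
    then show ?thesis by (cases "n = 0") (simp_all add: log_tail_def)
  qed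
  ultimately show ?thesis by simp
qed

lemma log_coeff_sums:
  assumes "summable (\<lambda>n. c n * x ^ n)"
  shows "(\<lambda>n. log_coeff c n * x ^ n) sums ((\<Sum>n. c n * x ^ n) + (\<Sum>n. c n * log_rem (x ^ n)))"
proof -
  have "summable (\<lambda>n. c n * (x\<^sup>2) ^ n)"
  proof (rule summable_comparison_test'[OF assms])
    fix n
    have "(x\<^sup>2) ^ n \<le> x ^ n" using x by (intro power_mono) (auto simp: power2_eq_square mult_left_le)
    then show "norm (c n * (x\<^sup>2) ^ n) \<le> c n * x ^ n" using c by (simp add: mult_left_mono)
  qed
  then have "(\<lambda>n. c n * x ^ n + log_tail c n * x ^ n) sums ((\<Sum>n. c n * x ^ n) + (\<Sum>n. c n * log_rem (x ^ n)))"
    by (intro sums_add summable_sums assms log_tail_sums)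
  moreover have "c n * x ^ n + log_tail c n * x ^ n = log_coeff c n * x ^ n" for n
    using log_coeff_eq[of n c] c by (cases "n = 0") (auto simp: algebra_simps)
  ultimately show ?thesis by simp
qed

end

section \<open>The exponential formula for Euler transforms\<close>

lemma is_euler_nonneg:
  assumes "is_euler c h" "\<And>n. 0 \<le> c n"
  shows "0 \<le> h n"
proof (induction n rule: less_induct)
  case (less n)
  show ?case
  proof (cases "n = 0")
    case True
    then show ?thesis using assms by (simp add: is_euler_def)
  next
    case False
    have "0 \<le> (\<Sum>k\<in>{1..n}. divisor_sum c k * h (n - k))"
      using less False assms by (intro sum_nonneg mult_nonneg_nonneg divisor_sum_nonneg) auto
    then have "0 \<le> real n * h n" using assms(1) by (simp add: is_euler_def)
    then show ?thesis using False by (simp add: zero_le_mult_iff)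
  qed
qed

text \<open>Combinatorially, one-element multisets are among those counted by \<open>h\<close>; in
  the recurrence they are the term d = k = n.\<close>

lemma is_euler_ge:
  assumes "is_euler c h" "\<And>n. 0 \<le> c n" "n > 0"
  shows "c n \<le> h n"
proof -
  have h0: "h 0 = 1" using assms(1) by (simp add: is_euler_def)
  have "real n * c n \<le> (\<Sum>d\<in>{n}. real d * c d)" by simp
  also have "\<dots> \<le> divisor_sum c n"
    unfolding divisor_sum_def using assms by (intro sum_mono2) auto
  also have "\<dots> = (\<Sum>k\<in>{n}. divisor_sum c k * h (n - k))" using h0 by simp
  also have "\<dots> \<le> (\<Sum>k\<in>{1..n}. divisor_sum c k * h (n - k))"
    using assms is_euler_nonneg[OF assms(1,2)] by (intro sum_mono2) (auto intro!: mult_nonneg_nonneg divisor_sum_nonneg)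
  also have "\<dots> = real n * h n" using assms(1) by (simp add: is_euler_def)
  finally show ?thesis using assms(3) by simp
qed

text \<open>The recurrence as the coefficient form of H' = S' H, where S has the coefficients
  \<open>log_coeff c\<close>.\<close>

lemma is_euler_Suc:
  assumes "is_euler c h"
  shows "real (Suc n) * h (Suc n) = (\<Sum>k\<le>n. real (Suc k) * log_coeff c (Suc k) * h (n - k))"
proof -
  have "real (Suc n) * h (Suc n) = (\<Sum>k\<in>{1..Suc n}. divisor_sum c k * h (Suc n - k))"
    using assms unfolding is_euler_def by blast
  also have "\<dots> = (\<Sum>k\<in>{0..n}. divisor_sum c (Suc k) * h (n - k))"
    using sum.shift_bounds_cl_Suc_ivl[of "\<lambda>k. divisor_sum c k * h (Suc n - k)" 0 n] by simp
  also have "\<dots> = (\<Sum>k\<le>n. real (Suc k) * log_coeff c (Suc k) * h (n - k))"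
    by (intro sum.cong) (auto simp: log_coeff_def)
  finally show ?thesis .
qed

text \<open>For the truncated polynomials p' \<le> q' p holds on the positive axis, because the
  product contains all terms of p' and further non-negative ones. Hence p exp (-q) does not increase
  from its value 1 at 0.\<close>

lemma is_euler_partial_sum_le:
  assumes E: "is_euler c h" and c: "\<And>n. 0 \<le> c n" and r: "0 \<le> r"
  shows "(\<Sum>n\<le>N. h n * r ^ n) \<le> exp (\<Sum>n\<le>N. log_coeff c n * r ^ n)"
proof -
  define p q where "p x = (\<Sum>n\<le>N. h n * x ^ n)" and "q x = (\<Sum>n\<le>N. log_coeff c n * x ^ n)" for x :: real
  define p' q' where "p' x = (\<Sum>n\<le>N. h n * (real n * x ^ (n - 1)))"
    and "q' x = (\<Sum>n\<le>N. log_coeff c n * (real n * x ^ (n - 1)))" for x :: real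
  note nn = is_euler_nonneg[OF E c] log_coeff_nonneg[OF c]
  have dp: "(p has_real_derivative p' x) (at x)" and dq: "(q has_real_derivative q' x) (at x)" for x
    unfolding p_def q_def p'_def q'_def by (auto intro!: derivative_eq_intros simp: mult_ac)
  have le: "p' x \<le> q' x * p x" if x: "0 \<le> x" for x
  proof -
    define g where "g k j = log_coeff c k * (real k * x ^ (k - 1)) * (h j * x ^ j)" for k j
    have g0: "0 \<le> g k j" for k j using nn x by (simp add: g_def)
    have conv: "h n * (real n * x ^ (n - 1)) = (\<Sum>k\<le>n. g k (n - k))" for n
    proof (cases n)
      case 0
      then show ?thesis by (simp add: g_def)
    next
      case (Suc m)
      have "(\<Sum>k\<le>Suc m. g k (Suc m - k)) = g 0 (Suc m) + (\<Sum>k\<le>m. g (Suc k) (m - k))"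
        by (subst sum.atMost_Suc_shift) simp
      also have "\<dots> = (\<Sum>k\<le>m. real (Suc k) * log_coeff c (Suc k) * h (m - k)) * x ^ m"
        unfolding sum_distrib_right
      proof (simp only: g_def of_nat_0 mult_zero_left mult_zero_right add_0, rule sum.cong[OF HOL.refl])
        fix k assume "k \<in> {..m}"
        then have "x ^ m = x ^ k * x ^ (m - k)" by (simp flip: power_add)
        then show "log_coeff c (Suc k) * (real (Suc k) * x ^ (Suc k - 1)) * (h (m - k) * x ^ (m - k)) =
            real (Suc k) * log_coeff c (Suc k) * h (m - k) * x ^ m" by simp
      qed
      also have "\<dots> = h n * (real n * x ^ (n - 1))"
        unfolding is_euler_Suc[OF E, symmetric] Suc by simp
      finally show ?thesis by (simp add: Suc)
    qed
    have "p' x = (\<Sum>n\<le>N. \<Sum>k\<le>n. g k (n - k))" unfolding p'_def conv ..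
    also have "\<dots> = (\<Sum>(k, j)\<in>{(k, j). k + j \<le> N}. g k j)"
      by (rule sum.triangle_reindex_eq[symmetric])
    also have "\<dots> \<le> (\<Sum>(k, j)\<in>{..N} \<times> {..N}. g k j)"
      by (intro sum_mono2) (auto simp: g0)
    also have "\<dots> = q' x * p x"
      unfolding q'_def p_def sum_product sum.cartesian_product[symmetric] g_def ..
    finally show ?thesis .
  qed
  have "p r * exp (- q r) \<le> p 0 * exp (- q 0)"
  proof (rule DERIV_nonpos_imp_nonincreasing[OF r])
    fix x assume "0 \<le> x" "x \<le> r"
    have "((\<lambda>x. p x * exp (- q x)) has_real_derivative (p' x - q' x * p x) * exp (- q x)) (at x)"
      by (auto intro!: derivative_eq_intros dp dq simp: algebra_simps)
    moreover have "(p' x - q' x * p x) * exp (- q x) \<le> 0"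
      using le[OF \<open>0 \<le> x\<close>] by (simp add: mult_nonpos_nonneg)
    ultimately show "\<exists>y. ((\<lambda>x. p x * exp (- q x)) has_real_derivative y) (at x) \<and> y \<le> 0" by blast
  qed
  also have "p 0 * exp (- q 0) = 1"
    using E by (simp add: p_def q_def power_0_left sum.delta if_distrib is_euler_def cong: if_cong)
  finally show ?thesis by (simp add: p_def q_def exp_minus field_simps)
qed

lemma is_euler_summable:
  assumes E: "is_euler c h" and c: "\<And>n. 0 \<le> c n" and r: "0 \<le> r"
    and s: "summable (\<lambda>n. log_coeff c n * r ^ n)"
  shows "summable (\<lambda>n. h n * r ^ n)" "(\<Sum>n. h n * r ^ n) \<le> exp (\<Sum>n. log_coeff c n * r ^ n)"
proof -
  have h: "0 \<le> h n * r ^ n" for n using is_euler_nonneg[OF E c] r by simp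
  have bd: "(\<Sum>n\<le>N. h n * r ^ n) \<le> exp (\<Sum>n. log_coeff c n * r ^ n)" for N
  proof -
    have "(\<Sum>n\<le>N. log_coeff c n * r ^ n) \<le> (\<Sum>n. log_coeff c n * r ^ n)"
      using log_coeff_nonneg[OF c] r by (intro sum_le_suminf s) auto
    then show ?thesis using is_euler_partial_sum_le[OF E c r, of N] by (meson exp_le_cancel_iff order_trans)
  qed
  show *: "summable (\<lambda>n. h n * r ^ n)"
  proof (rule bounded_imp_summable)
    show "(\<Sum>k\<le>n. h k * r ^ k) \<le> exp (\<Sum>n. log_coeff c n * r ^ n)" for n by (rule bd)
  qed (rule h)
  show "(\<Sum>n. h n * r ^ n) \<le> exp (\<Sum>n. log_coeff c n * r ^ n)"
  proof (rule suminf_le_const[OF *])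
    fix n
    have "(\<Sum>k<n. h k * r ^ k) \<le> (\<Sum>k\<le>n. h k * r ^ k)" by (rule sum_mono2) (use h in auto)
    then show "(\<Sum>k<n. h k * r ^ k) \<le> exp (\<Sum>n. log_coeff c n * r ^ n)" using bd order_trans by blast
  qed
qed

text \<open>H' = S' H makes H exp (-S) constant on the disc, and its value at 0 is 1.\<close>

lemma is_euler_exp:
  fixes z :: complex
  assumes E: "is_euler c h" and c: "\<And>n. 0 \<le> c n" and r: "0 \<le> r" "norm z < r"
    and s: "summable (\<lambda>n. log_coeff c n * r ^ n)"
  shows "(\<Sum>n. of_real (h n) * z ^ n) = exp (\<Sum>n. of_real (log_coeff c n) * z ^ n)"
proof -
  define H S where "H z = (\<Sum>n. of_real (h n) * z ^ n)" and "S z = (\<Sum>n. of_real (log_coeff c n) * z ^ n)" for z :: complex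
  let ?R = "of_real r :: complex"
  have "summable (\<lambda>n. of_real (h n * r ^ n) :: complex)" "summable (\<lambda>n. of_real (log_coeff c n * r ^ n) :: complex)"
    unfolding summable_of_real_iff using is_euler_summable(1)[OF E c r(1) s] s by auto
  then have sR: "summable (\<lambda>n. of_real (h n) * ?R ^ n)" "summable (\<lambda>n. of_real (log_coeff c n) * ?R ^ n)"
    by simp_all
  define h' s' where "h' = diffs (\<lambda>n. of_real (h n) :: complex)" and "s' = diffs (\<lambda>n. of_real (log_coeff c n) :: complex)"
  have dH: "(H has_field_derivative (\<Sum>n. h' n * z ^ n)) (at z)" and dS: "(S has_field_derivative (\<Sum>n. s' n * z ^ n)) (at z)"
    if "norm z < r" for z :: complex
    unfolding H_def S_def h'_def s'_def using that r by (intro termdiffs_strong[OF sR(1)] termdiffs_strong[OF sR(2)]; simp)+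
  have prod: "(\<Sum>n. h' n * z ^ n) = (\<Sum>n. s' n * z ^ n) * H z" if z: "norm z < r" for z :: complex
  proof -
    obtain r1 where r1: "norm z < r1" "r1 < r" using dense z by blast
    have "summable (\<lambda>n. s' n * (of_real r1) ^ n)"
      unfolding s'_def using r1 r norm_ge_zero[of z]
      by (intro termdiff_converges[of _ r] powser_inside[OF sR(2)]) (auto simp del: norm_ge_zero)
    then have "summable (\<lambda>n. norm (s' n * z ^ n))" using r1 by (intro powser_insidea[of s']) auto
    moreover have "summable (\<lambda>n. norm (of_real (h n) * z ^ n))"
      using z r by (intro powser_insidea[OF sR(1)]) auto
    ultimately have "(\<Sum>n. s' n * z ^ n) * H z = (\<Sum>n. \<Sum>k\<le>n. (s' k * z ^ k) * (of_real (h (n - k)) * z ^ (n - k)))"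
      unfolding H_def by (rule Cauchy_product)
    also have "\<dots> = (\<Sum>n. h' n * z ^ n)"
    proof (rule suminf_cong)
      fix n
      have "(\<Sum>k\<le>n. (s' k * z ^ k) * (of_real (h (n - k)) * z ^ (n - k))) = (\<Sum>k\<le>n. s' k * of_real (h (n - k))) * z ^ n"
        unfolding sum_distrib_right
      proof (rule sum.cong[OF HOL.refl])
        fix k assume "k \<in> {..n}"
        then have "z ^ n = z ^ k * z ^ (n - k)" by (simp flip: power_add)
        then show "(s' k * z ^ k) * (of_real (h (n - k)) * z ^ (n - k)) = s' k * of_real (h (n - k)) * z ^ n" by simp
      qed
      also have "(\<Sum>k\<le>n. s' k * of_real (h (n - k))) = of_real (\<Sum>k\<le>n. real (Suc k) * log_coeff c (Suc k) * h (n - k))"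
        by (simp add: s'_def diffs_def)
      also have "\<dots> = h' n" unfolding is_euler_Suc[OF E, symmetric] by (simp add: h'_def diffs_def)
      finally show "(\<Sum>k\<le>n. (s' k * z ^ k) * (of_real (h (n - k)) * z ^ (n - k))) = h' n * z ^ n" .
    qed
    finally show ?thesis by simp
  qed
  have "\<exists>k. \<forall>z\<in>(ball 0 r :: complex set). H z * exp (- S z) = k"
  proof (rule has_field_derivative_zero_constant)
    fix z :: complex assume "z \<in> ball 0 r"
    then have z: "norm z < r" by simp
    have "((\<lambda>z. H z * exp (- S z)) has_field_derivative 0) (at z)"
      by (auto intro!: derivative_eq_intros dH[OF z] dS[OF z] simp: prod[OF z] algebra_simps)
    then show "((\<lambda>z. H z * exp (- S z)) has_field_derivative 0) (at z within ball 0 r)"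
      by (rule has_field_derivative_at_within)
  qed simp
  then obtain k where k: "\<And>z. z \<in> ball 0 r \<Longrightarrow> H z * exp (- S z) = k" by blast
  have r0: "0 < r" using r norm_ge_zero[of z] by linarith
  have "H 0 = 1" "S 0 = 0"
    using E powser_zero[of "\<lambda>n. of_real (h n) :: complex"] powser_zero[of "\<lambda>n. of_real (log_coeff c n) :: complex"]
    by (simp_all add: H_def S_def is_euler_def)
  then have "k = 1" using k[of 0] r0 by simp
  then have "H z * exp (- S z) = 1" using k[of z] r by simp
  then show ?thesis unfolding H_def[symmetric] S_def[symmetric] by (simp add: exp_minus field_simps)
qed

lemma is_euler_exp_real:
  fixes x :: real
  assumes E: "is_euler c h" and c: "\<And>n. 0 \<le> c n" and r: "0 \<le> x" "x < r"
    and s: "summable (\<lambda>n. log_coeff c n * r ^ n)"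
  shows "(\<Sum>n. h n * x ^ n) = exp (\<Sum>n. log_coeff c n * x ^ n)"
proof -
  have sx: "summable (\<lambda>n. log_coeff c n * x ^ n)" using r by (intro powser_inside[OF s]) auto
  then have sh: "summable (\<lambda>n. h n * x ^ n)" by (rule is_euler_summable(1)[OF E c r(1)])
  have "of_real (\<Sum>n. h n * x ^ n) = (\<Sum>n. of_real (h n) * of_real x ^ n :: complex)"
    using suminf_of_real[OF sh, where 'a = complex] by simp
  also have "\<dots> = exp (\<Sum>n. of_real (log_coeff c n) * of_real x ^ n)"
    using r by (intro is_euler_exp[OF E c _ _ s]) auto
  also have "(\<Sum>n. of_real (log_coeff c n) * of_real x ^ n :: complex) = of_real (\<Sum>n. log_coeff c n * x ^ n)"
    using suminf_of_real[OF sx, where 'a = complex] by simp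
  finally have "of_real (\<Sum>n. h n * x ^ n) = (of_real (exp (\<Sum>n. log_coeff c n * x ^ n)) :: complex)"
    by (simp add: exp_of_real)
  then show ?thesis by (simp only: of_real_eq_iff)
qed

section \<open>The functional equation\<close>

text \<open>Real coefficients are evaluated in any Banach field, so that the real axis and the
  complex disc share the same lemmas.\<close>

definition ps :: "(nat \<Rightarrow> real) \<Rightarrow> 'a \<Rightarrow> 'a :: {real_normed_field, banach}" where
  "ps c z = (\<Sum>n. of_real (c n) * z ^ n)"

lemma ps_summable_norm:
  fixes z :: "'a :: {real_normed_field, banach}"
  assumes "summable (\<lambda>n. c n * r ^ n)" "\<And>n. 0 \<le> c n" "norm z \<le> r"
  shows "summable (\<lambda>n. norm (of_real (c n) * z ^ n))"
proof (rule summable_comparison_test'[OF assms(1), of 0])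
  fix n
  have "c n * norm z ^ n \<le> c n * r ^ n" using assms by (intro mult_left_mono power_mono) auto
  then show "norm (norm (of_real (c n) * z ^ n)) \<le> c n * r ^ n"
    using assms(2)[of n] by (simp add: norm_mult norm_power)
qed

lemma ps_summable:
  fixes z :: "'a :: {real_normed_field, banach}"
  assumes "summable (\<lambda>n. c n * r ^ n)" "\<And>n. 0 \<le> c n" "norm z \<le> r"
  shows "summable (\<lambda>n. of_real (c n) * z ^ n)"
  by (rule summable_norm_cancel[OF ps_summable_norm[OF assms]])

lemma ps_sums:
  fixes z :: "'a :: {real_normed_field, banach}"
  assumes "summable (\<lambda>n. c n * r ^ n)" "\<And>n. 0 \<le> c n" "norm z \<le> r"
  shows "(\<lambda>n. of_real (c n) * z ^ n) sums ps c z"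
  unfolding ps_def by (rule summable_sums[OF ps_summable[OF assms]])

lemma ps_of_real:
  assumes "summable (\<lambda>n. c n * x ^ n)"
  shows "ps c (of_real x :: 'a :: {real_normed_field, banach}) = of_real (ps c x)"
  using suminf_of_real[OF assms, where 'a = 'a] by (simp add: ps_def)

lemma ps_norm_le:
  fixes z :: "'a :: {real_normed_field, banach}"
  assumes "summable (\<lambda>n. c n * norm z ^ n)" "\<And>n. 0 \<le> c n"
  shows "norm (ps c z) \<le> ps c (norm z)"
proof -
  have eq: "norm (of_real (c n) * z ^ n) = c n * norm z ^ n" for n
    using assms(2)[of n] by (simp add: norm_mult norm_power)
  have "norm (ps c z) \<le> (\<Sum>n. norm (of_real (c n) * z ^ n))"
    unfolding ps_def by (rule summable_norm) (simp only: eq assms(1))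
  then show ?thesis by (simp only: eq) (simp add: ps_def)
qed

lemma ps_mono:
  assumes "summable (\<lambda>n. c n * y ^ n)" "\<And>n. 0 \<le> c n" "0 \<le> x" "x \<le> y"
  shows "ps c x \<le> ps c (y :: real)"
  unfolding ps_def
proof (rule suminf_le)
  show "of_real (c n) * x ^ n \<le> of_real (c n) * y ^ n" for n
    using assms by (simp add: mult_left_mono power_mono)
  show "summable (\<lambda>n. of_real (c n) * x ^ n)" using assms by (intro ps_summable[OF assms(1)]) auto
qed (use assms in auto)

lemma ps_nonneg:
  assumes "summable (\<lambda>n. c n * x ^ n)" "\<And>n. 0 \<le> c n" "0 \<le> (x :: real)"
  shows "0 \<le> ps c x"
  unfolding ps_def by (rule suminf_nonneg) (use assms in auto)

lemma ps_ge_partial: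
  assumes "summable (\<lambda>n. c n * x ^ n)" "\<And>n. 0 \<le> c n" "0 \<le> (x :: real)" "finite I"
  shows "(\<Sum>n\<in>I. c n * x ^ n) \<le> ps c x"
  unfolding ps_def using assms by (simp, intro sum_le_suminf) auto

lemma summable_smaller:
  assumes "summable (\<lambda>n. c n * r ^ n)" "\<And>n. 0 \<le> c n" "0 \<le> x" "x \<le> (r :: real)"
  shows "summable (\<lambda>n. c n * x ^ n)"
  using ps_summable[OF assms(1,2), of x] assms(3,4) by simp

text \<open>The coefficients of H - 1 - T - (T^2 + T(x^2)) / 2: from all multisets remove the empty
  one, the singletons and the unordered pairs.\<close>

definition triple :: "(nat \<Rightarrow> real) \<Rightarrow> (nat \<Rightarrow> real) \<Rightarrow> nat \<Rightarrow> real" where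
  "triple c h n = h n - (if n = 0 then 1 else 0) - c n
     - ((\<Sum>i\<le>n. c i * c (n - i)) + (if even n then c (n div 2) else 0)) / 2"

lemma even_ps_sums:
  fixes z :: "'a :: {real_normed_field, banach}"
  assumes "summable (\<lambda>n. c n * r ^ n)" "\<And>n. 0 \<le> c n" "norm (z\<^sup>2) \<le> r"
  shows "(\<lambda>n. of_real (if even n then c (n div 2) else 0) * z ^ n) sums ps c (z\<^sup>2)"
proof -
  have "(\<lambda>n. of_real (c n) * (z\<^sup>2) ^ n) sums ps c (z\<^sup>2)" by (rule ps_sums[OF assms])
  then have "(\<lambda>n. of_real (if even (2 * n) then c ((2 * n) div 2) else 0) * z ^ (2 * n)) sums ps c (z\<^sup>2)"
    by (simp add: power_mult)
  moreover have "strict_mono (\<lambda>n::nat. 2 * n)" by (simp add: strict_mono_def)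
  moreover have "of_real (if even n then c (n div 2) else 0) * z ^ n = 0" if "n \<notin> range (\<lambda>n. 2 * n)" for n
    using that by (auto elim: evenE)
  ultimately show ?thesis
    using sums_mono_reindex[of "\<lambda>n::nat. 2 * n" "\<lambda>n. of_real (if even n then c (n div 2) else 0) * z ^ n"] by blast
qed

lemma triple_sums:
  fixes z :: "'a :: {real_normed_field, banach}"
  assumes c: "summable (\<lambda>n. c n * r ^ n)" "\<And>n. 0 \<le> c n" and z: "norm z \<le> r" "r \<le> 1"
    and h: "(\<lambda>n. of_real (h n) * z ^ n) sums H"
  shows "(\<lambda>n. of_real (triple c h n) * z ^ n) sums (H - 1 - ps c z - ((ps c z)\<^sup>2 + ps c (z\<^sup>2)) / 2)"
proof -
  have r0: "0 \<le> r" using z norm_ge_zero order_trans by blast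
  have "norm z * norm z \<le> norm z * 1" using z by (intro mult_left_mono) auto
  then have "norm (z\<^sup>2) \<le> norm z * 1" by (simp add: norm_mult power2_eq_square)
  then have z2: "norm (z\<^sup>2) \<le> r" using z by simp
  note cs = ps_sums[OF c z(1)] and cn = ps_summable_norm[OF c z(1)]
  have sq: "(\<lambda>n. of_real (\<Sum>i\<le>n. c i * c (n - i)) * z ^ n) sums (ps c z)\<^sup>2"
  proof -
    have "(\<lambda>n. \<Sum>i\<le>n. (of_real (c i) * z ^ i) * (of_real (c (n - i)) * z ^ (n - i))) sums (ps c z * ps c z)"
      unfolding ps_def by (rule Cauchy_product_sums[OF cn cn])
    moreover have "(\<Sum>i\<le>n. (of_real (c i) * z ^ i) * (of_real (c (n - i)) * z ^ (n - i))) = of_real (\<Sum>i\<le>n. c i * c (n - i)) * z ^ n" for n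
      unfolding of_real_sum sum_distrib_right
    proof (rule sum.cong[OF HOL.refl])
      fix i assume "i \<in> {..n}"
      then have "z ^ n = z ^ i * z ^ (n - i)" by (simp flip: power_add)
      then show "(of_real (c i) * z ^ i) * (of_real (c (n - i)) * z ^ (n - i)) = of_real (c i * c (n - i)) * z ^ n" by simp
    qed
    ultimately show ?thesis by (simp only: power2_eq_square)
  qed
  have ev: "(\<lambda>n. of_real (if even n then c (n div 2) else 0) * z ^ n) sums ps c (z\<^sup>2)"
    by (rule even_ps_sums[OF c z2])
  have "(\<lambda>n. of_real (h n) * z ^ n - (if n = 0 then 1 else 0) - of_real (c n) * z ^ n
     - (of_real (\<Sum>i\<le>n. c i * c (n - i)) * z ^ n + of_real (if even n then c (n div 2) else 0) * z ^ n) / 2)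
     sums (H - 1 - ps c z - ((ps c z)\<^sup>2 + ps c (z\<^sup>2)) / 2)"
    by (intro sums_diff sums_divide sums_add h cs sq ev) (use sums_single[of 0 "\<lambda>_. 1 :: 'a"] in simp)
  moreover have "of_real (h n) * z ^ n - (if n = 0 then 1 else 0) - of_real (c n) * z ^ n
     - (of_real (\<Sum>i\<le>n. c i * c (n - i)) * z ^ n + of_real (if even n then c (n div 2) else 0) * z ^ n) / 2
     = of_real (triple c h n) * z ^ n" for n
  proof (cases "n = 0")
    case False
    then show ?thesis
      by (simp only: triple_def of_real_diff of_real_add of_real_divide of_real_numeral left_diff_distrib
          distrib_right times_divide_eq_left if_False of_real_0 diff_0_right mult_zero_left)
  qed (simp add: triple_def)
  ultimately show ?thesis by simp
qed

lemma is_euler_wmsets: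
  assumes "weighted X w"
  shows "is_euler (\<lambda>n. real (wcount X w n)) (\<lambda>n. real (card (wmsets X w n)))"
  unfolding is_euler_def
proof (intro conjI allI)
  show "real (card (wmsets X w 0)) = 1" by (simp add: card_wmsets_0[OF assms])
  fix n
  have "real n * real (card (wmsets X w n)) = real (n * card (wmsets X w n))" by simp
  also have "\<dots> = (\<Sum>k\<in>{1..n}. divisor_sum (\<lambda>n. real (wcount X w n)) k * real (card (wmsets X w (n - k))))"
    unfolding euler_recurrence[OF assms] divisor_sum_def by simp
  finally show "real n * real (card (wmsets X w n)) = (\<Sum>k\<in>{1..n}. divisor_sum (\<lambda>n. real (wcount X w n)) k * real (card (wmsets X w (n - k))))" .
qed

lemma triple_wmsets:
  assumes "weighted X w"
  shows "triple (\<lambda>n. real (wcount X w n)) (\<lambda>n. real (card (wmsets X w n))) n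
    = real (card {M \<in> wmsets X w n. size M \<ge> 3})"
proof -
  define q where "q = (\<Sum>i\<le>n. wcount X w i * wcount X w (n - i))"
  have "(\<Sum>i\<le>n. real (wcount X w i) * real (wcount X w (n - i))) = real q" by (simp add: q_def)
  moreover have "(if even n then real (wcount X w (n div 2)) else 0) = real (if even n then wcount X w (n div 2) else 0)" by simp
  moreover have "2 * real (card (wmsets X w n)) = 2 * real (card {M \<in> wmsets X w n. size M \<ge> 3}) + (if n = 0 then 2 else 0)
    + 2 * real (wcount X w n) + real q + real (if even n then wcount X w (n div 2) else 0)"
    using arg_cong[OF card_wmsets_size_ge_3[OF assms, of n], of real] unfolding q_def[symmetric] by simp
  moreover have "(if n = 0 then 2 else 0) = 2 * (if n = 0 then 1 else 0 :: real)" by simp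
  moreover have "m - i - w - (q' + e') / 2 = s"
    if "q' = q" "e' = e" "2 * m = 2 * s + i2 + 2 * w + q + e" "i2 = 2 * i" for m i w q q' e e' s i2 :: real
    using that by (simp add: field_simps)
  ultimately show ?thesis unfolding triple_def by blast
qed

lemma wcount_restrict: "wcount {x \<in> X. w x \<le> N} w n = (if n \<le> N then wcount X w n else 0)"
proof (cases "n \<le> N")
  case True
  then have "{x \<in> {x \<in> X. w x \<le> N}. w x = n} = {x \<in> X. w x = n}" by auto
  then show ?thesis using True by (simp add: wcount_def)
next
  case False
  then have "{x \<in> {x \<in> X. w x \<le> N}. w x = n} = {}" by auto
  then show ?thesis using False by (simp only: wcount_def card.empty if_False)
qed

lemma wmsets_restrict: "n \<le> N \<Longrightarrow> wmsets {x \<in> X. w x \<le> N} w n = wmsets X w n"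
  using member_weight_le[where w = w] by (fastforce simp: wmsets_def)

section \<open>The counting sequences of trees and leaves and their truncations\<close>

definition tc :: "nat \<Rightarrow> real" where "tc n = real (tree_count n)"
definition lc :: "nat \<Rightarrow> real" where "lc n = real (leaf_count n)"
definition hc :: "nat \<Rightarrow> real" where "hc n = real (card (wmsets shapes shape_weight n))"
definition mc :: "nat \<Rightarrow> real" where "mc n = real (card (wmsets leaves leaf_weight n))"

lemma tc_nonneg [simp]: "0 \<le> tc n" and lc_nonneg [simp]: "0 \<le> lc n"
  and hc_nonneg [simp]: "0 \<le> hc n" and mc_nonneg [simp]: "0 \<le> mc n"
  by (simp_all add: tc_def lc_def hc_def mc_def)

lemma tc_0 [simp]: "tc 0 = 0" and lc_0 [simp]: "lc 0 = 0" and lc_1 [simp]: "lc (Suc 0) = 1"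
  using leaf_count_1 by (simp_all add: tc_def lc_def tree_count_0 leaf_count_0)

lemma is_euler_tc: "is_euler tc hc"
  using is_euler_wmsets[OF weighted_shapes] by (simp add: tc_def[abs_def] hc_def[abs_def] tree_count_def)

lemma is_euler_lc: "is_euler lc mc"
  using is_euler_wmsets[OF weighted_leaves] by (simp add: lc_def[abs_def] mc_def[abs_def] leaf_count_def)

lemma lc_add_2: "lc (n + 2) = triple tc hc n"
  using triple_wmsets[OF weighted_shapes, of n] leaf_count_add_2[of n]
  by (simp add: tc_def[abs_def] hc_def[abs_def] tree_count_def lc_def)

lemma tc_eq_mc: "n > 0 \<Longrightarrow> tc n = mc (Suc n)"
  by (simp add: tc_def mc_def tree_count_eq_wmsets)

lemma mc_0: "mc 0 = 1"
  using is_euler_lc by (simp add: is_euler_def)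

lemma mc_1: "mc (Suc 0) = 1"
proof -
  have "real 1 * mc 1 = (\<Sum>k\<in>{1..1}. divisor_sum lc k * mc (1 - k))"
    using is_euler_lc unfolding is_euler_def by blast
  moreover have "{d. d = Suc 0 \<and> d dvd Suc 0} = {Suc 0}" by auto
  ultimately show ?thesis by (simp add: divisor_sum_def mc_0)
qed

lemma mc_eq: "mc n = (if n \<le> 1 then 1 else tc (n - 1))"
  using tc_eq_mc[of "n - 1"] mc_0 mc_1 by (cases n; cases "n = 1") auto

lemma lc_le_tc: "n \<ge> 2 \<Longrightarrow> lc n \<le> tc (n - 1)"
  using is_euler_ge[OF is_euler_lc lc_nonneg, of n] by (simp add: mc_eq)

definition trunc :: "nat \<Rightarrow> (nat \<Rightarrow> real) \<Rightarrow> nat \<Rightarrow> real" where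
  "trunc N c n = (if n \<le> N then c n else 0)"

lemma trunc_sums:
  fixes f :: "nat \<Rightarrow> real"
  shows "(\<lambda>n. trunc N c n * f n) sums (\<Sum>n\<le>N. c n * f n)"
proof -
  have "(\<lambda>n. if n \<in> {..N} then c n * f n else 0) sums (\<Sum>n\<in>{..N}. c n * f n)"
    by (rule sums_If_finite_set) simp
  moreover have "(if n \<in> {..N} then c n * f n else 0) = trunc N c n * f n" for n by (simp add: trunc_def)
  ultimately show ?thesis by simp
qed

text \<open>Trees of weight at most \<open>N\<close> are a weighted class of their own. Hence the
  truncated sequence also has non-negative \<open>triple\<close> coefficients, a fact that the
  defining formula with its subtractions does not reveal.\<close>

lemma trunc_shapes:
  obtains h where "is_euler (trunc N tc) h" "\<And>n. 0 \<le> triple (trunc N tc) h n"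
    "\<And>n. n \<le> N \<Longrightarrow> triple (trunc N tc) h n = lc (n + 2)"
proof -
  let ?X = "{x \<in> shapes. shape_weight x \<le> N}"
  define h where "h n = real (card (wmsets ?X shape_weight n))" for n
  have X: "weighted ?X shape_weight" by (rule weighted_subset[OF weighted_shapes]) auto
  have c: "(\<lambda>n. real (wcount ?X shape_weight n)) = trunc N tc"
    by (auto simp: wcount_restrict trunc_def tc_def tree_count_def)
  have tr: "triple (trunc N tc) h n = real (card {M \<in> wmsets ?X shape_weight n. size M \<ge> 3})" for n
    using triple_wmsets[OF X, of n] unfolding c h_def[abs_def] .
  show thesis
  proof (rule that[of h])
    show "is_euler (trunc N tc) h" using is_euler_wmsets[OF X] unfolding c h_def[abs_def] .
    show "0 \<le> triple (trunc N tc) h n" for n by (simp add: tr)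
    show "triple (trunc N tc) h n = lc (n + 2)" if "n \<le> N" for n
      unfolding tr wmsets_restrict[OF that] lc_def leaf_count_add_2 ..
  qed
qed

lemma trunc_leaves:
  obtains m where "is_euler (trunc N lc) m" "\<And>n. n \<le> N \<Longrightarrow> m n = mc n" "\<And>n. 0 \<le> m n"
proof -
  let ?X = "{x \<in> leaves. leaf_weight x \<le> N}"
  define m where "m n = real (card (wmsets ?X leaf_weight n))" for n
  have X: "weighted ?X leaf_weight" by (rule weighted_subset[OF weighted_leaves]) auto
  have c: "(\<lambda>n. real (wcount ?X leaf_weight n)) = trunc N lc"
    by (auto simp: wcount_restrict trunc_def lc_def leaf_count_def)
  show thesis
  proof (rule that[of m])
    show "is_euler (trunc N lc) m" using is_euler_wmsets[OF X] unfolding c m_def[abs_def] .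
    show "m n = mc n" if "n \<le> N" for n unfolding m_def wmsets_restrict[OF that] mc_def ..
    show "0 \<le> m n" for n by (simp add: m_def)
  qed
qed

text \<open>With y = T(x), b = \<Sum>k\<ge>2. T(x^k) / k and e = \<Sum>k\<ge>3. T(x^k) / k this
  counts multisets of at least three trees, since T(x^2) / 2 = b - e. Keeping b and e apart makes
  the expression monotone in each of the three.\<close>

definition theta :: "real \<Rightarrow> real \<Rightarrow> real \<Rightarrow> real" where
  "theta y b e = exp (y + b) - 1 - y - y\<^sup>2 / 2 - b + e"

text \<open>By its quadratic Taylor bound the exponential grows at least as much as the subtracted
  terms y + y^2 / 2 + b.\<close>

lemma theta_mono:
  assumes "0 \<le> u" "u \<le> y" "0 \<le> v" "v \<le> b" "e' \<le> e"
  shows "theta u v e' \<le> theta y b e"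
proof -
  define p q where "p = y - u" and "q = b - v"
  have pq: "0 \<le> p" "0 \<le> q" "y = u + p" "b = v + q" using assms by (auto simp: p_def q_def)
  have "(1 + u) * ((p + q) + (p + q)\<^sup>2 / 2) \<le> exp (u + v) * (exp (p + q) - 1)"
  proof (rule mult_mono)
    show "1 + u \<le> exp (u + v)" using exp_ge_add_one_self[of "u + v"] assms by linarith
    show "(p + q) + (p + q)\<^sup>2 / 2 \<le> exp (p + q) - 1"
      using exp_lower_Taylor_quadratic[of "p + q"] pq by simp
  qed (use pq in auto)
  moreover have "(1 + u) * ((p + q) + (p + q)\<^sup>2 / 2) = (p + q + u * p + p\<^sup>2 / 2)
      + (u * q + p * q + q\<^sup>2 / 2 + u * (p + q)\<^sup>2 / 2)"
    by (simp add: power2_eq_square field_simps)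
  moreover have "0 \<le> u * q + p * q + q\<^sup>2 / 2 + u * (p + q)\<^sup>2 / 2" using pq assms by simp
  moreover have "exp (u + v) * (exp (p + q) - 1) = exp (y + b) - exp (u + v)"
    by (simp add: pq algebra_simps exp_add[symmetric])
  moreover have "y\<^sup>2 / 2 = u\<^sup>2 / 2 + u * p + p\<^sup>2 / 2" by (simp add: pq power2_eq_square field_simps)
  ultimately show ?thesis using assms(5) pq(3,4) unfolding theta_def by linarith
qed

section \<open>Bounds by induction on coefficients\<close>

lemma trunc_nonneg: "(\<And>n. 0 \<le> c n) \<Longrightarrow> 0 \<le> trunc N c n"
  by (simp add: trunc_def)

lemma log_rem_sum_nonneg:
  assumes "0 < x" "x < 1" "\<And>n. 0 \<le> c n" "c 0 = 0"
  shows "0 \<le> (\<Sum>n\<le>N. c n * log_rem (x ^ n))"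
proof (rule sum_nonneg)
  show "0 \<le> c n * log_rem (x ^ n)" for n
    using log_rem_power_nonneg[of c x n] assms by simp
qed

text \<open>Truncation replaces T by a polynomial, so the exponential formula is available at every
  x in (0, 1) before anything is known about convergence of T.\<close>

lemma leaf_partial_sum_le:
  assumes x: "0 < x" "x < 1"
    and y: "(\<Sum>n\<le>N. tc n * x ^ n) \<le> y" "(\<Sum>n\<le>N. tc n * log_rem (x ^ n)) \<le> b"
      "(\<Sum>n\<le>N. tc n * (log_rem (x ^ n) - (x ^ n)\<^sup>2 / 2)) \<le> e"
  shows "(\<Sum>n\<le>N+2. lc n * x ^ n) \<le> x + x\<^sup>2 * theta y b e"
proof -
  obtain h where h: "is_euler (trunc N tc) h" "\<And>n. 0 \<le> triple (trunc N tc) h n"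
    "\<And>n. n \<le> N \<Longrightarrow> triple (trunc N tc) h n = lc (n + 2)" using trunc_shapes by blast
  let ?t = "trunc N tc"
  have t: "0 \<le> ?t n" "?t 0 = 0" for n by (simp_all add: trunc_nonneg trunc_def)
  obtain r where r: "x < r" "r < 1" using dense x by blast
  have st: "summable (\<lambda>n. ?t n * f n)" for f using trunc_sums[of N tc f] by (rule sums_summable)
  define u v w where "u = (\<Sum>n\<le>N. tc n * x ^ n)" and "v = (\<Sum>n\<le>N. tc n * log_rem (x ^ n))"
    and "w = (\<Sum>n\<le>N. tc n * (x\<^sup>2) ^ n)"
  have su: "suminf (\<lambda>n. ?t n * f n) = (\<Sum>n\<le>N. tc n * f n)" for f
    using trunc_sums[of N tc f] by (rule sums_unique[symmetric])
  have lr: "summable (\<lambda>n. log_coeff ?t n * r ^ n)"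
    using r x by (intro sums_summable[OF log_coeff_sums] t st) auto
  have "(\<Sum>n. h n * x ^ n) = exp (\<Sum>n. log_coeff ?t n * x ^ n)"
    using x r by (intro is_euler_exp_real[OF h(1) t(1) _ _ lr]) auto
  moreover have "(\<lambda>n. log_coeff ?t n * x ^ n) sums (u + v)"
    using log_coeff_sums[where c = ?t and x = x] t x st su by (simp add: u_def v_def)
  ultimately have hx: "(\<Sum>n. h n * x ^ n) = exp (u + v)" by (simp add: sums_iff)
  have "summable (\<lambda>n. h n * r ^ n)" using r x by (intro is_euler_summable(1)[OF h(1) t(1) _ lr]) auto
  then have "summable (\<lambda>n. h n * x ^ n)"
    using is_euler_nonneg[OF h(1) t(1)] r x by (intro summable_smaller[of h r x]) auto
  then have "(\<lambda>n. of_real (h n) * x ^ n) sums exp (u + v)" using hx by (simp add: sums_iff)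
  then have "(\<lambda>n. of_real (triple ?t h n) * x ^ n) sums (exp (u + v) - 1 - ps ?t x - ((ps ?t x)\<^sup>2 + ps ?t (x\<^sup>2)) / 2)"
    using x by (intro triple_sums[where r = x]) (auto simp: t st)
  then have s: "(\<lambda>n. triple ?t h n * x ^ n) sums (exp (u + v) - 1 - u - (u\<^sup>2 + w) / 2)"
    by (simp add: ps_def su u_def w_def)
  have w: "v - w / 2 = (\<Sum>n\<le>N. tc n * (log_rem (x ^ n) - (x ^ n)\<^sup>2 / 2))"
    unfolding v_def w_def sum_divide_distrib sum_subtractf[symmetric]
    by (intro sum.cong HOL.refl) (simp add: right_diff_distrib power_mult[symmetric] mult.commute)
  have "(\<Sum>n\<le>N. lc (n + 2) * x ^ n) = (\<Sum>n\<le>N. triple ?t h n * x ^ n)"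
    by (intro sum.cong) (auto simp: h(3))
  also have "\<dots> \<le> (\<Sum>n. triple ?t h n * x ^ n)"
    using h(2) x by (intro sum_le_suminf sums_summable[OF s]) auto
  also have "\<dots> = theta u v (v - w / 2)"
    using s by (simp add: sums_iff theta_def field_simps)
  also have "\<dots> \<le> theta y b e"
    using y x log_rem_sum_nonneg[of x tc N] by (intro theta_mono) (auto simp: u_def v_def w[symmetric] intro!: sum_nonneg)
  finally have *: "(\<Sum>n\<le>N. lc (n + 2) * x ^ n) \<le> theta y b e" .
  have "(\<Sum>n\<le>N+2. lc n * x ^ n) = x + (\<Sum>n\<le>N. lc (n + 2) * x ^ (n + 2))"
    by (simp add: sum.atMost_Suc_shift del: sum.atMost_Suc)
  also have "(\<Sum>n\<le>N. lc (n + 2) * x ^ (n + 2)) = x\<^sup>2 * (\<Sum>n\<le>N. lc (n + 2) * x ^ n)"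
    unfolding sum_distrib_left by (intro sum.cong) (auto simp: power2_eq_square)
  also have "\<dots> \<le> x\<^sup>2 * theta y b e" using * by (intro mult_left_mono) auto
  finally show ?thesis by simp
qed

text \<open>The same truncation on the side of the leaves. Multisets of leaves of weight up to
  \<open>N+2\<close> yield tree counts up to \<open>Suc N\<close>, as the weight drops by
  one.\<close>

lemma tree_partial_sum_le:
  assumes x: "0 < x" "x < 1"
    and le: "(\<Sum>n\<le>N+2. lc n * x ^ n) \<le> l" "(\<Sum>n\<le>N+2. lc n * log_rem (x ^ n)) \<le> a"
  shows "1 + x + x * (\<Sum>n\<le>Suc N. tc n * x ^ n) \<le> exp (l + a)"
proof -
  obtain m where m: "is_euler (trunc (N+2) lc) m" "\<And>n. n \<le> N+2 \<Longrightarrow> m n = mc n" "\<And>n. 0 \<le> m n"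
    using trunc_leaves[of "N+2"] by blast
  let ?t = "trunc (N+2) lc"
  have t: "0 \<le> ?t n" "?t 0 = 0" for n by (simp_all add: trunc_nonneg trunc_def)
  have st: "summable (\<lambda>n. ?t n * f n)" for f using trunc_sums[of "N+2" lc f] by (rule sums_summable)
  have su: "suminf (\<lambda>n. ?t n * f n) = (\<Sum>n\<le>N+2. lc n * f n)" for f
    using trunc_sums[of "N+2" lc f] by (rule sums_unique[symmetric])
  have lx: "(\<lambda>n. log_coeff ?t n * x ^ n) sums ((\<Sum>n\<le>N+2. lc n * x ^ n) + (\<Sum>n\<le>N+2. lc n * log_rem (x ^ n)))"
    using log_coeff_sums[where c = ?t and x = x] t x st unfolding su by simp
  have "(\<Sum>n\<le>N+2. m n * x ^ n) \<le> (\<Sum>n. m n * x ^ n)"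
    using m(3) x by (intro sum_le_suminf is_euler_summable(1)[OF m(1) t(1) _ sums_summable[OF lx]]) auto
  also have "\<dots> \<le> exp (\<Sum>n. log_coeff ?t n * x ^ n)"
    using x by (intro is_euler_summable(2)[OF m(1) t(1) _ sums_summable[OF lx]]) auto
  also have "\<dots> \<le> exp (l + a)" using lx le by (simp add: sums_iff)
  finally have *: "(\<Sum>n\<le>N+2. m n * x ^ n) \<le> exp (l + a)" .
  have "(\<Sum>n\<le>N+2. m n * x ^ n) = (\<Sum>n\<le>Suc (Suc N). mc n * x ^ n)"
    using m(2) by (intro sum.cong) auto
  also have "\<dots> = 1 + (\<Sum>n\<le>Suc N. mc (Suc n) * x ^ Suc n)"
    by (subst sum.atMost_Suc_shift) (simp add: mc_0)
  also have "(\<Sum>n\<le>Suc N. mc (Suc n) * x ^ Suc n) = (\<Sum>n\<le>Suc N. (if n = 0 then x else 0) + x * (tc n * x ^ n))"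
    by (intro sum.cong) (auto simp: mc_eq)
  also have "\<dots> = x + x * (\<Sum>n\<le>Suc N. tc n * x ^ n)"
    by (simp add: sum.distrib sum_distrib_left del: sum.atMost_Suc)
  finally show ?thesis using * by simp
qed

text \<open>\<open>y\<close> is a supersolution of the functional equation. A bound for trees up to
  weight N bounds leaves up to N + 2, hence trees up to N + 1, so each round gains one coefficient.
  The tail bounds \<open>b\<close>, \<open>e\<close> and \<open>a\<close> may rely on the partial
  sum bounds already reached.\<close>

lemma tree_bound_induction:
  assumes x: "0 < x" "x < 1" and y: "0 \<le> y"
    and step: "\<And>N. (\<Sum>n\<le>N. tc n * x ^ n) \<le> y \<Longrightarrow> (\<Sum>n\<le>N. tc n * log_rem (x ^ n)) \<le> b"
      "\<And>N. (\<Sum>n\<le>N. tc n * x ^ n) \<le> y \<Longrightarrow> (\<Sum>n\<le>N. tc n * (log_rem (x ^ n) - (x ^ n)\<^sup>2 / 2)) \<le> e"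
      "\<And>N. (\<Sum>n\<le>N. lc n * x ^ n) \<le> x + x\<^sup>2 * theta y b e \<Longrightarrow> (\<Sum>n\<le>N. lc n * log_rem (x ^ n)) \<le> a"
    and ineq: "exp (x + x\<^sup>2 * theta y b e + a) \<le> 1 + x + x * y"
  shows "(\<Sum>n\<le>N. tc n * x ^ n) \<le> y"
proof (induction N)
  case 0
  then show ?case using y by simp
next
  case (Suc N)
  have "(\<Sum>n\<le>N+2. lc n * x ^ n) \<le> x + x\<^sup>2 * theta y b e"
    using Suc step(1,2) by (intro leaf_partial_sum_le x) auto
  from tree_partial_sum_le[OF x this step(3)[OF this]]
  have "1 + x + x * (\<Sum>n\<le>Suc N. tc n * x ^ n) \<le> exp (x + x\<^sup>2 * theta y b e + a)" .
  also note ineq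
  finally have "x * (\<Sum>n\<le>Suc N. tc n * x ^ n) \<le> x * y" by simp
  then show ?case using x by (simp only: mult_le_cancel_left_pos)
qed

lemma tree_bound_summable:
  assumes "\<And>N. (\<Sum>n\<le>N. tc n * x ^ n) \<le> y" "0 < x"
  shows "summable (\<lambda>n. tc n * x ^ n)" "ps tc x \<le> y"
proof -
  show *: "summable (\<lambda>n. tc n * x ^ n)"
    by (rule bounded_imp_summable[OF _ assms(1)]) (use assms(2) in simp)
  have "(\<Sum>n<N. tc n * x ^ n) \<le> y" for N
  proof -
    have "(\<Sum>n<N. tc n * x ^ n) \<le> (\<Sum>n\<le>N. tc n * x ^ n)" by (rule sum_mono2) (use assms(2) in auto)
    then show ?thesis using assms(1)[of N] by linarith
  qed
  then show "ps tc x \<le> y" unfolding ps_def using * by (simp add: suminf_le_const)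
qed

lemma summable_lc:
  assumes "summable (\<lambda>n. tc n * r ^ n)" "0 \<le> r"
  shows "summable (\<lambda>n. lc n * r ^ n)"
proof -
  have "summable (\<lambda>n. r\<^sup>2 * (tc (Suc n) * r ^ n))"
  proof (cases "r = 0")
    case False
    have "summable (\<lambda>n. tc (Suc n) * r ^ Suc n)" using assms(1) summable_Suc_iff[of "\<lambda>n. tc n * r ^ n"] by simp
    then have "summable (\<lambda>n. r * (tc (Suc n) * r ^ Suc n))" by (rule summable_mult)
    moreover have "r * (tc (Suc n) * r ^ Suc n) = r\<^sup>2 * (tc (Suc n) * r ^ n)" for n by (simp add: power2_eq_square)
    ultimately show ?thesis by (simp only:)
  qed simp
  then have "summable (\<lambda>n. lc (n + 2) * r ^ (n + 2))"
  proof (rule summable_comparison_test'[of _ 0])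
    fix n
    have "lc (n + 2) * r ^ (n + 2) \<le> tc (Suc n) * r ^ (n + 2)"
      using lc_le_tc[of "n + 2"] assms(2) by (intro mult_right_mono) auto
    then show "norm (lc (n + 2) * r ^ (n + 2)) \<le> r\<^sup>2 * (tc (Suc n) * r ^ n)"
      using assms(2) by (simp add: power2_eq_square mult_ac)
  qed
  then show ?thesis using summable_iff_shift[of "\<lambda>n. lc n * r ^ n" 2] by simp
qed

text \<open>The functional equation of the tree series \<open>T\<close>; the terms \<open>B\<close>, \<open>A\<close> and \<open>T(z^2)\<close> only
  depend on \<open>T(z^k)\<close> for \<open>k \<ge> 2\<close>, hence have a larger radius of convergence.\<close>

lemma tree_equation:
  fixes z :: complex
  assumes r: "0 < r" "r < 1" "norm z < r" and s: "summable (\<lambda>n. tc n * r ^ n)"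
  shows "1 + z + z * ps tc z = exp (z + z\<^sup>2 * (exp (ps tc z + ps (log_tail tc) z) - 1 - ps tc z
      - ((ps tc z)\<^sup>2 + ps tc (z\<^sup>2)) / 2) + ps (log_tail lc) z)"
proof -
  have sl: "summable (\<lambda>n. lc n * r ^ n)" using s r by (intro summable_lc) auto
  have lt: "summable (\<lambda>n. log_coeff tc n * r ^ n)" "summable (\<lambda>n. log_coeff lc n * r ^ n)"
    using r by (intro sums_summable[OF log_coeff_sums] s sl; simp)+
  have split: "ps (log_coeff c) z = ps c z + ps (log_tail c) z"
    if c: "\<And>n. 0 \<le> c n" "c 0 = 0" "summable (\<lambda>n. c n * r ^ n)" "summable (\<lambda>n. log_coeff c n * r ^ n)" for c
  proof -
    have eq: "log_coeff c n = c n + log_tail c n" for n using log_coeff_eq[of n c] c(2) by (cases "n = 0") auto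
    have "summable (\<lambda>n. log_coeff c n * r ^ n - c n * r ^ n)" by (intro summable_diff c)
    then have lt: "summable (\<lambda>n. log_tail c n * r ^ n)" by (simp add: eq algebra_simps)
    have "summable (\<lambda>n. of_real (c n) * z ^ n)" "summable (\<lambda>n. of_real (log_tail c n) * z ^ n)"
      using r by (intro ps_summable[OF c(3) c(1)] ps_summable[OF lt log_tail_nonneg] c(1); simp)+
    from suminf_add[OF this] show ?thesis by (simp add: ps_def eq distrib_right)
  qed
  have nz: "norm z \<le> r" using r by simp
  have hr: "summable (\<lambda>n. hc n * r ^ n)" "summable (\<lambda>n. mc n * r ^ n)"
    using r by (intro is_euler_summable(1)[OF is_euler_tc _ _ lt(1)] is_euler_summable(1)[OF is_euler_lc _ _ lt(2)]; simp)+
  have "ps hc z = exp (ps (log_coeff tc) z)" "ps mc z = exp (ps (log_coeff lc) z)"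
    unfolding ps_def using r by (intro is_euler_exp[OF is_euler_tc _ _ _ lt(1)] is_euler_exp[OF is_euler_lc _ _ _ lt(2)]; simp)+
  then have H: "ps hc z = exp (ps tc z + ps (log_tail tc) z)" and M: "ps mc z = exp (ps lc z + ps (log_tail lc) z)"
    using split[of tc] split[of lc] s sl lt by simp_all
  have "(\<lambda>n. of_real (triple tc hc n) * z ^ n) sums (ps hc z - 1 - ps tc z - ((ps tc z)\<^sup>2 + ps tc (z\<^sup>2)) / 2)"
    using r by (intro triple_sums[OF s] ps_sums[OF hr(1)]) auto
  then have "(\<lambda>n. z\<^sup>2 * (of_real (triple tc hc n) * z ^ n)) sums (z\<^sup>2 * (ps hc z - 1 - ps tc z - ((ps tc z)\<^sup>2 + ps tc (z\<^sup>2)) / 2))"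
    by (rule sums_mult)
  moreover have "z\<^sup>2 * (of_real (triple tc hc n) * z ^ n) = of_real (lc (n + 2)) * z ^ (n + 2)" for n
    by (simp add: lc_add_2[symmetric] power2_eq_square)
  ultimately have "(\<lambda>n. of_real (lc (n + 2)) * z ^ (n + 2)) sums (z\<^sup>2 * (ps hc z - 1 - ps tc z - ((ps tc z)\<^sup>2 + ps tc (z\<^sup>2)) / 2))"
    by (simp only:)
  then have "(\<lambda>n. of_real (lc n) * z ^ n) sums (z\<^sup>2 * (ps hc z - 1 - ps tc z - ((ps tc z)\<^sup>2 + ps tc (z\<^sup>2)) / 2) + (\<Sum>n<2. of_real (lc n) * z ^ n))"
    by (rule iffD1[OF sums_iff_shift[of "\<lambda>n. of_real (lc n) * z ^ n" 2]])
  then have L: "ps lc z = z + z\<^sup>2 * (ps hc z - 1 - ps tc z - ((ps tc z)\<^sup>2 + ps tc (z\<^sup>2)) / 2)"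
    by (simp add: ps_def sums_iff eval_nat_numeral)
  have "(\<lambda>n. z * (of_real (tc n) * z ^ n) + (if n = 0 then z else 0)) sums (z * ps tc z + z)"
    using sums_single[of 0 "\<lambda>_. z"] by (intro sums_add sums_mult ps_sums[OF s _ nz]) auto
  moreover have "z * (of_real (tc n) * z ^ n) + (if n = 0 then z else 0) = of_real (mc (Suc n)) * z ^ Suc n" for n
    by (simp add: mc_eq)
  ultimately have "(\<lambda>n. of_real (mc (Suc n)) * z ^ Suc n) sums (z * ps tc z + z)" by simp
  then have "(\<lambda>n. of_real (mc n) * z ^ n) sums (z * ps tc z + z + 1)"
    by (subst (asm) sums_Suc_iff) (simp add: mc_0)
  then have "ps mc z = 1 + z + z * ps tc z" by (simp add: ps_def sums_iff)
  then show ?thesis using M unfolding L H by simp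
qed

section \<open>Enclosure of the radius of convergence\<close>

lemma divisor_sum_list:
  "divisor_sum c k = sum_list (map (\<lambda>d. if d dvd k then real d * c d else 0) [1..<Suc k])"
proof -
  have "divisor_sum c k = (\<Sum>d\<in>{1..k}. if d dvd k then real d * c d else 0)"
    unfolding divisor_sum_def by (simp add: sum.If_cases Int_def)
  also have "{1..k} = set [1..<Suc k]" by auto
  finally show ?thesis by (simp only: sum_list_distinct_conv_sum_set distinct_upt)
qed

lemma is_euler_list:
  assumes "is_euler c h"
  shows "real n * h n = sum_list (map (\<lambda>k. divisor_sum c k * h (n - k)) [1..<Suc n])"
proof -
  have "real n * h n = (\<Sum>k\<in>{1..n}. divisor_sum c k * h (n - k))"
    using assms unfolding is_euler_def by blast
  also have "{1..n} = set [1..<Suc n]" by auto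
  finally show ?thesis by (simp only: sum_list_distinct_conv_sum_set distinct_upt)
qed

lemma sum_atMost_list: "(\<Sum>i\<le>n. f i) = sum_list (map f [0..<Suc n])"
proof -
  have "{..n} = set [0..<Suc n]" by auto
  then show ?thesis by (simp only: sum_list_distinct_conv_sum_set distinct_upt)
qed

lemma lc_eq_triple: "n \<ge> 2 \<Longrightarrow> lc n = triple tc hc (n - 2)"
  using lc_add_2[of "n - 2"] by (simp only: le_add_diff_inverse2)

lemma upt_from_0: "1 < (numeral n :: nat) \<Longrightarrow> [0..<numeral n] = 0 # Suc 0 # [2..<numeral n]"
  by (simp add: upt_conv_Cons numeral_2_eq_2)

lemma upt_from_1: "1 < (numeral n :: nat) \<Longrightarrow> [Suc 0..<numeral n] = Suc 0 # [2..<numeral n]"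
  by (simp add: upt_conv_Cons numeral_2_eq_2)

lemmas upt_numeral = upt_rec_numeral upt_from_0 upt_from_1

lemmas lc_rec = lc_eq_triple triple_def sum_atMost_list upt_numeral
lemmas divisor_sum_rec = divisor_sum_list upt_numeral

text \<open>Each round rests on the previous ones: \<open>lc n\<close> needs \<open>tc\<close> and
  \<open>hc\<close> up to n - 2, \<open>mc n\<close> needs \<open>lc\<close> up to n,
  \<open>tc (n - 1)\<close> equals \<open>mc n\<close>, and \<open>hc (n - 1)\<close> follows from
  \<open>tc\<close>.\<close>

lemma values_12:
  "tc (Suc 0) = 1" "tc 2 = 1" "tc 3 = 1" "tc 4 = 2" "tc 5 = 4" "tc 6 = 8" "tc 7 = 16" "tc 8 = 32" "tc 9 = 67" "tc 10 = 142" "tc 11 = 307" "tc 12 = 669"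
  "lc 2 = 0" "lc 3 = 0" "lc 4 = 0" "lc 5 = 1" "lc 6 = 2" "lc 7 = 4" "lc 8 = 8" "lc 9 = 16" "lc 10 = 34" "lc 11 = 73" "lc 12 = 158"
proof -
  have [simp]: "hc 0 = 1" using is_euler_tc by (simp add: is_euler_def)
  have [simp]: "divisor_sum lc (Suc 0) = 1" by (simp add: divisor_sum_list)
  have lc2 [simp]: "lc 2 = 0" by (simp add: lc_rec mc_0 mc_1)
  have [simp]: "divisor_sum lc 2 = 1" by (simp add: divisor_sum_rec)
  have [simp]: "mc 2 = 1" using is_euler_list[OF is_euler_lc, of 2] by (simp add: upt_numeral mc_0 mc_1)
  have tc1 [simp]: "tc (Suc 0) = 1" using tc_eq_mc[of "Suc 0"] by (simp flip: numeral_2_eq_2)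
  have [simp]: "divisor_sum tc (Suc 0) = 1" by (simp add: divisor_sum_rec)
  have [simp]: "hc (Suc 0) = 1" using is_euler_list[OF is_euler_tc, of "Suc 0"] by (simp add: upt_numeral)
  have lc3 [simp]: "lc 3 = 0" by (simp add: lc_rec mc_0 mc_1)
  have [simp]: "divisor_sum lc 3 = 1" by (simp add: divisor_sum_rec)
  have [simp]: "mc 3 = 1" using is_euler_list[OF is_euler_lc, of 3] by (simp add: upt_numeral mc_0 mc_1)
  have tc2 [simp]: "tc 2 = 1" using tc_eq_mc[of "2"] by (simp)
  have [simp]: "divisor_sum tc 2 = 3" by (simp add: divisor_sum_rec)
  have [simp]: "hc 2 = 2" using is_euler_list[OF is_euler_tc, of "2"] by (simp add: upt_numeral)
  have lc4 [simp]: "lc 4 = 0" by (simp add: lc_rec mc_0 mc_1)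
  have [simp]: "divisor_sum lc 4 = 1" by (simp add: divisor_sum_rec)
  have [simp]: "mc 4 = 1" using is_euler_list[OF is_euler_lc, of 4] by (simp add: upt_numeral mc_0 mc_1)
  have tc3 [simp]: "tc 3 = 1" using tc_eq_mc[of "3"] by (simp)
  have [simp]: "divisor_sum tc 3 = 4" by (simp add: divisor_sum_rec)
  have [simp]: "hc 3 = 3" using is_euler_list[OF is_euler_tc, of "3"] by (simp add: upt_numeral)
  have lc5 [simp]: "lc 5 = 1" by (simp add: lc_rec mc_0 mc_1)
  have [simp]: "divisor_sum lc 5 = 6" by (simp add: divisor_sum_rec)
  have [simp]: "mc 5 = 2" using is_euler_list[OF is_euler_lc, of 5] by (simp add: upt_numeral mc_0 mc_1)
  have tc4 [simp]: "tc 4 = 2" using tc_eq_mc[of "4"] by (simp)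
  have [simp]: "divisor_sum tc 4 = 11" by (simp add: divisor_sum_rec)
  have [simp]: "hc 4 = 6" using is_euler_list[OF is_euler_tc, of "4"] by (simp add: upt_numeral)
  have lc6 [simp]: "lc 6 = 2" by (simp add: lc_rec mc_0 mc_1)
  have [simp]: "divisor_sum lc 6 = 13" by (simp add: divisor_sum_rec)
  have [simp]: "mc 6 = 4" using is_euler_list[OF is_euler_lc, of 6] by (simp add: upt_numeral mc_0 mc_1)
  have tc5 [simp]: "tc 5 = 4" using tc_eq_mc[of "5"] by (simp)
  have [simp]: "divisor_sum tc 5 = 21" by (simp add: divisor_sum_rec)
  have [simp]: "hc 5 = 11" using is_euler_list[OF is_euler_tc, of "5"] by (simp add: upt_numeral)
  have lc7 [simp]: "lc 7 = 4" by (simp add: lc_rec mc_0 mc_1)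
  have [simp]: "divisor_sum lc 7 = 29" by (simp add: divisor_sum_rec)
  have [simp]: "mc 7 = 8" using is_euler_list[OF is_euler_lc, of 7] by (simp add: upt_numeral mc_0 mc_1)
  have tc6 [simp]: "tc 6 = 8" using tc_eq_mc[of "6"] by (simp)
  have [simp]: "divisor_sum tc 6 = 54" by (simp add: divisor_sum_rec)
  have [simp]: "hc 6 = 23" using is_euler_list[OF is_euler_tc, of "6"] by (simp add: upt_numeral)
  have lc8 [simp]: "lc 8 = 8" by (simp add: lc_rec mc_0 mc_1)
  have [simp]: "divisor_sum lc 8 = 65" by (simp add: divisor_sum_rec)
  have [simp]: "mc 8 = 16" using is_euler_list[OF is_euler_lc, of 8] by (simp add: upt_numeral mc_0 mc_1)
  have tc7 [simp]: "tc 7 = 16" using tc_eq_mc[of "7"] by (simp)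
  have [simp]: "divisor_sum tc 7 = 113" by (simp add: divisor_sum_rec)
  have [simp]: "hc 7 = 46" using is_euler_list[OF is_euler_tc, of "7"] by (simp add: upt_numeral)
  have lc9 [simp]: "lc 9 = 16" by (simp add: lc_rec mc_0 mc_1)
  have [simp]: "divisor_sum lc 9 = 145" by (simp add: divisor_sum_rec)
  have [simp]: "mc 9 = 32" using is_euler_list[OF is_euler_lc, of 9] by (simp add: upt_numeral mc_0 mc_1)
  have tc8 [simp]: "tc 8 = 32" using tc_eq_mc[of "8"] by (simp)
  have [simp]: "divisor_sum tc 8 = 267" by (simp add: divisor_sum_rec)
  have [simp]: "hc 8 = 97" using is_euler_list[OF is_euler_tc, of "8"] by (simp add: upt_numeral)
  have lc10 [simp]: "lc 10 = 34" by (simp add: lc_rec mc_0 mc_1)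
  have [simp]: "divisor_sum lc 10 = 346" by (simp add: divisor_sum_rec)
  have [simp]: "mc 10 = 67" using is_euler_list[OF is_euler_lc, of 10] by (simp add: upt_numeral mc_0 mc_1)
  have tc9 [simp]: "tc 9 = 67" using tc_eq_mc[of "9"] by (simp)
  have [simp]: "divisor_sum tc 9 = 607" by (simp add: divisor_sum_rec)
  have [simp]: "hc 9 = 204" using is_euler_list[OF is_euler_tc, of "9"] by (simp add: upt_numeral)
  have lc11 [simp]: "lc 11 = 73" by (simp add: lc_rec mc_0 mc_1)
  have [simp]: "divisor_sum lc 11 = 804" by (simp add: divisor_sum_rec)
  have [simp]: "mc 11 = 142" using is_euler_list[OF is_euler_lc, of 11] by (simp add: upt_numeral mc_0 mc_1)
  have tc10 [simp]: "tc 10 = 142" using tc_eq_mc[of "10"] by (simp)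
  have [simp]: "divisor_sum tc 10 = 1443" by (simp add: divisor_sum_rec)
  have [simp]: "hc 10 = 441" using is_euler_list[OF is_euler_tc, of "10"] by (simp add: upt_numeral)
  have lc12 [simp]: "lc 12 = 158" by (simp add: lc_rec mc_0 mc_1)
  have [simp]: "divisor_sum lc 12 = 1909" by (simp add: divisor_sum_rec)
  have [simp]: "mc 12 = 307" using is_euler_list[OF is_euler_lc, of 12] by (simp add: upt_numeral mc_0 mc_1)
  have tc11 [simp]: "tc 11 = 307" using tc_eq_mc[of "11"] by (simp)
  have [simp]: "divisor_sum tc 11 = 3378" by (simp add: divisor_sum_rec)
  have [simp]: "hc 11 = 958" using is_euler_list[OF is_euler_tc, of "11"] by (simp add: upt_numeral)
  have lc13 [simp]: "lc 13 = 346" by (simp add: lc_rec mc_0 mc_1)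
  have [simp]: "divisor_sum lc 13 = 4499" by (simp add: divisor_sum_rec)
  have [simp]: "mc 13 = 669" using is_euler_list[OF is_euler_lc, of 13] by (simp add: upt_numeral mc_0 mc_1)
  have tc12 [simp]: "tc 12 = 669" using tc_eq_mc[of "12"] by (simp)
  show "tc (Suc 0) = 1" "tc 2 = 1" "tc 3 = 1" "tc 4 = 2" "tc 5 = 4" "tc 6 = 8" "tc 7 = 16" "tc 8 = 32" "tc 9 = 67" "tc 10 = 142" "tc 11 = 307" "tc 12 = 669"
    "lc 2 = 0" "lc 3 = 0" "lc 4 = 0" "lc 5 = 1" "lc 6 = 2" "lc 7 = 4" "lc 8 = 8" "lc 9 = 16" "lc 10 = 34" "lc 11 = 73" "lc 12 = 158"
    by simp_all
qed

lemma head_tc: "(\<Sum>n\<le>12. tc n * f n) = f (Suc 0) + f 2 + f 3 + 2 * f 4 + 4 * f 5 + 8 * f 6 + 16 * f 7 + 32 * f 8 + 67 * f 9 + 142 * f 10 + 307 * f 11 + 669 * f 12"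
  by (simp add: sum_atMost_list upt_numeral values_12)

lemma head_lc: "(\<Sum>n\<le>12. lc n * f n) = f (Suc 0) + f 5 + 2 * f 6 + 4 * f 7 + 8 * f 8 + 16 * f 9 + 34 * f 10 + 73 * f 11 + 158 * f 12"
  by (simp add: sum_atMost_list upt_numeral values_12)

section \<open>Rational bounds for the logarithmic remainder\<close>

lemma log_rem_ge_poly:
  assumes "0 \<le> p" "p \<le> u" "u < 1"
  shows "sum_list (map (\<lambda>j. p ^ j / real j) [2..<Suc k]) \<le> log_rem u"
proof -
  have u: "0 \<le> u" using assms by simp
  have "(\<Sum>j\<in>{2..<Suc k}. p ^ j / real j) \<le> (\<Sum>j\<in>{2..<Suc k}. (if j \<ge> 2 then 1 / real j else 0) * u ^ j)"
    using assms by (intro sum_mono) (auto intro!: divide_right_mono power_mono)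
  also have "\<dots> \<le> (\<Sum>j. (if j \<ge> 2 then 1 / real j else 0) * u ^ j)"
    using u sums_summable[OF log_rem_sums[OF u assms(3)]] by (intro sum_le_suminf) auto
  also have "\<dots> = log_rem u" using log_rem_sums[OF u assms(3)] by (simp add: sums_iff)
  finally show ?thesis by (simp only: interv_sum_list_conv_sum_set_nat set_upt)
qed

text \<open>After the power \<open>k\<close> the coefficients 1/j are replaced by 1 / (k + 1), which
  leaves a geometric series.\<close>

lemma log_rem_le_poly:
  assumes "0 \<le> u" "u \<le> q" "q < 1" "k \<ge> 1"
  shows "log_rem u \<le> sum_list (map (\<lambda>j. q ^ j / real j) [2..<Suc k]) + q ^ Suc k / (real (Suc k) * (1 - q))"
proof -
  have q: "0 \<le> q" using assms by simp
  let ?f = "\<lambda>j. (if j \<ge> 2 then 1 / real j else 0) * q ^ j"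
  have s: "?f sums log_rem q" using q assms(3) by (rule log_rem_sums)
  have "log_rem u \<le> log_rem q"
  proof (rule sums_le[OF _ log_rem_sums s])
    show "(if j \<ge> 2 then 1 / real j else 0) * u ^ j \<le> ?f j" for j
      using assms by (auto intro!: divide_right_mono power_mono)
  qed (use assms in auto)
  also have "\<dots> = (\<Sum>j. ?f (j + Suc k)) + (\<Sum>j<Suc k. ?f j)"
    using suminf_split_initial_segment[OF sums_summable[OF s], of "Suc k"] s by (simp only: sums_iff)
  also have "(\<Sum>j. ?f (j + Suc k)) \<le> (\<Sum>j. q ^ Suc k / real (Suc k) * q ^ j)"
  proof (rule suminf_le)
    show "?f (j + Suc k) \<le> q ^ Suc k / real (Suc k) * q ^ j" for j
    proof -
      have "1 / real (j + Suc k) \<le> 1 / real (Suc k)" by (intro divide_left_mono) auto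
      then have "1 / real (j + Suc k) * q ^ (j + Suc k) \<le> 1 / real (Suc k) * q ^ (j + Suc k)"
        using q by (intro mult_right_mono) auto
      also have "\<dots> = q ^ Suc k / real (Suc k) * q ^ j" by (simp add: power_add mult_ac)
      finally show ?thesis using assms(4) by simp
    qed
    show "summable (\<lambda>j. ?f (j + Suc k))" using s by (intro summable_ignore_initial_segment) (rule sums_summable)
    show "summable (\<lambda>j. q ^ Suc k / real (Suc k) * q ^ j)"
      using q assms(3) by (intro summable_mult summable_geometric) auto
  qed
  also have "\<dots> = q ^ Suc k / (real (Suc k) * (1 - q))"
    using q assms(3) by (subst suminf_mult) (auto simp: suminf_geometric intro!: summable_geometric)
  also have "(\<Sum>j<Suc k. ?f j) = (\<Sum>j\<in>{2..<Suc k}. q ^ j / real j)"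
    by (intro sum.mono_neutral_cong_right) auto
  finally show ?thesis by (simp only: interv_sum_list_conv_sum_set_nat set_upt add.commute)
qed

text \<open>For q up to 1/2 the denominator 1 - q is at least 1/2. The bound becomes linear in the
  powers of q, so tabulated powers can be inserted by linear arithmetic.\<close>

lemma log_rem_le_poly':
  assumes "0 \<le> q" "q \<le> 1 / 2" "k \<ge> 1"
  shows "log_rem q \<le> sum_list (map (\<lambda>j. q ^ j / real j) [2..<Suc k]) + 2 * q ^ Suc k / real (Suc k)"
proof -
  have "q ^ Suc k / (real (Suc k) * (1 - q)) \<le> q ^ Suc k / (real (Suc k) * (1 / 2))"
    using assms by (intro divide_left_mono mult_left_mono) auto
  also have "\<dots> = 2 * q ^ Suc k / real (Suc k)" by simp
  finally have "q ^ Suc k / (real (Suc k) * (1 - q)) \<le> 2 * q ^ Suc k / real (Suc k)" .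
  moreover have "log_rem q \<le> sum_list (map (\<lambda>j. q ^ j / real j) [2..<Suc k]) + q ^ Suc k / (real (Suc k) * (1 - q))"
    using assms by (intro log_rem_le_poly) auto
  ultimately show ?thesis by linarith
qed

text \<open>\<open>x1\<close> and \<open>x2\<close> bracket the radius of convergence. Their
  reciprocals, about 2.49756 and 2.49741, lie within 0.0001 of 2.4975.\<close>

definition x1 :: real where "x1 = 40039 / 100000"
definition x2 :: real where "x2 = 400415 / 1000000"

lemma log_rem_quintic_bounds:
  assumes "p \<le> u" "u \<le> q"
  shows "0 \<le> p \<Longrightarrow> q < 1 \<Longrightarrow> lo \<le> p ^ 2 / 2 + p ^ 3 / 3 + p ^ 4 / 4 + p ^ 5 / 5 \<Longrightarrow> lo \<le> log_rem u"
    and "0 \<le> p \<Longrightarrow> q < 1 \<Longrightarrow> q ^ 2 / 2 + q ^ 3 / 3 + q ^ 4 / 4 + q ^ 5 / 5 + q ^ 6 / (6 * (1 - q)) \<le> hi \<Longrightarrow> log_rem u \<le> hi"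
  using log_rem_ge_poly[of p u 5] log_rem_le_poly[of u q 5] assms by (simp_all add: upt_rec_numeral add.assoc)

lemma log_rem_cubic_bounds:
  assumes "p \<le> u" "u \<le> q"
  shows "0 \<le> p \<Longrightarrow> q < 1 \<Longrightarrow> lo \<le> p ^ 2 / 2 + p ^ 3 / 3 \<Longrightarrow> lo \<le> log_rem u"
    and "0 \<le> p \<Longrightarrow> q < 1 \<Longrightarrow> q ^ 2 / 2 + q ^ 3 / 3 + q ^ 4 / (4 * (1 - q)) \<le> hi \<Longrightarrow> log_rem u \<le> hi"
  using log_rem_ge_poly[of p u 3] log_rem_le_poly[of u q 3] assms by (simp_all add: upt_rec_numeral add.assoc)

text \<open>Rounded outwards to ten decimals. Above 15 only even exponents occur, as needed for
  squares.\<close>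

lemma x1_powers:
  "40039 / 100000 \<le> x1" "x1 \<le> 40039 / 100000"
  "1603121521 / 10000000000 \<le> x1 ^ 2" "x1 ^ 2 \<le> 1603121521 / 10000000000"
  "25674953 / 400000000 \<le> x1 ^ 3" "x1 ^ 3 \<le> 320936913 / 5000000000"
  "256999861 / 10000000000 \<le> x1 ^ 4" "x1 ^ 4 \<le> 128499931 / 5000000000"
  "51450087 / 5000000000 \<le> x1 ^ 5" "x1 ^ 5 \<le> 4116007 / 400000000"
  "206001 / 50000000 \<le> x1 ^ 6" "x1 ^ 6 \<le> 41200201 / 10000000000"
  "4124037 / 2500000000 \<le> x1 ^ 7" "x1 ^ 7 \<le> 16496149 / 10000000000"
  "1651223 / 2500000000 \<le> x1 ^ 8" "x1 ^ 8 \<le> 6604893 / 10000000000"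
  "2644533 / 10000000000 \<le> x1 ^ 9" "x1 ^ 9 \<le> 1322267 / 5000000000"
  "264711 / 2500000000 \<le> x1 ^ 10" "x1 ^ 10 \<le> 211769 / 2000000000"
  "8479 / 200000000 \<le> x1 ^ 11" "x1 ^ 11 \<le> 423951 / 10000000000"
  "33949 / 2000000000 \<le> x1 ^ 12" "x1 ^ 12 \<le> 84873 / 5000000000"
  "16991 / 2500000000 \<le> x1 ^ 13" "x1 ^ 13 \<le> 13593 / 2000000000"
  "6803 / 2500000000 \<le> x1 ^ 14" "x1 ^ 14 \<le> 27213 / 10000000000"
  "2179 / 2000000000 \<le> x1 ^ 15" "x1 ^ 15 \<le> 681 / 625000000"
  "2181 / 5000000000 \<le> x1 ^ 16" "x1 ^ 16 \<le> 4363 / 10000000000"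
  "699 / 10000000000 \<le> x1 ^ 18" "x1 ^ 18 \<le> 7 / 100000000"
  "7 / 625000000 \<le> x1 ^ 20" "x1 ^ 20 \<le> 113 / 10000000000"
  "17 / 10000000000 \<le> x1 ^ 22" "x1 ^ 22 \<le> 9 / 5000000000"
  "1 / 5000000000 \<le> x1 ^ 24" "x1 ^ 24 \<le> 3 / 10000000000"
  by (simp_all add: x1_def power_divide)

lemma log_rem_x1_1: "111085791 / 1000000000 \<le> log_rem (x1)" "log_rem (x1) \<le> 55542923 / 500000000"
proof -
  have u: "0 \<le> x1" "x1 \<le> 1 / 2" using x1_powers(1,2) by linarith+
  have "x1 ^ 2 / 2 + x1 ^ 3 / 3 + x1 ^ 4 / 4 + x1 ^ 5 / 5 + x1 ^ 6 / 6 + x1 ^ 7 / 7 + x1 ^ 8 / 8 + x1 ^ 9 / 9 + x1 ^ 10 / 10 + x1 ^ 11 / 11 + x1 ^ 12 / 12 + x1 ^ 13 / 13 + x1 ^ 14 / 14 + x1 ^ 15 / 15 \<le> log_rem (x1)"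
    using log_rem_ge_poly[of "x1" "x1" 15] u by (simp add: upt_rec_numeral flip: power_mult)
  then show "111085791 / 1000000000 \<le> log_rem (x1)"
    using x1_powers(3,4,5,6,7,8,9,10,11,12,13,14,15,16,17,18,19,20,21,22,23,24,25,26,27,28,29,30,31,32) by linarith
  have "log_rem (x1) \<le> x1 ^ 2 / 2 + x1 ^ 3 / 3 + x1 ^ 4 / 4 + x1 ^ 5 / 5 + x1 ^ 6 / 6 + x1 ^ 7 / 7 + x1 ^ 8 / 8 + x1 ^ 9 / 9 + x1 ^ 10 / 10 + x1 ^ 11 / 11 + x1 ^ 12 / 12 + x1 ^ 13 / 13 + x1 ^ 14 / 14 + x1 ^ 15 / 15 + 2 * x1 ^ 16 / 16"
    using log_rem_le_poly'[of "x1" 15] u by (simp add: upt_rec_numeral flip: power_mult)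
  then show "log_rem (x1) \<le> 55542923 / 500000000"
    using x1_powers(3,4,5,6,7,8,9,10,11,12,13,14,15,16,17,18,19,20,21,22,23,24,25,26,27,28,29,30,31,32) by linarith
qed

lemma log_rem_x1_2: "288257 / 20000000 \<le> log_rem (x1 ^ 2)" "log_rem (x1 ^ 2) \<le> 90081 / 6250000"
proof -
  have u: "0 \<le> x1 ^ 2" "x1 ^ 2 \<le> 1 / 2" using x1_powers(3,4) by linarith+
  have "x1 ^ 4 / 2 + x1 ^ 6 / 3 + x1 ^ 8 / 4 + x1 ^ 10 / 5 + x1 ^ 12 / 6 + x1 ^ 14 / 7 \<le> log_rem (x1 ^ 2)"
    using log_rem_ge_poly[of "x1 ^ 2" "x1 ^ 2" 7] u by (simp add: upt_rec_numeral flip: power_mult)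
  then show "288257 / 20000000 \<le> log_rem (x1 ^ 2)"
    using x1_powers(7,8,11,12,15,16,19,20,23,24,27,28,31,32) by linarith
  have "log_rem (x1 ^ 2) \<le> x1 ^ 4 / 2 + x1 ^ 6 / 3 + x1 ^ 8 / 4 + x1 ^ 10 / 5 + x1 ^ 12 / 6 + x1 ^ 14 / 7 + 2 * x1 ^ 16 / 8"
    using log_rem_le_poly'[of "x1 ^ 2" 7] u by (simp add: upt_rec_numeral flip: power_mult)
  then show "log_rem (x1 ^ 2) \<le> 90081 / 6250000"
    using x1_powers(7,8,11,12,15,16,19,20,23,24,27,28,31,32) by linarith
qed

lemma log_rem_x1_small:
  "1076311 / 500000000 \<le> log_rem (x1 ^ 3)" "log_rem (x1 ^ 3) \<le> 538159 / 250000000"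
  "168007 / 500000000 \<le> log_rem (x1 ^ 4)" "log_rem (x1 ^ 4) \<le> 67203 / 200000000"
  "10661 / 200000000 \<le> log_rem (x1 ^ 5)" "log_rem (x1 ^ 5) \<le> 53309 / 1000000000"
  "851 / 100000000 \<le> log_rem (x1 ^ 6)" "log_rem (x1 ^ 6) \<le> 8511 / 1000000000"
  "681 / 500000000 \<le> log_rem (x1 ^ 7)" "log_rem (x1 ^ 7) \<le> 1363 / 1000000000"
  "109 / 500000000 \<le> log_rem (x1 ^ 8)" "log_rem (x1 ^ 8) \<le> 219 / 1000000000"
  "17 / 500000000 \<le> log_rem (x1 ^ 9)" "log_rem (x1 ^ 9) \<le> 7 / 200000000"
  "1 / 200000000 \<le> log_rem (x1 ^ 10)" "log_rem (x1 ^ 10) \<le> 3 / 500000000"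
  "0 \<le> log_rem (x1 ^ 11)" "log_rem (x1 ^ 11) \<le> 1 / 1000000000"
  "0 \<le> log_rem (x1 ^ 12)" "log_rem (x1 ^ 12) \<le> 1 / 1000000000"
  by (rule log_rem_quintic_bounds[OF x1_powers(5,6)] log_rem_quintic_bounds[OF x1_powers(7,8)] log_rem_cubic_bounds[OF x1_powers(9,10)] log_rem_cubic_bounds[OF x1_powers(11,12)] log_rem_cubic_bounds[OF x1_powers(13,14)] log_rem_cubic_bounds[OF x1_powers(15,16)] log_rem_cubic_bounds[OF x1_powers(17,18)] log_rem_cubic_bounds[OF x1_powers(19,20)] log_rem_cubic_bounds[OF x1_powers(21,22)] log_rem_cubic_bounds[OF x1_powers(23,24)];
    simp add: power_divide)+

lemmas log_rem_x1 = log_rem_x1_1 log_rem_x1_2 log_rem_x1_small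

lemma x2_powers:
  "80083 / 200000 \<le> x2" "x2 \<le> 80083 / 200000"
  "801660861 / 5000000000 \<le> x2 ^ 2" "x2 ^ 2 \<le> 1603321723 / 10000000000"
  "641994067 / 10000000000 \<le> x2 ^ 3" "x2 ^ 3 \<le> 160498517 / 2500000000"
  "128532027 / 5000000000 \<le> x2 ^ 4" "x2 ^ 4 \<le> 51412811 / 2000000000"
  "102932303 / 10000000000 \<le> x2 ^ 5" "x2 ^ 5 \<le> 6433269 / 625000000"
  "20607819 / 5000000000 \<le> x2 ^ 6" "x2 ^ 6 \<le> 41215639 / 10000000000"
  "16503359 / 10000000000 \<le> x2 ^ 7" "x2 ^ 7 \<le> 51573 / 31250000"
  "103253 / 156250000 \<le> x2 ^ 8" "x2 ^ 8 \<le> 6608193 / 10000000000"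
  "2646019 / 10000000000 \<le> x2 ^ 9" "x2 ^ 9 \<le> 132301 / 500000000"
  "211901 / 2000000000 \<le> x2 ^ 10" "x2 ^ 10 \<le> 529753 / 5000000000"
  "212121 / 5000000000 \<le> x2 ^ 11" "x2 ^ 11 \<le> 424243 / 10000000000"
  "10617 / 625000000 \<le> x2 ^ 12" "x2 ^ 12 \<le> 169873 / 10000000000"
  "68019 / 10000000000 \<le> x2 ^ 13" "x2 ^ 13 \<le> 3401 / 500000000"
  "6809 / 2500000000 \<le> x2 ^ 14" "x2 ^ 14 \<le> 27237 / 10000000000"
  "2181 / 2000000000 \<le> x2 ^ 15" "x2 ^ 15 \<le> 5453 / 5000000000"
  "2183 / 5000000000 \<le> x2 ^ 16" "x2 ^ 16 \<le> 4367 / 10000000000"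
  "7 / 100000000 \<le> x2 ^ 18" "x2 ^ 18 \<le> 701 / 10000000000"
  "7 / 625000000 \<le> x2 ^ 20" "x2 ^ 20 \<le> 113 / 10000000000"
  "17 / 10000000000 \<le> x2 ^ 22" "x2 ^ 22 \<le> 9 / 5000000000"
  "1 / 5000000000 \<le> x2 ^ 24" "x2 ^ 24 \<le> 3 / 10000000000"
  by (simp_all add: x2_def power_divide)

lemma log_rem_x2_1: "22220497 / 200000000 \<le> log_rem (x2)" "log_rem (x2) \<le> 111102541 / 1000000000"
proof -
  have u: "0 \<le> x2" "x2 \<le> 1 / 2" using x2_powers(1,2) by linarith+
  have "x2 ^ 2 / 2 + x2 ^ 3 / 3 + x2 ^ 4 / 4 + x2 ^ 5 / 5 + x2 ^ 6 / 6 + x2 ^ 7 / 7 + x2 ^ 8 / 8 + x2 ^ 9 / 9 + x2 ^ 10 / 10 + x2 ^ 11 / 11 + x2 ^ 12 / 12 + x2 ^ 13 / 13 + x2 ^ 14 / 14 + x2 ^ 15 / 15 \<le> log_rem (x2)"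
    using log_rem_ge_poly[of "x2" "x2" 15] u by (simp add: upt_rec_numeral flip: power_mult)
  then show "22220497 / 200000000 \<le> log_rem (x2)"
    using x2_powers(3,4,5,6,7,8,9,10,11,12,13,14,15,16,17,18,19,20,21,22,23,24,25,26,27,28,29,30,31,32) by linarith
  have "log_rem (x2) \<le> x2 ^ 2 / 2 + x2 ^ 3 / 3 + x2 ^ 4 / 4 + x2 ^ 5 / 5 + x2 ^ 6 / 6 + x2 ^ 7 / 7 + x2 ^ 8 / 8 + x2 ^ 9 / 9 + x2 ^ 10 / 10 + x2 ^ 11 / 11 + x2 ^ 12 / 12 + x2 ^ 13 / 13 + x2 ^ 14 / 14 + x2 ^ 15 / 15 + 2 * x2 ^ 16 / 16"
    using log_rem_le_poly'[of "x2" 15] u by (simp add: upt_rec_numeral flip: power_mult)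
  then show "log_rem (x2) \<le> 111102541 / 1000000000"
    using x2_powers(3,4,5,6,7,8,9,10,11,12,13,14,15,16,17,18,19,20,21,22,23,24,25,26,27,28,29,30,31,32) by linarith
qed

lemma log_rem_x2_2: "450521 / 31250000 \<le> log_rem (x2 ^ 2)" "log_rem (x2 ^ 2) \<le> 7208391 / 500000000"
proof -
  have u: "0 \<le> x2 ^ 2" "x2 ^ 2 \<le> 1 / 2" using x2_powers(3,4) by linarith+
  have "x2 ^ 4 / 2 + x2 ^ 6 / 3 + x2 ^ 8 / 4 + x2 ^ 10 / 5 + x2 ^ 12 / 6 + x2 ^ 14 / 7 \<le> log_rem (x2 ^ 2)"
    using log_rem_ge_poly[of "x2 ^ 2" "x2 ^ 2" 7] u by (simp add: upt_rec_numeral flip: power_mult)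
  then show "450521 / 31250000 \<le> log_rem (x2 ^ 2)"
    using x2_powers(7,8,11,12,15,16,19,20,23,24,27,28,31,32) by linarith
  have "log_rem (x2 ^ 2) \<le> x2 ^ 4 / 2 + x2 ^ 6 / 3 + x2 ^ 8 / 4 + x2 ^ 10 / 5 + x2 ^ 12 / 6 + x2 ^ 14 / 7 + 2 * x2 ^ 16 / 8"
    using log_rem_le_poly'[of "x2 ^ 2" 7] u by (simp add: upt_rec_numeral flip: power_mult)
  then show "log_rem (x2 ^ 2) \<le> 7208391 / 500000000"
    using x2_powers(7,8,11,12,15,16,19,20,23,24,27,28,31,32) by linarith
qed

lemma log_rem_x2_small:
  "2153447 / 1000000000 \<le> log_rem (x2 ^ 3)" "log_rem (x2 ^ 3) \<le> 107673 / 50000000"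
  "336183 / 1000000000 \<le> log_rem (x2 ^ 4)" "log_rem (x2 ^ 4) \<le> 42023 / 125000000"
  "26669 / 500000000 \<le> log_rem (x2 ^ 5)" "log_rem (x2 ^ 5) \<le> 26671 / 500000000"
  "2129 / 250000000 \<le> log_rem (x2 ^ 6)" "log_rem (x2 ^ 6) \<le> 4259 / 500000000"
  "1363 / 1000000000 \<le> log_rem (x2 ^ 7)" "log_rem (x2 ^ 7) \<le> 341 / 250000000"
  "109 / 500000000 \<le> log_rem (x2 ^ 8)" "log_rem (x2 ^ 8) \<le> 219 / 1000000000"
  "7 / 200000000 \<le> log_rem (x2 ^ 9)" "log_rem (x2 ^ 9) \<le> 9 / 250000000"
  "1 / 200000000 \<le> log_rem (x2 ^ 10)" "log_rem (x2 ^ 10) \<le> 3 / 500000000"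
  "0 \<le> log_rem (x2 ^ 11)" "log_rem (x2 ^ 11) \<le> 1 / 1000000000"
  "0 \<le> log_rem (x2 ^ 12)" "log_rem (x2 ^ 12) \<le> 1 / 1000000000"
  by (rule log_rem_quintic_bounds[OF x2_powers(5,6)] log_rem_quintic_bounds[OF x2_powers(7,8)] log_rem_cubic_bounds[OF x2_powers(9,10)] log_rem_cubic_bounds[OF x2_powers(11,12)] log_rem_cubic_bounds[OF x2_powers(13,14)] log_rem_cubic_bounds[OF x2_powers(15,16)] log_rem_cubic_bounds[OF x2_powers(17,18)] log_rem_cubic_bounds[OF x2_powers(19,20)] log_rem_cubic_bounds[OF x2_powers(21,22)] log_rem_cubic_bounds[OF x2_powers(23,24)];
    simp add: power_divide)+

lemmas log_rem_x2 = log_rem_x2_1 log_rem_x2_2 log_rem_x2_small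

section \<open>Rational bounds for the exponential function\<close>

lemma exp_taylor_bounds:
  fixes t :: real
  assumes "0 \<le> t" "t \<le> 2"
  shows "sum_list (map (\<lambda>k. t ^ k / fact k) [0..<n]) \<le> exp t"
    and "exp t \<le> sum_list (map (\<lambda>k. t ^ k / fact k) [0..<n]) + 9 * t ^ n / fact n"
proof -
  obtain s where s: "\<bar>s\<bar> \<le> \<bar>t\<bar>" "exp t = (\<Sum>m<n. t ^ m / fact m) + exp s / fact n * t ^ n"
    using Maclaurin_exp_le by blast
  have sum: "(\<Sum>m<n. t ^ m / fact m) = sum_list (map (\<lambda>k. t ^ k / fact k) [0..<n])"
    by (simp only: interv_sum_list_conv_sum_set_nat set_upt lessThan_atLeast0)
  have "exp s \<le> exp (1 + 1)" using s(1) assms by simp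
  also have "\<dots> = exp 1 * exp (1 :: real)" by (rule exp_add)
  also have "\<dots> \<le> 3 * 3" using exp_le by (intro mult_mono) auto
  finally have "exp s \<le> 9" by simp
  then have "exp s / fact n * t ^ n \<le> 9 / fact n * t ^ n"
    using assms by (intro mult_right_mono divide_right_mono) auto
  moreover have "0 \<le> exp s / fact n * t ^ n" using assms by simp
  ultimately show "sum_list (map (\<lambda>k. t ^ k / fact k) [0..<n]) \<le> exp t"
    "exp t \<le> sum_list (map (\<lambda>k. t ^ k / fact k) [0..<n]) + 9 * t ^ n / fact n"
    unfolding s(2) sum by simp_all
qed

lemma square_ge: "0 \<le> l \<Longrightarrow> l \<le> x \<Longrightarrow> l' \<le> l * l \<Longrightarrow> l' \<le> x * (x :: real)"
  using mult_mono[of l x l x] by linarith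

lemma square_le: "0 \<le> x \<Longrightarrow> x \<le> h \<Longrightarrow> h * h \<le> h' \<Longrightarrow> x * x \<le> (h' :: real)"
  using mult_mono[of x h x h] by linarith

lemma exp_16:
  fixes t :: real
  shows "exp (16 * t) = ((exp t * exp t) * (exp t * exp t)) * ((exp t * exp t) * (exp t * exp t))
    * (((exp t * exp t) * (exp t * exp t)) * ((exp t * exp t) * (exp t * exp t)))"
proof -
  have double: "exp (2 * a) = exp a * exp a" for a :: real by (simp add: exp_add[symmetric])
  have "16 * t = 2 * (2 * (2 * (2 * t)))" by simp
  then show ?thesis by (simp only: double)
qed

text \<open>Taylor bounds at \<open>t\<close> followed by four squarings, rounding after each step.\<close>

lemma exp_16_lower:
  fixes t :: real
  assumes "0 \<le> t" "t \<le> 2" "l0 \<le> 1 + t + t ^ 2 / 2 + t ^ 3 / 6 + t ^ 4 / 24 + t ^ 5 / 120"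
    and "0 \<le> l0" "0 \<le> l1" "0 \<le> l2" "0 \<le> l3" "l1 \<le> l0 * l0" "l2 \<le> l1 * l1" "l3 \<le> l2 * l2" "l4 \<le> l3 * l3" "s = 16 * t"
  shows "l4 \<le> exp s"
proof -
  have "l0 \<le> exp t"
    using exp_taylor_bounds(1)[OF assms(1,2), of 6] assms(3) by (simp add: upt_numeral fact_numeral add.assoc)
  note 1 = square_ge[OF assms(4) this assms(8)]
  note 2 = square_ge[OF assms(5) 1 assms(9)]
  note 3 = square_ge[OF assms(6) 2 assms(10)]
  show ?thesis unfolding assms(12) exp_16 by (rule square_ge[OF assms(7) 3 assms(11)])
qed

lemma exp_16_upper:
  fixes t :: real
  assumes "0 \<le> t" "t \<le> 2" "1 + t + t ^ 2 / 2 + t ^ 3 / 6 + t ^ 4 / 24 + t ^ 5 / 120 + t ^ 6 / 80 \<le> h0"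
    and "h0 * h0 \<le> h1" "h1 * h1 \<le> h2" "h2 * h2 \<le> h3" "h3 * h3 \<le> h4" "s = 16 * t"
  shows "exp s \<le> h4"
proof -
  have "exp t \<le> h0"
    using exp_taylor_bounds(2)[OF assms(1,2), of 6] assms(3) by (simp add: upt_numeral fact_numeral add.assoc)
  note 1 = square_le[OF exp_ge_zero this assms(4)]
  note 2 = square_le[OF zero_le_square 1 assms(5)]
  note 3 = square_le[OF zero_le_square 2 assms(6)]
  show ?thesis unfolding assms(8) exp_16 by (rule square_le[OF zero_le_square 3 assms(7)])
qed

text \<open>Beyond \<open>m\<close>, log_rem (x^n) is at most x^(2n) / (2 (1 - x)), and one of the
  two factors x^n is at most x^(m+1). The tail is thus a small multiple of the partial sum of
  \<open>c\<close> itself, which the induction on coefficients controls.\<close>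

lemma log_rem_partial_sum_le:
  assumes c: "\<And>n. 0 \<le> c n" "c 0 = 0" and x: "0 < x" "x < 1"
    and f: "\<And>n. n > 0 \<Longrightarrow> 0 \<le> f n" "\<And>n. n > 0 \<Longrightarrow> f n \<le> log_rem (x ^ n)"
  shows "(\<Sum>n\<le>N. c n * f n) \<le> (\<Sum>n\<le>m. c n * f n) + x ^ Suc m / (2 * (1 - x)) * (\<Sum>n\<le>N. c n * x ^ n)"
proof -
  let ?K = "x ^ Suc m / (2 * (1 - x))"
  have K: "0 \<le> ?K" using x by simp
  have cf: "0 \<le> c n * f n" for n using c f(1) by (cases "n = 0") auto
  have cx: "0 \<le> c n * x ^ n" for n using c x by simp
  have "(\<Sum>n\<le>N. c n * f n) \<le> (\<Sum>n\<in>{..m} \<union> {Suc m..N}. c n * f n)"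
    by (rule sum_mono2) (use cf in auto)
  also have "\<dots> = (\<Sum>n\<le>m. c n * f n) + (\<Sum>n\<in>{Suc m..N}. c n * f n)"
    by (rule sum.union_disjoint) auto
  also have "(\<Sum>n\<in>{Suc m..N}. c n * f n) \<le> (\<Sum>n\<in>{Suc m..N}. ?K * (c n * x ^ n))"
  proof (rule sum_mono)
    fix n assume n: "n \<in> {Suc m..N}"
    have xn: "x ^ n < 1" "x ^ n \<le> x" using x n power_decreasing[of 1 n x] by (auto simp: power_less_one_iff)
    have "f n \<le> log_rem (x ^ n)" using n by (intro f) auto
    also have "\<dots> \<le> (x ^ n)\<^sup>2 / (2 * (1 - x ^ n))" using x xn by (intro log_rem_upper) auto
    also have "\<dots> \<le> (x ^ n)\<^sup>2 / (2 * (1 - x))"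
      using x xn by (intro divide_left_mono) (auto intro!: mult_pos_pos)
    also have "\<dots> \<le> (x ^ Suc m * x ^ n) / (2 * (1 - x))"
      unfolding power2_eq_square using x n by (intro divide_right_mono mult_right_mono power_decreasing) auto
    also have "\<dots> = ?K * x ^ n" by simp
    finally have "c n * f n \<le> c n * (?K * x ^ n)" using c by (intro mult_left_mono) auto
    then show "c n * f n \<le> ?K * (c n * x ^ n)" by (simp only: mult.left_commute)
  qed
  also have "\<dots> = ?K * (\<Sum>n\<in>{Suc m..N}. c n * x ^ n)" by (rule sum_distrib_left[symmetric])
  also have "\<dots> \<le> ?K * (\<Sum>n\<le>N. c n * x ^ n)"
    by (intro mult_left_mono K sum_mono2) (use cx in auto)
  finally show ?thesis by simp
qed

lemma log_rem_minus_sq: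
  assumes "0 < x" "x < 1" "n > 0"
  shows "0 \<le> log_rem (x ^ n) - (x ^ n)\<^sup>2 / 2" "log_rem (x ^ n) - (x ^ n)\<^sup>2 / 2 \<le> log_rem (x ^ n)"
  using log_rem_lower[of "x ^ n"] assms by (simp_all add: power_less_one_iff)

section \<open>Convergence at \<open>x1\<close>\<close>

lemma exp_y1_b1: "exp (124324411 / 100000000 :: real) \<le> 433355273 / 125000000"
  by (rule exp_16_upper[of "124324411 / 1600000000" "1080801352591 / 1000000000000" "1168131563763 / 1000000000000" "68226567513 / 50000000000" "1861945805843 / 1000000000000"]; simp add: power_divide)

lemma exp_S1: "exp (61336141 / 100000000 :: real) \<le> 923314127 / 500000000"
  by (rule exp_16_upper[of "61336141 / 1600000000" "519539678869 / 500000000000" "539842955839 / 500000000000" "291430416969 / 250000000000" "339726751739 / 250000000000"]; simp add: power_divide)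

lemma x1_pos: "0 < x1" "x1 < 1"
  by (simp_all add: x1_def)

lemma x1_tail: "x1 ^ Suc 12 / (2 * (1 - x1)) \<le> 1417 / 250000000"
  by (simp add: x1_def power_divide)

lemma theta_x1: "theta (5573 / 5000) (12864411 / 100000000) (3260567 / 100000000) \<le> 63503717 / 100000000"
proof -
  have "exp (5573 / 5000 + 12864411 / 100000000 :: real) \<le> 433355273 / 125000000" using exp_y1_b1 by simp
  then show ?thesis unfolding theta_def by (simp add: power2_eq_square)
qed

lemma leaf_bound_x1: "x1 + x1\<^sup>2 * theta (5573 / 5000) (12864411 / 100000000) (3260567 / 100000000) \<le> 25109709 / 50000000"
proof -
  have "x1\<^sup>2 * theta (5573 / 5000) (12864411 / 100000000) (3260567 / 100000000) \<le> x1\<^sup>2 * (63503717 / 100000000)"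
    by (intro mult_left_mono theta_x1) simp
  also have "\<dots> \<le> 25109709 / 50000000 - x1" by (simp add: x1_def power2_eq_square)
  finally show ?thesis by linarith
qed

lemma head_diff: "(\<Sum>n\<le>12. tc n * (log_rem (x ^ n) - (x ^ n)\<^sup>2 / 2))
    = (\<Sum>n\<le>12. tc n * log_rem (x ^ n)) - (\<Sum>n\<le>12. tc n * ((x ^ n)\<^sup>2 / 2))"
  by (simp only: right_diff_distrib sum_subtractf)

text \<open>A lower bound, because these squares enter the third argument of \<open>theta\<close>
  with a negative sign.\<close>

lemma head_sq_x1: "6002403 / 62500000 \<le> (\<Sum>n\<le>12. tc n * ((x1 ^ n)\<^sup>2 / 2))"
proof -
  have sq: "(x1 ^ n)\<^sup>2 = x1 ^ (2 * n)" for n by (simp add: power_mult[symmetric] mult.commute)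
  show ?thesis unfolding head_tc sq using x1_powers(3,7,11,15,19,23,27,31,33,35,37,39) by simp
qed

lemma head_x1:
  "(\<Sum>n\<le>12. tc n * log_rem (x1 ^ n)) + 1417 / 250000000 * (5573 / 5000) \<le> 12864411 / 100000000"
  "(\<Sum>n\<le>12. tc n * (log_rem (x1 ^ n) - (x1 ^ n)\<^sup>2 / 2)) + 1417 / 250000000 * (5573 / 5000) \<le> 3260567 / 100000000"
  "(\<Sum>n\<le>12. lc n * log_rem (x1 ^ n)) + 1417 / 250000000 * (25109709 / 50000000) \<le> 11116723 / 100000000"
proof -
  show 1: "(\<Sum>n\<le>12. tc n * log_rem (x1 ^ n)) + 1417 / 250000000 * (5573 / 5000) \<le> 12864411 / 100000000"
    unfolding head_tc using log_rem_x1 by simp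
  show "(\<Sum>n\<le>12. tc n * (log_rem (x1 ^ n) - (x1 ^ n)\<^sup>2 / 2)) + 1417 / 250000000 * (5573 / 5000) \<le> 3260567 / 100000000"
    unfolding head_diff using 1 head_sq_x1 by linarith
  show "(\<Sum>n\<le>12. lc n * log_rem (x1 ^ n)) + 1417 / 250000000 * (25109709 / 50000000) \<le> 11116723 / 100000000"
    unfolding head_lc using log_rem_x1 by simp
qed

text \<open>The test value 5573 / 5000 is a rounding of T at the radius of convergence; near it the
  right-hand side of the functional equation falls furthest below the left-hand side. The other
  three numbers are upper bounds for the tail series of trees, its part k \<ge> 3, and the tail
  series of leaves.\<close>

lemma tree_bound_x1: "(\<Sum>n\<le>N. tc n * x1 ^ n) \<le> 5573 / 5000"
proof (rule tree_bound_induction[OF x1_pos])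
  have tail: "x1 ^ Suc 12 / (2 * (1 - x1)) * s \<le> 1417 / 250000000 * u" if "s \<le> u" "0 \<le> s" for s u
    using x1_tail that by (intro mult_mono) auto
  have t0: "0 \<le> (\<Sum>n\<le>N. c n * x1 ^ n)" if "\<And>n. 0 \<le> c n" for c N
    using that x1_pos by (intro sum_nonneg) auto
  show "(\<Sum>n\<le>N. tc n * log_rem (x1 ^ n)) \<le> 12864411 / 100000000" if "(\<Sum>n\<le>N. tc n * x1 ^ n) \<le> 5573 / 5000" for N
    using log_rem_partial_sum_le[of tc x1 "\<lambda>n. log_rem (x1 ^ n)" N 12] tail[OF that t0] head_x1(1)
      log_rem_nonneg[of "x1 ^ _"] x1_pos
    by (smt (verit) log_rem_minus_sq tc_0 tc_nonneg)
  show "(\<Sum>n\<le>N. tc n * (log_rem (x1 ^ n) - (x1 ^ n)\<^sup>2 / 2)) \<le> 3260567 / 100000000" if "(\<Sum>n\<le>N. tc n * x1 ^ n) \<le> 5573 / 5000" for N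
    using log_rem_partial_sum_le[of tc x1 "\<lambda>n. log_rem (x1 ^ n) - (x1 ^ n)\<^sup>2 / 2" N 12] tail[OF that t0] head_x1(2)
      x1_pos
    by (smt (verit) log_rem_minus_sq tc_0 tc_nonneg)
  show "(\<Sum>n\<le>N. lc n * log_rem (x1 ^ n)) \<le> 11116723 / 100000000"
    if "(\<Sum>n\<le>N. lc n * x1 ^ n) \<le> x1 + x1\<^sup>2 * theta (5573 / 5000) (12864411 / 100000000) (3260567 / 100000000)" for N
    using log_rem_partial_sum_le[of lc x1 "\<lambda>n. log_rem (x1 ^ n)" N 12] tail[OF order_trans[OF that leaf_bound_x1] t0] head_x1(3)
      x1_pos
    by (smt (verit) log_rem_minus_sq lc_0 lc_nonneg)
  have "exp (x1 + x1\<^sup>2 * theta (5573 / 5000) (12864411 / 100000000) (3260567 / 100000000) + 11116723 / 100000000) \<le> exp (61336141 / 100000000)"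
    using leaf_bound_x1 by simp
  also have "\<dots> \<le> 923314127 / 500000000" by (rule exp_S1)
  also have "\<dots> \<le> 1 + x1 + x1 * (5573 / 5000)" by (simp add: x1_def)
  finally show "exp (x1 + x1\<^sup>2 * theta (5573 / 5000) (12864411 / 100000000) (3260567 / 100000000) + 11116723 / 100000000) \<le> 1 + x1 + x1 * (5573 / 5000)" .
qed simp

lemma summable_x1: "summable (\<lambda>n. tc n * x1 ^ n)"
  by (rule tree_bound_summable(1)[OF tree_bound_x1 x1_pos(1)])

lemma log_rem_series:
  assumes x: "0 < x" "x < 1" and s: "summable (\<lambda>n. c n * x ^ n)" and c: "\<And>n. 0 \<le> c n" "c 0 = 0"
  shows "summable (\<lambda>n. c n * log_rem (x ^ n))" "ps (log_tail c) x = (\<Sum>n. c n * log_rem (x ^ n))"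
    "summable (\<lambda>n. c n * (x\<^sup>2) ^ n)"
proof -
  have "x\<^sup>2 \<le> x" using x by (simp add: power2_eq_square mult_left_le)
  then show *: "summable (\<lambda>n. c n * (x\<^sup>2) ^ n)"
    using s c x by (intro summable_smaller[of c x "x\<^sup>2"]) auto
  show "summable (\<lambda>n. c n * log_rem (x ^ n))" using x c * by (intro summable_log_rem) auto
  show "ps (log_tail c) x = (\<Sum>n. c n * log_rem (x ^ n))"
    using log_tail_sums[OF c _ _ *] x by (simp add: ps_def sums_iff)
qed

lemma tree_equation_real:
  assumes x: "0 < x" "x < r" "r < 1" and s: "summable (\<lambda>n. tc n * r ^ n)"
  shows "1 + x + x * ps tc x = exp (x + x\<^sup>2 * theta (ps tc x) (ps (log_tail tc) x) (ps (log_tail tc) x - ps tc (x\<^sup>2) / 2)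
    + ps (log_tail lc) x)"
proof -
  have sx: "summable (\<lambda>n. tc n * x ^ n)" using s x by (intro summable_smaller[of tc r x]) auto
  then have sl: "summable (\<lambda>n. lc n * x ^ n)" using x by (intro summable_lc) auto
  have x1: "x < 1" using x by simp
  have tails: "summable (\<lambda>n. log_tail tc n * x ^ n)" "summable (\<lambda>n. log_tail lc n * x ^ n)"
    using log_tail_sums[of tc x] log_tail_sums[of lc x] log_rem_series(3)[OF x(1) x1 sx] log_rem_series(3)[OF x(1) x1 sl] x x1
    by (auto simp: sums_iff)
  have "1 + complex_of_real x + of_real x * ps tc (of_real x) = exp (of_real x + (of_real x)\<^sup>2 * (exp (ps tc (of_real x) + ps (log_tail tc) (of_real x)) - 1 - ps tc (of_real x)
      - ((ps tc (of_real x))\<^sup>2 + ps tc ((of_real x)\<^sup>2)) / 2) + ps (log_tail lc) (of_real x))"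
    using x s by (intro tree_equation[of r]) auto
  moreover have "ps tc ((of_real x)\<^sup>2 :: complex) = of_real (ps tc (x\<^sup>2))"
    using ps_of_real[OF log_rem_series(3)[OF x(1) x1 sx tc_nonneg tc_0], where 'a = complex] by simp
  ultimately have "complex_of_real (1 + x + x * ps tc x) = of_real (exp (x + x\<^sup>2 * (exp (ps tc x + ps (log_tail tc) x) - 1 - ps tc x
      - ((ps tc x)\<^sup>2 + ps tc (x\<^sup>2)) / 2) + ps (log_tail lc) x))"
    by (simp add: ps_of_real[OF sx] ps_of_real[OF tails(1)] ps_of_real[OF tails(2)] flip: exp_of_real)
  then have "1 + x + x * ps tc x = exp (x + x\<^sup>2 * (exp (ps tc x + ps (log_tail tc) x) - 1 - ps tc x
      - ((ps tc x)\<^sup>2 + ps tc (x\<^sup>2)) / 2) + ps (log_tail lc) x)"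
    by (simp only: of_real_eq_iff)
  also have "exp (ps tc x + ps (log_tail tc) x) - 1 - ps tc x - ((ps tc x)\<^sup>2 + ps tc (x\<^sup>2)) / 2
      = theta (ps tc x) (ps (log_tail tc) x) (ps (log_tail tc) x - ps tc (x\<^sup>2) / 2)"
    by (simp add: theta_def field_simps)
  finally show ?thesis .
qed

section \<open>No convergence beyond \<open>x2\<close>\<close>

lemma exp_y0_b2_lower: "866738653 / 250000000 \<le> exp (62163829 / 50000000 :: real)"
  by (rule exp_16_lower[of "62163829 / 800000000" "135100442899 / 125000000000" "36504259343 / 31250000000" "272908482597 / 200000000000" "930987998417 / 500000000000"]; simp add: power_divide)

lemma exp_y0_b2_upper: "exp (62163829 / 50000000 :: real) \<le> 693390951 / 200000000"
  by (rule exp_16_upper[of "62163829 / 800000000" "216160709189 / 200000000000" "36504259529 / 31250000000" "1364542426891 / 1000000000000" "930988017393 / 500000000000"]; simp add: power_divide)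

lemma exp_s0_lower: "1846740401 / 1000000000 \<le> exp (30671107 / 50000000 :: real)"
  by (rule exp_16_lower[of "30671107 / 800000000" "1039083301661 / 1000000000000" "107969410779 / 100000000000" "291434841599 / 250000000000" "271789654073 / 200000000000"]; simp add: power_divide)

lemma exp_s0_upper: "exp (61342217 / 100000000 :: real) \<le> 1846740459 / 1000000000"
  by (rule exp_16_upper[of "61342217 / 1600000000" "20781666073 / 20000000000" "43187764477 / 40000000000" "582869687663 / 500000000000" "679474145593 / 500000000000"]; simp add: power_divide)

lemma x2_pos: "0 < x2" "x2 < 1"
  by (simp_all add: x2_def)

lemma head_sq_x2: "(\<Sum>n\<le>12. tc n * ((x2 ^ n)\<^sup>2 / 2)) \<le> 19210609 / 200000000"
proof -
  have sq: "(x2 ^ n)\<^sup>2 = x2 ^ (2 * n)" for n by (simp add: power_mult[symmetric] mult.commute)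
  show ?thesis unfolding head_tc sq using x2_powers(4,8,12,16,20,24,28,32,34,36,38,40) by simp
qed

lemma head_x2:
  "3216457 / 25000000 \<le> (\<Sum>n\<le>12. tc n * log_rem (x2 ^ n))"
  "3260523 / 100000000 \<le> (\<Sum>n\<le>12. tc n * (log_rem (x2 ^ n) - (x2 ^ n)\<^sup>2 / 2))"
  "5559039 / 50000000 \<le> (\<Sum>n\<le>12. lc n * log_rem (x2 ^ n))"
proof -
  show 1: "3216457 / 25000000 \<le> (\<Sum>n\<le>12. tc n * log_rem (x2 ^ n))"
    unfolding head_tc using log_rem_x2 by simp
  show "3260523 / 100000000 \<le> (\<Sum>n\<le>12. tc n * (log_rem (x2 ^ n) - (x2 ^ n)\<^sup>2 / 2))"
    unfolding head_diff using 1 head_sq_x2 by linarith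
  show "5559039 / 50000000 \<le> (\<Sum>n\<le>12. lc n * log_rem (x2 ^ n))"
    unfolding head_lc using log_rem_x2 by simp
qed

text \<open>The derivative exp (y + b) - 1 - y increases on y \<ge> 0, so \<open>theta\<close> is
  convex there and lies above its tangents.\<close>

lemma theta_tangent:
  assumes "0 \<le> y" "0 \<le> y0" "0 \<le> b"
  shows "theta y0 b e + (exp (y0 + b) - 1 - y0) * (y - y0) \<le> theta y b e"
proof -
  have d: "((\<lambda>y. theta y b e) has_real_derivative exp (u + b) - 1 - u) (at u)" for u
    unfolding theta_def by (auto intro!: derivative_eq_intros)
  have mono: "exp (u + b) - 1 - u \<le> exp (v + b) - 1 - v" if "0 \<le> u" "u \<le> v" for u v
  proof -
    have "1 * (v - u) \<le> exp (u + b) * (exp (v - u) - 1)"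
    proof (rule mult_mono)
      show "v - u \<le> exp (v - u) - 1" using exp_ge_add_one_self[of "v - u"] by linarith
    qed (use that assms in auto)
    also have "\<dots> = exp (v + b) - exp (u + b)" by (simp add: algebra_simps exp_add[symmetric])
    finally show ?thesis by simp
  qed
  consider "y < y0" | "y = y0" | "y0 < y" by linarith
  then show ?thesis
  proof cases
    case 1
    obtain \<xi> where \<xi>: "y < \<xi>" "\<xi> < y0" "theta y0 b e - theta y b e = (y0 - y) * (exp (\<xi> + b) - 1 - \<xi>)"
      using MVT2[OF 1 d] by blast
    have "(y0 - y) * (exp (\<xi> + b) - 1 - \<xi>) \<le> (y0 - y) * (exp (y0 + b) - 1 - y0)"
      using \<xi> assms 1 by (intro mult_left_mono mono) auto
    then show ?thesis using \<xi>(3) by (simp add: algebra_simps)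
  next
    case 3
    obtain \<xi> where \<xi>: "y0 < \<xi>" "\<xi> < y" "theta y b e - theta y0 b e = (y - y0) * (exp (\<xi> + b) - 1 - \<xi>)"
      using MVT2[OF 3 d] by blast
    have "(y - y0) * (exp (y0 + b) - 1 - y0) \<le> (y - y0) * (exp (\<xi> + b) - 1 - \<xi>)"
      using \<xi> assms 3 by (intro mult_left_mono mono) auto
    then show ?thesis using \<xi>(3) by (simp add: algebra_simps)
  qed simp
qed

text \<open>At \<open>x2\<close> the right-hand side of the functional equation lies strictly above the left-hand side;
  as it is convex in the unknown, it suffices to look at a tangent with almost the right slope.\<close>

lemma no_solution_x2:
  assumes "0 \<le> y" "3216457 / 25000000 \<le> b" "3260523 / 100000000 \<le> e" "5559039 / 50000000 \<le> a"
  shows "1 + x2 + x2 * y < exp (x2 + x2\<^sup>2 * theta y b e + a)"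
proof -
  \<comment> \<open>\<open>y0\<close> is close to the point where the two sides have equal slope;
    \<open>b0\<close>, \<open>e0\<close> and \<open>a0\<close> are the assumed lower bounds of the
    three tail series.\<close>
  define y0 b0 e0 a0 :: real where "y0 = 11146183 / 10000000" and "b0 = 3216457 / 25000000" and "e0 = 3260523 / 100000000" and "a0 = 5559039 / 50000000"
  define Z where "Z = exp (y0 + b0)"
  define s0 where "s0 = x2 + x2\<^sup>2 * theta y0 b0 e0 + a0"
  have Z: "866738653 / 250000000 \<le> Z" "Z \<le> 693390951 / 200000000" using exp_y0_b2_lower exp_y0_b2_upper by (simp_all add: Z_def y0_def b0_def)
  have th: "theta y0 b0 e0 = Z - 1 - y0 - y0\<^sup>2 / 2 - b0 + e0" by (simp add: theta_def Z_def)
  have "30671107 / 50000000 \<le> s0" "s0 \<le> 61342217 / 100000000"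
  proof -
    have c: "127019256930511 / 200000000000000 \<le> theta y0 b0 e0" "theta y0 b0 e0 \<le> 127019285530511 / 200000000000000"
      unfolding th using Z by (simp_all add: y0_def b0_def e0_def power2_eq_square)
    have "x2\<^sup>2 * (127019256930511 / 200000000000000) \<le> x2\<^sup>2 * theta y0 b0 e0"
      "x2\<^sup>2 * theta y0 b0 e0 \<le> x2\<^sup>2 * (127019285530511 / 200000000000000)"
      using c by (intro mult_left_mono; simp)+
    moreover have "30671107 / 50000000 \<le> x2 + x2\<^sup>2 * (127019256930511 / 200000000000000) + a0"
      "x2 + x2\<^sup>2 * (127019285530511 / 200000000000000) + a0 \<le> 61342217 / 100000000"
      by (simp_all add: x2_def a0_def power2_eq_square)
    ultimately show "30671107 / 50000000 \<le> s0" "s0 \<le> 61342217 / 100000000" unfolding s0_def by linarith+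
  qed
  then have "exp (30671107 / 50000000) \<le> exp s0" "exp s0 \<le> exp (61342217 / 100000000)" by simp_all
  then have G: "1846740401 / 1000000000 \<le> exp s0" "exp s0 \<le> 1846740459 / 1000000000" using exp_s0_lower exp_s0_upper by linarith+
  \<comment> \<open>The slope of the linear lower bound minus the slope \<open>x2\<close> of the
    left-hand side. It is non-negative and tiny, so for \<open>y \<ge> 0\<close> at most
    \<open>\<sigma> * y0\<close> is lost.\<close>
  define \<sigma> where "\<sigma> = exp s0 * (x2\<^sup>2 * (Z - 1 - y0)) - x2"
  have zy: "169042039 / 125000000 \<le> Z - 1 - y0" "Z - 1 - y0 \<le> 270467291 / 200000000" using Z by (simp_all add: y0_def)
  have "1846740401 / 1000000000 * (x2\<^sup>2 * (169042039 / 125000000)) \<le> exp s0 * (x2\<^sup>2 * (Z - 1 - y0))"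
    using G zy by (intro mult_mono) auto
  moreover have "x2 \<le> 1846740401 / 1000000000 * (x2\<^sup>2 * (169042039 / 125000000))" by (simp add: x2_def power2_eq_square)
  ultimately have sg0: "0 \<le> \<sigma>" by (simp add: \<sigma>_def)
  have "exp s0 * (x2\<^sup>2 * (Z - 1 - y0)) \<le> 1846740459 / 1000000000 * (x2\<^sup>2 * (270467291 / 200000000))"
    using G zy by (intro mult_mono) auto
  moreover have "1846740459 / 1000000000 * (x2\<^sup>2 * (270467291 / 200000000)) \<le> x2 + 221 / 250000000" by (simp add: x2_def power2_eq_square)
  ultimately have sg1: "\<sigma> \<le> 221 / 250000000" by (simp add: \<sigma>_def)
  define d0 where "d0 = Z - 1 - y0"
  have tangent: "theta y0 b0 e0 + d0 * (y - y0) \<le> theta y b0 e0"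
    using theta_tangent[of y y0 b0 e0] assms(1) by (simp add: d0_def Z_def y0_def b0_def)
  have "theta y b0 e0 \<le> theta y b e"
    using assms by (intro theta_mono) (auto simp: b0_def e0_def)
  then have "s0 + x2\<^sup>2 * (d0 * (y - y0)) \<le> x2 + x2\<^sup>2 * theta y b e + a"
    using mult_left_mono[OF order_trans[OF tangent], of "theta y b e" "x2\<^sup>2"] assms(4)
    by (simp add: s0_def a0_def distrib_left)
  then have "exp (s0 + x2\<^sup>2 * (d0 * (y - y0))) \<le> exp (x2 + x2\<^sup>2 * theta y b e + a)" by simp
  moreover have "exp s0 * (1 + x2\<^sup>2 * (d0 * (y - y0))) \<le> exp (s0 + x2\<^sup>2 * (d0 * (y - y0)))"
    unfolding exp_add by (intro mult_left_mono exp_ge_add_one_self) simp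
  moreover have "exp s0 * (1 + x2\<^sup>2 * (d0 * (y - y0))) = exp s0 + \<sigma> * y - \<sigma> * y0 + x2 * y - x2 * y0"
    by (simp add: \<sigma>_def d0_def algebra_simps)
  moreover have "0 \<le> \<sigma> * y" using sg0 assms(1) by simp
  moreover have "\<sigma> * y0 \<le> 221 / 250000000 * y0" using sg1 by (intro mult_right_mono) (simp_all add: y0_def)
  moreover have "1 + x2 + x2 * y0 + 221 / 250000000 * y0 < 1846740401 / 1000000000" by (simp add: x2_def y0_def)
  ultimately show ?thesis using G(1) by linarith
qed

text \<open>Convergence at some larger \<open>r\<close> provides the functional equation at
  \<open>x2\<close>. The tail series are at least as large as their first twelve terms, and then no
  value of T solves the equation.\<close>

lemma not_summable_above_x2:
  assumes "x2 < r" "r < 1"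
  shows "\<not> summable (\<lambda>n. tc n * r ^ n)"
proof
  assume s: "summable (\<lambda>n. tc n * r ^ n)"
  have sx: "summable (\<lambda>n. tc n * x2 ^ n)" using s assms x2_pos by (intro summable_smaller[of tc r x2]) auto
  then have sl: "summable (\<lambda>n. lc n * x2 ^ n)" using x2_pos by (intro summable_lc) auto
  note T = log_rem_series[OF x2_pos sx tc_nonneg tc_0] and L = log_rem_series[OF x2_pos sl lc_nonneg lc_0]
  have nn: "0 \<le> tc n * log_rem (x2 ^ n)" "0 \<le> lc n * log_rem (x2 ^ n)"
    "0 \<le> tc n * (log_rem (x2 ^ n) - (x2 ^ n)\<^sup>2 / 2)" for n
    using log_rem_power_nonneg[of tc x2 n] log_rem_power_nonneg[of lc x2 n] x2_pos log_rem_minus_sq(1)[OF x2_pos, of n]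
    by (cases "n = 0"; simp)+
  have eq: "tc n * (log_rem (x2 ^ n) - (x2 ^ n)\<^sup>2 / 2) = tc n * log_rem (x2 ^ n) - tc n * (x2\<^sup>2) ^ n / 2" for n
    by (simp add: right_diff_distrib power_mult[symmetric] mult.commute)
  have "(\<lambda>n. tc n * (log_rem (x2 ^ n) - (x2 ^ n)\<^sup>2 / 2)) sums (ps (log_tail tc) x2 - ps tc (x2\<^sup>2) / 2)"
    unfolding eq T(2) using T(1,3) by (intro sums_diff sums_divide) (auto simp: ps_def)
  then have e: "3260523 / 100000000 \<le> ps (log_tail tc) x2 - ps tc (x2\<^sup>2) / 2"
    using head_x2(2) sum_le_suminf[of "\<lambda>n. tc n * (log_rem (x2 ^ n) - (x2 ^ n)\<^sup>2 / 2)" "{..12}"] nn(3)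
    by (simp add: sums_iff)
  have b: "3216457 / 25000000 \<le> ps (log_tail tc) x2"
    unfolding T(2) using head_x2(1) sum_le_suminf[OF T(1), of "{..12}"] nn(1) by simp
  have a: "5559039 / 50000000 \<le> ps (log_tail lc) x2"
    unfolding L(2) using head_x2(3) sum_le_suminf[OF L(1), of "{..12}"] nn(2) by simp
  have "0 \<le> ps tc x2" using sx x2_pos by (intro ps_nonneg) auto
  from no_solution_x2[OF this b e a] show False
    using tree_equation_real[OF x2_pos(1) assms s] by simp
qed

section \<open>The dominant singularity\<close>

lemma summable_complex_of_real_ps:
  assumes "summable (\<lambda>n. c n * r ^ n)"
  shows "summable (\<lambda>n. of_real (c n) * of_real r ^ n :: 'a :: {real_normed_field, banach})"
  using summable_of_real[OF assms, where 'a = 'a] by simp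

lemma ps_has_field_derivative:
  fixes z :: "'a :: {real_normed_field, banach}"
  assumes "summable (\<lambda>n. c n * r ^ n)" "norm z < r"
  shows "(ps c has_field_derivative ps (diffs c) z) (at z)"
proof -
  have "norm z < norm (of_real r :: 'a)" using assms(2) by simp
  from termdiffs_strong[OF summable_complex_of_real_ps[OF assms(1)] this] show ?thesis
    by (simp add: ps_def[abs_def] diffs_def)
qed

lemma summable_diffs:
  fixes r :: real
  assumes "summable (\<lambda>n. c n * r ^ n)" "0 \<le> x" "x < r"
  shows "summable (\<lambda>n. diffs c n * x ^ n)"
proof (rule termdiff_converges)
  show "norm x < r" using assms by simp
  show "summable (\<lambda>n. c n * y ^ n)" if "norm y < r" for y
    by (rule powser_inside[OF assms(1)]) (use that in auto)
qed

lemma diffs_nonneg: "(\<And>n. 0 \<le> c n) \<Longrightarrow> 0 \<le> (diffs c n :: real)"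
  by (simp add: diffs_def)

text \<open>Weierstrass' test: absolute convergence at the radius gives uniform convergence
  including the boundary circle.\<close>

lemma continuous_on_ps:
  fixes c :: "nat \<Rightarrow> real"
  assumes "summable (\<lambda>n. c n * r ^ n)" "\<And>n. 0 \<le> c n"
  shows "continuous_on (cball 0 r) (ps c :: 'a \<Rightarrow> 'a :: {real_normed_field, banach})"
proof -
  have "uniform_limit (cball 0 r) (\<lambda>n z. \<Sum>i<n. of_real (c i) * z ^ i) (\<lambda>z :: 'a. \<Sum>i. of_real (c i) * z ^ i) sequentially"
  proof (rule Weierstrass_m_test)
    fix n and z :: 'a assume "z \<in> cball 0 r"
    then have "norm z ^ n \<le> r ^ n" by (intro power_mono) auto
    then show "norm (of_real (c n) * z ^ n) \<le> c n * r ^ n"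
      using assms(2) by (simp add: norm_mult norm_power mult_left_mono)
  qed (rule assms)
  then have "continuous_on (cball 0 r) (\<lambda>z :: 'a. \<Sum>i. of_real (c i) * z ^ i)"
    by (rule uniform_limit_theorem[rotated]) (auto intro!: always_eventually continuous_intros)
  then show ?thesis by (simp add: ps_def[abs_def])
qed

text \<open>The coefficients of \<open>B(z) - T(z^2) / 2 = (\<Sum>k\<ge>3. T(z^k) / k)\<close>.\<close>

definition ec :: "nat \<Rightarrow> real" where
  "ec n = log_tail tc n - (if even n then tc (n div 2) else 0) / 2"

text \<open>For n = 2 m the divisor m contributes exactly the subtracted term tc m / 2.\<close>

lemma ec_nonneg [simp]: "0 \<le> ec n"
proof (cases "even n \<and> n > 0")
  case True
  then obtain m where m: "n = 2 * m" "m > 0" by (auto elim!: evenE)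
  have "(\<Sum>d\<in>{m}. real d * tc d) \<le> (\<Sum>d | d \<in> {1..<n} \<and> d dvd n. real d * tc d)"
    by (rule sum_mono2) (use m in auto)
  then have "real m * tc m / real n \<le> log_tail tc n"
    unfolding log_tail_def by (intro divide_right_mono) auto
  then show ?thesis using m by (simp add: ec_def)
next
  case False
  then show ?thesis using log_tail_nonneg[of tc n] by (cases "n = 0") (auto simp: ec_def)
qed

lemma ec_0 [simp]: "ec 0 = 0"
  by (simp add: ec_def)

definition rho :: real where
  "rho = Sup {x. 0 \<le> x \<and> summable (\<lambda>n. tc n * x ^ n)}"

section \<open>The radius of convergence\<close>

lemma le_x2_if_summable:
  assumes "0 \<le> x" "summable (\<lambda>n. tc n * x ^ n)"
  shows "x \<le> x2"
proof (rule ccontr)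
  assume "\<not> x \<le> x2"
  then obtain r where r: "x2 < r" "r < x" "r < 1" using x2_pos dense[of x2 "min x 1"] by auto
  have "summable (\<lambda>n. tc n * r ^ n)" using assms r x2_pos by (intro summable_smaller[of tc x r]) auto
  then show False using not_summable_above_x2[OF r(1,3)] by blast
qed

lemma bdd_above_summable: "bdd_above {x. 0 \<le> x \<and> summable (\<lambda>n. tc n * x ^ n)}"
  using le_x2_if_summable by (intro bdd_aboveI[of _ x2]) auto

lemma rho_bounds: "x1 \<le> rho" "rho \<le> x2"
proof -
  show "x1 \<le> rho" unfolding rho_def
    by (rule cSup_upper[OF _ bdd_above_summable]) (use summable_x1 x1_pos in simp)
  show "rho \<le> x2" unfolding rho_def
  proof (rule cSup_least)
    show "{x. 0 \<le> x \<and> summable (\<lambda>n. tc n * x ^ n)} \<noteq> {}"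
      using summable_x1 less_imp_le[OF x1_pos(1)] by blast
  qed (use le_x2_if_summable in blast)
qed

lemma rho_numeric: "2 / 5 < rho" "rho < 401 / 1000" "0 < rho" "rho < 3 / 5"
  using rho_bounds by (simp_all add: x1_def x2_def)

lemma summable_below_rho:
  assumes "0 \<le> x" "x < rho"
  shows "summable (\<lambda>n. tc n * x ^ n)"
proof -
  obtain r where "x < r" "0 \<le> r" "summable (\<lambda>n. tc n * r ^ n)"
    using assms(2) less_cSup_iff[OF _ bdd_above_summable, of x] summable_x1 x1_pos unfolding rho_def by fastforce
  then show ?thesis using assms by (intro summable_smaller[of tc r x]) auto
qed

lemma not_summable_above_rho: "rho < x \<Longrightarrow> \<not> summable (\<lambda>n. tc n * x ^ n)"
  using cSup_upper[OF _ bdd_above_summable, of x] rho_numeric unfolding rho_def[symmetric] by force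

text \<open>3/5 lies above \<open>rho\<close> while its square 0.36 lies below. The point 1/2 in
  between serves for the derivatives of these series.\<close>

lemma summable_log_tail_beyond:
  shows "summable (\<lambda>n. log_tail tc n * (3 / 5) ^ n)" "summable (\<lambda>n. log_tail lc n * (3 / 5) ^ n)"
    "summable (\<lambda>n. tc n * ((3 / 5)\<^sup>2) ^ n)"
proof -
  show t: "summable (\<lambda>n. tc n * ((3 / 5)\<^sup>2) ^ n)"
    by (rule summable_below_rho) (use rho_numeric in \<open>simp_all add: power2_eq_square\<close>)
  then have l: "summable (\<lambda>n. lc n * ((3 / 5)\<^sup>2) ^ n)" by (intro summable_lc) auto
  show "summable (\<lambda>n. log_tail tc n * (3 / 5) ^ n)"
    by (rule sums_summable[OF log_tail_sums[OF _ _ _ _ t]]) auto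
  show "summable (\<lambda>n. log_tail lc n * (3 / 5) ^ n)"
    by (rule sums_summable[OF log_tail_sums[OF _ _ _ _ l]]) auto
qed

lemma ps_ec:
  fixes z :: "'a :: {real_normed_field, banach}"
  assumes "norm z \<le> 3 / 5"
  shows "(\<lambda>n. of_real (ec n) * z ^ n) sums (ps (log_tail tc) z - ps tc (z\<^sup>2) / 2)"
proof -
  have "norm (z\<^sup>2) \<le> (3 / 5)\<^sup>2" using assms by (simp add: norm_power power_mono)
  then have "(\<lambda>n. of_real (log_tail tc n) * z ^ n - of_real (if even n then tc (n div 2) else 0) * z ^ n / 2)
      sums (ps (log_tail tc) z - ps tc (z\<^sup>2) / 2)"
    using assms by (intro sums_diff sums_divide even_ps_sums[OF summable_log_tail_beyond(3)]
        ps_sums[OF summable_log_tail_beyond(1)] log_tail_nonneg) auto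
  moreover have "of_real (log_tail tc n) * z ^ n - of_real (if even n then tc (n div 2) else 0) * z ^ n / 2 = of_real (ec n) * z ^ n" for n
    by (simp only: ec_def of_real_diff of_real_divide of_real_numeral left_diff_distrib times_divide_eq_left)
  ultimately show ?thesis by simp
qed

lemma ps_ec_eq: "norm z \<le> 3 / 5 \<Longrightarrow> ps ec z = ps (log_tail tc) z - ps tc (z\<^sup>2) / 2"
  using ps_ec[of z] by (simp add: ps_def sums_iff)

lemma summable_ec_beyond: "summable (\<lambda>n. ec n * (3 / 5) ^ n)"
  using sums_summable[OF ps_ec[of "3 / 5 :: real"]] by simp

text \<open>Without the tail terms \<open>theta\<close> is the exponential minus its quadratic
  Taylor polynomial, which is at least the cubic term.\<close>

lemma theta_lower: "0 \<le> y \<Longrightarrow> 0 \<le> b \<Longrightarrow> 0 \<le> e \<Longrightarrow> y ^ 3 / 6 \<le> theta y b e"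
proof -
  assume a: "0 \<le> y" "0 \<le> b" "0 \<le> e"
  have "(\<Sum>m<4. y ^ m / fact m) \<le> exp y"
    using exp_lower_Taylor_quadratic[of y] a Maclaurin_exp_le[of y 4] by auto
  then have "y ^ 3 / 6 \<le> theta y 0 0"
    by (simp add: theta_def eval_nat_numeral)
  also have "\<dots> \<le> theta y b e" using a by (intro theta_mono) auto
  finally show ?thesis .
qed

lemma ps_log_tail_nonneg:
  assumes "0 \<le> (x :: real)" "x \<le> 3 / 5"
  shows "0 \<le> ps (log_tail tc) x" "0 \<le> ps (log_tail lc) x" "0 \<le> ps ec x"
  using assms by (intro ps_nonneg log_tail_nonneg
    summable_smaller[OF summable_log_tail_beyond(1)] summable_smaller[OF summable_log_tail_beyond(2)] summable_smaller[OF summable_ec_beyond];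
    simp add: log_tail_nonneg)+

text \<open>The functional equation gives x T \<ge> x^2 T^3 / 6, so x T^2 \<le> 6: the cubic growth
  of the right-hand side keeps T bounded up to the radius. With x \<ge> 1/5 this means T^2 \<le>
  30.\<close>

lemma tree_series_le:
  assumes "1 / 5 \<le> x" "x < rho"
  shows "ps tc x \<le> 6"
proof -
  define y where "y = ps tc x"
  define r where "r = (x + rho) / 2"
  have r: "x < r" "r < rho" using assms by (auto simp: r_def)
  have x: "0 < x" "x < 3 / 5" using assms rho_numeric by auto
  have sr: "summable (\<lambda>n. tc n * r ^ n)" using r x by (intro summable_below_rho) auto
  have y: "0 \<le> y" unfolding y_def using assms x by (intro ps_nonneg summable_below_rho) auto
  have "1 + x + x * y = exp (x + x\<^sup>2 * theta y (ps (log_tail tc) x) (ps ec x) + ps (log_tail lc) x)"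
    using tree_equation_real[OF x(1) r(1) _ sr] r rho_numeric x by (simp add: y_def ps_ec_eq)
  moreover have "x\<^sup>2 * (y ^ 3 / 6) \<le> x\<^sup>2 * theta y (ps (log_tail tc) x) (ps ec x)"
    using y x by (intro mult_left_mono theta_lower ps_log_tail_nonneg) auto
  ultimately have "1 + (x + x\<^sup>2 * (y ^ 3 / 6)) \<le> 1 + x + x * y"
    using exp_ge_add_one_self[of "x + x\<^sup>2 * theta y (ps (log_tail tc) x) (ps ec x) + ps (log_tail lc) x"]
      ps_log_tail_nonneg(2)[of x] x by linarith
  then have "x * (x * y ^ 3) \<le> x * (6 * y)" by (simp add: power2_eq_square)
  then have *: "x * y ^ 3 \<le> 6 * y" using x by (simp only: mult_le_cancel_left_pos)
  show ?thesis unfolding y_def[symmetric]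
  proof (rule ccontr)
    assume "\<not> y \<le> 6"
    then have y6: "6 < y" by simp
    have "6 * y < (1 / 5) * (6 * 6) * y" using y6 by simp
    also have "\<dots> \<le> x * (y * y) * y" using y6 assms x by (intro mult_mono mult_right_mono) auto
    finally show False using * by (simp add: power3_eq_cube mult_ac)
  qed
qed

text \<open>The uniform bound passes to \<open>rho\<close> in each partial sum by letting x increase
  to \<open>rho\<close>.\<close>

lemma summable_rho: "summable (\<lambda>n. tc n * rho ^ n)"
proof (rule tree_bound_summable(1)[OF _ rho_numeric(3)])
  fix N
  have "((\<lambda>x. \<Sum>n\<le>N. tc n * x ^ n) \<longlongrightarrow> (\<Sum>n\<le>N. tc n * rho ^ n)) (at_left rho)"
    by (intro tendsto_intros)
  moreover have "\<forall>\<^sub>F x in at_left rho. (\<Sum>n\<le>N. tc n * x ^ n) \<le> 6"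
  proof -
    have "(\<Sum>n\<le>N. tc n * x ^ n) \<le> 6" if "2 / 5 < x" "x < rho" for x
      using ps_ge_partial[OF summable_below_rho[of x], of "{..N}"] tree_series_le[of x] that by simp
    then show ?thesis using eventually_at_left_real[OF rho_numeric(1)] by (auto elim!: eventually_mono)
  qed
  ultimately show "(\<Sum>n\<le>N. tc n * rho ^ n) \<le> 6"
    by (rule tendsto_upperbound) simp
qed

text \<open>\<open>H\<close>, \<open>M\<close> and \<open>F\<close> are the series of multisets of trees, of multisets of leaves, and of multisets of at
  least three trees. The others are defined such that \<open>x (1 - K) T' = N\<close> and \<open>K' = U T' + V\<close>.\<close>

abbreviation "Ts \<equiv> ps tc"
abbreviation "Bs \<equiv> ps (log_tail tc)"
abbreviation "Es \<equiv> ps ec"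
abbreviation "As \<equiv> ps (log_tail lc)"
abbreviation "dT \<equiv> ps (diffs tc)"
abbreviation "dB \<equiv> ps (diffs (log_tail tc))"
abbreviation "dE \<equiv> ps (diffs ec)"
abbreviation "dA \<equiv> ps (diffs (log_tail lc))"

definition Hs :: "'a \<Rightarrow> 'a :: {real_normed_field, banach}" where
  "Hs z = exp (Ts z + Bs z)"
definition Ms :: "'a \<Rightarrow> 'a :: {real_normed_field, banach}" where
  "Ms z = 1 + z + z * Ts z"
definition Fs :: "'a \<Rightarrow> 'a :: {real_normed_field, banach}" where
  "Fs z = Hs z - 1 - Ts z - (Ts z)\<^sup>2 / 2 - Bs z + Es z"
definition Ps :: "'a \<Rightarrow> 'a :: {real_normed_field, banach}" where
  "Ps z = Hs z - 1 - Ts z"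
definition Ks :: "'a \<Rightarrow> 'a :: {real_normed_field, banach}" where
  "Ks z = z * Ms z * Ps z"
definition Ns :: "'a \<Rightarrow> 'a :: {real_normed_field, banach}" where
  "Ns z = Ms z * (1 + 2 * z * Fs z + z\<^sup>2 * (dB z * (Hs z - 1) + dE z) + dA z) - 1 - Ts z"
definition Us :: "'a \<Rightarrow> 'a :: {real_normed_field, banach}" where
  "Us z = z\<^sup>2 * Ps z + z * Ms z * (Hs z - 1)"
definition Vs :: "'a \<Rightarrow> 'a :: {real_normed_field, banach}" where
  "Vs z = Ms z * Ps z + z * (1 + Ts z) * Ps z + z * Ms z * (dB z * Hs z)"

section \<open>Continuity and identities up to the boundary circle\<close>

lemma continuous_Ts: "continuous_on (cball 0 rho) (Ts :: 'a \<Rightarrow> 'a :: {real_normed_field, banach})"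
  by (rule continuous_on_ps[OF summable_rho]) simp

lemma continuous_series:
  "continuous_on (cball 0 (3 / 5)) (Bs :: 'a \<Rightarrow> 'a :: {real_normed_field, banach})"
  "continuous_on (cball 0 (3 / 5)) (Es :: 'a \<Rightarrow> 'a :: {real_normed_field, banach})"
  "continuous_on (cball 0 (3 / 5)) (As :: 'a \<Rightarrow> 'a :: {real_normed_field, banach})"
  by (intro continuous_on_ps summable_log_tail_beyond summable_ec_beyond log_tail_nonneg; simp)+

lemma summable_diffs_half:
  "summable (\<lambda>n. diffs (log_tail tc) n * (1 / 2) ^ n)"
  "summable (\<lambda>n. diffs ec n * (1 / 2) ^ n)"
  "summable (\<lambda>n. diffs (log_tail lc) n * (1 / 2) ^ n)"
  by (rule summable_diffs[OF summable_log_tail_beyond(1)] summable_diffs[OF summable_ec_beyond]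
      summable_diffs[OF summable_log_tail_beyond(2)]; simp)+

lemma continuous_dseries:
  "continuous_on (cball 0 (1 / 2)) (dB :: 'a \<Rightarrow> 'a :: {real_normed_field, banach})"
  "continuous_on (cball 0 (1 / 2)) (dE :: 'a \<Rightarrow> 'a :: {real_normed_field, banach})"
  "continuous_on (cball 0 (1 / 2)) (dA :: 'a \<Rightarrow> 'a :: {real_normed_field, banach})"
  by (intro continuous_on_ps summable_diffs_half diffs_nonneg log_tail_nonneg; simp)+

lemma cball_rho_subset: "cball (0 :: 'a :: real_normed_vector) rho \<subseteq> cball 0 (1 / 2)"
  "cball (0 :: 'a) rho \<subseteq> cball 0 (3 / 5)"
  using rho_numeric by auto

lemmas continuous_rho [continuous_intros] = continuous_Ts
  continuous_on_subset[OF continuous_series(1) cball_rho_subset(2)]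
  continuous_on_subset[OF continuous_series(2) cball_rho_subset(2)]
  continuous_on_subset[OF continuous_series(3) cball_rho_subset(2)]
  continuous_on_subset[OF continuous_dseries(1) cball_rho_subset(1)]
  continuous_on_subset[OF continuous_dseries(2) cball_rho_subset(1)]
  continuous_on_subset[OF continuous_dseries(3) cball_rho_subset(1)]

lemma continuous_rho_functions [continuous_intros]:
  "continuous_on (cball 0 rho) (Hs :: 'a \<Rightarrow> 'a :: {real_normed_field, banach})"
  "continuous_on (cball 0 rho) (Ms :: 'a \<Rightarrow> 'a)"
  "continuous_on (cball 0 rho) (Fs :: 'a \<Rightarrow> 'a)"
  "continuous_on (cball 0 rho) (Ps :: 'a \<Rightarrow> 'a)"
  "continuous_on (cball 0 rho) (Ks :: 'a \<Rightarrow> 'a)"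
  "continuous_on (cball 0 rho) (Ns :: 'a \<Rightarrow> 'a)"
  "continuous_on (cball 0 rho) (Us :: 'a \<Rightarrow> 'a)"
  "continuous_on (cball 0 rho) (Vs :: 'a \<Rightarrow> 'a)"
  unfolding Hs_def[abs_def] Ms_def[abs_def] Fs_def[abs_def] Ps_def[abs_def] Ks_def[abs_def] Ns_def[abs_def] Us_def[abs_def] Vs_def[abs_def]
  by (intro continuous_intros; simp)+

lemma functional_equation:
  fixes z :: complex
  assumes "norm z \<le> rho"
  shows "Ms z = exp (z + z\<^sup>2 * Fs z + As z)"
proof -
  define f where "f z = Ms z - exp (z + z\<^sup>2 * Fs z + As z)" for z :: complex
  have "f z = 0" if z: "norm z < rho" for z
  proof -
    obtain r where r: "norm z < r" "r < rho" using dense[OF z] by auto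
    have r0: "0 < r" using r(1) norm_ge_zero[of z] by linarith
    have sr: "summable (\<lambda>n. tc n * r ^ n)" using r r0 by (intro summable_below_rho) auto
    have "Fs z = exp (Ts z + Bs z) - 1 - Ts z - ((Ts z)\<^sup>2 + Ts (z\<^sup>2)) / 2"
      using ps_ec_eq[of z] r rho_numeric by (simp add: Fs_def Hs_def add_divide_distrib)
    then show ?thesis
      using tree_equation[OF r0 _ r(1) sr] r rho_numeric by (simp add: f_def Ms_def)
  qed
  moreover have "continuous_on (cball 0 rho) f"
    unfolding f_def by (intro continuous_intros)
  ultimately have "f z = 0"
    using rho_numeric assms by (intro continuous_constant_on_closure[of "ball 0 rho" f 0 z]) auto
  then show ?thesis by (simp add: f_def)
qed

lemma series_derivatives:
  fixes z :: "'a :: {real_normed_field, banach}"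
  assumes "norm z < rho"
  shows "(Ts has_field_derivative dT z) (at z)" "(Bs has_field_derivative dB z) (at z)"
    "(Es has_field_derivative dE z) (at z)" "(As has_field_derivative dA z) (at z)"
  by (rule ps_has_field_derivative[OF summable_rho] ps_has_field_derivative[OF summable_log_tail_beyond(1)]
     ps_has_field_derivative[OF summable_log_tail_beyond(2)] ps_has_field_derivative[OF summable_ec_beyond];
     use assms rho_numeric in simp)+

lemma function_derivatives:
  fixes z :: "'a :: {real_normed_field, banach}"
  assumes "norm z < rho"
  shows "(Hs has_field_derivative Hs z * (dT z + dB z)) (at z)"
    "(Ms has_field_derivative 1 + Ts z + z * dT z) (at z)"
    "(Fs has_field_derivative dT z * Ps z + dB z * (Hs z - 1) + dE z) (at z)"
    "(Ps has_field_derivative dT z * (Hs z - 1) + dB z * Hs z) (at z)"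
proof -
  note d = series_derivatives[OF assms]
  show H: "(Hs has_field_derivative Hs z * (dT z + dB z)) (at z)"
    unfolding Hs_def[abs_def] by (auto intro!: derivative_eq_intros d)
  show "(Ms has_field_derivative 1 + Ts z + z * dT z) (at z)"
    unfolding Ms_def[abs_def] by (auto intro!: derivative_eq_intros d)
  show "(Fs has_field_derivative dT z * Ps z + dB z * (Hs z - 1) + dE z) (at z)"
  proof -
    have "((\<lambda>z. (Ts z)\<^sup>2 / 2) has_field_derivative Ts z * dT z) (at z)"
      by (auto intro!: derivative_eq_intros d)
    from DERIV_add[OF DERIV_diff[OF DERIV_diff[OF DERIV_diff[OF DERIV_diff[OF H DERIV_const] d(1)] this] d(2)] d(3)]
    show ?thesis unfolding Fs_def[abs_def] Ps_def
      by (rule DERIV_cong) (simp add: algebra_simps)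
  qed
  show "(Ps has_field_derivative dT z * (Hs z - 1) + dB z * Hs z) (at z)"
    unfolding Ps_def[abs_def] by (rule derivative_eq_intros d H HOL.refl)+ (simp add: algebra_simps)
qed

lemma Ks_derivative:
  fixes z :: "'a :: {real_normed_field, banach}"
  assumes "norm z < rho"
  shows "(Ks has_field_derivative Us z * dT z + Vs z) (at z)"
  unfolding Ks_def[abs_def]
  by (rule derivative_eq_intros function_derivatives[OF assms] HOL.refl)+
    (simp add: Us_def Vs_def algebra_simps power2_eq_square)

lemma derivative_equation:
  fixes z :: complex
  assumes z: "norm z < rho"
  shows "z * (1 - Ks z) * dT z = Ns z"
proof -
  note d = series_derivatives[OF z] function_derivatives[OF z]
  let ?R = "1 + 2 * z * Fs z + z\<^sup>2 * (dT z * Ps z + dB z * (Hs z - 1) + dE z) + dA z"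
  have "((\<lambda>z. exp (z + z\<^sup>2 * Fs z + As z)) has_field_derivative exp (z + z\<^sup>2 * Fs z + As z) * ?R) (at z)"
    by (rule derivative_eq_intros d HOL.refl)+ (simp add: algebra_simps power2_eq_square)
  then have "(Ms has_field_derivative Ms z * ?R) (at z)"
  proof (rule DERIV_cong_ev[THEN iffD1, rotated 3, OF _ HOL.refl])
    show "\<forall>\<^sub>F x in nhds z. exp (x + x\<^sup>2 * Fs x + As x) = Ms x"
      using eventually_nhds_in_open[of "ball 0 rho" z] z
      by (auto elim!: eventually_mono simp: functional_equation[symmetric])
    show "exp (z + z\<^sup>2 * Fs z + As z) * ?R = Ms z * ?R" using functional_equation[of z] z by simp
  qed
  then have "Ms z * ?R = 1 + Ts z + z * dT z" using d(6) by (rule DERIV_unique)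
  then show ?thesis by (simp add: Ns_def Ks_def algebra_simps power2_eq_square)
qed

lemma of_real_series:
  assumes "0 \<le> x" "x \<le> rho"
  shows "Ts (of_real x :: 'a :: {real_normed_field, banach}) = of_real (Ts x)"
    "Bs (of_real x :: 'a) = of_real (Bs x)" "Es (of_real x :: 'a) = of_real (Es x)" "As (of_real x :: 'a) = of_real (As x)"
    "dB (of_real x :: 'a) = of_real (dB x)" "dE (of_real x :: 'a) = of_real (dE x)" "dA (of_real x :: 'a) = of_real (dA x)"
  by (intro ps_of_real summable_smaller[OF summable_rho] summable_smaller[OF summable_log_tail_beyond(1)]
      summable_smaller[OF summable_log_tail_beyond(2)] summable_smaller[OF summable_ec_beyond]
      summable_smaller[OF summable_diffs_half(1)] summable_smaller[OF summable_diffs_half(2)]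
      summable_smaller[OF summable_diffs_half(3)] diffs_nonneg log_tail_nonneg;
      use assms rho_numeric in simp)+

lemma of_real_functions:
  assumes "0 \<le> x" "x \<le> rho"
  shows "Hs (of_real x :: 'a :: {real_normed_field, banach}) = of_real (Hs x)"
    "Ms (of_real x :: 'a) = of_real (Ms x)" "Fs (of_real x :: 'a) = of_real (Fs x)" "Ps (of_real x :: 'a) = of_real (Ps x)"
    "Ks (of_real x :: 'a) = of_real (Ks x)" "Ns (of_real x :: 'a) = of_real (Ns x)" "Us (of_real x :: 'a) = of_real (Us x)"
proof -
  show H: "Hs (of_real x :: 'a) = of_real (Hs x)"
    by (simp add: Hs_def of_real_series[OF assms] flip: exp_of_real)
  show M: "Ms (of_real x :: 'a) = of_real (Ms x)" by (simp add: Ms_def of_real_series[OF assms])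
  show F: "Fs (of_real x :: 'a) = of_real (Fs x)" by (simp add: Fs_def of_real_series[OF assms] H)
  show P: "Ps (of_real x :: 'a) = of_real (Ps x)" by (simp add: Ps_def of_real_series[OF assms] H)
  show "Ks (of_real x :: 'a) = of_real (Ks x)" "Ns (of_real x :: 'a) = of_real (Ns x)" "Us (of_real x :: 'a) = of_real (Us x)"
    by (simp_all add: Ks_def Ns_def Us_def of_real_series[OF assms] H M F P)
qed

lemma functional_equation_real:
  assumes "0 \<le> x" "x \<le> rho"
  shows "Ms x = exp (x + x\<^sup>2 * Fs x + As x)"
proof -
  have "complex_of_real (Ms x) = of_real (exp (x + x\<^sup>2 * Fs x + As x))"
    using functional_equation[of "of_real x"] assms
    by (simp add: of_real_functions of_real_series flip: exp_of_real)
  then show ?thesis by (simp only: of_real_eq_iff)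
qed

lemma derivative_equation_real:
  assumes "0 \<le> x" "x < rho"
  shows "x * (1 - Ks x) * dT x = Ns x"
proof -
  have s: "summable (\<lambda>n. diffs tc n * x ^ n)" by (rule summable_diffs[OF summable_rho assms])
  have "complex_of_real (x * (1 - Ks x) * dT x) = of_real (Ns x)"
    using derivative_equation[of "of_real x"] assms
    by (simp add: of_real_functions ps_of_real[OF s])
  then show ?thesis by (simp only: of_real_eq_iff)
qed

section \<open>Positivity on the real segment and the value of K at \<open>rho\<close>\<close>

lemma series_nonneg:
  assumes "0 \<le> (x :: real)" "x \<le> rho"
  shows "0 \<le> Ts x" "0 \<le> Bs x" "0 \<le> Es x" "0 \<le> As x" "0 \<le> dB x" "0 \<le> dE x" "0 \<le> dA x" "x \<le> Ts x"
proof -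
  show "0 \<le> Ts x" "0 \<le> Bs x" "0 \<le> Es x" "0 \<le> As x" "0 \<le> dB x" "0 \<le> dE x" "0 \<le> dA x"
    using assms rho_numeric
    by (intro ps_nonneg summable_smaller[OF summable_rho] summable_smaller[OF summable_log_tail_beyond(1)]
      summable_smaller[OF summable_log_tail_beyond(2)] summable_smaller[OF summable_ec_beyond]
      summable_smaller[OF summable_diffs_half(1)] summable_smaller[OF summable_diffs_half(2)]
      summable_smaller[OF summable_diffs_half(3)] diffs_nonneg log_tail_nonneg; simp)+
  have "summable (\<lambda>n. tc n * x ^ n)" using assms by (intro summable_smaller[OF summable_rho]) auto
  from ps_ge_partial[OF this, of "{1}"] show "x \<le> Ts x" using assms by (simp add: values_12)
qed

lemma Fs_eq_theta: "Fs x = theta (Ts x) (Bs x) (Es x)"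
  by (simp add: Fs_def Hs_def theta_def)

lemma Fs_pos:
  assumes "0 < x" "x \<le> rho"
  shows "0 < Fs x"
proof -
  have "0 < Ts x ^ 3 / 6" using series_nonneg(8)[of x] assms by simp
  also have "\<dots> \<le> Fs x" unfolding Fs_eq_theta using assms by (intro theta_lower series_nonneg) auto
  finally show ?thesis .
qed

lemma Ps_pos:
  assumes "0 < x" "x \<le> rho"
  shows "0 < Ps x" "0 < Ms x" "1 < Hs x"
proof -
  have t: "0 < Ts x" "0 \<le> Bs x" using series_nonneg(2,8)[of x] assms by auto
  have "1 + Ts x < exp (Ts x)" using exp_lower_Taylor_quadratic[of "Ts x"] t zero_less_power[of "Ts x" 2] by linarith
  also have "\<dots> \<le> Hs x" using t by (simp add: Hs_def)
  finally show "0 < Ps x" "1 < Hs x" using t by (simp_all add: Ps_def)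
  show "0 < Ms x" using assms t by (simp add: Ms_def add_pos_nonneg)
qed

text \<open>The constant term vanishes, and on the right the n-th term is multiplied by n \<ge>
  1.\<close>

lemma As_le:
  assumes "0 \<le> x" "x \<le> rho"
  shows "As x \<le> x * dA x"
proof -
  have s: "summable (\<lambda>n. log_tail lc n * x ^ n)"
    using assms rho_numeric by (intro summable_smaller[OF summable_log_tail_beyond(2)] log_tail_nonneg) auto
  have s': "summable (\<lambda>n. diffs (log_tail lc) n * x ^ n)"
    using assms rho_numeric by (intro summable_smaller[OF summable_diffs_half(3)] diffs_nonneg log_tail_nonneg) auto
  have "As x = (\<Sum>n. log_tail lc (Suc n) * x ^ Suc n)"
    using suminf_split_head[OF s] by (simp add: ps_def)
  also have "\<dots> \<le> (\<Sum>n. x * (diffs (log_tail lc) n * x ^ n))"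
  proof (rule suminf_le)
    show "log_tail lc (Suc n) * x ^ Suc n \<le> x * (diffs (log_tail lc) n * x ^ n)" for n
    proof -
      have "1 * (log_tail lc (Suc n) * x ^ Suc n) \<le> real (Suc n) * (log_tail lc (Suc n) * x ^ Suc n)"
        using assms by (intro mult_right_mono mult_nonneg_nonneg log_tail_nonneg) auto
      then show ?thesis by (simp add: diffs_def algebra_simps)
    qed
    show "summable (\<lambda>n. log_tail lc (Suc n) * x ^ Suc n)"
      using s summable_Suc_iff[of "\<lambda>n. log_tail lc n * x ^ n"] by blast
  qed (intro summable_mult s')
  also have "\<dots> = x * dA x" using suminf_mult[OF s'] by (simp add: ps_def)
  finally show ?thesis .
qed

text \<open>Let S = log M. From 1 - exp (-S) \<le> S one gets x (1 + T) = M - 1 \<le> S M. Moreover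
  S is less than x times its derivative taken without the terms in T', because x^2 F gets doubled
  and A \<le> x A'.\<close>

lemma Ns_pos:
  assumes x: "0 < x" "x \<le> rho"
  shows "0 < Ns x"
proof -
  define S where "S = x + x\<^sup>2 * Fs x + As x"
  define R where "R = x\<^sup>2 * (dB x * (Hs x - 1) + dE x)"
  have M: "Ms x = exp S" using functional_equation_real[of x] x by (simp add: S_def)
  have "(1 - S) * Ms x \<le> exp (- S) * Ms x"
    using exp_ge_add_one_self[of "- S"] Ps_pos[OF x] by (intro mult_right_mono) auto
  then have "Ms x - S * Ms x \<le> 1" by (simp add: M algebra_simps flip: exp_add)
  moreover have "Ms x - 1 = x * (1 + Ts x)" by (simp add: Ms_def algebra_simps)
  ultimately have 1: "x * (1 + Ts x) \<le> S * Ms x" by linarith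
  have R: "0 \<le> R" unfolding R_def
    using series_nonneg[of x] x Ps_pos[OF x] by (intro mult_nonneg_nonneg add_nonneg_nonneg) auto
  have "0 < x\<^sup>2 * Fs x" using Fs_pos[OF x] x by simp
  then have "S < x * (1 + 2 * x * Fs x + R + dA x)"
    using As_le[of x] x mult_nonneg_nonneg[OF less_imp_le[OF x(1)] R] by (simp add: S_def power2_eq_square algebra_simps)
  then have "S * Ms x < x * (1 + 2 * x * Fs x + R + dA x) * Ms x"
    using Ps_pos[OF x] by (intro mult_strict_right_mono) auto
  with 1 have "x * (1 + Ts x) < x * ((1 + 2 * x * Fs x + R + dA x) * Ms x)" by (simp add: mult.assoc)
  then have "1 + Ts x < (1 + 2 * x * Fs x + R + dA x) * Ms x" using x by (simp only: mult_less_cancel_left_pos)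
  then show ?thesis by (simp add: Ns_def R_def mult.commute)
qed

text \<open>In x (1 - K) T' = N the right-hand side is positive and T' is non-negative.\<close>

lemma Ks_less_1:
  assumes "0 < x" "x < rho"
  shows "Ks x < 1"
proof (rule ccontr)
  assume "\<not> Ks x < 1"
  moreover have "0 \<le> dT x"
    using assms by (intro ps_nonneg summable_diffs[OF summable_rho] diffs_nonneg) auto
  ultimately have "x * (1 - Ks x) * dT x \<le> 0" using assms
    by (intro mult_nonpos_nonneg mult_nonneg_nonpos) auto
  then show False using derivative_equation_real[of x] Ns_pos[of x] assms by simp
qed

lemma Ks_rho_le: "Ks rho \<le> 1"
proof -
  have "(Ks \<longlongrightarrow> Ks rho) (at rho within cball 0 rho)"
    using continuous_rho_functions(5)[where 'a = real] rho_numeric(3) by (auto simp: continuous_on_def)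
  then have "(Ks \<longlongrightarrow> Ks rho) (at rho within {0..rho})"
    by (rule tendsto_within_subset) auto
  then have "(Ks \<longlongrightarrow> Ks rho) (at_left rho)"
    using at_within_Icc_at_left[OF rho_numeric(3)] by simp
  moreover have "\<forall>\<^sub>F x in at_left rho. Ks x \<le> 1"
    using eventually_at_left_real[OF rho_numeric(3)] Ks_less_1 by (auto elim!: eventually_mono intro: less_imp_le)
  ultimately show ?thesis by (rule tendsto_upperbound) simp
qed

lemma log_rem_sums_series:
  fixes x :: real
  assumes "0 \<le> x" "x \<le> 3 / 5"
  shows "(\<lambda>n. tc n * log_rem (x ^ n)) sums Bs x" "(\<lambda>n. lc n * log_rem (x ^ n)) sums As x"
    "(\<lambda>n. tc n * (log_rem (x ^ n) - (x ^ n)\<^sup>2 / 2)) sums Es x"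
proof -
  have x2: "x\<^sup>2 \<le> (3 / 5)\<^sup>2" using assms by (intro power_mono) auto
  have st: "summable (\<lambda>n. tc n * (x\<^sup>2) ^ n)"
    using x2 by (intro summable_smaller[OF summable_log_tail_beyond(3)]) auto
  have sl: "summable (\<lambda>n. lc n * (x\<^sup>2) ^ n)" using st by (intro summable_lc) auto
  have "summable (\<lambda>n. tc n * log_rem (x ^ n))" using assms by (intro summable_log_rem st) auto
  then show B: "(\<lambda>n. tc n * log_rem (x ^ n)) sums Bs x"
    using log_tail_sums[of tc x] st assms by (simp add: ps_def sums_iff)
  have "summable (\<lambda>n. lc n * log_rem (x ^ n))" using assms by (intro summable_log_rem sl) auto
  then show "(\<lambda>n. lc n * log_rem (x ^ n)) sums As x"
    using log_tail_sums[of lc x] sl assms by (simp add: ps_def sums_iff)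
  have "(\<lambda>n. tc n * log_rem (x ^ n) - tc n * (x\<^sup>2) ^ n / 2) sums (Bs x - Ts (x\<^sup>2) / 2)"
    using st by (intro sums_diff sums_divide B) (simp add: ps_def summable_sums)
  moreover have "tc n * log_rem (x ^ n) - tc n * (x\<^sup>2) ^ n / 2 = tc n * (log_rem (x ^ n) - (x ^ n)\<^sup>2 / 2)" for n
    by (simp add: right_diff_distrib power_mult[symmetric] mult.commute)
  ultimately show "(\<lambda>n. tc n * (log_rem (x ^ n) - (x ^ n)\<^sup>2 / 2)) sums Es x"
    using assms by (simp add: ps_ec_eq)
qed

text \<open>The tail series still converge up to 3/5, so a supersolution formed with them makes
  sense beyond \<open>rho\<close> and forces convergence through the induction on
  coefficients.\<close>

lemma convergence_criterion:
  assumes x: "0 < x" "x \<le> 3 / 5" and y: "0 \<le> y"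
    and ineq: "exp (x + x\<^sup>2 * theta y (Bs x) (Es x) + As x) \<le> 1 + x + x * y"
  shows "summable (\<lambda>n. tc n * x ^ n)"
proof (rule tree_bound_summable(1)[OF tree_bound_induction x(1)])
  show "exp (x + x\<^sup>2 * theta y (Bs x) (Es x) + As x) \<le> 1 + x + x * y" by (rule ineq)
  have x1: "x < 1" using x by simp
  have pos: "0 \<le> tc n * log_rem (x ^ n)" "0 \<le> lc n * log_rem (x ^ n)"
    "0 \<le> tc n * (log_rem (x ^ n) - (x ^ n)\<^sup>2 / 2)" for n
    using log_rem_power_nonneg[of tc x n] log_rem_power_nonneg[of lc x n] x log_rem_minus_sq(1)[OF x(1) x1, of n]
    by (cases "n = 0"; simp)+
  note s = log_rem_sums_series[OF less_imp_le[OF x(1)] x(2)]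
  show "(\<Sum>n\<le>N. tc n * log_rem (x ^ n)) \<le> Bs x" for N
    using sum_le_suminf[OF sums_summable[OF s(1)], of "{..N}"] pos s(1) by (simp add: sums_iff)
  show "(\<Sum>n\<le>N. lc n * log_rem (x ^ n)) \<le> As x" for N
    using sum_le_suminf[OF sums_summable[OF s(2)], of "{..N}"] pos s(2) by (simp add: sums_iff)
  show "(\<Sum>n\<le>N. tc n * (log_rem (x ^ n) - (x ^ n)\<^sup>2 / 2)) \<le> Es x" for N
    using sum_le_suminf[OF sums_summable[OF s(3)], of "{..N}"] pos s(3) by (simp add: sums_iff)
qed (use x y in auto)

text \<open>In the unknown, the difference of the two sides at \<open>rho\<close> has derivative rho
  (K(rho) - 1). If this is negative, a value slightly above T(rho) gives strict inequality; it
  persists for x slightly above \<open>rho\<close>, where a supersolution is impossible.\<close>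

lemma Ks_rho_ge: "1 \<le> Ks rho"
proof (rule ccontr)
  assume K: "\<not> 1 \<le> Ks rho"
  define G where "G x y = exp (x + x\<^sup>2 * theta y (Bs x) (Es x) + As x) - (1 + x + x * y)" for x y :: real
  define \<tau> where "\<tau> = Ts rho"
  have fe: "Ms rho = exp (rho + rho\<^sup>2 * theta \<tau> (Bs rho) (Es rho) + As rho)"
    using functional_equation_real[of rho] rho_numeric by (simp add: Fs_eq_theta \<tau>_def)
  then have G0: "G rho \<tau> = 0" by (simp add: G_def Ms_def \<tau>_def)
  have "(G rho has_real_derivative Ms rho * (rho\<^sup>2 * Ps rho) - rho) (at \<tau>)"
    unfolding G_def[abs_def] theta_def fe
    by (auto intro!: derivative_eq_intros simp: Ps_def Hs_def \<tau>_def theta_def)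
  moreover have "Ms rho * (rho\<^sup>2 * Ps rho) - rho < 0"
  proof -
    have "rho * Ks rho < rho * 1" using K rho_numeric by (intro mult_strict_left_mono) auto
    then show ?thesis by (simp add: Ks_def power2_eq_square algebra_simps)
  qed
  ultimately obtain d where d: "d > 0" "\<And>h. 0 < h \<Longrightarrow> h < d \<Longrightarrow> G rho (\<tau> + h) < G rho \<tau>"
    using DERIV_neg_dec_right by blast
  define y where "y = \<tau> + d / 2"
  have y: "G rho y < 0" "0 \<le> y" using d(2)[of "d / 2"] d(1) G0 series_nonneg(1)[of rho] rho_numeric
    by (simp_all add: y_def \<tau>_def)
  have "continuous_on (cball 0 (3 / 5)) (\<lambda>x. G x y)"
    unfolding G_def theta_def by (intro continuous_intros continuous_series)
  then have "continuous_on (ball 0 (3 / 5)) (\<lambda>x. G x y)"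
    by (rule continuous_on_subset) auto
  then have "isCont (\<lambda>x. G x y) rho"
    using rho_numeric by (simp add: continuous_on_eq_continuous_at)
  then have "\<forall>\<^sub>F x in at_right rho. G x y < 0"
    using y(1) by (intro order_tendstoD(2)[of _ "G rho y"]) (auto simp: isCont_def intro: filterlim_at_split[THEN iffD1, THEN conjunct2])
  moreover have "\<forall>\<^sub>F x in at_right rho. x \<in> {rho<..<3 / 5}"
    by (rule eventually_at_right_real[OF rho_numeric(4)])
  ultimately have "\<forall>\<^sub>F x in at_right rho. G x y < 0 \<and> x \<in> {rho<..<3 / 5}" by (rule eventually_conj)
  then obtain x where x: "G x y < 0" "rho < x" "x < 3 / 5"
    using eventually_happens[of _ "at_right rho"] by auto
  have "summable (\<lambda>n. tc n * x ^ n)"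
    by (rule convergence_criterion[of x y]) (use x y rho_numeric in \<open>auto simp: G_def\<close>)
  then show False using not_summable_above_rho[OF x(2)] by blast
qed

lemma Ks_rho: "Ks rho = 1"
  using Ks_rho_le Ks_rho_ge by simp

text \<open>The Taylor coefficients of exp w - 1 - w are non-negative.\<close>

lemma norm_exp_minus_le:
  fixes w :: complex
  shows "norm (exp w - 1 - w) \<le> exp (norm w) - 1 - norm w"
proof -
  have s: "(\<lambda>n. z ^ (n + 2) /\<^sub>R fact (n + 2)) sums (exp z - 1 - z)" for z :: "'a :: {real_normed_field, banach}"
    using sums_iff_shift[of "\<lambda>n. z ^ n /\<^sub>R fact n" 2] exp_converges[of z] by (simp add: numeral_2_eq_2 algebra_simps)
  have n: "norm (w ^ (n + 2) /\<^sub>R fact (n + 2)) = norm w ^ (n + 2) /\<^sub>R fact (n + 2)" for n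
    by (simp add: norm_mult norm_power norm_divide divide_inverse)
  have sn: "summable (\<lambda>n. norm (w ^ (n + 2) /\<^sub>R fact (n + 2)))"
    unfolding n by (rule sums_summable[OF s])
  have "norm (exp w - 1 - w) = norm (\<Sum>n. w ^ (n + 2) /\<^sub>R fact (n + 2))" using s[of w] by (simp add: sums_iff)
  also have "\<dots> \<le> (\<Sum>n. norm (w ^ (n + 2) /\<^sub>R fact (n + 2)))" by (rule summable_norm[OF sn])
  also have "\<dots> = exp (norm w) - 1 - norm w" unfolding n using s[of "norm w"] by (simp add: sums_iff)
  finally show ?thesis .
qed

lemma exp_minus_mono:
  assumes "0 \<le> u" "u \<le> (v :: real)"
  shows "exp u - 1 - u \<le> exp v - 1 - v"
proof -
  have "1 * (v - u) \<le> exp u * (exp (v - u) - 1)"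
  proof (rule mult_mono)
    show "v - u \<le> exp (v - u) - 1" using exp_ge_add_one_self[of "v - u"] by linarith
  qed (use assms in auto)
  also have "\<dots> = exp v - exp u" by (simp add: algebra_simps flip: exp_add)
  finally show ?thesis by simp
qed

lemma norm_series_le:
  fixes w :: complex
  assumes "norm w \<le> rho"
  shows "norm (Ts w) \<le> Ts rho" "norm (Bs w) \<le> Bs rho"
proof -
  have sT: "summable (\<lambda>n. tc n * norm w ^ n)"
    by (rule summable_smaller[OF summable_rho]) (use assms in auto)
  have sB: "summable (\<lambda>n. log_tail tc n * rho ^ n)" "summable (\<lambda>n. log_tail tc n * norm w ^ n)"
    by (rule summable_smaller[OF summable_log_tail_beyond(1)]; use assms rho_numeric in \<open>simp add: log_tail_nonneg\<close>)+
  show "norm (Ts w) \<le> Ts rho"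
    by (rule order_trans[OF ps_norm_le[OF sT] ps_mono[OF summable_rho]]) (use assms in auto)
  show "norm (Bs w) \<le> Bs rho"
    by (rule order_trans[OF ps_norm_le[OF sB(2)] ps_mono[OF sB(1)]]) (use assms in \<open>auto simp: log_tail_nonneg\<close>)
qed

text \<open>Written as (exp u - 1 - u) + B with u = T + B, no term is subtracted from a power series
  any more; in H - 1 - T the triangle inequality would be too weak.\<close>

lemma norm_Ps_le:
  fixes w :: complex
  assumes "norm w \<le> rho"
  shows "norm (Ps w) \<le> Ps rho"
proof -
  note le = norm_series_le[OF assms]
  have "Ps w = (exp (Ts w + Bs w) - 1 - (Ts w + Bs w)) + Bs w" by (simp add: Ps_def Hs_def)
  also have "norm \<dots> \<le> (exp (norm (Ts w + Bs w)) - 1 - norm (Ts w + Bs w)) + Bs rho"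
    by (rule order_trans[OF norm_triangle_ineq add_mono[OF norm_exp_minus_le le(2)]])
  also have "exp (norm (Ts w + Bs w)) - 1 - norm (Ts w + Bs w) \<le> exp (Ts rho + Bs rho) - 1 - (Ts rho + Bs rho)"
    using le norm_triangle_ineq[of "Ts w" "Bs w"] by (intro exp_minus_mono) auto
  also have "exp (Ts rho + Bs rho) - 1 - (Ts rho + Bs rho) + Bs rho = Ps rho" by (simp add: Ps_def Hs_def)
  finally show ?thesis by simp
qed

text \<open>Among the points with \<open>\<bar>w\<bar> \<le> \<rho>\<close>, only \<open>w = \<rho>\<close> attains \<open>\<bar>1 + w\<bar> = 1 + \<rho>\<close>.\<close>

lemma norm_Ks_less_1:
  fixes w :: complex
  assumes w: "norm w \<le> rho" "w \<noteq> of_real rho"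
  shows "norm (Ks w) < 1"
proof -
  have "norm (1 + w) < 1 + rho"
  proof (cases "norm w < rho")
    case True
    then show ?thesis using norm_triangle_ineq[of 1 w] by simp
  next
    case False
    then have n: "norm w = rho" using w by simp
    have "norm (1 + w) \<noteq> norm (1 :: complex) + norm w"
      using norm_triangle_eq[of 1 w] w(2) by (simp add: n scaleR_conv_of_real)
    then show ?thesis using norm_triangle_ineq[of 1 w] n by simp
  qed
  moreover have "norm (w * Ts w) \<le> rho * Ts rho"
    unfolding norm_mult using norm_series_le[OF w(1)] w rho_numeric by (intro mult_mono) auto
  ultimately have M: "norm (Ms w) < Ms rho"
    using norm_triangle_ineq[of "1 + w" "w * Ts w"] by (simp add: Ms_def)
  have P: "0 < Ps rho" by (rule Ps_pos) (use rho_numeric in auto)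
  have "norm (Ks w) = norm w * norm (Ms w) * norm (Ps w)" by (simp add: Ks_def norm_mult)
  also have "\<dots> \<le> rho * norm (Ms w) * Ps rho"
    using w norm_Ps_le[OF w(1)] rho_numeric by (intro mult_mono) auto
  also have "\<dots> < rho * Ms rho * Ps rho"
    using M P rho_numeric by (intro mult_strict_right_mono mult_strict_left_mono) auto
  also have "\<dots> = 1" using Ks_rho by (simp add: Ks_def)
  finally show ?thesis .
qed

section \<open>Rescaling to the unit disc and verification of the local hypotheses\<close>

definition Dz :: "complex \<Rightarrow> complex" where
  "Dz z = 1 - Ks (of_real rho * z)"

text \<open>Derivatives of order at most \<open>1 / \<bar>D\<bar>\<close>, which is the order of \<open>T'\<close>. These functions form an algebra that is
  closed under \<open>exp\<close>, so no derivatives of \<open>N\<close>, \<open>U\<close> and \<open>V\<close> need to be computed.\<close>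

definition good :: "(complex \<Rightarrow> complex) \<Rightarrow> bool" where
  "good f \<longleftrightarrow> continuous_on (cball 0 1 - ball 0 (1/2)) f \<and>
     (\<exists>f' C. \<forall>z. 1/2 < norm z \<longrightarrow> norm z < 1 \<longrightarrow>
       (f has_field_derivative f' z) (at z) \<and> norm (f' z) \<le> C / norm (Dz z))"

lemma norm_scaled: "norm (complex_of_real rho * z) = rho * norm z"
  using rho_numeric by (simp add: norm_mult)

lemma norm_scaled_le: "norm z \<le> 1 \<Longrightarrow> norm (complex_of_real rho * z) \<le> rho"
  and norm_scaled_less: "norm z < 1 \<Longrightarrow> norm (complex_of_real rho * z) < rho"
  using rho_numeric by (simp_all add: norm_scaled mult_left_le)

lemma norm_Ks_scaled:
  assumes "norm z \<le> 1" "z \<noteq> 1"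
  shows "norm (Ks (complex_of_real rho * z)) < 1"
  using assms rho_numeric by (intro norm_Ks_less_1 norm_scaled_le) auto

lemma norm_Ks_scaled_less: "norm z < 1 \<Longrightarrow> norm (Ks (complex_of_real rho * z)) < 1"
  by (rule norm_Ks_scaled) auto

lemma Dz_nonzero: "norm z \<le> 1 \<Longrightarrow> z \<noteq> 1 \<Longrightarrow> Dz z \<noteq> 0"
  using norm_Ks_scaled[of z] by (auto simp: Dz_def)

lemma Dz_nonzero_less: "norm z < 1 \<Longrightarrow> Dz z \<noteq> 0"
  by (rule Dz_nonzero) auto

lemma Dz_Re_pos: "norm z < 1 \<Longrightarrow> 0 < Re (Dz z)"
  using norm_Ks_scaled_less[of z] complex_Re_le_cmod[of "Ks (complex_of_real rho * z)"] by (auto simp: Dz_def)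

lemma norm_Dz_le: "norm z < 1 \<Longrightarrow> norm (Dz z) \<le> 2"
  using norm_Ks_scaled_less[of z] norm_triangle_ineq4[of 1 "Ks (complex_of_real rho * z)"] by (auto simp: Dz_def)

lemma continuous_on_annulus_bounded:
  assumes "continuous_on (cball 0 1 - ball 0 (1/2)) (f :: complex \<Rightarrow> complex)"
  obtains B where "0 \<le> B" "\<And>z. 1/2 < norm z \<Longrightarrow> norm z < 1 \<Longrightarrow> norm (f z) \<le> B"
proof -
  have "compact (cball 0 1 - ball 0 (1/2) :: complex set)" by (intro compact_diff) auto
  from compact_continuous_image[OF assms this]
  have "bounded (f ` (cball 0 1 - ball 0 (1/2)))" by (rule compact_imp_bounded)
  then obtain B where B: "B > 0" "\<And>w. w \<in> f ` (cball 0 1 - ball 0 (1/2)) \<Longrightarrow> norm w \<le> B"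
    using bounded_pos by metis
  show ?thesis by (rule that[of B]) (use B in auto)
qed

lemma goodE:
  assumes "good f"
  obtains B C f' where "0 \<le> B" "0 \<le> C"
    "\<And>z. 1/2 < norm z \<Longrightarrow> norm z < 1 \<Longrightarrow> norm (f z) \<le> B"
    "\<And>z. 1/2 < norm z \<Longrightarrow> norm z < 1 \<Longrightarrow> (f has_field_derivative f' z) (at z)"
    "\<And>z. 1/2 < norm z \<Longrightarrow> norm z < 1 \<Longrightarrow> norm (f' z) \<le> C / norm (Dz z)"
proof -
  from assms obtain f' C where f: "continuous_on (cball 0 1 - ball 0 (1/2)) f"
    "\<And>z. 1/2 < norm z \<Longrightarrow> norm z < 1 \<Longrightarrow> (f has_field_derivative f' z) (at z)"
    "\<And>z. 1/2 < norm z \<Longrightarrow> norm z < 1 \<Longrightarrow> norm (f' z) \<le> C / norm (Dz z)"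
    unfolding good_def by blast
  obtain B where B: "0 \<le> B" "\<And>z. 1/2 < norm z \<Longrightarrow> norm z < 1 \<Longrightarrow> norm (f z) \<le> B"
    using continuous_on_annulus_bounded[OF f(1)] by blast
  have "norm (f' z) \<le> max C 0 / norm (Dz z)" if "1/2 < norm z" "norm z < 1" for z
    by (rule order_trans[OF f(3)[OF that]]) (intro divide_right_mono; simp)
  then show ?thesis using that[of B "max C 0" f'] B f by simp
qed

lemma goodI:
  assumes "continuous_on (cball 0 1 - ball 0 (1/2)) f"
    "\<And>z. 1/2 < norm z \<Longrightarrow> norm z < 1 \<Longrightarrow> (f has_field_derivative f' z) (at z)"
    "\<And>z. 1/2 < norm z \<Longrightarrow> norm z < 1 \<Longrightarrow> norm (f' z) \<le> C / norm (Dz z)"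
  shows "good f"
  unfolding good_def using assms by blast

lemma good_continuous: "good f \<Longrightarrow> continuous_on (cball 0 1 - ball 0 (1/2)) f"
  by (simp add: good_def)

text \<open>|Dz| is at most 2 in the disc, so bounded derivatives are of order 1 / |Dz|.\<close>

lemma good_bounded_derivative:
  assumes f: "continuous_on (cball 0 1 - ball 0 (1/2)) f"
    "\<And>z. 1/2 < norm z \<Longrightarrow> norm z < 1 \<Longrightarrow> (f has_field_derivative f' z) (at z)"
    "\<And>z. 1/2 < norm z \<Longrightarrow> norm z < 1 \<Longrightarrow> norm (f' z) \<le> C"
  shows "good f"
proof (rule goodI[OF f(1) f(2)])
  fix z :: complex assume z: "1/2 < norm z" "norm z < 1"
  have D: "0 < norm (Dz z)" using Dz_nonzero_less[of z] z by auto
  have "norm (f' z) * norm (Dz z) \<le> norm (f' z) * 2"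
    using norm_Dz_le[of z] z by (intro mult_left_mono) auto
  also have "\<dots> \<le> 2 * C" using f(3)[OF z] by simp
  finally show "norm (f' z) \<le> 2 * C / norm (Dz z)" using D by (simp add: pos_le_divide_eq)
qed auto

lemma good_const: "good (\<lambda>_. c)"
  by (rule good_bounded_derivative[of _ "\<lambda>_. 0" 0]) auto

lemma good_scaled_ident: "good (\<lambda>z. of_real rho * z)"
  by (rule good_bounded_derivative[of _ "\<lambda>_. of_real rho" rho])
    (use rho_numeric in \<open>auto intro!: continuous_intros derivative_eq_intros\<close>)

lemma good_divide_ident: "good (\<lambda>z. 1 / z)"
proof (rule good_bounded_derivative[of _ "\<lambda>z. - 1 / z\<^sup>2" 4])
  show "continuous_on (cball 0 1 - ball 0 (1/2)) (\<lambda>z. 1 / z :: complex)"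
    by (intro continuous_intros) auto
  fix z :: complex assume z: "1/2 < norm z" "norm z < 1"
  show "((\<lambda>z. 1 / z) has_field_derivative - 1 / z\<^sup>2) (at z)"
    using z by (auto intro!: derivative_eq_intros simp: power2_eq_square)
  have "(1/2)\<^sup>2 \<le> (norm z)\<^sup>2" using z by (intro power_mono) auto
  then have "1 \<le> 4 * (norm z)\<^sup>2" by (simp add: power_divide)
  then show "norm (- 1 / z\<^sup>2) \<le> 4" using z by (simp add: norm_divide norm_power divide_le_eq)
qed

lemma good_add:
  assumes "good f" "good g"
  shows "good (\<lambda>z. f z + g z)"
proof -
  obtain B C f' where f: "0 \<le> B" "0 \<le> C" "\<And>z. 1/2 < norm z \<Longrightarrow> norm z < 1 \<Longrightarrow> norm (f z) \<le> B"
    "\<And>z. 1/2 < norm z \<Longrightarrow> norm z < 1 \<Longrightarrow> (f has_field_derivative f' z) (at z)"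
    "\<And>z. 1/2 < norm z \<Longrightarrow> norm z < 1 \<Longrightarrow> norm (f' z) \<le> C / norm (Dz z)"
    using goodE[OF assms(1)] by blast
  obtain B' C' g' where g: "0 \<le> B'" "0 \<le> C'" "\<And>z. 1/2 < norm z \<Longrightarrow> norm z < 1 \<Longrightarrow> norm (g z) \<le> B'"
    "\<And>z. 1/2 < norm z \<Longrightarrow> norm z < 1 \<Longrightarrow> (g has_field_derivative g' z) (at z)"
    "\<And>z. 1/2 < norm z \<Longrightarrow> norm z < 1 \<Longrightarrow> norm (g' z) \<le> C' / norm (Dz z)"
    using goodE[OF assms(2)] by blast
  show ?thesis
  proof (rule goodI[of _ "\<lambda>z. f' z + g' z" "C + C'"])
    show "continuous_on (cball 0 1 - ball 0 (1/2)) (\<lambda>z. f z + g z)"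
      by (intro continuous_intros good_continuous assms)
    fix z :: complex assume z: "1/2 < norm z" "norm z < 1"
    show "((\<lambda>z. f z + g z) has_field_derivative f' z + g' z) (at z)" by (intro DERIV_add f g z)
    show "norm (f' z + g' z) \<le> (C + C') / norm (Dz z)"
      unfolding add_divide_distrib by (intro order_trans[OF norm_triangle_ineq] add_mono f g z)
  qed
qed

lemma good_mult:
  assumes "good f" "good g"
  shows "good (\<lambda>z. f z * g z)"
proof -
  obtain B C f' where f: "0 \<le> B" "0 \<le> C" "\<And>z. 1/2 < norm z \<Longrightarrow> norm z < 1 \<Longrightarrow> norm (f z) \<le> B"
    "\<And>z. 1/2 < norm z \<Longrightarrow> norm z < 1 \<Longrightarrow> (f has_field_derivative f' z) (at z)"
    "\<And>z. 1/2 < norm z \<Longrightarrow> norm z < 1 \<Longrightarrow> norm (f' z) \<le> C / norm (Dz z)"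
    using goodE[OF assms(1)] by blast
  obtain B' C' g' where g: "0 \<le> B'" "0 \<le> C'" "\<And>z. 1/2 < norm z \<Longrightarrow> norm z < 1 \<Longrightarrow> norm (g z) \<le> B'"
    "\<And>z. 1/2 < norm z \<Longrightarrow> norm z < 1 \<Longrightarrow> (g has_field_derivative g' z) (at z)"
    "\<And>z. 1/2 < norm z \<Longrightarrow> norm z < 1 \<Longrightarrow> norm (g' z) \<le> C' / norm (Dz z)"
    using goodE[OF assms(2)] by blast
  show ?thesis
  proof (rule goodI[of _ "\<lambda>z. f' z * g z + g' z * f z" "C * B' + C' * B"])
    show "continuous_on (cball 0 1 - ball 0 (1/2)) (\<lambda>z. f z * g z)"
      by (intro continuous_intros good_continuous assms)
    fix z :: complex assume z: "1/2 < norm z" "norm z < 1"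
    show "((\<lambda>z. f z * g z) has_field_derivative f' z * g z + g' z * f z) (at z)" by (intro DERIV_mult f g z)
    have "norm (f' z * g z) \<le> C / norm (Dz z) * B'" "norm (g' z * f z) \<le> C' / norm (Dz z) * B"
      unfolding norm_mult by (intro mult_mono f g z divide_nonneg_nonneg; simp)+
    then show "norm (f' z * g z + g' z * f z) \<le> (C * B' + C' * B) / norm (Dz z)"
      using norm_triangle_ineq[of "f' z * g z" "g' z * f z"] by (simp add: add_divide_distrib)
  qed
qed

lemma good_diff: "good f \<Longrightarrow> good g \<Longrightarrow> good (\<lambda>z. f z - g z)"
  using good_add[OF _ good_mult[OF good_const[of "- 1"]], of f g] by simp

lemma good_minus: "good f \<Longrightarrow> good (\<lambda>z. - f z)"
  using good_mult[OF good_const[of "- 1"], of f] by simp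

lemma good_power: "good f \<Longrightarrow> good (\<lambda>z. f z ^ n)"
  by (induction n) (auto intro: good_const good_mult)

lemma good_divide_numeral: "good f \<Longrightarrow> good (\<lambda>z. f z / numeral n)"
  using good_mult[OF _ good_const[of "1 / numeral n"], of f] by simp

lemma good_exp:
  assumes "good f"
  shows "good (\<lambda>z. exp (f z))"
proof -
  obtain B C f' where f: "0 \<le> B" "0 \<le> C" "\<And>z. 1/2 < norm z \<Longrightarrow> norm z < 1 \<Longrightarrow> norm (f z) \<le> B"
    "\<And>z. 1/2 < norm z \<Longrightarrow> norm z < 1 \<Longrightarrow> (f has_field_derivative f' z) (at z)"
    "\<And>z. 1/2 < norm z \<Longrightarrow> norm z < 1 \<Longrightarrow> norm (f' z) \<le> C / norm (Dz z)"
    using goodE[OF assms] by blast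
  show ?thesis
  proof (rule goodI[of _ "\<lambda>z. exp (f z) * f' z" "exp B * C"])
    show "continuous_on (cball 0 1 - ball 0 (1/2)) (\<lambda>z. exp (f z))"
      by (intro continuous_intros good_continuous assms)
    fix z :: complex assume z: "1/2 < norm z" "norm z < 1"
    show "((\<lambda>z. exp (f z)) has_field_derivative exp (f z) * f' z) (at z)"
      using DERIV_chain[OF DERIV_exp f(4)[OF z]] by (simp add: o_def)
    have "norm (exp (f z)) \<le> exp B"
      by (rule order_trans[OF norm_exp]) (use f(3)[OF z] in simp)
    then show "norm (exp (f z) * f' z) \<le> exp B * C / norm (Dz z)"
      unfolding norm_mult times_divide_eq_right[symmetric] using f(5)[OF z] by (intro mult_mono) auto
  qed
qed

lemma DERIV_scaled:
  assumes "(f has_field_derivative f') (at (complex_of_real rho * z))"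
  shows "((\<lambda>z. f (of_real rho * z)) has_field_derivative f' * of_real rho) (at z)"
proof (rule DERIV_chain2[of f f' "\<lambda>z. of_real rho * z" z])
  show "((\<lambda>z. complex_of_real rho * z) has_field_derivative of_real rho) (at z)"
    by (auto intro!: derivative_eq_intros)
qed (rule assms)

lemma continuous_scaled:
  assumes "continuous_on (cball 0 rho) f"
  shows "continuous_on (cball 0 1) (\<lambda>z. f (complex_of_real rho * z))"
  by (rule continuous_on_compose2[OF assms]) (auto intro!: continuous_intros norm_scaled_le)

text \<open>Convergence at 1/2, which exceeds \<open>rho\<close>, bounds the derivative on the whole
  rescaled disc.\<close>

lemma good_ps:
  assumes c: "\<And>n. 0 \<le> c n" and s: "summable (\<lambda>n. c n * (1 / 2) ^ n)"
  shows "good (\<lambda>z. ps c (of_real rho * z))"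
proof (rule good_bounded_derivative[of _ "\<lambda>z. ps (diffs c) (of_real rho * z) * of_real rho" "ps (diffs c) rho * rho"])
  have "continuous_on (cball 0 1) (\<lambda>z. ps c (complex_of_real rho * z))"
    by (rule continuous_scaled[OF continuous_on_subset[OF continuous_on_ps[OF s c] cball_rho_subset(1)]])
  then show "continuous_on (cball 0 1 - ball 0 (1/2)) (\<lambda>z. ps c (complex_of_real rho * z))"
    by (rule continuous_on_subset) auto
  have sd: "summable (\<lambda>n. diffs c n * rho ^ n)"
    by (rule summable_diffs[OF s]) (use rho_numeric in auto)
  fix z :: complex assume z: "1/2 < norm z" "norm z < 1"
  have z1: "norm (complex_of_real rho * z) < 1 / 2" "norm (complex_of_real rho * z) \<le> rho"
    using norm_scaled_less[OF z(2)] rho_numeric by auto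
  show "((\<lambda>z. ps c (of_real rho * z)) has_field_derivative ps (diffs c) (of_real rho * z) * of_real rho) (at z)"
    by (rule DERIV_scaled[OF ps_has_field_derivative[OF s z1(1)]])
  have "summable (\<lambda>n. diffs c n * norm (complex_of_real rho * z) ^ n)"
    by (rule summable_smaller[OF sd diffs_nonneg[OF c]]) (use z1 in auto)
  from order_trans[OF ps_norm_le[OF this diffs_nonneg[OF c]] ps_mono[OF sd diffs_nonneg[OF c] norm_ge_zero z1(2)]]
  show "norm (ps (diffs c) (of_real rho * z) * complex_of_real rho) \<le> ps (diffs c) rho * rho"
    using rho_numeric by (simp add: norm_mult)
qed

lemma good_series:
  "good (\<lambda>z. Bs (of_real rho * z))" "good (\<lambda>z. Es (of_real rho * z))" "good (\<lambda>z. As (of_real rho * z))"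
  "good (\<lambda>z. dB (of_real rho * z))" "good (\<lambda>z. dE (of_real rho * z))" "good (\<lambda>z. dA (of_real rho * z))"
  by (intro good_ps summable_diffs_half diffs_nonneg log_tail_nonneg
      summable_smaller[OF summable_log_tail_beyond(1)] summable_smaller[OF summable_log_tail_beyond(2)]
      summable_smaller[OF summable_ec_beyond]; simp)+

lemma tree_derivative:
  assumes "1/2 < norm z" "norm z < 1"
  shows "((\<lambda>z. Ts (of_real rho * z)) has_field_derivative (Ns (of_real rho * z) / z) / Dz z) (at z)"
proof -
  have w: "norm (complex_of_real rho * z) < rho" using assms norm_scaled_less by auto
  have z0: "z \<noteq> 0" "Dz z \<noteq> 0" using assms Dz_nonzero_less[of z] by auto
  have "((\<lambda>z. Ts (complex_of_real rho * z)) has_field_derivative dT (of_real rho * z) * of_real rho) (at z)"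
    by (rule DERIV_scaled[OF series_derivatives(1)[OF w]])
  moreover have "dT (of_real rho * z) * of_real rho = (Ns (of_real rho * z) / z) / Dz z"
    unfolding derivative_equation[OF w, symmetric] using z0 by (simp add: Dz_def)
  ultimately show ?thesis by simp
qed

text \<open>The instance that dictates the admissible order: the derivative is (N / z) / D, and N is
  continuous on the closed disc, hence bounded.\<close>

lemma good_Ts: "good (\<lambda>z. Ts (of_real rho * z))"
proof -
  have cont: "continuous_on (cball 0 1 - ball 0 (1/2)) (\<lambda>z. Ts (complex_of_real rho * z))"
    by (rule continuous_on_subset[OF continuous_scaled[OF continuous_Ts]]) auto
  have "continuous_on (cball 0 1 - ball 0 (1/2)) (\<lambda>z. Ns (complex_of_real rho * z))"
    by (rule continuous_on_subset[OF continuous_scaled[OF continuous_rho_functions(6)]]) auto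
  then have "continuous_on (cball 0 1 - ball 0 (1/2)) (\<lambda>z. Ns (complex_of_real rho * z) / z)"
    by (intro continuous_intros) auto
  then obtain B where B: "\<And>z. 1/2 < norm z \<Longrightarrow> norm z < 1 \<Longrightarrow> norm (Ns (complex_of_real rho * z) / z) \<le> B"
    using continuous_on_annulus_bounded by blast
  show ?thesis
  proof (rule goodI[OF cont tree_derivative])
    fix z :: complex assume "1/2 < norm z" "norm z < 1"
    from B[OF this] show "norm ((Ns (of_real rho * z) / z) / Dz z) \<le> B / norm (Dz z)"
      unfolding norm_divide[of _ "Dz z"] by (intro divide_right_mono) auto
  qed
qed

lemmas good_intros = good_const good_scaled_ident good_add good_diff good_minus good_mult good_power
  good_divide_numeral good_exp good_series good_Ts

lemma good_functions:
  "good (\<lambda>z. Ns (of_real rho * z))" "good (\<lambda>z. Us (of_real rho * z))"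
  "good (\<lambda>z. Vs (of_real rho * z))" "good Dz"
  unfolding Ns_def Us_def Vs_def Dz_def[abs_def] Ks_def Ms_def Fs_def Ps_def Hs_def
  by (intro good_intros)+

text \<open>By the derivative equation this is rho T'(rho z) D(z), in a form that makes sense on the
  boundary.\<close>

definition Pz :: "complex \<Rightarrow> complex" where
  "Pz z = Ns (of_real rho * z) * (1 / z)"

text \<open>Insert rho T' = P / D into D' = -rho (U T' + V) and multiply by D.\<close>

definition Qz :: "complex \<Rightarrow> complex" where
  "Qz z = - (Us (of_real rho * z) * Pz z + of_real rho * Vs (of_real rho * z) * Dz z)"

lemma good_Pz: "good Pz" and good_Qz: "good Qz"
proof -
  show P: "good Pz" unfolding Pz_def[abs_def] by (intro good_intros good_functions good_divide_ident)
  show "good Qz" unfolding Qz_def[abs_def] by (intro good_intros good_functions P)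
qed

lemma Dz_derivative:
  assumes "1/2 < norm z" "norm z < 1"
  shows "(Dz has_field_derivative Qz z / Dz z) (at z)"
proof -
  have w: "norm (complex_of_real rho * z) < rho" using assms norm_scaled_less by auto
  have z0: "z \<noteq> 0" "Dz z \<noteq> 0" using assms Dz_nonzero_less[of z] by auto
  let ?w = "complex_of_real rho * z"
  have "(Dz has_field_derivative 0 - (Us ?w * dT ?w + Vs ?w) * of_real rho) (at z)"
    unfolding Dz_def[abs_def]
    by (intro DERIV_diff DERIV_const DERIV_scaled[OF Ks_derivative[OF w]])
  moreover have "Pz z = of_real rho * dT ?w * Dz z"
    unfolding Pz_def derivative_equation[OF w, symmetric] using z0 by (simp add: Dz_def)
  then have "0 - (Us ?w * dT ?w + Vs ?w) * of_real rho = Qz z / Dz z"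
    using z0 by (simp add: Qz_def field_simps)
  ultimately show ?thesis by simp
qed

lemma deriv_Ts_coefficient:
  "(deriv ^^ n) (\<lambda>z. Ts (complex_of_real rho * z)) 0 / fact n = of_real (tc n * rho ^ n)"
proof -
  define F where "F = Abs_fps (\<lambda>n. complex_of_real (tc n * rho ^ n))"
  have "summable (\<lambda>n. complex_of_real (tc n * rho ^ n) * 1 ^ n)"
    using summable_of_real[OF summable_rho, where 'a = complex] by simp
  then have "ereal (norm (1 :: complex)) \<le> conv_radius (\<lambda>n. complex_of_real (tc n * rho ^ n))"
    by (rule conv_radius_geI)
  then have "0 < fps_conv_radius F"
    unfolding fps_conv_radius_def F_def by (simp add: less_le_trans[of 0 "ereal 1"])
  moreover have "eval_fps F z = Ts (complex_of_real rho * z)" for z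
    by (simp add: eval_fps_def F_def ps_def power_mult_distrib mult_ac)
  ultimately have "(\<lambda>z. Ts (complex_of_real rho * z)) has_fps_expansion F"
    by (simp add: has_fps_expansion_def)
  from fps_nth_fps_expansion[OF this, of n] show ?thesis by (simp add: F_def)
qed

text \<open>At 1 the term with D drops out, so P has the value N(rho) and Q the value -U(rho)
  N(rho); hence \<beta> = 2 U(rho) N(rho).\<close>

theorem tree_coefficients_asymptotics:
  "(\<lambda>n. sqrt (real n) * (real (Suc n) * (tc (Suc n) * rho ^ Suc n)))
     \<longlonglongrightarrow> Ns rho / (sqrt (2 * (Us rho * Ns rho)) * sqrt pi)"
proof -
  have N: "0 < Ns rho" by (rule Ns_pos) (use rho_numeric in auto)
  have U: "0 < Us rho"
    using Ps_pos[of rho] rho_numeric by (simp add: Us_def add_pos_pos)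
  obtain P' CP where P: "\<And>z. 1/2 < norm z \<Longrightarrow> norm z < 1 \<Longrightarrow> (Pz has_field_derivative P' z) (at z)"
    "\<And>z. 1/2 < norm z \<Longrightarrow> norm z < 1 \<Longrightarrow> norm (P' z) \<le> CP / norm (Dz z)"
    using good_Pz unfolding good_def by blast
  obtain Q' CQ where Q: "\<And>z. 1/2 < norm z \<Longrightarrow> norm z < 1 \<Longrightarrow> (Qz has_field_derivative Q' z) (at z)"
    "\<And>z. 1/2 < norm z \<Longrightarrow> norm z < 1 \<Longrightarrow> norm (Q' z) \<le> CQ / norm (Dz z)"
    using good_Qz unfolding good_def by blast
  have P1: "Pz 1 = of_real (Ns rho)" and D1: "Dz 1 = 0"
    using of_real_functions[of rho, where 'a = complex] rho_numeric by (simp_all add: Pz_def Dz_def Ks_rho)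
  have Q1: "Qz 1 = of_real (- (2 * (Us rho * Ns rho)) / 2)"
    using of_real_functions[of rho, where 'a = complex] rho_numeric by (simp add: Qz_def P1 D1)
  interpret sqrt_singularity Dz Pz Qz P' Q' "2 * (Us rho * Ns rho)" "max CP CQ"
  proof
    show "continuous_on (cball 0 1 - ball 0 (1 / 2)) Dz" "continuous_on (cball 0 1 - ball 0 (1 / 2)) Pz"
      "continuous_on (cball 0 1 - ball 0 (1 / 2)) Qz"
      by (intro good_continuous good_functions good_Pz good_Qz)+
    show "norm (P' z) \<le> max CP CQ / norm (Dz z)" "norm (Q' z) \<le> max CP CQ / norm (Dz z)"
      if "1 / 2 < norm z" "norm z < 1" for z
      using divide_right_mono[of CP "max CP CQ" "norm (Dz z)"] divide_right_mono[of CQ "max CP CQ" "norm (Dz z)"]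
        P(2)[OF that] Q(2)[OF that] by simp_all
    show "Qz 1 = of_real (- (2 * (Us rho * Ns rho)) / 2)" by (rule Q1)
  qed (use P(1) Q(1) D1 N U Dz_derivative Dz_nonzero Dz_Re_pos in \<open>simp_all\<close>)
  have "(\<lambda>z. Ts (complex_of_real rho * z)) holomorphic_on ball 0 1"
    unfolding holomorphic_on_def field_differentiable_def
  proof
    fix z :: complex assume "z \<in> ball 0 1"
    then have w: "norm (complex_of_real rho * z) < rho" using norm_scaled_less by auto
    have "((\<lambda>z. Ts (complex_of_real rho * z)) has_field_derivative dT (of_real rho * z) * of_real rho) (at z)"
      by (rule DERIV_scaled[OF series_derivatives(1)[OF w]])
    then show "\<exists>f'. ((\<lambda>z. Ts (complex_of_real rho * z)) has_field_derivative f') (at z within ball 0 1)"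
      using has_field_derivative_at_within by blast
  qed
  from coefficients_asymptotics[OF this]
  have "(\<lambda>n. complex_of_real (sqrt (real n)) * (of_nat (Suc n) * ((deriv ^^ Suc n) (\<lambda>z. Ts (complex_of_real rho * z)) 0 / fact (Suc n))))
    \<longlonglongrightarrow> Pz 1 / of_real (sqrt (2 * (Us rho * Ns rho)) * sqrt pi)"
    using tree_derivative by (simp only: Pz_def mult_1_right times_divide_eq_right)
  then have "(\<lambda>n. complex_of_real (sqrt (real n) * (real (Suc n) * (tc (Suc n) * rho ^ Suc n))))
    \<longlonglongrightarrow> of_real (Ns rho / (sqrt (2 * (Us rho * Ns rho)) * sqrt pi))"
    unfolding deriv_Ts_coefficient P1 by (simp only: of_real_mult of_real_divide of_real_of_nat_eq)
  then show ?thesis by (simp only: tendsto_of_real_iff)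
qed

section \<open>Numerical value of the constant\<close>

text \<open>The series \<Sum>j\<ge>2. u^j, which takes the role of \<open>log_rem\<close> for
  derivatives: x B'(x) is the sum of n * tc n * psi (x^n).\<close>

definition psi :: "real \<Rightarrow> real" where
  "psi u = u\<^sup>2 / (1 - u)"

lemma psi_bounds:
  assumes "q \<le> u" "u \<le> Q"
  shows "0 \<le> q \<Longrightarrow> Q < 1 \<Longrightarrow> lo * (1 - q) \<le> q * q \<Longrightarrow> lo \<le> psi u"
    and "0 \<le> q \<Longrightarrow> Q < 1 \<Longrightarrow> Q * Q \<le> hi * (1 - Q) \<Longrightarrow> psi u \<le> hi"
proof -
  show "lo \<le> psi u" if "0 \<le> q" "Q < 1" "lo * (1 - q) \<le> q * q"
  proof -
    have u: "0 \<le> u" "u < 1" using assms that by auto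
    have "lo \<le> q * q / (1 - q)" using that u assms by (simp add: pos_le_divide_eq)
    also have "\<dots> \<le> u * u / (1 - u)" using assms u that by (intro frac_le mult_mono) auto
    finally show ?thesis by (simp add: psi_def power2_eq_square)
  qed
  show "psi u \<le> hi" if "0 \<le> q" "Q < 1" "Q * Q \<le> hi * (1 - Q)"
  proof -
    have u: "0 \<le> u" "u < 1" using assms that by auto
    have "u * u / (1 - u) \<le> Q * Q / (1 - Q)" using assms u that by (intro frac_le mult_mono) auto
    also have "\<dots> \<le> hi" using that assms by (simp add: pos_divide_le_eq)
    finally show ?thesis by (simp add: psi_def power2_eq_square)
  qed
qed

lemma log_rem_mono:
  assumes "0 \<le> y" "y \<le> z" "z < 1"
  shows "log_rem y \<le> log_rem z"
proof -
  have "ln ((1 - z) / (1 - y)) \<le> (1 - z) / (1 - y) - 1" using assms by (intro ln_le_minus_one) auto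
  also have "\<dots> = - ((z - y) / (1 - y))" using assms by (simp add: field_simps)
  finally have "ln ((1 - z) / (1 - y)) \<le> - ((z - y) / (1 - y))" .
  moreover have "(z - y) / 1 \<le> (z - y) / (1 - y)" using assms by (intro divide_left_mono) auto
  ultimately have "ln ((1 - z) / (1 - y)) \<le> - (z - y)" by simp
  then show ?thesis using assms by (simp add: log_rem_def ln_div)
qed

text \<open>The first terms are kept exactly. Beyond \<open>m\<close> the factor \<open>f n\<close>
  is at most K x^n, so the tail is at most K times the whole series at \<open>x\<close>.\<close>

lemma head_tail_bounds:
  fixes c f :: "nat \<Rightarrow> real"
  assumes c: "\<And>n. 0 \<le> c n" "c 0 = 0" and f: "\<And>n. 0 < n \<Longrightarrow> 0 \<le> f n" and s: "(\<lambda>n. c n * f n) sums s"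
    and r: "summable (\<lambda>n. c n * x ^ n)" "0 \<le> x" and K: "\<And>n. n > m \<Longrightarrow> f n \<le> K * x ^ n" "0 \<le> K"
  shows "(\<Sum>n\<le>m. c n * f n) \<le> s" "s \<le> (\<Sum>n\<le>m. c n * f n) + K * ps c x"
proof -
  have cf: "0 \<le> c n * f n" for n using c f[of n] by (cases "n = 0") auto
  show "(\<Sum>n\<le>m. c n * f n) \<le> s"
    using sum_le_suminf[OF sums_summable[OF s], of "{..m}"] cf s by (simp add: sums_iff)
  have "(\<lambda>n. if n \<in> {..m} then c n * f n else 0) sums (\<Sum>n\<le>m. c n * f n)"
    by (rule sums_If_finite_set) simp
  moreover have "(\<lambda>n. K * (c n * x ^ n)) sums (K * ps c x)"
    using r(1) by (intro sums_mult) (simp add: ps_def summable_sums)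
  ultimately have S: "(\<lambda>n. (if n \<in> {..m} then c n * f n else 0) + K * (c n * x ^ n)) sums ((\<Sum>n\<le>m. c n * f n) + K * ps c x)"
    by (rule sums_add)
  have "c n * f n \<le> (if n \<in> {..m} then c n * f n else 0) + K * (c n * x ^ n)" for n
  proof (cases "n \<le> m")
    case True
    then show ?thesis using K(2) c r(2) by simp
  next
    case False
    then have "c n * f n \<le> c n * (K * x ^ n)" using K(1)[of n] c by (intro mult_left_mono) auto
    then show ?thesis using False by (simp add: mult_ac)
  qed
  then show "s \<le> (\<Sum>n\<le>m. c n * f n) + K * ps c x" by (rule sums_le[OF _ s S])
qed

lemma sums_diffs:
  fixes x :: real
  assumes "summable (\<lambda>n. diffs c n * x ^ n)"
  shows "(\<lambda>n. real n * c n * x ^ n) sums (x * ps (diffs c) x)"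
proof -
  have "(\<lambda>n. x * (of_nat n * c n * x ^ (n - Suc 0))) sums (x * (\<Sum>n. diffs c n * x ^ n))"
    by (intro sums_mult diffs_equiv assms)
  moreover have "x * (of_nat n * c n * x ^ (n - Suc 0)) = real n * c n * x ^ n" for n
    by (cases n) auto
  ultimately show ?thesis by (simp add: ps_def)
qed

lemma rho_power_less_1: "0 < n \<Longrightarrow> rho ^ n < 1"
  using rho_numeric by (simp add: power_less_one_iff)

lemma psi_rho_le: "0 < n \<Longrightarrow> psi (rho ^ n) \<le> (rho ^ n)\<^sup>2 / (1 - rho)"
  unfolding psi_def using rho_numeric rho_power_less_1[of n] power_decreasing[of 1 n rho]
  by (intro divide_left_mono mult_pos_pos) auto

lemma psi_rho_nonneg: "0 < n \<Longrightarrow> 0 \<le> psi (rho ^ n)"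
  unfolding psi_def using rho_power_less_1[of n] by simp

lemma psi_sums:
  assumes c: "\<And>n. 0 \<le> c n" "c 0 = 0" and s: "summable (\<lambda>n. c n * rho ^ n)"
    and d: "summable (\<lambda>n. diffs (log_tail c) n * (1 / 2) ^ n)"
  shows "(\<lambda>n. c n * (real n * psi (rho ^ n))) sums (rho * ps (diffs (log_tail c)) rho)"
proof -
  have "rho\<^sup>2 < rho" using rho_numeric by (simp add: power2_eq_square)
  then have "summable (\<lambda>n. diffs c n * (rho\<^sup>2) ^ n)"
    by (intro summable_diffs[OF s]) auto
  then have "summable (\<lambda>n. 1 / (1 - rho) * (real n * c n * (rho\<^sup>2) ^ n))"
    by (intro summable_mult sums_summable[OF sums_diffs])
  then have sp: "summable (\<lambda>n. real n * c n * ((rho ^ n)\<^sup>2 / (1 - rho ^ n)))"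
  proof (rule summable_comparison_test'[of _ 0])
    fix n
    have "real n * c n * psi (rho ^ n) \<le> real n * c n * ((rho ^ n)\<^sup>2 / (1 - rho))"
    proof (cases "n = 0")
      case False
      then show ?thesis by (intro mult_left_mono psi_rho_le mult_nonneg_nonneg c) auto
    qed simp
    moreover have "0 \<le> real n * c n * psi (rho ^ n)" using psi_rho_nonneg[of n] c by (cases "n = 0") auto
    ultimately show "norm (real n * c n * ((rho ^ n)\<^sup>2 / (1 - rho ^ n))) \<le> 1 / (1 - rho) * (real n * c n * (rho\<^sup>2) ^ n)"
    proof -
      have "1 / (1 - rho) * (real n * c n * (rho\<^sup>2) ^ n) = real n * c n * ((rho ^ n)\<^sup>2 / (1 - rho))"
        by (simp add: power_mult[symmetric] mult.commute)
      moreover have "norm (real n * c n * psi (rho ^ n)) = real n * c n * psi (rho ^ n)"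
        using \<open>0 \<le> real n * c n * psi (rho ^ n)\<close> by (simp only: real_norm_def abs_of_nonneg)
      ultimately show ?thesis
        using \<open>real n * c n * psi (rho ^ n) \<le> real n * c n * ((rho ^ n)\<^sup>2 / (1 - rho))\<close>
        by (simp only: psi_def)
    qed
  qed
  have "(\<lambda>n. real n * log_tail c n * rho ^ n) sums (\<Sum>n. real n * c n * ((rho ^ n)\<^sup>2 / (1 - rho ^ n)))"
    by (rule log_tail_deriv_sums[where c = c and x = rho]) (use sp c rho_numeric in auto)
  moreover have "(\<lambda>n. real n * log_tail c n * rho ^ n) sums (rho * ps (diffs (log_tail c)) rho)"
    by (intro sums_diffs summable_smaller[OF d] diffs_nonneg log_tail_nonneg c) (use rho_numeric in auto)
  ultimately have "(\<Sum>n. real n * c n * ((rho ^ n)\<^sup>2 / (1 - rho ^ n))) = rho * ps (diffs (log_tail c)) rho"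
    by (rule sums_unique2)
  then have "(\<lambda>n. real n * c n * ((rho ^ n)\<^sup>2 / (1 - rho ^ n))) sums (rho * ps (diffs (log_tail c)) rho)"
    using summable_sums[OF sp] by simp
  then show ?thesis by (simp add: psi_def mult_ac)
qed

lemma rho_dB_sums: "(\<lambda>n. tc n * (real n * psi (rho ^ n))) sums (rho * dB rho)"
  by (intro psi_sums summable_rho summable_diffs_half) auto

lemma rho_dA_sums: "(\<lambda>n. lc n * (real n * psi (rho ^ n))) sums (rho * dA rho)"
  by (intro psi_sums summable_lc summable_rho summable_diffs_half) (use rho_numeric in auto)

text \<open>B - E is the single term T(x^2) / 2 at \<open>rho\<close>, so it can be enclosed without
  treating E separately.\<close>

lemma T2_sums: "(\<lambda>n. tc n * ((rho ^ n)\<^sup>2 / 2)) sums (Bs rho - Es rho)"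
proof -
  have "rho\<^sup>2 < rho" using rho_numeric by (simp add: power2_eq_square)
  then have "summable (\<lambda>n. tc n * (rho\<^sup>2) ^ n)" by (intro summable_below_rho) auto
  then have "(\<lambda>n. tc n * (rho\<^sup>2) ^ n / 2) sums (Ts (rho\<^sup>2) / 2)"
    by (intro sums_divide) (simp add: ps_def summable_sums)
  then show ?thesis using rho_numeric by (simp add: ps_ec_eq power_mult[symmetric] mult.commute)
qed

text \<open>The same for derivatives: x times the derivative of T(x^2) / 2 is the sum of n * tc n *
  x^(2n).\<close>

lemma dT2_sums: "(\<lambda>n. tc n * (real n * (rho ^ n)\<^sup>2)) sums (rho * dB rho - rho * dE rho)"
proof -
  have "rho\<^sup>2 < rho" using rho_numeric by (simp add: power2_eq_square)
  then have "summable (\<lambda>n. diffs tc n * (rho\<^sup>2) ^ n)"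
    by (intro summable_diffs[OF summable_rho]) auto
  then have s: "summable (\<lambda>n. (real n * tc n) * (rho\<^sup>2) ^ n)" by (rule sums_summable[OF sums_diffs])
  have half: "rho \<le> 1 / 2" "0 \<le> rho" using rho_numeric by auto
  have 1: "(\<lambda>n. real n * log_tail tc n * rho ^ n - real n * ec n * rho ^ n) sums (rho * dB rho - rho * dE rho)"
    using half by (intro sums_diff sums_diffs summable_smaller[OF summable_diffs_half(1)]
      summable_smaller[OF summable_diffs_half(2)] diffs_nonneg log_tail_nonneg) auto
  have eq: "real n * log_tail tc n * rho ^ n - real n * ec n * rho ^ n
      = (if even n then real (n div 2) * tc (n div 2) else 0) * rho ^ n" for n
    by (auto simp: ec_def algebra_simps elim!: evenE)
  have "(\<lambda>n. of_real (if even n then real (n div 2) * tc (n div 2) else 0) * rho ^ n) sums ps (\<lambda>n. real n * tc n) (rho\<^sup>2)"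
    by (rule even_ps_sums[OF s]) auto
  then have 2: "(\<lambda>n. (if even n then real (n div 2) * tc (n div 2) else 0) * rho ^ n) sums ps (\<lambda>n. real n * tc n) (rho\<^sup>2)"
    by (simp only: of_real_eq_id id_apply)
  have "rho * dB rho - rho * dE rho = ps (\<lambda>n. real n * tc n) (rho\<^sup>2)"
    by (rule sums_unique2[OF 1[unfolded eq] 2])
  then have "(\<lambda>n. real n * tc n * (rho\<^sup>2) ^ n) sums (rho * dB rho - rho * dE rho)"
    using summable_sums[OF s] by (simp add: ps_def)
  then show ?thesis by (simp add: power_mult[symmetric] mult_ac)
qed

text \<open>Each leaf count is at most the previous tree count; the resulting crude bound serves in
  tail estimates.\<close>

lemma leaf_series_le: "ps lc rho \<le> rho + rho * Ts rho"
proof -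
  have s: "summable (\<lambda>n. tc n * rho ^ n)" by (rule summable_rho)
  have sl: "summable (\<lambda>n. lc n * rho ^ n)" using rho_numeric by (intro summable_lc s) auto
  have s1: "summable (\<lambda>n. tc (Suc n) * rho ^ Suc n)" using s summable_Suc_iff[of "\<lambda>n. tc n * rho ^ n"] by blast
  have T: "Ts rho = (\<Sum>n. tc (Suc n) * rho ^ Suc n)" using suminf_split_head[OF s] by (simp add: ps_def)
  have "ps lc rho = (\<Sum>n. lc (n + 2) * rho ^ (n + 2)) + rho"
    using suminf_split_initial_segment[OF sl, of 2] by (simp add: ps_def numeral_2_eq_2)
  moreover have "(\<Sum>n. lc (n + 2) * rho ^ (n + 2)) \<le> (\<Sum>n. rho * (tc (Suc n) * rho ^ Suc n))"
  proof (rule suminf_le)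
    show "lc (n + 2) * rho ^ (n + 2) \<le> rho * (tc (Suc n) * rho ^ Suc n)" for n
      using mult_right_mono[OF lc_le_tc[of "n + 2"], of "rho ^ (n + 2)"] rho_numeric by (simp add: mult_ac)
  qed (use s1 sl summable_iff_shift[of "\<lambda>n. lc n * rho ^ n" 2] in \<open>auto intro!: summable_mult\<close>)
  moreover have "\<dots> = rho * Ts rho" unfolding T by (rule suminf_mult[OF s1])
  ultimately show ?thesis by linarith
qed

section \<open>Enclosures at \<open>rho\<close> from those at \<open>x1\<close> and
  \<open>x2\<close>\<close>

lemma rho_power_mono: "x1 ^ n \<le> rho ^ n" "rho ^ n \<le> x2 ^ n"
  using rho_bounds x1_pos rho_numeric by (intro power_mono; simp)+

lemma rho_powers:
  "40039 / 100000 \<le> rho" "rho \<le> 80083 / 200000"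
  "1603121521 / 10000000000 \<le> rho ^ 2" "rho ^ 2 \<le> 1603321723 / 10000000000"
  "25674953 / 400000000 \<le> rho ^ 3" "rho ^ 3 \<le> 160498517 / 2500000000"
  "256999861 / 10000000000 \<le> rho ^ 4" "rho ^ 4 \<le> 51412811 / 2000000000"
  "51450087 / 5000000000 \<le> rho ^ 5" "rho ^ 5 \<le> 6433269 / 625000000"
  "206001 / 50000000 \<le> rho ^ 6" "rho ^ 6 \<le> 41215639 / 10000000000"
  "4124037 / 2500000000 \<le> rho ^ 7" "rho ^ 7 \<le> 51573 / 31250000"
  "1651223 / 2500000000 \<le> rho ^ 8" "rho ^ 8 \<le> 6608193 / 10000000000"
  "2644533 / 10000000000 \<le> rho ^ 9" "rho ^ 9 \<le> 132301 / 500000000"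
  "264711 / 2500000000 \<le> rho ^ 10" "rho ^ 10 \<le> 529753 / 5000000000"
  "8479 / 200000000 \<le> rho ^ 11" "rho ^ 11 \<le> 424243 / 10000000000"
  "33949 / 2000000000 \<le> rho ^ 12" "rho ^ 12 \<le> 169873 / 10000000000"
  by (rule order_trans[OF x1_powers(1) rho_bounds(1)] order_trans[OF rho_bounds(2) x2_powers(2)]
    order_trans[OF x1_powers(3) rho_power_mono(1)] order_trans[OF rho_power_mono(2) x2_powers(4)]
    order_trans[OF x1_powers(5) rho_power_mono(1)] order_trans[OF rho_power_mono(2) x2_powers(6)]
    order_trans[OF x1_powers(7) rho_power_mono(1)] order_trans[OF rho_power_mono(2) x2_powers(8)]
    order_trans[OF x1_powers(9) rho_power_mono(1)] order_trans[OF rho_power_mono(2) x2_powers(10)]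
    order_trans[OF x1_powers(11) rho_power_mono(1)] order_trans[OF rho_power_mono(2) x2_powers(12)]
    order_trans[OF x1_powers(13) rho_power_mono(1)] order_trans[OF rho_power_mono(2) x2_powers(14)]
    order_trans[OF x1_powers(15) rho_power_mono(1)] order_trans[OF rho_power_mono(2) x2_powers(16)]
    order_trans[OF x1_powers(17) rho_power_mono(1)] order_trans[OF rho_power_mono(2) x2_powers(18)]
    order_trans[OF x1_powers(19) rho_power_mono(1)] order_trans[OF rho_power_mono(2) x2_powers(20)]
    order_trans[OF x1_powers(21) rho_power_mono(1)] order_trans[OF rho_power_mono(2) x2_powers(22)]
    order_trans[OF x1_powers(23) rho_power_mono(1)] order_trans[OF rho_power_mono(2) x2_powers(24)])+

lemma log_rem_rho_mono: "log_rem (x1 ^ n) \<le> log_rem (rho ^ n)" "log_rem (rho ^ n) \<le> log_rem (x2 ^ n)"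
proof -
  have "x2 ^ n < 1" if "n > 0" using that x2_pos by (simp add: power_less_one_iff)
  then have "log_rem (x1 ^ n) \<le> log_rem (rho ^ n) \<and> log_rem (rho ^ n) \<le> log_rem (x2 ^ n)"
    using rho_power_mono[of n] rho_power_less_1[of n] log_rem_mono[of "x1 ^ n" "rho ^ n"] log_rem_mono[of "rho ^ n" "x2 ^ n"]
      x1_pos rho_numeric by (cases "n = 0") simp_all
  then show "log_rem (x1 ^ n) \<le> log_rem (rho ^ n)" "log_rem (rho ^ n) \<le> log_rem (x2 ^ n)" by simp_all
qed

lemma square_rho_mono: "(x1 ^ n)\<^sup>2 \<le> (rho ^ n)\<^sup>2" "(rho ^ n)\<^sup>2 \<le> (x2 ^ n)\<^sup>2"
  using power_mono[OF rho_power_mono(1)[of n], of 2] power_mono[OF rho_power_mono(2)[of n], of 2] x1_pos rho_numeric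
  by simp_all

lemma head_mono: "(\<And>n. f n \<le> g n) \<Longrightarrow> (\<Sum>n\<le>m. tc n * f n) \<le> (\<Sum>n\<le>m. tc n * g n)"
  by (intro sum_mono mult_left_mono tc_nonneg) auto

lemma psi_rho:
  "1336803523 / 5000000000 \<le> psi (rho)" "psi (rho) \<le> 334256553 / 1250000000"
  "9564561 / 312500000 \<le> psi (rho ^ 2)" "psi (rho ^ 2) \<le> 153074851 / 5000000000"
  "22013061 / 5000000000 \<le> psi (rho ^ 3)" "psi (rho ^ 3) \<le> 8808637 / 2000000000"
  "1694779 / 2500000000 \<le> psi (rho ^ 4)" "psi (rho ^ 4) \<le> 1695637 / 2500000000"
  "1069853 / 10000000000 \<le> psi (rho ^ 5)" "psi (rho ^ 5) \<le> 535263 / 5000000000"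
  "170447 / 10000000000 \<le> psi (rho ^ 6)" "psi (rho ^ 6) \<le> 10661 / 625000000"
  "27257 / 10000000000 \<le> psi (rho ^ 7)" "psi (rho ^ 7) \<le> 13641 / 5000000000"
  "873 / 2000000000 \<le> psi (rho ^ 8)" "psi (rho ^ 8) \<le> 437 / 1000000000"
  "699 / 10000000000 \<le> psi (rho ^ 9)" "psi (rho ^ 9) \<le> 701 / 10000000000"
  "7 / 625000000 \<le> psi (rho ^ 10)" "psi (rho ^ 10) \<le> 113 / 10000000000"
  "17 / 10000000000 \<le> psi (rho ^ 11)" "psi (rho ^ 11) \<le> 9 / 5000000000"
  "1 / 5000000000 \<le> psi (rho ^ 12)" "psi (rho ^ 12) \<le> 3 / 10000000000"
  by (rule psi_bounds[OF rho_powers(1,2)]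
    psi_bounds[OF rho_powers(3,4)]
    psi_bounds[OF rho_powers(5,6)]
    psi_bounds[OF rho_powers(7,8)]
    psi_bounds[OF rho_powers(9,10)]
    psi_bounds[OF rho_powers(11,12)]
    psi_bounds[OF rho_powers(13,14)]
    psi_bounds[OF rho_powers(15,16)]
    psi_bounds[OF rho_powers(17,18)]
    psi_bounds[OF rho_powers(19,20)]
    psi_bounds[OF rho_powers(21,22)]
    psi_bounds[OF rho_powers(23,24)]; simp)+

lemma mult_power_rho_le: "13 \<le> n \<Longrightarrow> real n * rho ^ n \<le> 13 * rho ^ 13"
proof (induction n rule: dec_induct)
  case (step n)
  have "real (Suc n) * rho \<le> real (Suc n) * (1 / 2)" using rho_numeric by (intro mult_left_mono) auto
  also have "\<dots> \<le> real n * 1" using step(1) by simp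
  finally have "real (Suc n) * rho \<le> real n * 1" .
  then have "real (Suc n) * rho * rho ^ n \<le> real n * 1 * rho ^ n"
    using rho_numeric by (intro mult_right_mono) auto
  then show ?case using step(3) by (simp add: mult_ac)
qed simp

text \<open>The sequence n rho^n decreases from 13 on, and 3 / 20000 is an upper rounding of 13
  rho^13 / (1 - rho).\<close>

lemma psi_tail: "12 < n \<Longrightarrow> real n * psi (rho ^ n) \<le> 3 / 20000 * rho ^ n"
proof -
  assume n: "12 < n"
  have r: "0 < 1 - rho" "0 \<le> rho ^ n" using rho_numeric by auto
  have "13 * rho ^ 13 \<le> 13 * (rho * 169873 / 10000000000)"
    using mult_left_mono[OF rho_powers(24), of rho] rho_numeric by (simp add: power_Suc[symmetric])
  also have "\<dots> \<le> 3 / 20000 * (1 - rho)" using rho_bounds by (simp add: x2_def)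
  finally have "real n * rho ^ n \<le> 3 / 20000 * (1 - rho)" using mult_power_rho_le[of n] n by linarith
  then have "real n * rho ^ n / (1 - rho) \<le> 3 / 20000" using r by (simp add: pos_divide_le_eq)
  from mult_right_mono[OF this r(2)]
  have "real n * ((rho ^ n)\<^sup>2 / (1 - rho)) \<le> 3 / 20000 * rho ^ n" by (simp add: power2_eq_square)
  moreover have "real n * psi (rho ^ n) \<le> real n * ((rho ^ n)\<^sup>2 / (1 - rho))"
    using psi_rho_le[of n] n by (intro mult_left_mono) auto
  ultimately show ?thesis by linarith
qed

lemma sq_le_psi: "0 < n \<Longrightarrow> (rho ^ n)\<^sup>2 \<le> psi (rho ^ n)"
  unfolding psi_def using rho_power_less_1[of n] rho_numeric by (simp add: pos_le_divide_eq mult_left_le)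

text \<open>577 / 100000000 is an upper rounding of (3 / 20000) / 26: a factor 13 comes from n \<ge>
  13 and a factor 2 from log_rem \<le> psi / 2.\<close>

lemma small_tails:
  assumes "12 < n"
  shows "log_rem (rho ^ n) \<le> 577 / 100000000 * rho ^ n" "(rho ^ n)\<^sup>2 / 2 \<le> 577 / 100000000 * rho ^ n"
    "real n * (rho ^ n)\<^sup>2 \<le> 3 / 20000 * rho ^ n"
proof -
  have r: "0 \<le> rho ^ n" "rho ^ n < 1" using rho_numeric rho_power_less_1[of n] assms by auto
  have "13 * psi (rho ^ n) \<le> real n * psi (rho ^ n)" using assms psi_rho_nonneg[of n] by (intro mult_right_mono) auto
  also note psi_tail[OF assms]
  finally have p: "psi (rho ^ n) / 2 \<le> 577 / 100000000 * rho ^ n" using r by simp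
  have "log_rem (rho ^ n) \<le> psi (rho ^ n) / 2" using log_rem_upper[OF r] by (simp only: psi_def divide_divide_eq_left mult.commute[of _ 2])
  then show "log_rem (rho ^ n) \<le> 577 / 100000000 * rho ^ n" using p by linarith
  show "(rho ^ n)\<^sup>2 / 2 \<le> 577 / 100000000 * rho ^ n" using sq_le_psi[of n] p assms by simp
  have "real n * (rho ^ n)\<^sup>2 \<le> real n * psi (rho ^ n)" using sq_le_psi[of n] assms by (intro mult_left_mono) auto
  then show "real n * (rho ^ n)\<^sup>2 \<le> 3 / 20000 * rho ^ n" using psi_tail[OF assms] by linarith
qed

lemma Bs_lower: "1286363 / 10000000 \<le> Bs rho"
proof -
  have "(\<Sum>n\<le>12. tc n * log_rem (rho ^ n)) \<le> Bs rho"
    by (rule head_tail_bounds(1)[OF tc_nonneg tc_0 _ log_rem_sums_series(1) summable_rho _ small_tails(1)])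
      (use rho_numeric rho_power_less_1 in \<open>auto intro!: log_rem_nonneg\<close>)
  moreover have "1286363 / 10000000 \<le> (\<Sum>n\<le>12. tc n * log_rem (x1 ^ n))"
    unfolding head_tc using log_rem_x1 by simp
  moreover note head_mono[of "\<lambda>n. log_rem (x1 ^ n)" "\<lambda>n. log_rem (rho ^ n)" 12, OF log_rem_rho_mono(1)]
  ultimately show ?thesis by linarith
qed

text \<open>The argument is 11149 / 10000 plus the lower bound of \<open>Bs rho\<close>.\<close>

lemma exp_tree_upper: "3467855167 / 1000000000 \<le> exp (12435363 / 10000000 :: real)"
  by (rule exp_16_lower[of "12435363 / 160000000" "540410543739 / 500000000000" "1168174223137 / 1000000000000" "1364631015601 / 1000000000000" "93110890437 / 50000000000"]; simp add: power_divide)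

text \<open>At the singularity the series of T converges too slowly for direct summation. Instead, K
  grows with T and B, so a larger T(rho) would contradict K(rho) = 1.\<close>

lemma Ts_rho_upper: "Ts rho \<le> 11149 / 10000"
proof (rule ccontr)
  assume "\<not> Ts rho \<le> 11149 / 10000"
  then have T: "11149 / 10000 \<le> Ts rho" by simp
  note B = Bs_lower
  have "exp (12435363 / 10000000) - 1 - (12435363 / 10000000 :: real) \<le> exp (Ts rho + Bs rho) - 1 - (Ts rho + Bs rho)"
    using T B by (intro exp_minus_mono) auto
  then have P: "1352955167 / 1000000000 \<le> Ps rho" using exp_tree_upper B by (simp add: Ps_def Hs_def)
  have "x1 * (11149 / 10000) \<le> rho * Ts rho" using T rho_bounds x1_pos by (intro mult_mono) auto
  then have M: "1 + x1 + x1 * (11149 / 10000) \<le> Ms rho" using rho_bounds by (simp add: Ms_def)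
  have "x1 * (1 + x1 + x1 * (11149 / 10000)) * (1352955167 / 1000000000) \<le> rho * Ms rho * Ps rho"
    using P M rho_bounds x1_pos rho_numeric by (intro mult_mono mult_nonneg_nonneg) auto
  moreover have "1 < x1 * (1 + x1 + x1 * (11149 / 10000)) * (1352955167 / 1000000000)" by (simp add: x1_def)
  ultimately show False using Ks_rho by (simp add: Ks_def)
qed

text \<open>The tail of this series is controlled by T(rho), so the upper bound for T(rho), which
  rests on \<open>Bs_lower\<close> alone, has to precede it.\<close>

lemma Bs_upper: "Bs rho \<le> 643331 / 5000000"
proof -
  have "Bs rho \<le> (\<Sum>n\<le>12. tc n * log_rem (rho ^ n)) + 577 / 100000000 * Ts rho"
    by (rule head_tail_bounds(2)[OF tc_nonneg tc_0 _ log_rem_sums_series(1) summable_rho _ small_tails(1)])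
      (use rho_numeric rho_power_less_1 in \<open>auto intro!: log_rem_nonneg\<close>)
  moreover have "(\<Sum>n\<le>12. tc n * log_rem (x2 ^ n)) \<le> 128659767027 / 1000000000000"
    unfolding head_tc using log_rem_x2 by simp
  moreover note head_mono[of "\<lambda>n. log_rem (rho ^ n)" "\<lambda>n. log_rem (x2 ^ n)" 12, OF log_rem_rho_mono(2)]
  ultimately show ?thesis using Ts_rho_upper by linarith
qed

lemma exp_tree_lower: "exp (6215331 / 5000000 :: real) \<le> 3466225453 / 1000000000"
  by (rule exp_16_upper[of "6215331 / 80000000" "54039466741 / 50000000000" "1168105586261 / 1000000000000" "272894132131 / 200000000000" "1861780183789 / 1000000000000"]; simp add: power_divide)

lemma Ts_rho_lower: "1393 / 1250 \<le> Ts rho"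
proof (rule ccontr)
  assume "\<not> 1393 / 1250 \<le> Ts rho"
  then have T: "Ts rho \<le> 1393 / 1250" "0 \<le> Ts rho" using series_nonneg(1)[of rho] rho_numeric by auto
  have B: "Bs rho \<le> 643331 / 5000000" "0 \<le> Bs rho" using Bs_upper series_nonneg(2)[of rho] rho_numeric by auto
  have "exp (Ts rho + Bs rho) - 1 - (Ts rho + Bs rho) \<le> exp (6215331 / 5000000) - 1 - (6215331 / 5000000 :: real)"
    using T B by (intro exp_minus_mono) auto
  then have P: "Ps rho \<le> 1351825453 / 1000000000" using exp_tree_lower B by (simp add: Ps_def Hs_def)
  have "rho * Ts rho \<le> x2 * (1393 / 1250)" using T rho_bounds x2_pos by (intro mult_mono) auto
  then have M: "Ms rho \<le> 1 + x2 + x2 * (1393 / 1250)" using rho_bounds by (simp add: Ms_def)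
  have "rho * Ms rho * Ps rho \<le> x2 * (1 + x2 + x2 * (1393 / 1250)) * (1351825453 / 1000000000)"
    using P M rho_bounds x2_pos rho_numeric Ps_pos[of rho] by (intro mult_mono mult_nonneg_nonneg) auto
  moreover have "x2 * (1 + x2 + x2 * (1393 / 1250)) * (1351825453 / 1000000000) < 1" by (simp add: x2_def)
  ultimately show False using Ks_rho by (simp add: Ks_def)
qed

lemma rho_dB_bounds: "876613 / 2500000 \<le> rho * dB rho" "rho * dB rho \<le> 701771 / 2000000"
proof -
  have "(\<Sum>n\<le>12. tc n * (real n * psi (rho ^ n))) \<le> rho * dB rho" "rho * dB rho \<le> (\<Sum>n\<le>12. tc n * (real n * psi (rho ^ n))) + 3 / 20000 * ps tc rho"
    by (rule head_tail_bounds(1)[OF tc_nonneg tc_0 _ rho_dB_sums summable_rho _ psi_tail]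
        head_tail_bounds(2)[OF tc_nonneg tc_0 _ rho_dB_sums summable_rho _ psi_tail];
      use rho_numeric psi_rho_nonneg in simp)+
  moreover have "876613 / 2500000 \<le> (\<Sum>n\<le>12. tc n * (real n * psi (rho ^ n)))" "(\<Sum>n\<le>12. tc n * (real n * psi (rho ^ n))) \<le> 70143653 / 200000000"
    unfolding head_tc using psi_rho by simp_all
  ultimately show "876613 / 2500000 \<le> rho * dB rho" "rho * dB rho \<le> 701771 / 2000000" using Ts_rho_upper by linarith+
qed

lemma head_n_sq:
  "290963 / 1250000 \<le> (\<Sum>n\<le>12. tc n * (real n * (x1 ^ n)\<^sup>2))" "(\<Sum>n\<le>12. tc n * (real n * (x2 ^ n)\<^sup>2)) \<le> 23281429 / 100000000"
proof -
  have sq: "(x ^ n)\<^sup>2 = x ^ (2 * n)" for x :: real and n by (simp add: power_mult[symmetric] mult.commute)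
  show "290963 / 1250000 \<le> (\<Sum>n\<le>12. tc n * (real n * (x1 ^ n)\<^sup>2))"
    unfolding head_tc sq using x1_powers(3,7,11,15,19,23,27,31,33,35,37,39) by simp
  show "(\<Sum>n\<le>12. tc n * (real n * (x2 ^ n)\<^sup>2)) \<le> 23281429 / 100000000"
    unfolding head_tc sq using x2_powers(4,8,12,16,20,24,28,32,34,36,38,40) by simp
qed

lemma T2_bounds: "7503 / 78125 \<le> Bs rho - Es rho" "Bs rho - Es rho \<le> 192119 / 2000000"
proof -
  have "(\<Sum>n\<le>12. tc n * ((rho ^ n)\<^sup>2 / 2)) \<le> Bs rho - Es rho" "Bs rho - Es rho \<le> (\<Sum>n\<le>12. tc n * ((rho ^ n)\<^sup>2 / 2)) + 577 / 100000000 * ps tc rho"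
    by (rule head_tail_bounds(1)[OF tc_nonneg tc_0 _ T2_sums summable_rho _ small_tails(2)]
        head_tail_bounds(2)[OF tc_nonneg tc_0 _ T2_sums summable_rho _ small_tails(2)];
      use rho_numeric psi_rho_nonneg in simp)+
  moreover have "7503 / 78125 \<le> (\<Sum>n\<le>12. tc n * ((rho ^ n)\<^sup>2 / 2))" "(\<Sum>n\<le>12. tc n * ((rho ^ n)\<^sup>2 / 2)) \<le> 96053067027 / 1000000000000"
    using head_sq_x1 head_mono[of "\<lambda>n. (x1 ^ n)\<^sup>2 / 2" "\<lambda>n. (rho ^ n)\<^sup>2 / 2" 12]
      head_sq_x2 head_mono[of "\<lambda>n. (rho ^ n)\<^sup>2 / 2" "\<lambda>n. (x2 ^ n)\<^sup>2 / 2" 12] square_rho_mono by simp_all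
  ultimately show "7503 / 78125 \<le> Bs rho - Es rho" "Bs rho - Es rho \<le> 192119 / 2000000" using Ts_rho_upper by linarith+
qed

lemma dT2_bounds: "290963 / 1250000 \<le> rho * dB rho - rho * dE rho" "rho * dB rho - rho * dE rho \<le> 291227 / 1250000"
proof -
  have "(\<Sum>n\<le>12. tc n * (real n * (rho ^ n)\<^sup>2)) \<le> rho * dB rho - rho * dE rho" "rho * dB rho - rho * dE rho \<le> (\<Sum>n\<le>12. tc n * (real n * (rho ^ n)\<^sup>2)) + 3 / 20000 * ps tc rho"
    by (rule head_tail_bounds(1)[OF tc_nonneg tc_0 _ dT2_sums summable_rho _ small_tails(3)]
        head_tail_bounds(2)[OF tc_nonneg tc_0 _ dT2_sums summable_rho _ small_tails(3)];
      use rho_numeric psi_rho_nonneg in simp)+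
  moreover have "290963 / 1250000 \<le> (\<Sum>n\<le>12. tc n * (real n * (rho ^ n)\<^sup>2))" "(\<Sum>n\<le>12. tc n * (real n * (rho ^ n)\<^sup>2)) \<le> 46562873 / 200000000"
    using head_n_sq head_mono[of "\<lambda>n. real n * (x1 ^ n)\<^sup>2" "\<lambda>n. real n * (rho ^ n)\<^sup>2" 12]
      head_mono[of "\<lambda>n. real n * (rho ^ n)\<^sup>2" "\<lambda>n. real n * (x2 ^ n)\<^sup>2" 12] square_rho_mono
      by (simp_all add: mult_left_mono)
  ultimately show "290963 / 1250000 \<le> rho * dB rho - rho * dE rho" "rho * dB rho - rho * dE rho \<le> 291227 / 1250000" using Ts_rho_upper by linarith+
qed

lemma leaf_series_less: "ps lc rho \<le> 1"
proof -
  have "rho * Ts rho \<le> x2 * (11149 / 10000)" using rho_bounds rho_numeric Ts_rho_upper series_nonneg(1)[of rho] x2_pos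
    by (intro mult_mono) auto
  also have "\<dots> \<le> 1 - x2" by (simp add: x2_def)
  finally show ?thesis using leaf_series_le rho_bounds by linarith
qed

lemma summable_lc_rho: "summable (\<lambda>n. lc n * rho ^ n)"
  using rho_numeric by (intro summable_lc summable_rho) auto

lemma rho_dA_bounds: "13411 / 50000 \<le> rho * dA rho" "rho * dA rho \<le> 671039 / 2500000"
proof -
  have "(\<Sum>n\<le>12. lc n * (real n * psi (rho ^ n))) \<le> rho * dA rho" "rho * dA rho \<le> (\<Sum>n\<le>12. lc n * (real n * psi (rho ^ n))) + 3 / 20000 * ps lc rho"
    by (rule head_tail_bounds(1)[OF lc_nonneg lc_0 _ rho_dA_sums summable_lc_rho _ psi_tail]
        head_tail_bounds(2)[OF lc_nonneg lc_0 _ rho_dA_sums summable_lc_rho _ psi_tail];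
      use rho_numeric psi_rho_nonneg in simp)+
  moreover have "13411 / 50000 \<le> (\<Sum>n\<le>12. lc n * (real n * psi (rho ^ n)))" "(\<Sum>n\<le>12. lc n * (real n * psi (rho ^ n))) \<le> 83833 / 312500"
    unfolding head_lc using psi_rho by simp_all
  ultimately show "13411 / 50000 \<le> rho * dA rho" "rho * dA rho \<le> 671039 / 2500000" using leaf_series_less by linarith+
qed

section \<open>Interval arithmetic for the constant\<close>

lemma mult_lower:
  fixes x y :: real
  assumes "a \<le> x" "c \<le> y" "0 \<le> a" "0 \<le> c" "l \<le> a * c"
  shows "l \<le> x * y"
  using mult_mono[of a x c y] assms by linarith

lemma mult_upper:
  fixes x y :: real
  assumes "a \<le> x" "x \<le> b" "c \<le> y" "y \<le> d" "0 \<le> a" "0 \<le> c" "b * d \<le> h"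
  shows "x * y \<le> h"
  using mult_mono[of x b y d] assms by linarith

lemma exp_H_lower: "3466121673 / 1000000000 \<le> exp (12430363 / 10000000 :: real)"
  by (rule exp_16_lower[of "12430363 / 160000000" "1080787312347 / 1000000000000" "116810121453 / 100000000000" "682230223693 / 500000000000" "11635951953 / 6250000000"]; simp add: power_divide)

lemma exp_H_upper: "exp (6217831 / 5000000 :: real) \<le> 3467959 / 1000000"
  by (rule exp_16_upper[of "6217831 / 80000000" "54041155501 / 50000000000" "584089297577 / 500000000000" "42645038443 / 31250000000" "1862245687097 / 1000000000000"]; simp add: power_divide)

lemma Ns_Us_bounds:
  "26319673 / 10000000 \<le> Ns rho" "Ns rho \<le> 5279527 / 2000000" "20399539 / 10000000 \<le> Us rho" "Us rho \<le> 5105197 / 2500000"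
proof -
  have r: "40039 / 100000 \<le> rho" "rho \<le> 80083 / 200000" by (rule rho_powers)+
  have T: "1393 / 1250 \<le> Ts rho" "Ts rho \<le> 11149 / 10000" by (rule Ts_rho_lower Ts_rho_upper)+
  have "exp (12430363 / 10000000) \<le> Hs rho" "Hs rho \<le> exp (6217831 / 5000000)"
    using T Bs_lower Bs_upper by (simp_all add: Hs_def)
  then have H: "1083163 / 312500 \<le> Hs rho" "Hs rho \<le> 3467959 / 1000000" using exp_H_lower exp_H_upper by linarith+
  have rT: "2230973 / 5000000 \<le> rho * Ts rho" "rho * Ts rho \<le> 4464227 / 10000000"
    by (rule mult_lower[OF r(1) T(1)] mult_upper[OF r T]; simp)+
  have M: "9232923 / 5000000 \<le> Ms rho" "Ms rho \<le> 18468377 / 10000000"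
    using r rT unfolding Ms_def by linarith+
  have P: "1689027 / 1250000 \<le> Ps rho" "Ps rho \<le> 1353559 / 1000000"
    using H T unfolding Ps_def by linarith+
  have TT: "12418873 / 10000000 \<le> Ts rho * Ts rho" "Ts rho * Ts rho \<le> 12430021 / 10000000"
    by (rule mult_lower[OF T(1) T(1)] mult_upper[OF T T]; simp)+
  have F: "633661 / 1000000 \<le> Fs rho" "Fs rho \<le> 636577 / 1000000"
    using P TT T2_bounds unfolding Fs_def Ps_def power2_eq_square by linarith+
  have rF: "507423 / 2000000 \<le> rho * Fs rho" "rho * Fs rho \<le> 50979 / 200000"
    by (rule mult_lower[OF r(1) F(1)] mult_upper[OF r F]; simp)+
  have bH: "12153789 / 10000000 \<le> (rho * dB rho) * Hs rho" "(rho * dB rho) * Hs rho \<le> 6084283 / 5000000"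
    by (rule mult_lower[OF rho_dB_bounds(1) H(1)] mult_upper[OF rho_dB_bounds H]; simp)+
  have X: "9823973 / 10000000 \<le> (rho * dB rho * Hs rho - (rho * dB rho - rho * dE rho))" "(rho * dB rho * Hs rho - (rho * dB rho - rho * dE rho)) \<le> 4920431 / 5000000"
    using bH dT2_bounds by linarith+
  have rX: "196671 / 500000 \<le> rho * (rho * dB rho * Hs rho - (rho * dB rho - rho * dE rho))" "rho * (rho * dB rho * Hs rho - (rho * dB rho - rho * dE rho)) \<le> 3940429 / 10000000"
    by (rule mult_lower[OF r(1) X(1)] mult_upper[OF r X]; simp)+
  have dA: "133971 / 200000 \<le> dA rho" "dA rho \<le> 3351927 / 5000000"
  proof -
    have "0 \<le> dA rho" using series_nonneg(7)[of rho] rho_numeric by simp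
    then have "rho * dA rho \<le> 80083 / 200000 * dA rho" "40039 / 100000 * dA rho \<le> rho * dA rho"
      using r by (intro mult_right_mono; simp)+
    then show "133971 / 200000 \<le> dA rho" "dA rho \<le> 3351927 / 5000000" using rho_dA_bounds by linarith+
  qed
  \<comment> \<open>Regrouped so that \<open>dB\<close> and \<open>dE\<close> occur only through
    \<open>rho * dB rho\<close> and \<open>rho * dB rho - rho * dE rho\<close>, both of which are
    enclosed directly.\<close>
  have "(1 + 2 * rho * Fs rho + rho\<^sup>2 * (dB rho * (Hs rho - 1) + dE rho) + dA rho) = 1 + 2 * (rho * Fs rho) + rho * (rho * dB rho * Hs rho - (rho * dB rho - rho * dE rho)) + dA rho"
    by (simp add: power2_eq_square algebra_simps)
  then have Y: "128531 / 50000 \<le> (1 + 2 * rho * Fs rho + rho\<^sup>2 * (dB rho * (Hs rho - 1) + dE rho) + dA rho)" "(1 + 2 * rho * Fs rho + rho\<^sup>2 * (dB rho * (Hs rho - 1) + dE rho) + dA rho) \<le> 25742183 / 10000000"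
    using rF rX dA by linarith+
  have MY: "47468673 / 10000000 \<le> Ms rho * (1 + 2 * rho * Fs rho + rho\<^sup>2 * (dB rho * (Hs rho - 1) + dE rho) + dA rho)" "Ms rho * (1 + 2 * rho * Fs rho + rho\<^sup>2 * (dB rho * (Hs rho - 1) + dE rho) + dA rho) \<le> 9508327 / 2000000"
    by (rule mult_lower[OF M(1) Y(1)] mult_upper[OF M Y]; simp)+
  show "26319673 / 10000000 \<le> Ns rho" "Ns rho \<le> 5279527 / 2000000" unfolding Ns_def using MY T by linarith+
  have rr: "1603121 / 10000000 \<le> rho * rho" "rho * rho \<le> 801661 / 5000000"
    by (rule mult_lower[OF r(1) r(1)] mult_upper[OF r r]; simp)+
  have rrP: "2166171 / 10000000 \<le> (rho * rho) * Ps rho" "(rho * rho) * Ps rho \<le> 2170191 / 10000000"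
    by (rule mult_lower[OF rr(1) P(1)] mult_upper[OF rr P]; simp)+
  have rM: "369677 / 500000 \<le> rho * Ms rho" "rho * Ms rho \<le> 924377 / 1250000"
    by (rule mult_lower[OF r(1) M(1)] mult_upper[OF r M]; simp)+
  have H1: "770663 / 312500 \<le> (Hs rho - 1)" "(Hs rho - 1) \<le> 2467959 / 1000000"
    using H by linarith+
  have rMH: "2279171 / 1250000 \<le> (rho * Ms rho) * (Hs rho - 1)" "(rho * Ms rho) * (Hs rho - 1) \<le> 18250597 / 10000000"
    by (rule mult_lower[OF rM(1) H1(1)] mult_upper[OF rM H1]; simp)+
  show "20399539 / 10000000 \<le> Us rho" "Us rho \<le> 5105197 / 2500000"
    unfolding Us_def power2_eq_square using rrP rMH by linarith+
qed

text \<open>Since sin (\<pi> / 6) = 1/2 and sine increases, it suffices that Taylor bounds put the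
  sine below 1/2 at 314 / 600 and above 1/2 at 31417 / 60000.\<close>

lemma pi_bounds: "314 / 100 \<le> pi" "pi \<le> 31417 / 10000"
proof -
  have sin_bound: "\<bar>sin x - (\<Sum>m<9. sin_coeff m * x ^ m)\<bar> \<le> inverse (fact 9) * \<bar>x\<bar> ^ 9" for x :: real
    by (rule Maclaurin_sin_bound)
  have sum: "(\<Sum>m<9. sin_coeff m * x ^ m) = x - x ^ 3 / 6 + x ^ 5 / 120 - x ^ 7 / 5040" for x :: real
  proof -
    have "(\<Sum>m<9. sin_coeff m * x ^ m) = sum_list (map (\<lambda>m. sin_coeff m * x ^ m) [0..<9])"
      by (simp only: interv_sum_list_conv_sum_set_nat set_upt lessThan_atLeast0)
    then show ?thesis by (simp add: upt_numeral sin_coeff_def fact_numeral)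
  qed
  have sin_le: "sin x \<le> x - x ^ 3 / 6 + x ^ 5 / 120 - x ^ 7 / 5040 + x ^ 9 / 362880"
    and sin_ge: "x - x ^ 3 / 6 + x ^ 5 / 120 - x ^ 7 / 5040 - x ^ 9 / 362880 \<le> sin x" if "0 \<le> x" for x :: real
    using sin_bound[of x] that unfolding sum abs_le_iff by (simp_all add: fact_numeral)
  have pi6: "sin (pi / 6) = 1 / 2" by (simp add: sin_30)
  show "314 / 100 \<le> pi"
  proof (rule ccontr)
    assume "\<not> 314 / 100 \<le> pi"
    then have "sin (pi / 6) \<le> sin (314 / 600)" using pi_ge_two by (subst sin_mono_le_eq) auto
    moreover have "sin (314 / 600) < (1 / 2 :: real)"
      using sin_le[of "314 / 600"] by (simp add: power_divide)
    ultimately show False using pi6 by simp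
  qed
  show "pi \<le> 31417 / 10000"
  proof (rule ccontr)
    assume "\<not> pi \<le> 31417 / 10000"
    then have "sin (31417 / 60000) \<le> sin (pi / 6)" using pi_ge_two by (subst sin_mono_le_eq) auto
    moreover have "(1 / 2 :: real) < sin (31417 / 60000)"
      using sin_ge[of "31417 / 60000"] by (simp add: power_divide)
    ultimately show False using pi6 by simp
  qed
qed

text \<open>The last division by \<open>rho\<close> reflects that n arches mean weight n + 1,
  whereas the theorem normalises by the n-th power of 1 / rho.\<close>

definition asymptotic_constant :: real where
  "asymptotic_constant = Ns rho / (sqrt (2 * (Us rho * Ns rho)) * sqrt pi) / rho"

lemma asymptotic_constant_bounds: "1125 / 1000 < asymptotic_constant" "asymptotic_constant < 1135 / 1000"
proof -
  define c where "c = asymptotic_constant"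
  note NU = Ns_Us_bounds
  have pos: "0 < Ns rho" "0 < Us rho" "0 < rho" using NU rho_numeric by auto
  then have c0: "0 < c" by (simp add: c_def asymptotic_constant_def)
  have "(sqrt (2 * (Us rho * Ns rho)))\<^sup>2 = 2 * (Us rho * Ns rho)" "(sqrt pi)\<^sup>2 = pi"
    using pos by simp_all
  then have "c\<^sup>2 = (Ns rho)\<^sup>2 / (2 * (Us rho * Ns rho) * pi) / rho\<^sup>2"
    by (simp only: c_def asymptotic_constant_def power_divide power_mult_distrib)
  \<comment> \<open>Solved for N to remove the square roots: each bound on c becomes a comparison of
    rational numbers.\<close>
  then have c2: "Ns rho = c\<^sup>2 * (2 * (pi * (rho * rho * Us rho)))"
    using pos by (simp add: field_simps power2_eq_square)
  have rr: "1603121 / 10000000 \<le> rho * rho" "rho * rho \<le> 801661 / 5000000"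
    by (rule mult_lower[OF rho_powers(1) rho_powers(1)] mult_upper[OF rho_powers(1,2) rho_powers(1,2)]; simp)+
  have rrU: "817573 / 2500000 \<le> rho * rho * Us rho" "rho * rho * Us rho \<le> 327411 / 1000000"
    by (rule mult_lower[OF rr(1) NU(3)] mult_upper[OF rr NU(3,4)]; simp)+
  have Z: "2567179 / 2500000 \<le> pi * (rho * rho * Us rho)" "pi * (rho * rho * Us rho) \<le> 160723 / 156250"
    by (rule mult_lower[OF pi_bounds(1) rrU(1)] mult_upper[OF pi_bounds rrU]; simp)+
  show "1125 / 1000 < asymptotic_constant"
  proof (rule ccontr)
    assume "\<not> 1125 / 1000 < asymptotic_constant"
    then have "c\<^sup>2 \<le> (1125 / 1000)\<^sup>2" using c0 by (intro power_mono) (auto simp: c_def)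
    then have "Ns rho \<le> (1125 / 1000)\<^sup>2 * (2 * (160723 / 156250))"
      unfolding c2 using Z by (intro mult_mono) auto
    then show False using NU(1) by (simp add: power2_eq_square)
  qed
  show "asymptotic_constant < 1135 / 1000"
  proof (rule ccontr)
    assume "\<not> asymptotic_constant < 1135 / 1000"
    then have "(1135 / 1000)\<^sup>2 \<le> c\<^sup>2" by (intro power_mono) (auto simp: c_def)
    then have "(1135 / 1000)\<^sup>2 * (2 * (2567179 / 2500000)) \<le> Ns rho"
      unfolding c2 using Z by (intro mult_mono) auto
    then show False using NU(2) by (simp add: power2_eq_square)
  qed
qed

theorem mainTheorem5:
  shows "\<exists>c \<gamma> :: real.
    \<bar>c - 1.13\<bar> < 0.005 \<and> \<bar>\<gamma> - 2.4975\<bar> < 0.0001 \<and>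
    (\<lambda>n. real (card (cohorts n))) \<sim>[at_top] (\<lambda>n. c * real n powr (-3/2) * \<gamma> ^ n)"
proof (intro exI conjI)
  define c where "c = asymptotic_constant"
  show "\<bar>c - 1.13\<bar> < 0.005" unfolding abs_less_iff using asymptotic_constant_bounds by (simp add: c_def)
  have "24974 / 10000 < 1 / rho" "1 / rho < 24976 / 10000"
    using rho_bounds rho_numeric by (simp_all add: x1_def x2_def field_simps)
  then show "\<bar>1 / rho - 2.4975\<bar> < 0.0001" unfolding abs_less_iff by simp
  show "(\<lambda>n. real (card (cohorts n))) \<sim>[at_top] (\<lambda>n. c * real n powr (-3/2) * (1 / rho) ^ n)"
  proof (rule asymp_equivI')
    have c: "0 < c" using asymptotic_constant_bounds by (simp add: c_def)
    have A: "(\<lambda>n. sqrt (real n) * (real (Suc n) * (tc (Suc n) * rho ^ Suc n))) \<longlonglongrightarrow> c * rho"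
      using tree_coefficients_asymptotics rho_numeric by (simp add: c_def asymptotic_constant_def)
    have B: "(\<lambda>n. real n / real (Suc n)) \<longlonglongrightarrow> 1" by (rule LIMSEQ_n_over_Suc_n)
    \<comment> \<open>The factor n / (n + 1) turns sqrt n * (n + 1) into n^(3/2) without changing
      the limit.\<close>
    have "(\<lambda>n. sqrt (real n) * (real (Suc n) * (tc (Suc n) * rho ^ Suc n)) * (real n / real (Suc n)) / (c * rho))
      \<longlonglongrightarrow> c * rho * 1 / (c * rho)"
      using c rho_numeric by (intro tendsto_divide tendsto_mult[OF A B] tendsto_const) auto
    moreover have "\<forall>\<^sub>F n in sequentially. sqrt (real n) * (real (Suc n) * (tc (Suc n) * rho ^ Suc n)) * (real n / real (Suc n)) / (c * rho)
        = real (card (cohorts n)) / (c * real n powr (-3/2) * (1 / rho) ^ n)"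
      using eventually_gt_at_top[of 0]
    proof eventually_elim
      case (elim n)
      have "real n powr (-3/2) = inverse (real n powr (1 + 1/2))" by (simp add: powr_minus[symmetric])
      also have "real n powr (1 + 1/2) = real n * sqrt (real n)"
        using elim by (simp only: powr_add powr_half_sqrt powr_one of_nat_0_le_iff)
      finally have p: "real n powr (-3/2) = inverse (real n * sqrt (real n))" .
      have "sqrt (real n) * (real (Suc n) * (tc (Suc n) * rho ^ Suc n)) * (real n / real (Suc n)) / (c * rho)
        = tc (Suc n) / (c * inverse (real n * sqrt (real n)) * (1 / rho) ^ n)"
        using elim c rho_numeric by (simp add: field_simps del: of_nat_Suc)
      then show ?case by (simp only: p card_cohorts_eq_tree_count tc_def)
    qed
    ultimately show "(\<lambda>n. real (card (cohorts n)) / (c * real n powr (-3/2) * (1 / rho) ^ n)) \<longlonglongrightarrow> 1"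
      using c rho_numeric by (simp add: tendsto_cong)
  qed
qed

end
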